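(* Let $\mathcal{P}=\langle \Sigma \mid \mathcal{R}\rangle$ be a semigroup presentation and $w\in\Sigma^+$. Let $D$ be the braided diagram group $D_b(\mathcal{P},w)$ (resp. the planar diagram group $D(\mathcal{P},w)$, the annular diagram group $D_a(\mathcal{P},w)$). Then there is a short exact sequence of groups $$1 \to R \to D \to S \to 1$$ where $R$ is (isomorphic to) a subgroup of some right-angled Artin group and $S$ is (isomorphic to) a subgroup of Thompson's group $V$ (resp. $F$, $T$).
   Context: Right-angled Artin groups are allowed to have an infinite defining graph. Thompson's groups. $V$ is the group of right-continuous bijections of $\mathbb{S}^1=[0,1]/(0\sim 1)$ which map dyadic rationals to dyadic rationals, are differentiable except at finitely many dyadic rationals, and which, on each maximal interval of differentiability, are affine with derivative a power of $2$. $T\subset V$ is the subgroup of those which are homeomorphisms of $\mathbb{S}^1$. $F$ is the group of piecewise linear homeomorphisms of $[0,1]$, differentiable except at finitely many dyadic rationals, whose derivatives on intervals of differentiability are powers of $2$ (homeomorphisms orientation-preserving). Semigroup presentations. $\mathcal{P}=\langle\Sigma\mid\mathcal{R}\rangle$ consists of an alphabet $\Sigma$ and a set $\mathcal{R}$ of relations $u=v$ with $u,v\in\Sigma^+$ (non-empty words), with the convention that if $u=v$ belongs to $\mathcal{R}$ then $v=u$ does not (so no relation $u=u$). Braided diagrams. A wire is a copy of $[0,1]$ with bottom $0$ and top $1$. A transistor is a copy of $[0,1]^2$ and a frame is a copy of $\partial[0,1]^2$; both have top, bottom, left and right sides, the top and bottom sides being ordered left-to-right. A braided diagram $\Delta$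 over $\mathcal{P}$ is a labelled oriented quotient space obtained from a finite non-empty collection of wires labelled by letters of $\Sigma$, a finite (possibly empty) collection of transistors, and a frame, such that: each endpoint of each wire is attached to a transistor or to the frame; the bottom of a wire is attached to the top side of a transistor or to the bottom side of the frame; the top of a wire is attached to the bottom side of a transistor or to the top side of the frame; images of distinct wires are disjoint; for each transistor $T$, if $\mathrm{top}(T)$ (resp. $\mathrm{bot}(T)$) is the word read left-to-right from the labels of wires attached to its top (resp. bottom) side, then $\mathrm{top}(T)=\mathrm{bot}(T)$ or $\mathrm{bot}(T)=\mathrm{top}(T)$ belongs to $\mathcal{R}$; writing $T_1\prec T_2$ when some wire has its bottom on the top side of $T_1$ and its top on the bottom side of $T_2$, the transitive closure of $\prec$ is a strict partial order. Diagrams are considered up to homeomorphisms preserving labels and all left-right and top-bottom orientations of transistors and frame. $\mathrm{top}(\Delta)$ and $\mathrm{bot}(\Delta)$ are the words read along the top and bottom sides of the frame; a $(u,v)$-diagram has $\mathrm{top}(\Delta)=u$, $\mathrm{bot}(\Delta)=v$. If $\mathrm{bot}(\Delta_1)=\mathrm{top}(\Delta_2)$, the concatenation $\Delta_1\circ\Delta_2$ is obtained by gluing $\Delta_2$ below $\Delta_1$ (matching wires in left-to-right order). A dipole is a pair of transistors $T_1\prec T_2$ such that all wires $w_1,\dots,w_n$ attached to the top side of $T_1$ are attached to the bottom side of $T_2$ in the same left-to-right order, no other wire is attached to the bottom side of $T_2$, and $\mathrm{top}(T_2)=\mathrm{bot}(T_1)$. Reducing it means deleting $T_1,T_2,w_1,\dots,w_n$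 and joining, in order, the wires on the top side of $T_2$ with those on the bottom side of $T_1$. Two diagrams are equal modulo dipoles if they have the same (unique) dipole-free reduction. $D_b(\mathcal{P},w)$ is the group of braided $(w,w)$-diagrams modulo dipoles, under concatenation. A diagram is planar if it embeds into the plane preserving the left-to-right and top-bottom orientations of transistors and frame; $D(\mathcal{P},w)$ is the subgroup of $D_b(\mathcal{P},w)$ of planar diagrams. A diagram is annular if it can be drawn in an annulus with pairwise disjoint wires: the top (resp. bottom) side of the frame is replaced with the inner (resp. outer) boundary circle, oriented counterclockwise and with a basepoint disjoint from the wires from which labels are read, and the resulting object embeds in the plane preserving orientations of transistors. $D_a(\mathcal{P},w)$ is the group of annular $(w,w)$-diagrams modulo dipoles, under concatenation (basepoints are matched). *)

theory Defs
  imports "HOL-Analysis.Analysis" "HOL-Algebra.Bij" "HOL-Algebra.Coset"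
begin

section \<open>Semigroup presentations\<close>

definition semigroup_presentation :: "'a set \<Rightarrow> ('a list \<times> 'a list) set \<Rightarrow> bool" where
  "semigroup_presentation A R \<longleftrightarrow>
     (\<forall>(u, v)\<in>R. u \<in> lists A \<and> u \<noteq> [] \<and> v \<in> lists A \<and> v \<noteq> [] \<and> (v, u) \<notin> R)"


section \<open>Braided diagrams\<close>

text \<open>Up to homeomorphisms preserving labels and orientations, a braided diagram amounts to
  finite incidence data, which is what we record. Wires and transistors are named by natural
  numbers. Every side of a transistor or of the frame is the list, read from left to right, of
  the wires attached to it. Following the attachment rules of diagrams, \<open>ttop\<close> and \<open>fbot\<close>
  (tops of transistors, bottom of the frame) carry the bottoms of wires, while \<open>tbot\<close> and
  \<open>ftop\<close> carry the tops of wires. The fields are irrelevant outside \<open>wires\<close> and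
  \<open>transistors\<close>.\<close>

record 'a diagram =
  wires :: "nat set"
  label :: "nat \<Rightarrow> 'a"
  transistors :: "nat set"
  ttop :: "nat \<Rightarrow> nat list"
  tbot :: "nat \<Rightarrow> nat list"
  ftop :: "nat list"
  fbot :: "nat list"

definition word :: "'a diagram \<Rightarrow> nat list \<Rightarrow> 'a list" where
  "word \<Delta> ws = map (label \<Delta>) ws"

text \<open>\<open>T\<^sub>1 \<prec> T\<^sub>2\<close>: some wire goes from the top side of \<open>T\<^sub>1\<close> up to the bottom side of \<open>T\<^sub>2\<close>.\<close>

definition prec :: "'a diagram \<Rightarrow> (nat \<times> nat) set" where
  "prec \<Delta> = {(T1, T2). T1 \<in> transistors \<Delta> \<and> T2 \<in> transistors \<Delta> \<and>
     set (ttop \<Delta> T1) \<inter> set (tbot \<Delta> T2) \<noteq> {}}"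

text \<open>The two equations between multisets say that the top of each wire, and likewise the bottom
  of each wire, is attached exactly once, and that only wires of the diagram are attached.\<close>

definition braided_diagram :: "'a set \<Rightarrow> ('a list \<times> 'a list) set \<Rightarrow> 'a diagram \<Rightarrow> bool" where
  "braided_diagram A R \<Delta> \<longleftrightarrow>
     finite (wires \<Delta>) \<and> wires \<Delta> \<noteq> {} \<and> finite (transistors \<Delta>) \<and>
     label \<Delta> ` wires \<Delta> \<subseteq> A \<and>
     mset (ftop \<Delta>) + (\<Sum>T\<in>transistors \<Delta>. mset (tbot \<Delta> T)) = mset_set (wires \<Delta>) \<and>
     mset (fbot \<Delta>) + (\<Sum>T\<in>transistors \<Delta>. mset (ttop \<Delta> T)) = mset_set (wires \<Delta>) \<and>
     (\<forall>T\<in>transistors \<Delta>. (word \<Delta> (ttop \<Delta> T), word \<Delta> (tbot \<Delta> T)) \<in> R \<or>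
                          (word \<Delta> (tbot \<Delta> T), word \<Delta> (ttop \<Delta> T)) \<in> R) \<and>
     acyclic (prec \<Delta>)"

definition diagram_iso :: "'a diagram \<Rightarrow> 'a diagram \<Rightarrow> bool" where
  "diagram_iso \<Delta> \<Delta>' \<longleftrightarrow>
     (\<exists>\<phi> \<psi>. bij_betw \<phi> (wires \<Delta>) (wires \<Delta>') \<and>
            bij_betw \<psi> (transistors \<Delta>) (transistors \<Delta>') \<and>
            (\<forall>x\<in>wires \<Delta>. label \<Delta>' (\<phi> x) = label \<Delta> x) \<and>
            (\<forall>T\<in>transistors \<Delta>. ttop \<Delta>' (\<psi> T) = map \<phi> (ttop \<Delta> T) \<and>
                                 tbot \<Delta>' (\<psi> T) = map \<phi> (tbot \<Delta> T)) \<and>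
            ftop \<Delta>' = map \<phi> (ftop \<Delta>) \<and> fbot \<Delta>' = map \<phi> (fbot \<Delta>))"

definition top_word :: "'a diagram \<Rightarrow> 'a list" where
  "top_word \<Delta> = word \<Delta> (ftop \<Delta>)"

definition bot_word :: "'a diagram \<Rightarrow> 'a list" where
  "bot_word \<Delta> = word \<Delta> (fbot \<Delta>)"

definition ww_diagrams :: "'a set \<Rightarrow> ('a list \<times> 'a list) set \<Rightarrow> 'a list \<Rightarrow> 'a diagram set" where
  "ww_diagrams A R w = {\<Delta>. braided_diagram A R \<Delta> \<and> top_word \<Delta> = w \<and> bot_word \<Delta> = w}"

definition id_diagram :: "'a list \<Rightarrow> 'a diagram" where
  "id_diagram w = \<lparr>wires = {..<length w}, label = (\<lambda>i. w ! i), transistors = {},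
     ttop = (\<lambda>_. []), tbot = (\<lambda>_. []), ftop = [0..<length w], fbot = [0..<length w]\<rparr>"

text \<open>Concatenation, with \<open>\<Delta>\<^sub>2\<close> below \<open>\<Delta>\<^sub>1\<close>. Even names come from \<open>\<Delta>\<^sub>1\<close> and odd ones from \<open>\<Delta>\<^sub>2\<close>,
  except that the \<open>i\<close>-th wire on the top side of the frame of \<open>\<Delta>\<^sub>2\<close> becomes one with the \<open>i\<close>-th wire
  on the bottom side of the frame of \<open>\<Delta>\<^sub>1\<close> and takes over its name.\<close>

definition glued_name :: "'a diagram \<Rightarrow> 'a diagram \<Rightarrow> nat \<Rightarrow> nat" where
  "glued_name \<Delta>1 \<Delta>2 x =
     (case map_of (zip (ftop \<Delta>2) (fbot \<Delta>1)) x of Some y \<Rightarrow> 2 * y | None \<Rightarrow> 2 * x + 1)"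

definition concat_diagram :: "'a diagram \<Rightarrow> 'a diagram \<Rightarrow> 'a diagram" where
  "concat_diagram \<Delta>1 \<Delta>2 =
     \<lparr>wires = (\<lambda>x. 2 * x) ` wires \<Delta>1 \<union> glued_name \<Delta>1 \<Delta>2 ` wires \<Delta>2,
      label = (\<lambda>n. if even n then label \<Delta>1 (n div 2) else label \<Delta>2 (n div 2)),
      transistors = (\<lambda>T. 2 * T) ` transistors \<Delta>1 \<union> (\<lambda>T. 2 * T + 1) ` transistors \<Delta>2,
      ttop = (\<lambda>n. if even n then map (\<lambda>x. 2 * x) (ttop \<Delta>1 (n div 2))
                  else map (glued_name \<Delta>1 \<Delta>2) (ttop \<Delta>2 (n div 2))),
      tbot = (\<lambda>n. if even n then map (\<lambda>x. 2 * x) (tbot \<Delta>1 (n div 2))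
                  else map (glued_name \<Delta>1 \<Delta>2) (tbot \<Delta>2 (n div 2))),
      ftop = map (\<lambda>x. 2 * x) (ftop \<Delta>1),
      fbot = map (glued_name \<Delta>1 \<Delta>2) (fbot \<Delta>2)\<rparr>"


section \<open>Dipoles\<close>

definition dipole :: "'a diagram \<Rightarrow> nat \<Rightarrow> nat \<Rightarrow> bool" where
  "dipole \<Delta> T1 T2 \<longleftrightarrow>
     (T1, T2) \<in> prec \<Delta> \<and> ttop \<Delta> T1 = tbot \<Delta> T2 \<and>
     word \<Delta> (ttop \<Delta> T2) = word \<Delta> (tbot \<Delta> T1)"

text \<open>Joining the \<open>i\<close>-th wire \<open>a\<^sub>i\<close> on the top side of \<open>T\<^sub>2\<close> with the \<open>i\<close>-th wire \<open>b\<^sub>i\<close> on the bottom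
  side of \<open>T\<^sub>1\<close>: the resulting wire keeps the name \<open>a\<^sub>i\<close>. Its top is that of \<open>a\<^sub>i\<close>, so only the sides
  carrying bottoms of wires have to be renamed.\<close>

definition joined_name :: "'a diagram \<Rightarrow> nat \<Rightarrow> nat \<Rightarrow> nat \<Rightarrow> nat" where
  "joined_name \<Delta> T1 T2 x =
     (case map_of (zip (tbot \<Delta> T1) (ttop \<Delta> T2)) x of Some y \<Rightarrow> y | None \<Rightarrow> x)"

definition reduce_dipole :: "'a diagram \<Rightarrow> nat \<Rightarrow> nat \<Rightarrow> 'a diagram" where
  "reduce_dipole \<Delta> T1 T2 = \<Delta>
     \<lparr>wires := wires \<Delta> - set (ttop \<Delta> T1) - set (tbot \<Delta> T1),
      transistors := transistors \<Delta> - {T1, T2},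
      ttop := (\<lambda>T. map (joined_name \<Delta> T1 T2) (ttop \<Delta> T)),
      fbot := map (joined_name \<Delta> T1 T2) (fbot \<Delta>)\<rparr>"

inductive reduces_to :: "'a diagram \<Rightarrow> 'a diagram \<Rightarrow> bool" where
  iso: "diagram_iso \<Delta> \<Delta>' \<Longrightarrow> reduces_to \<Delta> \<Delta>'"
| reduce: "dipole \<Delta> T1 T2 \<Longrightarrow> reduces_to (reduce_dipole \<Delta> T1 T2) \<Delta>' \<Longrightarrow> reduces_to \<Delta> \<Delta>'"

definition dipole_free :: "'a diagram \<Rightarrow> bool" where
  "dipole_free \<Delta> \<longleftrightarrow> (\<nexists>T1 T2. dipole \<Delta> T1 T2)"

definition eq_mod_dipoles :: "'a diagram \<Rightarrow> 'a diagram \<Rightarrow> bool" where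
  "eq_mod_dipoles \<Delta> \<Delta>' \<longleftrightarrow> (\<exists>\<Delta>0. dipole_free \<Delta>0 \<and> reduces_to \<Delta> \<Delta>0 \<and> reduces_to \<Delta>' \<Delta>0)"


section \<open>Planar and annular diagrams\<close>

text \<open>Drawing a diagram in an open region \<open>U\<close> of the plane whose boundary is the image of the frame:
  \<open>B T\<close> is the image of the transistor \<open>T\<close> and \<open>\<gamma> x\<close> parametrises the image of the wire \<open>x\<close> from
  its bottom (parameter \<open>0\<close>) to its top (parameter \<open>1\<close>). Away from its endpoints a wire meets
  neither the frame nor the transistors; where the endpoints go is prescribed separately.\<close>

definition disjoint_drawing ::
  "'a diagram \<Rightarrow> complex set \<Rightarrow> (nat \<Rightarrow> complex set) \<Rightarrow> (nat \<Rightarrow> real \<Rightarrow> complex) \<Rightarrow> bool" where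
  "disjoint_drawing \<Delta> U B \<gamma> \<longleftrightarrow>
     (\<forall>T\<in>transistors \<Delta>. B T \<subseteq> U) \<and> disjoint_family_on B (transistors \<Delta>) \<and>
     (\<forall>x\<in>wires \<Delta>. arc (\<gamma> x) \<and> \<gamma> x ` {0<..<1} \<subseteq> U - (\<Union>T\<in>transistors \<Delta>. B T)) \<and>
     disjoint_family_on (\<lambda>x. path_image (\<gamma> x)) (wires \<Delta>)"

text \<open>The points \<open>ps\<close> lie, in this order, on the curve \<open>\<sigma>\<close> restricted to \<open>I\<close>.\<close>

definition in_order_along :: "(real \<Rightarrow> complex) \<Rightarrow> real set \<Rightarrow> complex list \<Rightarrow> bool" where
  "in_order_along \<sigma> I ps \<longleftrightarrow>
     (\<exists>ss. set ss \<subseteq> I \<and> sorted_wrt (<) ss \<and> ps = map \<sigma> ss)"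

text \<open>The frame is the boundary of the unit square, with the rest of the diagram inside it, and each
  transistor \<open>T\<close> is an upright rectangle with lower left corner \<open>p T\<close> and upper right corner
  \<open>q T\<close>. The wires are arbitrary arcs; they are not required to be monotone.\<close>

definition planar_diagram :: "'a diagram \<Rightarrow> bool" where
  "planar_diagram \<Delta> \<longleftrightarrow>
     (\<exists>p q \<gamma>.
        (\<forall>T\<in>transistors \<Delta>. Re (p T) < Re (q T) \<and> Im (p T) < Im (q T)) \<and>
        disjoint_drawing \<Delta> (box 0 (Complex 1 1)) (\<lambda>T. cbox (p T) (q T)) \<gamma> \<and>
        in_order_along (\<lambda>s. Complex s 1) {0..1} (map (\<lambda>x. pathfinish (\<gamma> x)) (ftop \<Delta>)) \<and>
        in_order_along (\<lambda>s. Complex s 0) {0..1} (map (\<lambda>x. pathstart (\<gamma> x)) (fbot \<Delta>)) \<and>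
        (\<forall>T\<in>transistors \<Delta>.
           in_order_along (\<lambda>s. Complex s (Im (q T))) {Re (p T)..Re (q T)}
             (map (\<lambda>x. pathstart (\<gamma> x)) (ttop \<Delta> T)) \<and>
           in_order_along (\<lambda>s. Complex s (Im (p T))) {Re (p T)..Re (q T)}
             (map (\<lambda>x. pathfinish (\<gamma> x)) (tbot \<Delta> T))))"

text \<open>The annulus is \<open>1 \<le> \<bar>z\<bar> \<le> 2\<close>; its inner and outer circles are the top and bottom sides of the
  frame, read counterclockwise from the basepoints \<open>cis \<alpha>\<close> and \<open>2 cis \<beta>\<close>. Each transistor \<open>T\<close> is a
  sector \<open>r T \<le> \<bar>z\<bar> \<le> r' T\<close>, \<open>\<theta> T \<le> arg z \<le> \<theta>' T\<close>, with its top side facing the inner circle; an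
  orientation preserving embedding then has the left-to-right direction of its sides
  counterclockwise.\<close>

definition sector :: "real \<Rightarrow> real \<Rightarrow> real \<Rightarrow> real \<Rightarrow> complex set" where
  "sector r r' \<theta> \<theta>' = {rcis \<rho> \<phi> | \<rho> \<phi>. r \<le> \<rho> \<and> \<rho> \<le> r' \<and> \<theta> \<le> \<phi> \<and> \<phi> \<le> \<theta>'}"

definition annular_diagram :: "'a diagram \<Rightarrow> bool" where
  "annular_diagram \<Delta> \<longleftrightarrow>
     (\<exists>r r' \<theta> \<theta>' \<gamma> \<alpha> \<beta>.
        (\<forall>T\<in>transistors \<Delta>. 1 < r T \<and> r T < r' T \<and> r' T < 2 \<and>
                             \<theta> T < \<theta>' T \<and> \<theta>' T < \<theta> T + 2 * pi) \<and>
        disjoint_drawing \<Delta> {z. 1 < norm z \<and> norm z < 2}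
          (\<lambda>T. sector (r T) (r' T) (\<theta> T) (\<theta>' T)) \<gamma> \<and>
        in_order_along (rcis 1) {\<alpha><..<\<alpha> + 2 * pi} (map (\<lambda>x. pathfinish (\<gamma> x)) (ftop \<Delta>)) \<and>
        in_order_along (rcis 2) {\<beta><..<\<beta> + 2 * pi} (map (\<lambda>x. pathstart (\<gamma> x)) (fbot \<Delta>)) \<and>
        (\<forall>T\<in>transistors \<Delta>.
           in_order_along (rcis (r T)) {\<theta> T..\<theta>' T}
             (map (\<lambda>x. pathstart (\<gamma> x)) (ttop \<Delta> T)) \<and>
           in_order_along (rcis (r' T)) {\<theta> T..\<theta>' T}
             (map (\<lambda>x. pathfinish (\<gamma> x)) (tbot \<Delta> T))))"


section \<open>Diagram groups\<close>

definition dipole_rel ::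
  "'a set \<Rightarrow> ('a list \<times> 'a list) set \<Rightarrow> 'a list \<Rightarrow> ('a diagram \<times> 'a diagram) set" where
  "dipole_rel A R w =
     {(\<Delta>, \<Delta>'). \<Delta> \<in> ww_diagrams A R w \<and> \<Delta>' \<in> ww_diagrams A R w \<and> eq_mod_dipoles \<Delta> \<Delta>'}"

definition braided_diagram_group ::
  "'a set \<Rightarrow> ('a list \<times> 'a list) set \<Rightarrow> 'a list \<Rightarrow> 'a diagram set monoid" where
  "braided_diagram_group A R w =
     \<lparr>carrier = ww_diagrams A R w // dipole_rel A R w,
      mult = (\<lambda>X Y. \<Union>\<Delta>1\<in>X. \<Union>\<Delta>2\<in>Y. dipole_rel A R w `` {concat_diagram \<Delta>1 \<Delta>2}),
      one = dipole_rel A R w `` {id_diagram w}\<rparr>"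

definition planar_diagram_group ::
  "'a set \<Rightarrow> ('a list \<times> 'a list) set \<Rightarrow> 'a list \<Rightarrow> 'a diagram set monoid" where
  "planar_diagram_group A R w = (braided_diagram_group A R w)
     \<lparr>carrier := {\<Delta> \<in> ww_diagrams A R w. planar_diagram \<Delta>} // dipole_rel A R w\<rparr>"

text \<open>An annular diagram is a braided diagram admitting an annular drawing, so the annular diagram
  group, too, consists of classes of braided diagrams.\<close>

definition annular_diagram_group ::
  "'a set \<Rightarrow> ('a list \<times> 'a list) set \<Rightarrow> 'a list \<Rightarrow> 'a diagram set monoid" where
  "annular_diagram_group A R w = (braided_diagram_group A R w)
     \<lparr>carrier := {\<Delta> \<in> ww_diagrams A R w. annular_diagram \<Delta>} // dipole_rel A R w\<rparr>"


section \<open>Right-angled Artin groups\<close>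

text \<open>The group with generators \<open>X\<close> and relators \<open>L\<close>. A word is a list of letters \<open>(x, True)\<close>,
  standing for \<open>x\<close>, and \<open>(x, False)\<close>, standing for the inverse of \<open>x\<close>.\<close>

inductive_set presentation_rel ::
  "'x set \<Rightarrow> ('x \<times> bool) list set \<Rightarrow> (('x \<times> bool) list \<times> ('x \<times> bool) list) set"
  for X L where
  refl: "u \<in> lists (X \<times> UNIV) \<Longrightarrow> (u, u) \<in> presentation_rel X L"
| sym: "(u, v) \<in> presentation_rel X L \<Longrightarrow> (v, u) \<in> presentation_rel X L"
| trans: "(u, v) \<in> presentation_rel X L \<Longrightarrow> (v, z) \<in> presentation_rel X L \<Longrightarrow>
    (u, z) \<in> presentation_rel X L"
| cancel: "u \<in> lists (X \<times> UNIV) \<Longrightarrow> v \<in> lists (X \<times> UNIV) \<Longrightarrow> x \<in> X \<Longrightarrow>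
    (u @ [(x, b), (x, \<not> b)] @ v, u @ v) \<in> presentation_rel X L"
| relator: "u \<in> lists (X \<times> UNIV) \<Longrightarrow> v \<in> lists (X \<times> UNIV) \<Longrightarrow> l \<in> L \<Longrightarrow> l \<in> lists (X \<times> UNIV) \<Longrightarrow>
    (u @ l @ v, u @ v) \<in> presentation_rel X L"

definition presented_group :: "'x set \<Rightarrow> ('x \<times> bool) list set \<Rightarrow> ('x \<times> bool) list set monoid" where
  "presented_group X L =
     \<lparr>carrier = lists (X \<times> UNIV) // presentation_rel X L,
      mult = (\<lambda>U V. \<Union>u\<in>U. \<Union>v\<in>V. presentation_rel X L `` {u @ v}),
      one = presentation_rel X L `` {[]}\<rparr>"

text \<open>Defining graphs may be infinite. When a group embeds in some right-angled Artin group, only the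
  generators occurring in chosen words for its elements matter, so the graph can be taken with at
  most as many vertices as the group has elements, or countably many. Hence asking for a graph
  with vertices of type \<open>'a diagram\<close>, when the group is a subgroup of a braided diagram
  group over the alphabet type \<open>'a\<close>, is no restriction.\<close>

definition simple_graph :: "'v set \<Rightarrow> ('v \<times> 'v) set \<Rightarrow> bool" where
  "simple_graph V E \<longleftrightarrow> E \<subseteq> V \<times> V \<and> Relation.sym E \<and> irrefl E"

definition right_angled_Artin_group :: "'v set \<Rightarrow> ('v \<times> 'v) set \<Rightarrow> ('v \<times> bool) list set monoid" where
  "right_angled_Artin_group V E =
     presented_group V {[(u, True), (v, True), (u, False), (v, False)] | u v. (u, v) \<in> E}"


section \<open>Thompson's groups\<close>

definition dyadic :: "real set" where
  "dyadic = {of_int m / 2 ^ n | (m::int) (n::nat). True}"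

text \<open>The circle \<open>[0,1]/(0 \<sim> 1)\<close> is identified with \<open>[0,1)\<close>, its topology being the one transported
  by \<open>x \<mapsto> cis (2 \<pi> x)\<close>, and intervals of the circle are images under \<open>frac\<close> of intervals of the
  line. An element of \<open>V\<close> is affine, in the coordinates of the circle, on every interval that
  avoids the finite set \<open>Q\<close> of exceptional dyadic points.\<close>

definition thompson_V :: "(real \<Rightarrow> real) monoid" where
  "thompson_V = (BijGroup {0..<1})
     \<lparr>carrier := {f \<in> Bij {0..<1}.
        (\<forall>x\<in>{0..<1}. continuous (at_right x) (\<lambda>y. cis (2 * pi * f y))) \<and>
        f ` (dyadic \<inter> {0..<1}) \<subseteq> dyadic \<and>
        (\<exists>Q. finite Q \<and> Q \<subseteq> dyadic \<inter> {0..<1} \<and>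
           (\<forall>a b. a < b \<and> (\<forall>x\<in>{a<..<b}. frac x \<notin> Q) \<longrightarrow>
              (\<exists>(k::int) c. \<forall>x\<in>{a<..<b}. f (frac x) = frac (2 powi k * x + c))))}\<rparr>"

definition thompson_T :: "(real \<Rightarrow> real) monoid" where
  "thompson_T = thompson_V
     \<lparr>carrier := {f \<in> carrier thompson_V.
        \<exists>h h'. homeomorphism (sphere (0::complex) 1) (sphere 0 1) h h' \<and>
          (\<forall>x\<in>{0..<1}. h (cis (2 * pi * x)) = cis (2 * pi * f x))}\<rparr>"

definition thompson_F :: "(real \<Rightarrow> real) monoid" where
  "thompson_F = (BijGroup {0..1})
     \<lparr>carrier := {f \<in> Bij {0..1}.
        (\<exists>f'. homeomorphism {0..1} {0..1} f f') \<and> strict_mono_on {0..1} f \<and>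
        (\<exists>Q. finite Q \<and> Q \<subseteq> dyadic \<and>
           (\<forall>a b. a < b \<and> {a<..<b} \<subseteq> {0..1} - Q \<longrightarrow>
              (\<exists>(k::int) c. \<forall>x\<in>{a<..<b}. f x = 2 powi k * x + c)))}\<rparr>"


section \<open>Short exact sequences\<close>

text \<open>\<open>1 \<rightarrow> N \<rightarrow> G \<rightarrow> Q \<rightarrow> 1\<close>; \<open>short_exact_sequence\<close> from the library forces the three groups to
  have the same type.\<close>

definition group_extension ::
  "('n, 'x) monoid_scheme \<Rightarrow> ('g, 'y) monoid_scheme \<Rightarrow> ('q, 'z) monoid_scheme \<Rightarrow>
   ('n \<Rightarrow> 'g) \<Rightarrow> ('g \<Rightarrow> 'q) \<Rightarrow> bool" where
  "group_extension N G Q i p \<longleftrightarrow>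
     group N \<and> group G \<and> group Q \<and> i \<in> mon N G \<and> p \<in> epi G Q \<and>
     i ` carrier N = kernel G Q p"

end

theory Submission
  imports Defs "HOL-Complex_Analysis.Complex_Analysis" "HOL-Library.Countable"
begin

text \<open>Every wire of a \<open>(w,w)\<close>-diagram carries a chart \<open>[0,1) \<rightarrow>
[0,1)\<close>: the wires on the top side of the frame cut \<open>[0,1)\<close> into dyadic pieces,
at a transistor the charts of the wires on its top side are joined to a chart of the transistor,
which is cut again into the charts of the wires on its bottom side. The charts on the bottom side of
the frame join to an element of \<open>V\<close>. A transistor together with its chart is a letter,
and the letters read from top to bottom form a word; letters commute when their charts have disjoint
ranges. Dipoles are cancelling pairs of letters, so that a diagram modulo dipoles is determined by
its element of \<open>V\<close> and by its word in the right-angled Artin group on the letters.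
Concatenation turns this into a homomorphism to a semidirect product, whence the extension.

A diagram is planar (annular) iff all its charts, as well as its element of \<open>V\<close>, are
increasing maps onto intervals of the line (onto intervals of the circle). If they are, one draws
each wire as a vertical segment at the image of the midpoint under its chart. Conversely, in a
drawing the points with the same value of the charts form flow lines. One of them, closed up outside
the drawing, is a simple closed curve, and the jump of its winding number shows that flow lines do
not cross, so that charts preserve the order.\<close>

section \<open>Words modulo partial commutation\<close>

text \<open>Merging the charts of a side and cutting the result again replaces each transistor by
  binary merges and splits, that is, sends the diagram to one over the presentation with a single
  letter x and the relation x = xx; braided (planar, annular) diagrams over it are the usual
  pictures of elements of V (F, T). This loses track of the relations applied. A letter therefore
  records a relation together with the place in [0,1) where it acts; placing a diagram below an
  element of V moves that place, which is the action in the semidirect product. On the kernel the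
  action is trivial and words multiply in the Artin group.

  Words describe diagrams faithfully because overlap of ranges controls the order of transistors:
  overlapping ones are comparable, disjoint adjacent ones may be exchanged.

  Drawings are the obstacle in the planar and annular cases. Wires are arbitrary arcs, so that even
  closure under products is awkward to see from pictures. Closure is therefore proved for monotone
  charts, and winding numbers enter only to show that a drawing forces monotonicity.\<close>

abbreviation inv_letter :: "'v \<times> bool => 'v \<times> bool" where
 "inv_letter a \<equiv> (fst a, ~ snd a)"

locale partial_commutation =
 fixes comm :: "'v => 'v => bool"
 assumes comm_sym: "comm x y ==> comm y x" and comm_irrefl: "~ comm x x"
begin

definition proj :: "'v => 'v => ('v \<times> bool) list => ('v \<times> bool) list" where
 "proj x y u = filter (%a. fst a = x | fst a = y) u"

text \<open>Two words differ by exchanges of adjacent commuting letters exactly when their projections to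
  pairs of non-commuting vertices agree; taking this as the definition makes transitivity,
  congruence and cancellation immediate.\<close>

definition teq :: "('v \<times> bool) list => ('v \<times> bool) list => bool" where
 "teq u v \<longleftrightarrow> (\<forall>x y. ~ comm x y --> proj x y u = proj x y v)"

text \<open>No vertex commutes with itself, so \<open>y\<close> also takes the value
  \<open>fst a\<close>, which forces \<open>a\<close> to occur in \<open>u\<close>. The condition
  says that \<open>a\<close> can be moved to the front by exchanges; it is invariant under
  \<open>teq\<close> because it mentions only projections to pairs that do not commute.\<close>

definition starts :: "'v \<times> bool => ('v \<times> bool) list => bool" where
 "starts a u \<longleftrightarrow> (\<forall>y. ~ comm (fst a) y --> (\<exists>r. proj (fst a) y u = a # r))"

text \<open>The constructive form of \<open>starts\<close>: the result is what remains once
  \<open>a\<close> has been moved to the front and removed.\<close>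

fun pull :: "'v \<times> bool => ('v \<times> bool) list => ('v \<times> bool) list option" where
 "pull a [] = None"
| "pull a (b # u) = (if b = a then Some u
   else if comm (fst a) (fst b) then map_option (Cons b) (pull a u) else None)"

fun reduced :: "('v \<times> bool) list => bool" where
 "reduced [] = True"
| "reduced (b # u) = (reduced u & ~ starts (inv_letter b) u)"

text \<open>Left multiplication by a letter on reduced words: cancel the inverse letter if it can be
  brought to the front, otherwise prepend. These operators turn out to satisfy the relations of the
  Artin group up to \<open>teq\<close>, so that the group acts on reduced words.\<close>

definition push :: "'v \<times> bool => ('v \<times> bool) list => ('v \<times> bool) list" where
 "push a u = (case pull (inv_letter a) u of Some v => v | None => a # u)"

lemma teq_refl [simp]: "teq u u" by (simp add: teq_def)

lemma teq_sym: "teq u v ==> teq v u" by (simp add: teq_def)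

lemma teq_trans [trans]: "teq u v ==> teq v z ==> teq u z" by (simp add: teq_def)

lemma teq_Cons: "teq (a # u) (a # v) \<longleftrightarrow> teq u v" unfolding teq_def proj_def by auto

lemma teq_append: "teq u u' ==> teq v v' ==> teq (u @ v) (u' @ v')" unfolding teq_def proj_def by auto

lemma teq_swap: "comm (fst a) (fst b) ==> teq (a # b # u) (b # a # u)" unfolding teq_def proj_def using comm_sym comm_irrefl by auto

lemma teq_nil: "teq u [] ==> u = []"
proof (cases u)
 case (Cons a v)
 then have "proj (fst a) (fst a) u ~= []" by (simp add: proj_def)
 moreover assume "teq u []"
 then have "proj (fst a) (fst a) u = proj (fst a) (fst a) []" using comm_irrefl[of "fst a"] unfolding teq_def by blast
 ultimately show ?thesis by (simp add: proj_def)
qed simp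

lemma starts_cong: "teq u v ==> starts a u \<longleftrightarrow> starts a v" unfolding starts_def teq_def by simp

lemma starts_Cons_same: "starts a (a # u)" unfolding starts_def proj_def by simp

lemma starts_Cons_comm: "comm (fst a) (fst b) ==> starts a (b # u) \<longleftrightarrow> starts a u"
 unfolding starts_def proj_def using comm_irrefl by auto

lemma starts_Cons_noncomm:
 assumes "starts a (b # u)" "~ comm (fst a) (fst b)"
 shows "b = a"
proof -
 have "\<exists>r. proj (fst a) (fst b) (b # u) = a # r" using assms unfolding starts_def by blast
 then show ?thesis by (simp add: proj_def)
qed

lemma starts_imp_pull: "starts a u ==> \<exists>v. pull a u = Some v"
proof (induction u)
 case Nil
 have "~ comm (fst a) (fst a)" by (rule comm_irrefl)
 then show ?case using Nil unfolding starts_def proj_def by auto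
next
 case (Cons b u)
 show ?case
 proof (cases "b = a")
  case False
  then have c: "comm (fst a) (fst b)" using starts_Cons_noncomm[OF Cons.prems] by blast
  then show ?thesis using Cons starts_Cons_comm[OF c] False by auto
 qed simp
qed

lemma pull_teq: "pull a u = Some v ==> teq u (a # v)"
proof (induction u arbitrary: v)
 case (Cons b u)
 show ?case
 proof (cases "b = a")
  case True
  then show ?thesis using Cons by simp
 next
  case False
  then have c: "comm (fst a) (fst b)" using Cons.prems by (auto split: if_splits)
  then obtain v' where v': "pull a u = Some v'" "v = b # v'" using Cons.prems False by auto
  have "teq (b # u) (b # a # v')" using Cons.IH[OF v'(1)] by (simp add: teq_Cons)
  also have "teq (b # a # v') (a # b # v')" by (rule teq_swap) (rule comm_sym[OF c])
  finally show ?thesis using v' by simp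
 qed
qed simp

lemma pull_iff_starts: "(\<exists>v. pull a u = Some v) \<longleftrightarrow> starts a u"
proof
 assume "\<exists>v. pull a u = Some v"
 then show "starts a u" using pull_teq starts_cong starts_Cons_same by blast
qed (rule starts_imp_pull)

lemma pull_None_iff: "pull a u = None \<longleftrightarrow> ~ starts a u" using pull_iff_starts[of a u] by (cases "pull a u") auto

text \<open>Letters passed on the way commute with \<open>a\<close>, so removing \<open>a\<close>
  does not change whether their inverses start the rest; and if the inverse of \<open>a\<close>
  started what remains, \<open>u\<close> would contain a cancellation.\<close>

lemma pull_reduced:
 assumes "pull a u = Some v" "reduced u"
 shows "reduced v & ~ starts (inv_letter a) v" using assms
proof (induction u arbitrary: v)
 case (Cons b u)
 show ?case
 proof (cases "b = a")
  case True
  then show ?thesis using Cons by simp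
 next
  case False
  then have c: "comm (fst a) (fst b)" using Cons.prems by (auto split: if_splits)
  then obtain v' where v': "pull a u = Some v'" "v = b # v'" using Cons.prems False by auto
  have IH: "reduced v' & ~ starts (inv_letter a) v'" using Cons.IH[OF v'(1)] Cons.prems by simp
  have "starts (inv_letter b) u \<longleftrightarrow> starts (inv_letter b) (a # v')" using pull_teq[OF v'(1)] by (rule starts_cong)
  also have "\<dots> \<longleftrightarrow> starts (inv_letter b) v'" using comm_sym[OF c] by (intro starts_Cons_comm) simp
  finally have "~ starts (inv_letter b) v'" using Cons.prems by simp
  then show ?thesis using IH v'(2) c starts_Cons_comm[of "inv_letter a" b v'] by simp
 qed
qed simp

lemma push_reduced: "reduced u ==> reduced (push a u)" unfolding push_def using pull_reduced pull_None_iff[of "inv_letter a" u]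
 by (auto split: option.splits)

lemma push_cases:
 obtains v where "starts (inv_letter a) u" "push a u = v" "teq u (inv_letter a # v)"
 | "~ starts (inv_letter a) u" "push a u = a # u"
proof (cases "pull (inv_letter a) u")
 case None
 then show ?thesis using that(2) pull_None_iff[of "inv_letter a" u] by (simp add: push_def)
next
 case (Some v)
 then have "starts (inv_letter a) u" using pull_iff_starts by blast
 then show ?thesis using that(1) Some pull_teq[OF Some] push_def by simp
qed

lemma push_cong:
 assumes "teq u v"
 shows "teq (push a u) (push a v)"
proof (cases "starts (inv_letter a) u")
 case True
 then have v: "starts (inv_letter a) v" using starts_cong[OF assms] by simp
 have "teq u (inv_letter a # push a u)" using True by (cases rule: push_cases[of a u]) auto
 moreover have "teq v (inv_letter a # push a v)" using v by (cases rule: push_cases[of a v]) auto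
 ultimately have "teq (inv_letter a # push a u) (inv_letter a # push a v)" using assms teq_trans teq_sym by blast
 then show ?thesis by (simp only: teq_Cons)
next
 case False
 then have v: "~ starts (inv_letter a) v" using starts_cong[OF assms] by simp
 have "push a u = a # u" using False by (cases rule: push_cases[of a u]) auto
 moreover have "push a v = a # v" using v by (cases rule: push_cases[of a v]) auto
 ultimately show ?thesis using assms by (simp only: teq_Cons)
qed

text \<open>Either the inner \<open>push\<close> removes an occurrence of \<open>a\<close>, which is
  then put back because reducedness rules out a second cancellation, or it prepends a letter that
  the outer \<open>push\<close> removes.\<close>

lemma push_inverse:
 assumes "reduced u"
 shows "teq (push a (push (inv_letter a) u)) u"
proof (cases rule: push_cases[of "inv_letter a" u])
 case (1 v)
 then have "pull a u ~= None" using pull_None_iff[of a u] by simp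
 then obtain v' where v': "pull a u = Some v'" by auto
 then have "push (inv_letter a) u = v'" by (simp add: push_def)
 moreover have "push a v' = a # v'" using pull_reduced[OF v' assms] pull_None_iff[of "inv_letter a" v'] by (simp add: push_def)
 ultimately show ?thesis using pull_teq[OF v'] teq_sym by simp
next
 case 2
 then show ?thesis by (simp add: push_def)
qed

text \<open>Whether the inverse of \<open>a\<close> starts a word is unaffected by adding or
  removing letters commuting with \<open>a\<close>. Hence the two operators cancel or prepend
  independently of each other, which gives four cases.\<close>

lemma push_commute:
 assumes "comm (fst a) (fst b)"
 shows "teq (push a (push b u)) (push b (push a u))"
proof -
 let ?a = "inv_letter a" and ?b = "inv_letter b"
 note c = comm_sym[OF assms]
 have ab: "starts ?a (b # z) = starts ?a z" "starts ?a (?b # z) = starts ?a z"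
  and ba: "starts ?b (a # z) = starts ?b z" "starts ?b (?a # z) = starts ?b z" for z using assms c starts_Cons_comm by simp_all
 have swap: "teq (?a # ?b # z) (?b # ?a # z)" "teq (?a # b # z) (b # ?a # z)"
  "teq (?b # a # z) (a # ?b # z)" "teq (a # b # z) (b # a # z)" for z using assms c by (simp_all add: teq_swap)
 show ?thesis
 proof (cases rule: push_cases[of b u])
  case b1: (1 v)
  note sa = starts_cong[OF b1(3), of ?a, unfolded ab]
  show ?thesis
  proof (cases rule: push_cases[of a u])
   case a1: (1 w)
   obtain z where z: "push a v = z" "teq v (?a # z)" using sa a1 by (cases rule: push_cases[of a v]) auto
   obtain y where y: "push b w = y" "teq w (?b # y)" using b1 starts_cong[OF a1(3), of ?b, unfolded ba] by (cases rule: push_cases[of b w]) auto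
   have "teq (?b # ?a # z) (?b # v)" using teq_sym[OF z(2)] by (simp only: teq_Cons)
   also note teq_sym[OF b1(3)]
   also note a1(3)
   also have "teq (?a # w) (?a # ?b # y)" using y(2) by (simp only: teq_Cons)
   also have "teq (?a # ?b # y) (?b # ?a # y)" by (rule swap)
   finally show ?thesis using z y a1 b1 by (simp add: teq_Cons)
  next
   case a2: 2
   have z: "push a v = a # v" using sa a2 by (cases rule: push_cases[of a v]) auto
   obtain y where y: "push b (a # u) = y" "teq (a # u) (?b # y)" using b1 ba by (cases rule: push_cases[of b "a # u"]) auto
   have "teq (?b # a # v) (a # ?b # v)" by (rule swap)
   also have "teq (a # ?b # v) (a # u)" using b1(3) teq_Cons teq_sym by metis
   also note y(2)
   finally show ?thesis using z y a2 b1 by (simp add: teq_Cons)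
  qed
 next
  case b2: 2
  show ?thesis
  proof (cases rule: push_cases[of a u])
   case a1: (1 w)
   obtain z where z: "push a (b # u) = z" "teq (b # u) (?a # z)" using a1 ab by (cases rule: push_cases[of a "b # u"]) auto
   have y: "push b w = b # w" using b2 starts_cong[OF a1(3), of ?b, unfolded ba] by (cases rule: push_cases[of b w]) auto
   have "teq (?a # z) (b # u)" by (rule teq_sym) (rule z)
   also have "teq (b # u) (b # ?a # w)" using a1(3) teq_Cons by metis
   also have "teq (b # ?a # w) (?a # b # w)" by (rule teq_sym) (rule swap)
   finally show ?thesis using z y a1 b2 by (simp add: teq_Cons)
  next
   case a2: 2
   have "push a (b # u) = a # b # u" using a2 ab by (cases rule: push_cases[of a "b # u"]) auto
   moreover have "push b (a # u) = b # a # u" using b2 ba by (cases rule: push_cases[of b "a # u"]) auto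
   ultimately show ?thesis using a2 b2 swap by simp
  qed
 qed
qed

lemma foldr_push_reduced: "reduced z ==> reduced (foldr push u z)" by (induction u) (auto simp: push_reduced)

lemma foldr_push_cong: "teq y z ==> teq (foldr push u y) (foldr push u z)" by (induction u) (auto simp: push_cong)

text \<open>Built up from the right, a reduced word never offers a cancellation, so it is recovered
  from its action on the empty word.\<close>

lemma foldr_push_self: "reduced u ==> foldr push u [] = u"
proof (induction u)
 case (Cons a u)
 then show ?case using pull_None_iff[of "inv_letter a" u] by (simp add: push_def)
qed simp

end

section \<open>Presented groups\<close>

context
 fixes X :: "'x set" and L :: "('x \<times> bool) list set"
begin

abbreviation "letters \<equiv> X \<times> (UNIV :: bool set)"
abbreviation "prel \<equiv> presentation_rel X L"
abbreviation "cls u \<equiv> prel `` {u}"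

lemma presentation_rel_lists: "(u, v) \<in> prel ==> u \<in> lists letters & v \<in> lists letters"
 by (induction rule: presentation_rel.induct) auto

lemma presentation_rel_append:
 assumes "(u, v) \<in> prel" "p \<in> lists letters" "q \<in> lists letters"
 shows "(p @ u @ q, p @ v @ q) \<in> prel" using assms(1)
proof (induction rule: presentation_rel.induct)
 case (refl u)
 then show ?case using assms by (intro presentation_rel.refl) auto
next
 case (sym u v)
 then show ?case by (blast intro: presentation_rel.sym)
next
 case (trans u v z)
 then show ?case by (blast intro: presentation_rel.trans)
next
 case (cancel u v x b)
 have "((p @ u) @ [(x, b), (x, ~ b)] @ (v @ q), (p @ u) @ (v @ q)) \<in> prel" using cancel assms by (intro presentation_rel.cancel) auto
 then show ?case by simp
next
 case (relator u v l)
 have "((p @ u) @ l @ (v @ q), (p @ u) @ (v @ q)) \<in> prel" using relator assms by (intro presentation_rel.relator) auto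
 then show ?case by simp
qed

lemma equiv_presentation_rel: "equiv (lists letters) prel"
proof (rule equivI)
 show "prel \<subseteq> lists letters \<times> lists letters" by (rule subrelI) (use presentation_rel_lists in blast)
 show "refl_on (lists letters) prel" by (auto intro!: refl_onI presentation_rel.refl)
 show "sym_on UNIV prel" by (auto intro: symI presentation_rel.sym)
 show "trans_on UNIV prel" by (auto intro: transI presentation_rel.trans)
qed

lemma cls_eq_iff: "u \<in> lists letters ==> v \<in> lists letters ==> cls u = cls v \<longleftrightarrow> (u, v) \<in> prel"
 using eq_equiv_class_iff[OF equiv_presentation_rel] by blast

lemma cls_in_carrier: "u \<in> lists letters ==> cls u \<in> carrier (presented_group X L)"
 unfolding presented_group_def by (simp add: quotientI)

lemma carrier_cases:
 assumes "U \<in> carrier (presented_group X L)"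
 obtains u where "u \<in> lists letters" "U = cls u" using assms by (auto simp: presented_group_def quotient_def)

lemma cls_append:
 assumes "u \<in> lists letters" "v \<in> lists letters"
 shows "cls u \<otimes>\<^bsub>presented_group X L\<^esub> cls v = cls (u @ v)"
proof -
 have eq: "cls (u' @ v') = cls (u @ v)" if "u' \<in> cls u" "v' \<in> cls v" for u' v'
 proof -
  have 1: "(u, u') \<in> prel" "(v, v') \<in> prel" using that by auto
  note l = presentation_rel_lists[OF 1(1)] presentation_rel_lists[OF 1(2)]
  have "(u @ v, u' @ v) \<in> prel" using presentation_rel_append[OF 1(1), of "[]" v] l by simp
  moreover have "(u' @ v, u' @ v') \<in> prel" using presentation_rel_append[OF 1(2), of u' "[]"] l by simp
  ultimately have "(u @ v, u' @ v') \<in> prel" by (rule presentation_rel.trans)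
  then show ?thesis using l by (subst eq_commute, subst cls_eq_iff) auto
 qed
 have "(\<Union>u'\<in>cls u. \<Union>v'\<in>cls v. cls (u' @ v')) = (\<Union>u'\<in>cls u. \<Union>v'\<in>cls v. cls (u @ v))"
  by (rule SUP_cong[OF HOL.refl], rule SUP_cong[OF HOL.refl], rule eq)
 moreover have "u \<in> cls u" "v \<in> cls v" using assms by (auto intro: presentation_rel.refl)
 then have "(\<Union>u'\<in>cls u. \<Union>v'\<in>cls v. cls (u @ v)) = cls (u @ v)" by (metis UN_constant empty_iff)
 ultimately show ?thesis by (simp only: presented_group_def monoid.simps)
qed

lemma one_presented: "\<one>\<^bsub>presented_group X L\<^esub> = cls []" by (simp add: presented_group_def)

lemma cls_cancel: "a \<in> letters ==> v \<in> lists letters ==> (a # inv_letter a # v, v) \<in> prel"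
 using presentation_rel.cancel[of "[]" X v "fst a" "snd a" L] by (cases a) auto

lemma inv_word_lists: "u \<in> lists letters ==> rev (map inv_letter u) \<in> lists letters" by (induction u) auto

lemma inverse_word:
 "u \<in> lists letters ==> (rev (map inv_letter u) @ u, []) \<in> prel"
proof (induction u)
 case Nil
 then show ?case by (simp add: presentation_rel.refl)
next
 case (Cons a u)
 have "(inv_letter a # inv_letter (inv_letter a) # u, u) \<in> prel" using Cons by (intro cls_cancel) auto
 then have "(inv_letter a # a # u, u) \<in> prel" by simp
 then have "(rev (map inv_letter u) @ (inv_letter a # a # u) @ [], rev (map inv_letter u) @ u @ []) \<in> prel"
  using Cons.prems inv_word_lists[of u] by (intro presentation_rel_append) auto
 then show ?case using Cons by (auto intro: presentation_rel.trans)
qed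

lemma group_presented: "group (presented_group X L)"
proof (rule groupI)
 fix U V W
 assume U: "U \<in> carrier (presented_group X L)" and V: "V \<in> carrier (presented_group X L)"
  and W: "W \<in> carrier (presented_group X L)"
 obtain u v w where "u \<in> lists letters" "U = cls u" "v \<in> lists letters" "V = cls v"
  "w \<in> lists letters" "W = cls w" using U V W carrier_cases by metis
 then show "U \<otimes>\<^bsub>presented_group X L\<^esub> V \<otimes>\<^bsub>presented_group X L\<^esub> W =
  U \<otimes>\<^bsub>presented_group X L\<^esub> (V \<otimes>\<^bsub>presented_group X L\<^esub> W)" by (simp add: cls_append)
next
 fix U V
 assume U: "U \<in> carrier (presented_group X L)" and V: "V \<in> carrier (presented_group X L)"
 obtain u v where "u \<in> lists letters" "U = cls u" "v \<in> lists letters" "V = cls v" using U V carrier_cases by metis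
 then show "U \<otimes>\<^bsub>presented_group X L\<^esub> V \<in> carrier (presented_group X L)" by (simp add: cls_append cls_in_carrier)
next
 show "\<one>\<^bsub>presented_group X L\<^esub> \<in> carrier (presented_group X L)" by (simp add: one_presented cls_in_carrier)
next
 fix U
 assume U: "U \<in> carrier (presented_group X L)"
 then obtain u where u: "u \<in> lists letters" "U = cls u" using carrier_cases by metis
 then show "\<one>\<^bsub>presented_group X L\<^esub> \<otimes>\<^bsub>presented_group X L\<^esub> U = U" by (simp add: one_presented cls_append)
 have l: "rev (map inv_letter u) \<in> lists letters" using u inv_word_lists by blast
 then have "cls (rev (map inv_letter u)) \<otimes>\<^bsub>presented_group X L\<^esub> U = \<one>\<^bsub>presented_group X L\<^esub>"
  using u inverse_word[OF u(1)] by (simp add: one_presented cls_append cls_eq_iff)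
 then show "\<exists>V\<in>carrier (presented_group X L). V \<otimes>\<^bsub>presented_group X L\<^esub> U = \<one>\<^bsub>presented_group X L\<^esub>"
  using l cls_in_carrier by blast
qed

lemma cls_inverse:
 assumes "u \<in> lists letters"
 shows "cls (rev (map inv_letter u)) = inv\<^bsub>presented_group X L\<^esub> (cls u)"
proof (rule group.inv_equality[OF group_presented, symmetric])
 have l: "rev (map inv_letter u) \<in> lists letters" using assms inv_word_lists by blast
 show "cls (rev (map inv_letter u)) \<otimes>\<^bsub>presented_group X L\<^esub> cls u = \<one>\<^bsub>presented_group X L\<^esub>"
  using l assms inverse_word[OF assms] by (simp add: one_presented cls_append cls_eq_iff)
 show "cls u \<in> carrier (presented_group X L)" using assms by (rule cls_in_carrier)
 show "cls (rev (map inv_letter u)) \<in> carrier (presented_group X L)" using l by (rule cls_in_carrier)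
qed

end

section \<open>Right-angled Artin groups\<close>

definition commutators :: "('v \<times> 'v) set => ('v \<times> bool) list set" where
 "commutators E = {[(u, True), (v, True), (u, False), (v, False)] | u v. (u, v) \<in> E}"

lemma right_angled_Artin_group_eq: "right_angled_Artin_group V E = presented_group V (commutators E)"
 unfolding right_angled_Artin_group_def commutators_def ..

locale raag =
 fixes V :: "'v set" and E :: "('v \<times> 'v) set"
 assumes graph: "simple_graph V E"
begin

sublocale partial_commutation "%x y. (x, y) \<in> E" using graph unfolding simple_graph_def by unfold_locales (auto dest: symD simp: irrefl_def)

abbreviation "aeq u v \<equiv> (u, v) \<in> presentation_rel V (commutators E)"
abbreviation "acls u \<equiv> presentation_rel V (commutators E) `` {u}"
abbreviation "AG \<equiv> presented_group V (commutators E)"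

lemma edge_vertices: "(x, y) \<in> E ==> x \<in> V & y \<in> V" using graph unfolding simple_graph_def by auto

interpretation AG: group AG by (rule group_presented)

lemma push_commutator:
 assumes "(x, y) \<in> E" "reduced z"
 shows "teq (foldr push [(x, True), (y, True), (x, False), (y, False)] z) z"
proof -
 define z1 where "z1 = push (y, False) z"
 have z1: "reduced z1" using assms push_reduced unfolding z1_def by simp
 have "teq (push (y, True) (push (x, False) z1)) (push (x, False) (push (y, True) z1))" using assms comm_sym by (intro push_commute) auto
 then have "teq (push (x, True) (push (y, True) (push (x, False) z1)))
  (push (x, True) (push (x, False) (push (y, True) z1)))" by (rule push_cong)
 also have "teq (push (x, True) (push (x, False) (push (y, True) z1))) (push (y, True) z1)"
  using push_inverse[of "push (y, True) z1" "(x, True)"] push_reduced[OF z1] by simp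
 also have "teq (push (y, True) z1) z" using push_inverse[of z "(y, True)"] assms unfolding z1_def by simp
 finally show ?thesis by (simp add: z1_def)
qed

text \<open>The relations hold for the \<open>push\<close> operators, so words equal in the Artin
  group act equally on reduced words modulo \<open>teq\<close>. Applied to the empty word, this is
  van der Waerden's argument that a reduced word is determined by its group element.\<close>

lemma aeq_foldr_push: "aeq u v ==> reduced z ==> teq (foldr push u z) (foldr push v z)"
proof (induction arbitrary: z rule: presentation_rel.induct)
 case (sym u v)
 then show ?case using teq_sym by blast
next
 case (trans u v z)
 then show ?case using teq_trans by blast
next
 case (cancel u v x b)
 show ?case using foldr_push_cong[OF push_inverse[of "foldr push v z" "(x, b)"]] foldr_push_reduced[OF cancel.prems] by simp
next
 case (relator u v l)
 then obtain x y where l: "l = [(x, True), (y, True), (x, False), (y, False)]" "(x, y) \<in> E" unfolding commutators_def by auto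
 have "teq (foldr push u (foldr push l (foldr push v z))) (foldr push u (foldr push v z))"
  using push_commutator[OF l(2) foldr_push_reduced[OF relator.prems]] foldr_push_cong unfolding l(1) by blast
 then show ?case by simp
qed simp

lemma reduced_aeq_imp_teq: "aeq u v ==> reduced u ==> reduced v ==> teq u v" using aeq_foldr_push[of u v "[]"] foldr_push_self by simp

text \<open>The relators are commutators of positive letters; the other combinations of signs follow
  by passing to inverses in the group.\<close>

lemma letter_commute:
 assumes "(fst a, fst b) \<in> E"
 shows "acls [a] \<otimes>\<^bsub>AG\<^esub> acls [b] = acls [b] \<otimes>\<^bsub>AG\<^esub> acls [a]"
proof -
 obtain x s y t where ab: "a = (x, s)" "b = (y, t)" by (cases a, cases b) auto
 have xy: "x \<in> V" "y \<in> V" "(x, y) \<in> E" using assms edge_vertices ab by auto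
 define g where "g \<equiv> %c. acls [c]"
 have car: "g c \<in> carrier AG" if "fst c \<in> V" for c unfolding g_def using that by (intro cls_in_carrier) (auto simp: mem_Times_iff)
 have inv: "g (z, False) = inv\<^bsub>AG\<^esub> g (z, True)" if "z \<in> V" for z
  unfolding g_def using cls_inverse[of "[(z, True)]" V "commutators E"] that by simp
 have "aeq ([] @ [(x, True), (y, True), (x, False), (y, False)] @ []) ([] @ [])"
  using xy by (intro presentation_rel.relator) (auto simp: commutators_def)
 then have "acls [(x, True), (y, True), (x, False), (y, False)] = acls []" using xy by (subst cls_eq_iff) auto
 moreover have "acls [(x, True), (y, True), (x, False), (y, False)] =
   g (x, True) \<otimes>\<^bsub>AG\<^esub> g (y, True) \<otimes>\<^bsub>AG\<^esub> g (x, False) \<otimes>\<^bsub>AG\<^esub> g (y, False)"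
  unfolding g_def using xy by (simp add: cls_append)
 ultimately have "g (x, True) \<otimes>\<^bsub>AG\<^esub> g (y, True) \<otimes>\<^bsub>AG\<^esub> inv\<^bsub>AG\<^esub> g (x, True) \<otimes>\<^bsub>AG\<^esub> inv\<^bsub>AG\<^esub> g (y, True) = \<one>\<^bsub>AG\<^esub>"
  using inv xy one_presented by metis
 then have "\<one>\<^bsub>AG\<^esub> = g (x, True) \<otimes>\<^bsub>AG\<^esub> g (y, True) \<otimes>\<^bsub>AG\<^esub> inv\<^bsub>AG\<^esub> g (x, True) \<otimes>\<^bsub>AG\<^esub> inv\<^bsub>AG\<^esub> g (y, True)"
  by (rule HOL.sym)
 then have "g (x, True) \<otimes>\<^bsub>AG\<^esub> g (y, True) \<otimes>\<^bsub>AG\<^esub> inv\<^bsub>AG\<^esub> g (x, True) = g (y, True)"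
  using car[of "(x, True)"] car[of "(y, True)"] xy by (subst (asm) AG.inv_solve_right) auto
 then have tt: "g (x, True) \<otimes>\<^bsub>AG\<^esub> g (y, True) = g (y, True) \<otimes>\<^bsub>AG\<^esub> g (x, True)"
  using car[of "(x, True)"] car[of "(y, True)"] xy
   AG.inv_solve_right[of "g (y, True)" "g (x, True) \<otimes>\<^bsub>AG\<^esub> g (y, True)" "g (x, True)"] by auto
 have inv_comm: "inv\<^bsub>AG\<^esub> p \<otimes>\<^bsub>AG\<^esub> q = q \<otimes>\<^bsub>AG\<^esub> inv\<^bsub>AG\<^esub> p"
  if "p \<otimes>\<^bsub>AG\<^esub> q = q \<otimes>\<^bsub>AG\<^esub> p" "p \<in> carrier AG" "q \<in> carrier AG" for p q
  using that by (metis AG.inv_closed AG.inv_solve_left' AG.m_assoc AG.m_closed AG.r_inv AG.r_one)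
 have ft: "g (x, False) \<otimes>\<^bsub>AG\<^esub> g (y, True) = g (y, True) \<otimes>\<^bsub>AG\<^esub> g (x, False)"
  using inv_comm[OF tt] car xy inv by simp
 have tf: "g (x, True) \<otimes>\<^bsub>AG\<^esub> g (y, False) = g (y, False) \<otimes>\<^bsub>AG\<^esub> g (x, True)"
  using inv_comm[OF tt[symmetric]] car xy inv by simp
 have ff: "g (x, False) \<otimes>\<^bsub>AG\<^esub> g (y, False) = g (y, False) \<otimes>\<^bsub>AG\<^esub> g (x, False)"
  using inv_comm[OF ft[symmetric]] car xy inv by simp
 show ?thesis using tt ft tf ff unfolding ab g_def by (cases s; cases t) simp_all
qed

lemma aeq_swap:
 assumes "(fst a, fst b) \<in> E" "u \<in> lists (V \<times> UNIV)"
 shows "aeq (a # b # u) (b # a # u)"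
proof -
 have ab: "a \<in> V \<times> UNIV" "b \<in> V \<times> UNIV" using assms edge_vertices by (auto simp: mem_Times_iff)
 then have "acls [a, b] = acls [b, a]" using letter_commute[OF assms(1)] by (simp add: cls_append)
 then have "aeq [a, b] [b, a]" using ab by (simp add: cls_eq_iff)
 then show ?thesis using presentation_rel_append[of "[a, b]" "[b, a]" V _ "[]" u] assms by simp
qed

lemma aeq_Cons: "aeq u v ==> a \<in> V \<times> UNIV ==> aeq (a # u) (a # v)" using presentation_rel_append[of u v V _ "[a]" "[]"] by simp

lemma pull_aeq:
 "pull a u = Some v ==> u \<in> lists (V \<times> UNIV) ==> aeq u (a # v) & a # v \<in> lists (V \<times> UNIV)"
proof (induction u arbitrary: v)
 case (Cons b u)
 show ?case
 proof (cases "b = a")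
  case True
  then show ?thesis using Cons.prems presentation_rel.refl[of "b # u" V] by auto
 next
  case False
  then have c: "(fst a, fst b) \<in> E" using Cons.prems by (auto split: if_splits)
  then obtain v' where v': "pull a u = Some v'" "v = b # v'" using Cons.prems False by auto
  have IH: "aeq u (a # v')" "a # v' \<in> lists (V \<times> UNIV)" using Cons.IH[OF v'(1)] Cons.prems by auto
  have "aeq (b # u) (b # a # v')" using Cons.prems by (intro aeq_Cons IH) auto
  moreover have "aeq (b # a # v') (a # b # v')" using c IH comm_sym by (intro aeq_swap) auto
  ultimately show ?thesis using v' IH Cons.prems by (auto intro: presentation_rel.trans)
 qed
qed simp

text \<open>Equality of projections is turned into actual exchanges: the first letter of
  \<open>u\<close> starts \<open>v\<close>, so \<open>pull\<close> brings it to the front of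
  \<open>v\<close>, and the tails are compared by induction.\<close>

lemma teq_imp_aeq: "teq u v ==> u \<in> lists (V \<times> UNIV) ==> v \<in> lists (V \<times> UNIV) ==> aeq u v"
proof (induction u arbitrary: v)
 case Nil
 then show ?case using teq_nil[OF teq_sym[OF Nil(1)]] by (simp add: presentation_rel.refl)
next
 case (Cons a u)
 have "starts a v" using starts_cong[OF Cons.prems(1)] starts_Cons_same by blast
 then obtain v' where v': "pull a v = Some v'" using starts_imp_pull by blast
 have e: "aeq v (a # v')" "a # v' \<in> lists (V \<times> UNIV)" using pull_aeq[OF v'] Cons.prems by auto
 have "teq u v'" using pull_teq[OF v'] Cons.prems(1) teq_trans teq_Cons by blast
 then have "aeq u v'" using Cons e by auto
 then have "aeq (a # u) (a # v')" using Cons.prems by (intro aeq_Cons) auto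
 then show ?case using e presentation_rel.sym presentation_rel.trans by blast
qed

end

section \<open>Charts on the half-open unit interval\<close>

text \<open>Half-open, so that the two halves are disjoint copies of the whole and cut points need
  no convention. Having a type makes charts total functions, with \<open>bij\<close>,
  \<open>inj\<close> and \<open>range\<close> in place of relativised notions.\<close>

typedef ivl = "{0..<1::real}" morphisms pt mk by (rule exI[of _ 0]) auto

setup_lifting type_definition_ivl

lemma pt_bounds: "0 <= pt t" "pt t < 1" using pt[of t] by auto

lemma pt_mk: "0 <= x ==> x < 1 ==> pt (mk x) = x" by (rule mk_inverse) simp

definition lo :: "ivl => ivl" where "lo t = mk (pt t / 2)"
definition hi :: "ivl => ivl" where "hi t = mk ((pt t + 1) / 2)"

lemma pt_lo: "pt (lo t) = pt t / 2" unfolding lo_def using pt_bounds[of t] by (intro pt_mk) auto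

lemma pt_hi: "pt (hi t) = (pt t + 1) / 2" unfolding hi_def using pt_bounds[of t] by (intro pt_mk) auto

text \<open>The codomain is left general because the same operation is later applied to real-valued
  lifts of charts.\<close>

definition join :: "(ivl => 'b) => (ivl => 'b) => ivl => 'b" where
 "join c d t = (if pt t < 1 / 2 then c (mk (2 * pt t)) else d (mk (2 * pt t - 1)))"

lemma join_lo: "join c d (lo t) = c t" using pt_bounds[of t] by (simp add: join_def pt_lo pt_inverse)

lemma join_hi: "join c d (hi t) = d t"
proof -
 have "2 * pt (hi t) - 1 = pt t" "~ pt (hi t) < 1 / 2" using pt_bounds[of t] by (auto simp: pt_hi field_simps)
 then show ?thesis by (simp add: join_def pt_inverse)
qed

lemma lo_hi_cases:
 obtains s where "t = lo s" | s where "t = hi s"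
proof (cases "pt t < 1 / 2")
 case True
 then have "t = lo (mk (2 * pt t))" using pt_bounds[of t] by (simp add: lo_def pt_mk pt_inverse)
 then show ?thesis by (rule that)
next
 case False
 then have "t = hi (mk (2 * pt t - 1))" using pt_bounds[of t] by (simp add: hi_def pt_mk pt_inverse)
 then show ?thesis by (rule that)
qed

lemma join_lo_hi: "join (c \<circ> lo) (c \<circ> hi) = c"
proof
 fix t show "join (c \<circ> lo) (c \<circ> hi) t = c t" by (cases t rule: lo_hi_cases) (simp_all add: join_lo join_hi)
qed

lemma join_comp_lo: "join c d \<circ> lo = c" and join_comp_hi: "join c d \<circ> hi = d" by (auto simp: join_lo join_hi)

lemma comp_join: "f \<circ> join c d = join (f \<circ> c) (f \<circ> d)" by (auto simp: join_def)

text \<open>The empty list is a default case: relations consist of non-empty words and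
  \<open>w\<close> is non-empty, so no side is ever empty.\<close>

fun joinl :: "(ivl => 'b) list => ivl => 'b" where
 "joinl [] = undefined"
| "joinl [c] = c"
| "joinl (c # d # cs) = join c (joinl (d # cs))"

text \<open>Cuts at 1/2, 3/4, 7/8 and so on. This particular dyadic subdivision is a choice; the
  comb shape makes \<open>pieces\<close> and \<open>joinl\<close> mutually inverse by the same
  recursion.\<close>

fun pieces :: "nat => (ivl => 'b) => (ivl => 'b) list" where
 "pieces 0 c = []"
| "pieces (Suc 0) c = [c]"
| "pieces (Suc (Suc n)) c = (c \<circ> lo) # pieces (Suc n) (c \<circ> hi)"

lemma length_pieces [simp]: "length (pieces n c) = n" by (induction n c rule: pieces.induct) (simp_all del: o_apply)

lemma joinl_pieces: "n ~= 0 ==> joinl (pieces n c) = c"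
proof (induction n c rule: pieces.induct)
 case (3 n c)
 have "pieces (Suc n) (c \<circ> hi) ~= []" by (metis length_pieces list.size(3) nat.distinct(1))
 then obtain d ds where "pieces (Suc n) (c \<circ> hi) = d # ds" by (cases "pieces (Suc n) (c \<circ> hi)") auto
 then show ?case using 3 join_lo_hi[of c] by (simp del: o_apply)
qed auto

lemma pieces_joinl: "pieces (length cs) (joinl cs) = cs" by (induction cs rule: joinl.induct) (auto simp: join_comp_lo join_comp_hi)

lemma pieces_comp: "pieces n (f \<circ> c) = map ((\<circ>) f) (pieces n c)"
 by (induction n c rule: pieces.induct) (simp_all add: comp_assoc del: o_apply)

lemma joinl_comp: "cs ~= [] ==> joinl (map ((\<circ>) f) cs) = f \<circ> joinl cs" by (induction cs rule: joinl.induct) (auto simp: comp_join)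

definition emb :: "nat => nat => ivl => ivl" where
 "emb n i = pieces n id ! i"

lemma pieces_nth: "i < n ==> pieces n c ! i = c \<circ> emb n i" using pieces_comp[of n c id] by (simp add: emb_def)

lemma joinl_emb: "i < length cs ==> joinl cs (emb (length cs) i t) = (cs ! i) t"
 using pieces_nth[of i "length cs" "joinl cs"] by (simp add: pieces_joinl)

lemma emb_Suc_Suc: "emb (Suc (Suc n)) 0 = lo" "emb (Suc (Suc n)) (Suc i) = hi \<circ> emb (Suc n) i" if "i < Suc n"
 using pieces_nth[OF that, of hi] by (simp_all add: emb_def)

lemma emb_surj: "n ~= 0 ==> \<exists>i t. i < n & s = emb n i t"
proof (induction n arbitrary: s)
 case (Suc n)
 show ?case
 proof (cases n)
  case 0
  then show ?thesis by (auto simp: emb_def)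
 next
  case (Suc m)
  show ?thesis
  proof (cases s rule: lo_hi_cases)
   case (1 t)
   then have "s = emb (Suc n) 0 t" using Suc emb_Suc_Suc(1)[of 0 m] by simp
   then show ?thesis by blast
  next
   case (2 t)
   obtain i r where "i < n" "t = emb n i r" using Suc.IH[of t] Suc by auto
   then have "Suc i < Suc n" "s = emb (Suc n) (Suc i) r" using 2 emb_Suc_Suc(2)[of i m] Suc by auto
   then show ?thesis by blast
  qed
 qed
qed simp

text \<open>The order of [0,1) is the lexicographic order of pairs (number of the piece, position in
  it). Together with \<open>emb_surj\<close> this reduces order statements about joined charts to
  indices of wires.\<close>

lemma emb_less:
 "i < n ==> j < n ==> pt (emb n i s) < pt (emb n j t) \<longleftrightarrow> i < j | (i = j & pt s < pt t)"
proof (induction n arbitrary: i j)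
 case (Suc n)
 show ?case
 proof (cases n)
  case 0
  then show ?thesis using Suc.prems by (auto simp: emb_def)
 next
  case n: (Suc m)
  have e0: "emb (Suc n) 0 = lo" and e1: "!!i. i < n ==> emb (Suc n) (Suc i) = hi \<circ> emb n i"
   using emb_Suc_Suc(1)[of 0 m] emb_Suc_Suc(2)[of _ m] n by auto
  have b: "pt s < 1" "0 <= pt t" "pt (emb n k r) < 1" "0 <= pt (emb n k r)" for k r using pt_bounds by auto
  show ?thesis
  proof (cases i)
   case 0
   then show ?thesis using e0 e1 Suc.prems b(1) less_le_trans[OF b(1), of "pt (emb n (j - 1) t) + 1"] b(4)[of "j - 1" t]
    by (cases j) (auto simp: pt_lo pt_hi)
  next
   case i: (Suc i')
   show ?thesis
   proof (cases j)
    case 0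
    then show ?thesis using e0 e1 Suc.prems pt_bounds[of t] b(4)[of i' s] i by (auto simp: pt_lo pt_hi)
   next
    case (Suc j')
    then show ?thesis using e1[of i'] e1[of j'] Suc.prems Suc.IH[of i' j'] i by (simp add: pt_hi)
   qed
  qed
 qed
qed simp

lemma pt_eq_iff: "pt s = pt t \<longleftrightarrow> s = t" by (rule pt_inject)

lemma emb_eq_iff: "i < n ==> j < n ==> emb n i s = emb n j t \<longleftrightarrow> i = j & s = t"
 using emb_less[of i n j s t] emb_less[of j n i t s] pt_eq_iff[of s t] pt_eq_iff[of "emb n i s" "emb n j t"]
 by (auto simp: not_less_iff_gr_or_eq)

lemma range_joinl:
 assumes "cs ~= []"
 shows "range (joinl cs) = (\<Union>c\<in>set cs. range c)"
proof
 show "range (joinl cs) \<subseteq> (\<Union>c\<in>set cs. range c)"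
 proof safe
  fix s
  obtain i t where "i < length cs" "s = emb (length cs) i t" using emb_surj assms by blast
  then show "joinl cs s \<in> (\<Union>c\<in>set cs. range c)" using joinl_emb nth_mem by blast
 qed
 show "(\<Union>c\<in>set cs. range c) \<subseteq> range (joinl cs)"
 proof safe
  fix c t assume "c \<in> set cs"
  then obtain i where "i < length cs" "cs ! i = c" by (auto simp: in_set_conv_nth)
  then show "c t \<in> range (joinl cs)" using joinl_emb[of i cs t] by (metis rangeI)
 qed
qed

lemma inj_joinl:
 assumes "cs ~= []" "!!i s j t. i < length cs ==> j < length cs ==> (cs ! i) s = (cs ! j) t ==> i = j & s = t"
 shows "inj (joinl cs)"
proof (rule injI)
 fix s t assume e: "joinl cs s = joinl cs t"
 obtain i s' where i: "i < length cs" "s = emb (length cs) i s'" using emb_surj assms(1) by blast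
 obtain j t' where j: "j < length cs" "t = emb (length cs) j t'" using emb_surj assms(1) by blast
 show "s = t" using assms(2)[OF i(1) j(1), of s' t'] e i j joinl_emb[of i cs s'] joinl_emb[of j cs t'] by simp
qed

lemma inj_joinl_nth:
 assumes "inj (joinl cs)" "i < length cs" "j < length cs" "(cs ! i) s = (cs ! j) t"
 shows "i = j & s = t"
proof -
 have "emb (length cs) i s = emb (length cs) j t" using assms joinl_emb by (metis injD)
 then show ?thesis using assms emb_eq_iff by blast
qed

text \<open>Generated syntactically for two purposes: the expressions are countable, so charts can
  be coded by numbers, and induction over them yields the dyadic affine form that membership in V
  demands.\<close>

inductive chart :: "(ivl => ivl) => bool" where
 chart_id: "chart id"
| chart_lo: "chart c ==> chart (c \<circ> lo)"
| chart_hi: "chart c ==> chart (c \<circ> hi)"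
| chart_join: "chart c ==> chart d ==> chart (join c d)"

lemma chart_pieces: "chart c ==> d \<in> set (pieces n c) ==> chart d" by (induction n c rule: pieces.induct) (auto intro: chart.intros)

lemma chart_joinl: "cs ~= [] ==> (!!c. c \<in> set cs ==> chart c) ==> chart (joinl cs)"
 by (induction cs rule: joinl.induct) (auto intro: chart_join)

lemma chart_comp: "chart d ==> chart c ==> chart (c \<circ> d)"
 by (induction rule: chart.induct) (auto intro: chart.intros simp: comp_join comp_assoc[symmetric])

datatype chart_expr = CId | CLo chart_expr | CHi chart_expr | CJoin chart_expr chart_expr

instance chart_expr :: countable by countable_datatype

primrec chart_of :: "chart_expr => ivl => ivl" where
 "chart_of CId = id"
| "chart_of (CLo e) = chart_of e \<circ> lo"
| "chart_of (CHi e) = chart_of e \<circ> hi"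
| "chart_of (CJoin e e') = join (chart_of e) (chart_of e')"

lemma chart_imp_chart_of: "chart c ==> \<exists>e. c = chart_of e" by (induction rule: chart.induct) (metis chart_of.simps)+

text \<open>Several expressions may denote the same chart; one is chosen per chart, so that the code
  depends on the chart alone.\<close>

definition chart_code :: "(ivl => ivl) => nat" where
 "chart_code c = to_nat (SOME e. c = chart_of e)"

lemma chart_code_inj: "chart c ==> chart d ==> chart_code c = chart_code d ==> c = d"
 unfolding chart_code_def using someI_ex[OF chart_imp_chart_of] by (metis to_nat_split)

section \<open>Charts are piecewise affine\<close>

lemma dyadic_add: "x \<in> dyadic ==> y \<in> dyadic ==> x + y \<in> dyadic"
proof -
 assume "x \<in> dyadic" "y \<in> dyadic"
 then obtain m n :: int and p q :: nat where "x = of_int m / 2 ^ p" "y = of_int n / 2 ^ q" unfolding dyadic_def by auto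
 then have "x + y = of_int (m * 2 ^ q + n * 2 ^ p) / 2 ^ (p + q)" by (simp add: add_frac_eq power_add)
 then show ?thesis unfolding dyadic_def by blast
qed

lemma dyadic_mult: "x \<in> dyadic ==> y \<in> dyadic ==> x * y \<in> dyadic"
proof -
 assume "x \<in> dyadic" "y \<in> dyadic"
 then obtain m n :: int and p q :: nat where "x = of_int m / 2 ^ p" "y = of_int n / 2 ^ q" unfolding dyadic_def by auto
 then have "x * y = of_int (m * n) / 2 ^ (p + q)" by (simp add: add_frac_eq power_add)
 then show ?thesis unfolding dyadic_def by blast
qed

lemma dyadic_of_int: "of_int m / 2 ^ n \<in> dyadic" unfolding dyadic_def by blast

lemma dyadic_powi: "2 powi k \<in> dyadic"
proof (cases "k \<ge> 0")
 case True
 then show ?thesis using dyadic_of_int[of "2 ^ nat k" 0] by (simp add: power_int_def)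
next
 case False
 then show ?thesis using dyadic_of_int[of 1 "nat (- k)"] by (simp add: power_int_def power_one_over)
qed

definition cell :: "nat => real => int" where "cell N x = \<lfloor>x * 2 ^ N\<rfloor>"

text \<open>The level \<open>N\<close> bounds the denominators of the break points. It may be raised
  freely, which lets two maps be joined at a common level.\<close>

definition dyadic_affine :: "nat => (ivl => real) => bool" where
 "dyadic_affine N g \<longleftrightarrow> (\<forall>t0. \<exists>(k::int) b. b \<in> dyadic &
   (\<forall>t. cell N (pt t) = cell N (pt t0) --> g t = 2 powi k * pt t + b))"

lemma cell_Suc: "cell N x = cell (Suc N) x div 2" using floor_divide_real_eq_div[of 2 "x * 2 ^ Suc N"] by (simp add: cell_def)

lemma cell_add: "cell (N + m) x = cell (N + m) y ==> cell N x = cell N y"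
proof (induction m)
 case (Suc m)
 then show ?case using cell_Suc[of "N + m" x] cell_Suc[of "N + m" y] by simp
qed simp

lemma cell_lo: "cell N (pt (lo t)) = cell N (pt t) div 2" using floor_divide_real_eq_div[of 2 "pt t * 2 ^ N"] by (simp add: cell_def pt_lo)

lemma cell_hi: "cell N (pt (hi t)) = (cell N (pt t) + 2 ^ N) div 2"
proof -
 have "cell N (pt (hi t)) = \<lfloor>(pt t * 2 ^ N + 2 ^ N) / of_int 2\<rfloor>" by (simp add: cell_def pt_hi algebra_simps)
 also have "\<dots> = \<lfloor>pt t * 2 ^ N + 2 ^ N\<rfloor> div 2" by (rule floor_divide_real_eq_div) simp
 also have "\<lfloor>pt t * 2 ^ N + 2 ^ N\<rfloor> = cell N (pt t) + 2 ^ N"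
  using floor_add_int[of "pt t * 2 ^ N" "2 ^ N"] by (simp add: cell_def)
 finally show ?thesis .
qed

lemma cell_Suc_lo: "cell (Suc N) (pt (lo t)) = cell N (pt t)" by (simp add: cell_def pt_lo)

lemma cell_Suc_hi: "cell (Suc N) (pt (hi t)) = cell N (pt t) + 2 ^ N"
proof -
 have "pt (hi t) * 2 ^ Suc N = pt t * 2 ^ N + of_int (2 ^ N)" by (simp add: pt_hi field_simps)
 then show ?thesis unfolding cell_def using floor_add_int[of "pt t * 2 ^ N" "2 ^ N"] by simp
qed

lemma cell_bounds: "0 <= cell N (pt t)" "cell N (pt t) < 2 ^ N" using pt_bounds[of t] by (auto simp: cell_def floor_less_iff)

lemma dyadic_affine_add:
 assumes "dyadic_affine N g"
 shows "dyadic_affine (N + m) g" unfolding dyadic_affine_def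
proof
 fix t0
 obtain k b where kb: "b \<in> dyadic" "!!t. cell N (pt t) = cell N (pt t0) ==> g t = 2 powi k * pt t + b"
  using assms unfolding dyadic_affine_def by meson
 then show "\<exists>(k::int) b. b \<in> dyadic &
   (\<forall>t. cell (N + m) (pt t) = cell (N + m) (pt t0) --> g t = 2 powi k * pt t + b)" using cell_add[of N m] by blast
qed

text \<open>Halving sends each cell of level \<open>N\<close> into a single cell of the same level,
  so the level does not grow; the slope loses a factor two.\<close>

lemma dyadic_affine_lo:
 assumes "dyadic_affine N g"
 shows "dyadic_affine N (g \<circ> lo)" unfolding dyadic_affine_def
proof
 fix t0
 obtain k b where kb: "b \<in> dyadic" "!!t. cell N (pt t) = cell N (pt (lo t0)) ==> g t = 2 powi k * pt t + b"
  using assms unfolding dyadic_affine_def by meson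
 have "(g \<circ> lo) t = 2 powi (k - 1) * pt t + b" if "cell N (pt t) = cell N (pt t0)" for t
  using kb(2)[of "lo t"] that cell_lo[of N t] cell_lo[of N t0] by (simp add: pt_lo power_int_diff)
 then show "\<exists>(k::int) b. b \<in> dyadic &
   (\<forall>t. cell N (pt t) = cell N (pt t0) --> (g \<circ> lo) t = 2 powi k * pt t + b)" using kb(1) by blast
qed

lemma dyadic_affine_hi:
 assumes "dyadic_affine N g"
 shows "dyadic_affine N (g \<circ> hi)" unfolding dyadic_affine_def
proof
 fix t0
 obtain k b where kb: "b \<in> dyadic" "!!t. cell N (pt t) = cell N (pt (hi t0)) ==> g t = 2 powi k * pt t + b"
  using assms unfolding dyadic_affine_def by meson
 have "(g \<circ> hi) t = 2 powi (k - 1) * pt t + (2 powi (k - 1) + b)" if "cell N (pt t) = cell N (pt t0)" for t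
  using kb(2)[of "hi t"] that cell_hi[of N t] cell_hi[of N t0] by (simp add: pt_hi power_int_diff field_simps)
 then show "\<exists>(k::int) b. b \<in> dyadic &
   (\<forall>t. cell N (pt t) = cell N (pt t0) --> (g \<circ> hi) t = 2 powi k * pt t + b)" using dyadic_add[OF dyadic_powi kb(1)] by blast
qed

lemma dyadic_affine_join:
 assumes "dyadic_affine N g" "dyadic_affine N h"
 shows "dyadic_affine (Suc N) (join g h)" unfolding dyadic_affine_def
proof
 fix t0
 let ?P = "\<exists>(k::int) b. b \<in> dyadic &
   (\<forall>t. cell (Suc N) (pt t) = cell (Suc N) (pt t0) --> join g h t = 2 powi k * pt t + b)"
 show ?P
 proof (cases t0 rule: lo_hi_cases)
  case (1 s)
  obtain k b where kb: "b \<in> dyadic" "!!t. cell N (pt t) = cell N (pt s) ==> g t = 2 powi k * pt t + b"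
   using assms(1) unfolding dyadic_affine_def by meson
  have "join g h t = 2 powi (k + 1) * pt t + b" if e: "cell (Suc N) (pt t) = cell (Suc N) (pt t0)" for t
  proof (cases t rule: lo_hi_cases)
   case t: (1 r)
   then show ?thesis using kb(2)[of r] e 1 cell_Suc_lo[of N r] cell_Suc_lo[of N s] by (simp add: join_lo pt_lo power_int_add)
  next
   case (2 r)
   then show ?thesis using e 1 cell_bounds[of N s] cell_bounds[of N r] by (simp add: cell_Suc_lo cell_Suc_hi)
  qed
  then show ?thesis using kb(1) by blast
 next
  case (2 s)
  obtain k b where kb: "b \<in> dyadic" "!!t. cell N (pt t) = cell N (pt s) ==> h t = 2 powi k * pt t + b"
   using assms(2) unfolding dyadic_affine_def by meson
  have "join g h t = 2 powi (k + 1) * pt t + ((-1) * 2 powi k + b)"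
   if e: "cell (Suc N) (pt t) = cell (Suc N) (pt t0)" for t
  proof (cases t rule: lo_hi_cases)
   case t: (2 r)
   then show ?thesis using kb(2)[of r] e 2 cell_Suc_hi[of N r] cell_Suc_hi[of N s] by (simp add: join_hi pt_hi power_int_add field_simps)
  next
   case (1 r)
   then show ?thesis using e 2 cell_bounds[of N s] cell_bounds[of N r] by (simp add: cell_Suc_lo cell_Suc_hi)
  qed
  moreover have "(-1) * 2 powi k + b \<in> dyadic" using dyadic_of_int[of "-1" 0] by (intro dyadic_add dyadic_mult dyadic_powi kb) simp
  ultimately show ?thesis by blast
 qed
qed

lemma chart_dyadic_affine: "chart c ==> \<exists>N. dyadic_affine N (pt \<circ> c)"
proof (induction rule: chart.induct)
 case chart_id
 have "dyadic_affine 0 (pt \<circ> id)"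
  unfolding dyadic_affine_def using dyadic_of_int[of 0 0] by (auto intro!: exI[of _ "0::int"] exI[of _ "0::real"])
 then show ?case ..
next
 case (chart_lo c)
 then show ?case using dyadic_affine_lo by (metis comp_assoc)
next
 case (chart_hi c)
 then show ?case using dyadic_affine_hi by (metis comp_assoc)
next
 case (chart_join c d)
 then obtain M N where "dyadic_affine M (pt \<circ> c)" "dyadic_affine N (pt \<circ> d)" by blast
 then have "dyadic_affine (M + N) (pt \<circ> c)" "dyadic_affine (M + N) (pt \<circ> d)"
  using dyadic_affine_add[of M _ N] dyadic_affine_add[of N _ M] by (auto simp: add.commute)
 then show ?case using dyadic_affine_join comp_join by metis
qed

text \<open>The restriction makes the function extensional on [0,1), the form in which
  \<open>Bij\<close> expects its elements.\<close>

definition real_map :: "(ivl => ivl) => real => real" where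
 "real_map f = restrict (%x. pt (f (mk x))) {0..<1}"

lemma real_map_pt: "real_map f (pt t) = pt (f t)" using pt_bounds[of t] by (simp add: real_map_def pt_inverse)

lemma real_map_bij: "bij f ==> real_map f \<in> Bij {0..<1}"
proof -
 assume f: "bij f"
 have "bij_betw (%x. pt (f (mk x))) {0..<1} {0..<1}"
 proof (rule bij_betw_byWitness[where f' = "%x. pt (inv_into UNIV f (mk x))"])
  show "\<forall>x\<in>{0..<1}. pt (inv_into UNIV f (mk (pt (f (mk x))))) = x" using f by (auto simp: pt_inverse pt_mk bij_is_inj)
  show "\<forall>x\<in>{0..<1}. pt (f (mk (pt (inv_into UNIV f (mk x))))) = x" using f by (auto simp: pt_inverse pt_mk bij_is_surj surj_f_inv_f)
 qed (auto simp: pt_bounds)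
 then have "bij_betw (real_map f) {0..<1} {0..<1}" unfolding real_map_def by (subst bij_betw_cong[of _ _ "%x. pt (f (mk x))"]) simp_all
 then show ?thesis unfolding Bij_def real_map_def by simp
qed

lemma carrier_thompson_V:
 "f \<in> carrier thompson_V \<longleftrightarrow> f \<in> Bij {0..<1} &
   (\<forall>x\<in>{0..<1}. continuous (at_right x) (%y. cis (2 * pi * f y))) &
   f ` (dyadic \<inter> {0..<1}) \<subseteq> dyadic &
   (\<exists>Q. finite Q & Q \<subseteq> dyadic \<inter> {0..<1} &
    (\<forall>a b. a < b & (\<forall>x\<in>{a<..<b}. frac x \<notin> Q) -->
     (\<exists>(k::int) c. \<forall>x\<in>{a<..<b}. f (frac x) = frac (2 powi k * x + c))))" by (simp add: thompson_V_def)

lemma real_map_in_V: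
 assumes f: "bij f" "chart f"
 shows "real_map f \<in> carrier thompson_V"
proof -
 obtain N where N: "dyadic_affine N (pt \<circ> f)" using chart_dyadic_affine f by blast
 have loc: "\<exists>(k::int) b. b \<in> dyadic & (\<forall>x\<in>{0..<1}. cell N x = cell N x0 --> real_map f x = 2 powi k * x + b)"
  if "x0 \<in> {0..<1}" for x0
 proof -
  obtain k b where "b \<in> dyadic" and
   kb: "!!t. cell N (pt t) = cell N (pt (mk x0)) ==> (pt \<circ> f) t = 2 powi k * pt t + b" using N unfolding dyadic_affine_def by meson
  moreover have "real_map f x = 2 powi k * x + b" if "x \<in> {0..<1}" "cell N x = cell N x0" for x
   using kb[of "mk x"] that \<open>x0 \<in> {0..<1}\<close> by (simp add: real_map_def pt_mk)
  ultimately show ?thesis by blast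
 qed
 have cont: "continuous (at_right x) (%y. cis (2 * pi * real_map f y))" if x: "x \<in> {0..<1}" for x
 proof -
  obtain k b where kb: "!!y. y \<in> {0..<1} ==> cell N y = cell N x ==> real_map f y = 2 powi k * y + b" using loc[OF x] by blast
  \<comment> \<open>The right end of the dyadic cell of \<open>x\<close>, capped at 1: cells are
    closed on the left, which is why continuity from the right comes out.\<close>
  define d :: real where "d = min 1 (of_int (cell N x + 1) / 2 ^ N)"
  have "x * 2 ^ N < of_int (cell N x + 1)" unfolding cell_def by linarith
  then have xd: "x < d" using x by (simp add: d_def field_simps)
  have ev: "real_map f y = 2 powi k * y + b" if "x <= y" "y < d" for y
  proof (rule kb)
   show "y \<in> {0..<1}" using that x by (simp add: d_def)
   have "cell N x <= cell N y" unfolding cell_def using that by (intro floor_mono) simp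
   moreover have "y * 2 ^ N < of_int (cell N x + 1)" using that by (simp add: d_def field_simps)
   then have "cell N y < cell N x + 1" unfolding cell_def by linarith
   ultimately show "cell N y = cell N x" by simp
  qed
  have "((%y. cis (2 * pi * (2 powi k * y + b))) \<longlongrightarrow> cis (2 * pi * (2 powi k * x + b))) (at_right x)" by (intro tendsto_intros)
  moreover have "\<forall>\<^sub>F y in at_right x. cis (2 * pi * (2 powi k * y + b)) = cis (2 * pi * real_map f y)"
   unfolding eventually_at_right_field using xd ev by (intro exI[of _ d]) auto
  ultimately have "((%y. cis (2 * pi * real_map f y)) \<longlongrightarrow> cis (2 * pi * (2 powi k * x + b))) (at_right x)"
   by (rule Lim_transform_eventually)
  then show ?thesis using ev[of x] xd by (simp add: continuous_within)
 qed
 have dy: "real_map f ` (dyadic \<inter> {0..<1}) \<subseteq> dyadic"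
 proof safe
  fix x :: real assume x: "x \<in> dyadic" "x \<in> {0..<1}"
  obtain k b where "b \<in> dyadic" "real_map f x = 2 powi k * x + b" using loc[OF x(2)] x(2) by blast
  then show "real_map f x \<in> dyadic" using x by (simp add: dyadic_add dyadic_mult dyadic_powi)
 qed
 \<comment> \<open>All multiples of \<open>2^-N\<close> in [0,1), whether or not the slope changes
   there. In particular 0 is included, so an interval avoiding them modulo 1 contains no
   integer.\<close>
 define Q where "Q = (%j::nat. real j / 2 ^ N) ` {..<2 ^ N}"
 have Q: "finite Q" "Q \<subseteq> dyadic \<inter> {0..<1}" using dyadic_of_int[of "int _" N] by (auto simp: Q_def field_simps)
 have aff: "\<exists>(k::int) c. \<forall>x\<in>{a<..<b}. real_map f (frac x) = frac (2 powi k * x + c)"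
  if ab: "a < b" "\<forall>x\<in>{a<..<b}. frac x \<notin> Q" for a b
 proof -
  have no: "x * 2 ^ N ~= of_int m" if "x \<in> {a<..<b}" for x m
  proof
   assume xm: "x * 2 ^ N = of_int m"
   define j where "j = m - \<lfloor>x\<rfloor> * 2 ^ N"
   have fj: "frac x = of_int j / 2 ^ N" using xm by (simp add: frac_def j_def field_simps)
   then have "real_of_int j = frac x * 2 ^ N" by simp
   then have "0 <= real_of_int j" "real_of_int j < real_of_int (2 ^ N)" using frac_ge_0[of x] frac_lt_1[of x] by simp_all
   then have "0 <= j" "j < 2 ^ N" by linarith+
   then have "frac x \<in> Q" using fj unfolding Q_def by (intro image_eqI[of _ _ "nat j"]) (auto simp: nat_less_iff)
   then show False using ab that by blast
  qed
  define m where "m = (a + b) / 2"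
  have m: "m \<in> {a<..<b}" using ab by (simp add: m_def)
  have const: "cell N x = cell N m" if x: "x \<in> {a<..<b}" for x
  proof (rule ccontr)
   assume "cell N x ~= cell N m"
   then obtain y z where yz: "y \<in> {a<..<b}" "z \<in> {a<..<b}" "cell N y < cell N z" using x m by (meson linorder_neqE)
   define p where "p = of_int (cell N z) / (2::real) ^ N"
   have "y * 2 ^ N < of_int (cell N z)" "of_int (cell N z) <= z * 2 ^ N" using yz(3) unfolding cell_def by linarith+
   then have "y < p" "p <= z" by (simp_all add: p_def field_simps)
   then have "p \<in> {a<..<b}" using yz by simp
   then show False using no[of p "cell N z"] by (simp add: p_def)
  qed
  \<comment> \<open>Cells of level 0 are unit intervals, so equal cells of level \<open>N\<close>
    give equal integer parts.\<close>
  have fl: "\<lfloor>x\<rfloor> = \<lfloor>m\<rfloor>" if "x \<in> {a<..<b}" for x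
   using cell_add[of 0 N x m] const[OF that] by (simp add: cell_def)
  have fm: "frac m \<in> {0..<1}" using frac_lt_1[of m] by simp
  have cf: "cell N (frac x) = cell N x - \<lfloor>x\<rfloor> * 2 ^ N" for x
   using floor_diff_of_int[of "x * 2 ^ N" "\<lfloor>x\<rfloor> * 2 ^ N"] by (simp add: cell_def frac_def algebra_simps)
  obtain k c where kc: "!!x. x \<in> {0..<1} ==> cell N x = cell N (frac m) ==> real_map f x = 2 powi k * x + c" using loc[OF fm] by blast
  have "real_map f (frac x) = frac (2 powi k * x + (c - 2 powi k * of_int \<lfloor>m\<rfloor>))" if x: "x \<in> {a<..<b}" for x
  proof -
   have fx: "frac x \<in> {0..<1}" using frac_lt_1[of x] by simp
   have "cell N (frac x) = cell N (frac m)" using cf const fl x by simp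
   with fx have "real_map f (frac x) = 2 powi k * frac x + c" by (rule kc)
   also have "\<dots> = 2 powi k * x + (c - 2 powi k * of_int \<lfloor>m\<rfloor>)" using fl[OF x] by (simp add: frac_def algebra_simps)
   finally have e: "real_map f (frac x) = 2 powi k * x + (c - 2 powi k * of_int \<lfloor>m\<rfloor>)" .
   have "real_map f (frac x) \<in> {0..<1}" using real_map_pt[of f "mk (frac x)"] pt_bounds[of "f (mk (frac x))"] fx by (simp add: pt_mk)
   then show ?thesis using e by (simp add: frac_eq)
  qed
  then show ?thesis by blast
 qed
 show ?thesis unfolding carrier_thompson_V
 proof (intro conjI exI[of _ Q] allI impI ballI)
  show "real_map f \<in> Bij {0..<1}" using f(1) by (rule real_map_bij)
 next
  fix a b :: real
  assume "a < b & (\<forall>x\<in>{a<..<b}. frac x \<notin> Q)"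
  then show "\<exists>(k::int) c. \<forall>x\<in>{a<..<b}. real_map f (frac x) = frac (2 powi k * x + c)" using aff by blast
 qed (fact cont dy Q)+
qed

section \<open>Sweeping a diagram from top to bottom\<close>

text \<open>Every multiplicity on the right is at most one, so nothing can be counted twice on the
  left. Applied to upper and to lower ends of wires: each end is attached in exactly one
  place.\<close>

lemma mset_partition:
 assumes F: "finite F" "finite W" and eq: "mset xs + (\<Sum>T\<in>F. mset (g T)) = mset_set W"
 shows "distinct xs" "!!T. T \<in> F ==> distinct (g T)" "!!T. T \<in> F ==> set xs \<inter> set (g T) = {}"
  "!!S T. S \<in> F ==> T \<in> F ==> S ~= T ==> set (g S) \<inter> set (g T) = {}"
  "W = set xs \<union> (\<Union>T\<in>F. set (g T))"
proof -
 have c: "count (mset xs) x + (\<Sum>T\<in>F. count (mset (g T)) x) <= 1" for x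
  using arg_cong[OF eq, of "%M. count M x"] by (simp add: count_sum count_mset_set')
 have c1: "count (mset (g T)) x <= (\<Sum>T\<in>F. count (mset (g T)) x)" if "T \<in> F" for T x using F that by (intro member_le_sum) auto
 have pos: "1 <= count (mset ys) x" if "x \<in> set ys" for x and ys :: "'b list" using that by (simp add: Suc_le_eq flip: set_mset_mset)
 have single: "distinct ys" if "!!x. count (mset ys) x <= 1" for ys :: "'b list"
 proof -
  have "count (mset ys) x = (if x \<in> set ys then 1 else 0)" for x
  proof (cases "x \<in> set ys")
   case True
   then show ?thesis using le_antisym[OF that[of x] pos] by simp
  qed (simp add: count_eq_zero_iff)
  then show ?thesis unfolding distinct_count_atmost_1 by blast
 qed
 show "distinct xs" by (rule single) (meson c add_leD1)
 show "distinct (g T)" if "T \<in> F" for T by (rule single) (use c c1[OF that] in \<open>meson add_leD2 le_trans\<close>)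
 show "set xs \<inter> set (g T) = {}" if "T \<in> F" for T
 proof (rule ccontr)
  assume "set xs \<inter> set (g T) ~= {}"
  then obtain x where "x \<in> set xs" "x \<in> set (g T)" by blast
  then have "1 <= count (mset xs) x" "1 <= count (mset (g T)) x" by (auto intro: pos)
  then show False using c[of x] c1[OF that, of x] by linarith
 qed
 show "set (g S) \<inter> set (g T) = {}" if ST: "S \<in> F" "T \<in> F" "S ~= T" for S T
 proof (rule ccontr)
  assume "set (g S) \<inter> set (g T) ~= {}"
  then obtain x where x: "x \<in> set (g S)" "x \<in> set (g T)" by blast
  have "(\<Sum>T\<in>{S, T}. count (mset (g T)) x) <= (\<Sum>T\<in>F. count (mset (g T)) x)" using F ST by (intro sum_mono2) auto
  then have "count (mset (g S)) x + count (mset (g T)) x <= (\<Sum>T\<in>F. count (mset (g T)) x)" using ST(3) by simp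
  then show False using pos[OF x(1)] pos[OF x(2)] c[of x] by linarith
 qed
 show "W = set xs \<union> (\<Union>T\<in>F. set (g T))" using arg_cong[OF eq, of set_mset] F by (auto simp: set_mset_sum)
qed

lemma topological_sort:
 assumes "finite F" "acyclic r"
 shows "\<exists>Ts. distinct Ts & set Ts = F & sorted_wrt (%S T. (S, T) \<notin> r) Ts" using assms(1)
proof (induction "card F" arbitrary: F)
 case 0
 then show ?case by (intro exI[of _ "[]"]) auto
next
 case (Suc n)
 let ?r = "r \<inter> F \<times> F"
 have "finite ?r" using Suc by auto
 moreover have "acyclic ?r" using assms(2) by (rule acyclic_subset) auto
 ultimately have "wf (?r\<inverse>)" by (rule finite_acyclic_wf_converse)
 moreover have "F ~= {}" using Suc by auto
 ultimately obtain S where S: "S \<in> F" "!!T. (T, S) \<in> ?r\<inverse> ==> T \<notin> F"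
  using wf_eq_minimal[of "?r\<inverse>"] by (metis ex_in_conv)
 have "n = card (F - {S})" using Suc(2) S(1) Suc.prems by simp
 moreover have "finite (F - {S})" using Suc.prems by simp
 ultimately obtain Ts where Ts: "distinct Ts" "set Ts = F - {S}"
  "sorted_wrt (%S T. (S, T) \<notin> r) Ts" using Suc(1) by blast
 have "(S, T) \<notin> r" if "T \<in> F" for T using S that by blast
 then have "sorted_wrt (%S T. (S, T) \<notin> r) (S # Ts)" using Ts by simp
 moreover have "distinct (S # Ts)" "set (S # Ts) = F" using Ts S(1) by auto
 ultimately show ?case by blast
qed

text \<open>The relation \<open>prec\<close> points upwards, so this lists the transistors from top
  to bottom: an earlier transistor never lies directly below a later one.\<close>

definition linext :: "'a diagram => nat list => bool" where
 "linext dg Ts \<longleftrightarrow> distinct Ts & set Ts = transistors dg & sorted_wrt (%S T. (S, T) \<notin> prec dg) Ts"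

definition seen :: "'a diagram => nat list => nat set" where
 "seen dg Us = set (ftop dg) \<union> (\<Union>T\<in>set Us. set (tbot dg T))"

text \<open>The wires met by a horizontal line just below the transistors \<open>Us\<close>.\<close>

definition live :: "'a diagram => nat list => nat set" where
 "live dg Us = seen dg Us - (\<Union>T\<in>set Us. set (ttop dg T))"

definition tchart :: "'a diagram => (nat => ivl => 'b) => nat => ivl => 'b" where
 "tchart dg c T = joinl (map c (ttop dg T))"

definition charting :: "'a diagram => (nat => ivl => ivl) => bool" where
 "charting dg c \<longleftrightarrow> map c (ftop dg) = pieces (length (ftop dg)) id &
   (\<forall>T\<in>transistors dg. map c (tbot dg T) = pieces (length (tbot dg T)) (tchart dg c T))"

text \<open>The invariant of the sweep: the charts of the wires met by a horizontal line cut [0,1)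
  into disjoint pieces. A point of [0,1) thus singles out one wire and one parameter, which is how
  wires are recognised by their charts throughout.\<close>

definition tiling :: "(nat => ivl => 'b) => nat set => bool" where
 "tiling c L \<longleftrightarrow> (\<forall>x\<in>L. \<forall>y\<in>L. \<forall>s t. c x s = c y t --> x = y & s = t) & (\<Union>x\<in>L. range (c x)) = UNIV"

lemma tilingD: "tiling c L ==> x \<in> L ==> y \<in> L ==> c x s = c y t ==> x = y & s = t" unfolding tiling_def by blast

lemma tiling_inj_joinl:
 assumes "tiling c L" "set xs \<subseteq> L" "distinct xs" "xs ~= []"
 shows "inj (joinl (map c xs))"
proof (rule inj_joinl)
 fix i j s t
 assume "i < length (map c xs)" "j < length (map c xs)" "(map c xs ! i) s = (map c xs ! j) t"
 then show "i = j & s = t" using assms tilingD[OF assms(1), of "xs ! i" "xs ! j" s t] nth_eq_iff_index_eq[of xs i j] by (auto simp: subset_iff)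
qed (use assms in simp)

text \<open>The wires \<open>xs\<close> enter a transistor and \<open>ys\<close> leave it. Both
  sides join to the same chart, so they cover the same set, and injectivity of that chart separates
  the new pieces from each other.\<close>

lemma tiling_step:
 assumes t: "tiling c L" and xs: "set xs \<subseteq> L" "distinct xs" "xs ~= []" and ys: "distinct ys" "ys ~= []"
  and p: "map c ys = pieces (length ys) (joinl (map c xs))"
 shows "tiling c (L - set xs \<union> set ys)"
proof -
 have j: "joinl (map c ys) = joinl (map c xs)" unfolding p using ys by (intro joinl_pieces) simp
 have r: "(\<Union>y\<in>set ys. range (c y)) = (\<Union>x\<in>set xs. range (c x))"
  using range_joinl[of "map c ys"] range_joinl[of "map c xs"] j xs ys by simp
 have i: "inj (joinl (map c ys))" unfolding j using tiling_inj_joinl[OF t xs] .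
 have yy: "x = y & s = t" if "x \<in> set ys" "y \<in> set ys" "c x s = c y t" for x y s t
 proof -
  obtain k where k: "k < length ys" "ys ! k = x" using \<open>x \<in> set ys\<close> by (auto simp: in_set_conv_nth)
  obtain l where l: "l < length ys" "ys ! l = y" using \<open>y \<in> set ys\<close> by (auto simp: in_set_conv_nth)
  have "k = l & s = t" using inj_joinl_nth[OF i, of k l s t] k l that(3) by simp
  then show ?thesis using k l by blast
 qed
 have zy: False if "z \<in> L - set xs" "y \<in> set ys" "c z s = c y t" for z y s t
 proof -
  have "c y t \<in> (\<Union>x\<in>set xs. range (c x))" using that(2) r by blast
  then obtain x s' where "x \<in> set xs" "c y t = c x s'" by blast
  then show False using tilingD[OF t, of z x s s'] that xs by auto
 qed
 have "(\<Union>x\<in>L - set xs \<union> set ys. range (c x)) = (\<Union>x\<in>L. range (c x))" using r xs(1) by blast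
 then have "(\<Union>x\<in>L - set xs \<union> set ys. range (c x)) = UNIV" using t unfolding tiling_def by simp
 moreover have "x = y & s = t" if "x \<in> L - set xs \<union> set ys" "y \<in> L - set xs \<union> set ys" "c x s = c y t" for x y s t
  using that yy zy zy[OF _ _ HOL.sym] tilingD[OF t, of x y s t] by (metis DiffD1 UnE)
 ultimately show ?thesis unfolding tiling_def by blast
qed

locale ww_diagram =
 fixes A :: "'a set" and R :: "('a list \<times> 'a list) set" and w :: "'a list" and dg :: "'a diagram"
 assumes pres: "semigroup_presentation A R" and w_nonempty: "w ~= []" and ww: "dg \<in> ww_diagrams A R w"
begin

lemma bd: "braided_diagram A R dg" and tw: "map (label dg) (ftop dg) = w" and bw: "map (label dg) (fbot dg) = w"
 using ww unfolding ww_diagrams_def top_word_def bot_word_def word_def by auto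

lemma fin: "finite (wires dg)" "finite (transistors dg)" and acyc: "acyclic (prec dg)"
 and tops_eq: "mset (ftop dg) + (\<Sum>T\<in>transistors dg. mset (tbot dg T)) = mset_set (wires dg)"
 and bots_eq: "mset (fbot dg) + (\<Sum>T\<in>transistors dg. mset (ttop dg T)) = mset_set (wires dg)"
 and rels: "T \<in> transistors dg ==> (word dg (ttop dg T), word dg (tbot dg T)) \<in> R \<or>
             (word dg (tbot dg T), word dg (ttop dg T)) \<in> R"
 and labels: "x \<in> wires dg ==> label dg x \<in> A" using bd unfolding braided_diagram_def by auto

lemmas tops = mset_partition[OF fin(2,1) tops_eq]
lemmas bots = mset_partition[OF fin(2,1) bots_eq]

lemma nonempty: "ftop dg ~= []" "fbot dg ~= []" "T \<in> transistors dg ==> ttop dg T ~= [] & tbot dg T ~= []"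
proof -
 show "ftop dg ~= []" "fbot dg ~= []" using tw bw w_nonempty by auto
 assume "T \<in> transistors dg"
 then show "ttop dg T ~= [] & tbot dg T ~= []" using rels[of T] pres unfolding semigroup_presentation_def word_def by fastforce
qed

lemma length_frame: "length (ftop dg) = length w" "length (fbot dg) = length w" using tw bw by (metis length_map)+

lemma ex_linext: "\<exists>Ts. linext dg Ts" unfolding linext_def using topological_sort[OF fin(2) acyc] by blast

text \<open>What one step of the sweep provides, gathered for the inductions to come: the inputs of
  \<open>T\<close> are at hand, its outputs are new, and they feed no transistor passed so
  far.\<close>

lemma linext_step:
 assumes "linext dg (Us @ T # Vs)"
 shows "T \<in> transistors dg" "T \<notin> set Us" "set Us \<subseteq> transistors dg"
  "set (ttop dg T) \<subseteq> live dg Us" "set (tbot dg T) \<inter> seen dg Us = {}"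
  "!!S. S \<in> insert T (set Us) ==> set (ttop dg S) \<inter> set (tbot dg T) = {}"
  "live dg (Us @ [T]) = live dg Us - set (ttop dg T) \<union> set (tbot dg T)"
  "seen dg (Us @ [T]) = seen dg Us \<union> set (tbot dg T)"
proof -
 have le: "distinct (Us @ T # Vs)" "set Us \<union> {T} \<union> set Vs = transistors dg"
  "!!S. S \<in> set Us ==> (S, T) \<notin> prec dg" "!!S. S \<in> set Vs ==> (T, S) \<notin> prec dg"
  using assms unfolding linext_def by (auto simp: sorted_wrt_append)
 show T: "T \<in> transistors dg" and TU: "T \<notin> set Us" and U: "set Us \<subseteq> transistors dg" using le by auto
 have irr: "(T, T) \<notin> prec dg" using acyc unfolding acyclic_def by blast
 show d: "set (ttop dg S) \<inter> set (tbot dg T) = {}" if "S \<in> insert T (set Us)" for S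
  using that le(3) irr T U unfolding prec_def by blast
 show n: "set (tbot dg T) \<inter> seen dg Us = {}" using tops(3)[OF T] tops(4)[OF _ T] T TU U unfolding seen_def by blast
 show "set (ttop dg T) \<subseteq> live dg Us"
 proof
  fix x assume x: "x \<in> set (ttop dg T)"
  have "x \<in> wires dg" using bots(5) x T by blast
  then consider "x \<in> set (ftop dg)" | S where "S \<in> transistors dg" "x \<in> set (tbot dg S)" using tops(5) by blast
  then have "x \<in> seen dg Us"
  proof cases
   case 2
   then have "(T, S) \<in> prec dg" using x T unfolding prec_def by auto
   then have "S \<in> set Us" using le(2,4) irr 2 by blast
   then show ?thesis using 2 unfolding seen_def by blast
  qed (simp add: seen_def)
  moreover have "x \<notin> set (ttop dg S)" if "S \<in> set Us" for S using bots(4)[OF _ T, of S] x that TU U by blast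
  ultimately show "x \<in> live dg Us" unfolding live_def by blast
 qed
 show "seen dg (Us @ [T]) = seen dg Us \<union> set (tbot dg T)" unfolding seen_def by auto
 then show "live dg (Us @ [T]) = live dg Us - set (ttop dg T) \<union> set (tbot dg T)" unfolding live_def using d by auto
qed

text \<open>Induction over the prefixes of one fixed sweep; the remainder stays in the hypothesis so
  that \<open>linext\<close> always speaks of a complete list.\<close>

lemma linext_induct [consumes 1, case_names Nil step]:
 assumes le: "linext dg (Ts @ Vs)" and nil: "P []"
  and step: "!!Us T Ws. linext dg (Us @ T # Ws) ==> P Us ==> P (Us @ [T])"
 shows "P Ts" using le
proof (induction Ts arbitrary: Vs rule: rev_induct)
 case (snoc T Us)
 then show ?case using step[of Us T Vs] by simp
qed (rule nil)

lemma live_Nil: "live dg [] = set (ftop dg)" and seen_Nil: "seen dg [] = set (ftop dg)" unfolding live_def seen_def by auto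

lemma seen_all: "linext dg Ts ==> seen dg Ts = wires dg" using tops(5) unfolding linext_def seen_def by blast

lemma live_all:
 assumes "linext dg Ts"
 shows "live dg Ts = set (fbot dg)"
proof -
 have "live dg Ts = wires dg - (\<Union>T\<in>transistors dg. set (ttop dg T))"
  using seen_all[OF assms] assms unfolding live_def linext_def by simp
 then show ?thesis using bots(3,5) by blast
qed

text \<open>The charts on the top side of the frame are prescribed, and the sweep determines every
  other chart from those above it.\<close>

lemma charting_agree:
 assumes "charting dg c" "charting dg d" "x \<in> wires dg"
 shows "c x = d x"
proof -
 obtain Ts where Ts: "linext dg Ts" using ex_linext by blast
 then have "linext dg (Ts @ [])" by simp
 then have "\<forall>x\<in>seen dg Ts. c x = d x"
 proof (induction rule: linext_induct)
  case Nil
  have "map c (ftop dg) = map d (ftop dg)" using assms unfolding charting_def by simp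
  then show ?case by (simp add: seen_Nil)
 next
  case (step Us T Ws)
  note s = linext_step[OF step(1)]
  have "map c (ttop dg T) = map d (ttop dg T)" using s(4) step(2) unfolding live_def by auto
  then have "tchart dg c T = tchart dg d T" unfolding tchart_def by (rule arg_cong)
  then have "map c (tbot dg T) = map d (tbot dg T)" using assms s(1) unfolding charting_def by simp
  then show ?case using step(2) s(8) by auto
 qed
 then show ?thesis using seen_all[OF Ts] assms(3) by simp
qed

text \<open>With \<open>sh\<close> the chart of a wire can be modified before it enters the transistor below; this is
 used for lifts of charts to the line.\<close>

lemma ex_general_charting:
 fixes i0 :: "ivl => 'b" and sh :: "nat => (ivl => 'b) => ivl => 'b"
 shows "\<exists>c. map c (ftop dg) = pieces (length (ftop dg)) i0 & (\<forall>T\<in>transistors dg.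
  map c (tbot dg T) = pieces (length (tbot dg T)) (joinl (map (%x. sh x (c x)) (ttop dg T))))"
proof -
 let ?m = "%c T. joinl (map (%x. sh x (c x)) (ttop dg T))"
 obtain Ts where Ts: "linext dg Ts" using ex_linext by blast
 then have "linext dg (Ts @ [])" by simp
 then have "\<exists>c. map c (ftop dg) = pieces (length (ftop dg)) i0 &
   (\<forall>T\<in>set Ts. map c (tbot dg T) = pieces (length (tbot dg T)) ((?m c T)))"
 proof (induction rule: linext_induct)
  case Nil
  define c where "c = the \<circ> map_of (zip (ftop dg) (pieces (length (ftop dg)) i0))"
  have "map c (ftop dg) = pieces (length (ftop dg)) i0" unfolding c_def using tops(1) by (intro nth_equalityI) (auto simp: map_of_zip_nth)
  moreover have "\<forall>T\<in>set []. map c (tbot dg T) = pieces (length (tbot dg T)) ((?m c T))" by simp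
  ultimately show ?case by blast
 next
  case (step Us T Ws)
  note s = linext_step[OF step(1)]
  obtain c where c: "map c (ftop dg) = pieces (length (ftop dg)) i0"
   "!!T. T \<in> set Us ==> map c (tbot dg T) = pieces (length (tbot dg T)) ((?m c T))" using step(2) by blast
  let ?ps = "pieces (length (tbot dg T)) ((?m c T))"
  \<comment> \<open>Only the outputs of \<open>T\<close> receive new charts. They have not been seen
    before and enter no transistor already treated, so the earlier equations persist.\<close>
  define d where "d x = (if x \<in> set (tbot dg T) then the (map_of (zip (tbot dg T) ?ps) x) else c x)" for x
  have dT: "map d (tbot dg T) = ?ps" unfolding d_def using tops(2)[OF s(1)] by (intro nth_equalityI) (auto simp: map_of_zip_nth)
  have same: "map d xs = map c xs" "map (%x. sh x (d x)) xs = map (%x. sh x (c x)) xs"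
   if "set xs \<inter> set (tbot dg T) = {}" for xs using that unfolding d_def by auto
  have tc: "?m d S = ?m c S" if "S \<in> insert T (set Us)" for S using same(2)[OF s(6)[OF that]] by (rule arg_cong)
  have "map d (tbot dg S) = map c (tbot dg S)" if "S \<in> set Us" for S using s(5) that unfolding seen_def by (intro same(1)) blast
  moreover have "map d (ftop dg) = map c (ftop dg)" using s(5) unfolding seen_def by (intro same(1)) blast
  ultimately have "map d (ftop dg) = pieces (length (ftop dg)) i0"
   "\<forall>S\<in>set (Us @ [T]). map d (tbot dg S) = pieces (length (tbot dg S)) (?m d S)" using c dT tc by auto
  then show ?case by blast
 qed
 then show ?thesis using Ts unfolding linext_def by auto
qed

lemma ex_charting: "\<exists>c. charting dg c" unfolding charting_def tchart_def using ex_general_charting[of id "%x c. c"] .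

lemma charting_tiling:
 assumes c: "charting dg c" and "linext dg (Ts @ Vs)"
 shows "tiling c (live dg Ts)" using assms(2)
proof (induction rule: linext_induct)
 case Nil
 have p: "map c (ftop dg) = pieces (length (ftop dg)) (joinl (map (%_. id) [0::nat]))" using c unfolding charting_def by simp
 have t: "tiling (%_. id :: ivl => ivl) {0}" unfolding tiling_def by auto
 have j: "joinl (map c (ftop dg)) = id" using p joinl_pieces[of "length (ftop dg)" id] nonempty(1) by simp
 have "x = y & s = t" if xy: "x \<in> set (ftop dg)" "y \<in> set (ftop dg)" "c x s = c y t" for x y s t
 proof -
  obtain k where k: "k < length (ftop dg)" "ftop dg ! k = x" using xy(1) by (auto simp: in_set_conv_nth)
  obtain l where l: "l < length (ftop dg)" "ftop dg ! l = y" using xy(2) by (auto simp: in_set_conv_nth)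
  have "k = l & s = t" using inj_joinl_nth[of "map c (ftop dg)" k l s t] j k l xy(3) by simp
  then show ?thesis using k l by blast
 qed
 moreover have "(\<Union>x\<in>set (ftop dg). range (c x)) = UNIV" using range_joinl[of "map c (ftop dg)"] j nonempty(1) by simp
 ultimately show ?case unfolding tiling_def live_Nil by blast
next
 case (step Us T Ws)
 note s = linext_step[OF step(1)]
 show ?case unfolding s(7) using step(2) s(4) bots(2)[OF s(1)] tops(2)[OF s(1)] nonempty(3)[OF s(1)] c s(1)
  by (intro tiling_step) (auto simp: charting_def tchart_def)
qed

lemma charting_chart:
 assumes c: "charting dg c"
 shows "x \<in> wires dg ==> chart (c x)" "T \<in> transistors dg ==> chart (tchart dg c T)"
proof -
 have tc: "chart (tchart dg c T)" if "T \<in> transistors dg" "!!x. x \<in> set (ttop dg T) ==> chart (c x)" for T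
  unfolding tchart_def using that nonempty(3)[OF that(1)] by (intro chart_joinl) auto
 obtain Ts where Ts: "linext dg Ts" using ex_linext by blast
 then have "linext dg (Ts @ [])" by simp
 then have "\<forall>x\<in>seen dg Ts. chart (c x)"
 proof (induction rule: linext_induct)
  case Nil
  have "c x \<in> set (pieces (length (ftop dg)) id)" if "x \<in> set (ftop dg)" for x
   using c that unfolding charting_def by (metis imageI list.set_map)
  then show ?case using chart_pieces[OF chart_id] by (auto simp: seen_Nil)
 next
  case (step Us T Ws)
  note s = linext_step[OF step(1)]
  have "chart (tchart dg c T)" using tc[OF s(1)] step(2) s(4) unfolding live_def by blast
  moreover have "c x \<in> set (pieces (length (tbot dg T)) (tchart dg c T))" if "x \<in> set (tbot dg T)" for x
   using c that s(1) unfolding charting_def by (metis imageI list.set_map)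
  ultimately show ?case using step(2) s(8) chart_pieces by blast
 qed
 then show *: "chart (c x)" if "x \<in> wires dg" for x using seen_all[OF Ts] that by simp
 show "chart (tchart dg c T)" if "T \<in> transistors dg" using tc[OF that] * bots(5) that by blast
qed

lemma tchart_inj:
 assumes "charting dg c" "T \<in> transistors dg"
 shows "inj (tchart dg c T)"
proof -
 obtain Ts where Ts: "linext dg Ts" using ex_linext by blast
 then obtain Us Vs where Us: "Ts = Us @ T # Vs" using assms(2) unfolding linext_def by (metis split_list)
 have "set (ttop dg T) \<subseteq> live dg Us" using linext_step(4) Ts Us by blast
 then show ?thesis unfolding tchart_def using assms bots(2) nonempty(3) charting_tiling[OF assms(1) Ts[unfolded Us]]
  by (intro tiling_inj_joinl[of _ "live dg Us"]) auto
qed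

lemma tchart_tbot: "charting dg c ==> T \<in> transistors dg ==> joinl (map c (tbot dg T)) = tchart dg c T"
 using joinl_pieces[of "length (tbot dg T)" "tchart dg c T"] nonempty(3)[of T] unfolding charting_def by simp

text \<open>At the end of the sweep the live wires are those on the bottom side of the frame; since
  they tile [0,1), their joined chart is a bijection. This is the element of V attached to the
  diagram.\<close>

lemma frame_chart:
 assumes "charting dg c"
 shows "chart (joinl (map c (fbot dg)))" "bij (joinl (map c (fbot dg)))"
proof -
 obtain Ts where Ts: "linext dg Ts" using ex_linext by blast
 have t: "tiling c (set (fbot dg))" using charting_tiling[OF assms, of Ts "[]"] Ts live_all by simp
 then have "inj (joinl (map c (fbot dg)))" using bots(1) nonempty by (intro tiling_inj_joinl) auto
 moreover have "surj (joinl (map c (fbot dg)))" using range_joinl[of "map c (fbot dg)"] t nonempty(2) unfolding tiling_def by auto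
 ultimately show "bij (joinl (map c (fbot dg)))" by (rule bijI)
 show "chart (joinl (map c (fbot dg)))" using charting_chart(1)[OF assms] bots(5) nonempty(2) by (intro chart_joinl) auto
qed

end

section \<open>Transistors as letters\<close>

text \<open>A vertex of the defining graph is a relation together with a chart; it is coded as a diagram.\<close>

definition vcode :: "'a list => 'a list => (ivl => ivl) => 'a diagram" where
 "vcode u v m = \<lparr>wires = {chart_code m}, label = (%i. (u @ v) ! i), transistors = {},
   ttop = (%_. []), tbot = (%_. []), ftop = [0..<length u], fbot = [0..<length v]\<rparr>"

text \<open>The label function alone does not reveal where \<open>u @ v\<close> ends or splits; the
  two lengths are recovered from the sides of the frame.\<close>

lemma vcode_inj:
 assumes "vcode u v m = vcode u' v' m'" "chart m" "chart m'"
 shows "u = u' & v = v' & m = m'"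
proof -
 from assms(1) have e: "chart_code m = chart_code m'" "!!i. (u @ v) ! i = (u' @ v') ! i"
  "[0..<length u] = [0..<length u']" "[0..<length v] = [0..<length v']" unfolding vcode_def by (auto dest: fun_cong)
 have l: "length u = length u'" "length v = length v'" using arg_cong[OF e(3), of length] arg_cong[OF e(4), of length] by simp_all
 have "u @ v = u' @ v'" using e(2) l by (intro nth_equalityI) auto
 then show ?thesis using l chart_code_inj[OF assms(2,3) e(1)] by simp
qed

definition vertices :: "('a list \<times> 'a list) set => 'a diagram set" where
 "vertices R = {vcode u v m | u v m. (u, v) \<in> R & chart m}"

definition edges :: "('a list \<times> 'a list) set => ('a diagram \<times> 'a diagram) set" where
 "edges R = {(vcode u v m, vcode u' v' m') | u v m u' v' m'. (u, v) \<in> R & chart m &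
   (u', v') \<in> R & chart m' & range m \<inter> range m' = {}}"

lemma vcode_eq_iff:
 "chart m ==> chart m' ==> vcode u v m = vcode u' v' m' \<longleftrightarrow> u = u' & v = v' & m = m'" using vcode_inj by blast

lemma edgesE:
 assumes "(x, y) \<in> edges R"
 obtains u v m u' v' m' where "x = vcode u v m" "y = vcode u' v' m'" "(u, v) \<in> R" "(u', v') \<in> R"
  "chart m" "chart m'" "range m \<inter> range m' = {}"
 using assms unfolding edges_def by (simp only: mem_Collect_eq) (elim exE conjE Pair_inject, rule that)

lemma edgesI:
 assumes "chart m" "chart m'" "(u, v) \<in> R" "(u', v') \<in> R" "range m \<inter> range m' = {}"
 shows "(vcode u v m, vcode u' v' m') \<in> edges R" unfolding edges_def mem_Collect_eq using assms by metis

lemma vcode_edge_iff: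
 assumes "chart m" "chart m'" "(u, v) \<in> R" "(u', v') \<in> R"
 shows "(vcode u v m, vcode u' v' m') \<in> edges R \<longleftrightarrow> range m \<inter> range m' = {}"
proof
 assume "(vcode u v m, vcode u' v' m') \<in> edges R"
 then show "range m \<inter> range m' = {}" by (rule edgesE) (simp add: assms vcode_eq_iff)
qed (use assms edgesI in blast)

lemma raag_vertices_edges: "raag (vertices R) (edges R)"
proof
 have "(x, x) \<notin> edges R" for x
 proof
  assume "(x, x) \<in> edges R"
  then show False
  proof (rule edgesE)
   fix u v m u' v' m'
   assume "x = vcode u v m" "x = vcode u' v' m'" "chart m" "chart m'" "range m \<inter> range m' = {}"
   then show False using vcode_eq_iff[of m m' u v u' v'] by auto
  qed
 qed
 then have "irrefl (edges R)" unfolding irrefl_def by blast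
 moreover have "Relation.sym (edges R)"
 proof (rule symI)
  fix x y assume "(x, y) \<in> edges R"
  then show "(y, x) \<in> edges R"
  proof (rule edgesE)
   fix u v m u' v' m'
   assume *: "x = vcode u v m" "y = vcode u' v' m'" "(u, v) \<in> R" "(u', v') \<in> R"
    "chart m" "chart m'" "range m \<inter> range m' = {}"
   show ?thesis unfolding *(1,2) using *(3-7) by (intro edgesI) auto
  qed
 qed
 ultimately show "simple_graph (vertices R) (edges R)" unfolding simple_graph_def by (auto simp: edges_def vertices_def)
qed

text \<open>A transistor read against the orientation of its relation gives an inverse letter. That
  \<open>(u, v)\<close> and \<open>(v, u)\<close> never both belong to \<open>R\<close> makes this
  unambiguous and turns the transistor read upside down into the inverse letter.\<close>

definition rletter :: "('a list \<times> 'a list) set => 'a list => 'a list => (ivl => ivl) => 'a diagram \<times> bool" where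
 "rletter R u v m = (if (u, v) \<in> R then (vcode u v m, True) else (vcode v u m, False))"

definition dletter :: "('a list \<times> 'a list) set => 'a diagram => (nat => ivl => ivl) => nat => 'a diagram \<times> bool" where
 "dletter R dg c T = rletter R (word dg (ttop dg T)) (word dg (tbot dg T)) (tchart dg c T)"

text \<open>A relation and not a function, since the word depends on the linear extension chosen. By
  \<open>evals_unique\<close> it is single-valued up to \<open>teq\<close>.\<close>

definition evals :: "('a list \<times> 'a list) set => 'a diagram => (ivl => ivl) => ('a diagram \<times> bool) list => bool" where
 "evals R dg f u \<longleftrightarrow> (\<exists>c Ts. charting dg c & linext dg Ts & f = joinl (map c (fbot dg)) &
   u = map (dletter R dg c) Ts)"

lemma rletter_vertex: "(u, v) \<in> R | (v, u) \<in> R ==> chart m ==> rletter R u v m \<in> vertices R \<times> UNIV"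
 unfolding rletter_def vertices_def by auto

lemma rletter_inv:
 "semigroup_presentation A R ==> (u, v) \<in> R | (v, u) \<in> R ==> inv_letter (rletter R u v m) = rletter R v u m"
 unfolding rletter_def semigroup_presentation_def by auto

lemma rletter_eq_iff:
 "(u, v) \<in> R | (v, u) \<in> R ==> (u', v') \<in> R | (v', u') \<in> R ==> chart m ==> chart m' ==>
  rletter R u v m = rletter R u' v' m' \<longleftrightarrow> u = u' & v = v' & m = m'" unfolding rletter_def by (auto simp: vcode_eq_iff)

lemma rletter_comm_iff:
 assumes "(u, v) \<in> R | (v, u) \<in> R" "(u', v') \<in> R | (v', u') \<in> R" "chart m" "chart m'"
 shows "(fst (rletter R u v m), fst (rletter R u' v' m')) \<in> edges R \<longleftrightarrow> range m \<inter> range m' = {}"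
 by (cases "(u, v) \<in> R"; cases "(u', v') \<in> R") (use assms in \<open>simp_all add: rletter_def vcode_edge_iff\<close>)

lemma sorted_wrt_unique:
 assumes "!!a b. Q a b ==> ~ Q b a"
 shows "sorted_wrt Q xs ==> sorted_wrt Q ys ==> set xs = set ys ==> xs = ys"
proof (induction xs arbitrary: ys)
 case (Cons a xs)
 then obtain b ys' where ys: "ys = b # ys'" by (cases ys) auto
 have "a = b"
 proof (rule ccontr)
  assume "a ~= b"
  then have "Q a b" "Q b a" using Cons.prems ys by auto
  then show False using assms by blast
 qed
 moreover have "~ Q a a" "~ Q b b" using assms by blast+
 then have "a \<notin> set xs" "b \<notin> set ys'" using Cons.prems ys by auto
 ultimately have "set xs = set ys'" using Cons.prems(3) ys by auto
 then have "xs = ys'" using Cons ys by auto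
 then show ?case using ys \<open>a = b\<close> by simp
qed simp

lemma (in partial_commutation) pull_map:
 "pull a (map l Ts) = Some r ==>
  \<exists>Us T Vs. Ts = Us @ T # Vs & l T = a & (\<forall>S\<in>set Us. comm (fst a) (fst (l S))) & r = map l (Us @ Vs)"
proof (induction Ts arbitrary: r)
 case (Cons S Ts)
 show ?case
 proof (cases "l S = a")
  case True
  then show ?thesis using Cons.prems by (intro exI[of _ "[]"] exI[of _ S] exI[of _ Ts]) auto
 next
  case False
  then obtain r' where r: "comm (fst a) (fst (l S))" "pull a (map l Ts) = Some r'" "r = l S # r'" using Cons.prems by (auto split: if_splits)
  obtain Us T Vs where "Ts = Us @ T # Vs" "l T = a" "\<forall>S\<in>set Us. comm (fst a) (fst (l S))" "r' = map l (Us @ Vs)"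
   using Cons.IH[OF r(2)] by blast
  then show ?thesis using r by (intro exI[of _ "S # Us"] exI[of _ T] exI[of _ Vs]) auto
 qed
qed simp

text \<open>Locates the cancellation in the underlying list: two positions with inverse letters,
  separated by letters commuting with both. For transistors this will be a dipole.\<close>

lemma (in partial_commutation) not_reduced_map:
 "~ reduced (map l Ts) ==>
  \<exists>Us S Ms T Vs. Ts = Us @ S # Ms @ T # Vs & l T = inv_letter (l S) & (\<forall>M\<in>set Ms. comm (fst (l S)) (fst (l M)))"
proof (induction Ts)
 case (Cons S Ts)
 show ?case
 proof (cases "reduced (map l Ts)")
  case True
  then have "starts (inv_letter (l S)) (map l Ts)" using Cons.prems by simp
  then obtain r where "pull (inv_letter (l S)) (map l Ts) = Some r" using starts_imp_pull by blast
  from pull_map[OF this] obtain Us T Vs where "Ts = Us @ T # Vs" "l T = inv_letter (l S)"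
   "\<forall>M\<in>set Us. comm (fst (l S)) (fst (l M))" by auto
  then show ?thesis by (intro exI[of _ "[]"] exI[of _ S] exI[of _ Us] exI[of _ T] exI[of _ Vs]) simp
 next
  case False
  then obtain Us S' Ms T Vs where *: "Ts = Us @ S' # Ms @ T # Vs" "l T = inv_letter (l S')"
   "\<forall>M\<in>set Ms. comm (fst (l S')) (fst (l M))" using Cons.IH by blast
  show ?thesis by (intro exI[of _ "S # Us"] exI[of _ S'] exI[of _ Ms] exI[of _ T] exI[of _ Vs]) (use * in simp)
 qed
qed simp

section \<open>Overlap of charts and the order of transistors\<close>

context ww_diagram
begin

sublocale raag "vertices R" "edges R" by (rule raag_vertices_edges)

lemma dletter_vertex: "charting dg c ==> T \<in> transistors dg ==> dletter R dg c T \<in> vertices R \<times> UNIV"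
 unfolding dletter_def by (intro rletter_vertex rels charting_chart)

lemma dletter_comm_iff:
 "charting dg c ==> S \<in> transistors dg ==> T \<in> transistors dg ==>
  (fst (dletter R dg c S), fst (dletter R dg c T)) \<in> edges R \<longleftrightarrow> range (tchart dg c S) \<inter> range (tchart dg c T) = {}"
 unfolding dletter_def by (intro rletter_comm_iff rels charting_chart)

lemma range_tchart: "T \<in> transistors dg ==> range (tchart dg c T) = (\<Union>x\<in>set (ttop dg T). range (c x))"
 unfolding tchart_def using range_joinl[of "map c (ttop dg T)"] nonempty(3) by simp

lemma range_tchart_tbot:
 "charting dg c ==> T \<in> transistors dg ==> range (tchart dg c T) = (\<Union>x\<in>set (tbot dg T). range (c x))"
 using range_joinl[of "map c (tbot dg T)"] nonempty(3) tchart_tbot[of c T] by simp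

lemma prec_overlap: "charting dg c ==> (T, S) \<in> prec dg ==> range (tchart dg c S) \<inter> range (tchart dg c T) ~= {}"
proof -
 assume c: "charting dg c" and "(T, S) \<in> prec dg"
 then obtain x where x: "T \<in> transistors dg" "S \<in> transistors dg" "x \<in> set (ttop dg T)" "x \<in> set (tbot dg S)"
  unfolding prec_def by auto
 then have "range (c x) \<subseteq> range (tchart dg c S)" "range (c x) \<subseteq> range (tchart dg c T)"
  using range_tchart[of T c] range_tchart_tbot[OF c, of S] by auto
 then show ?thesis by blast
qed

text \<open>Just below \<open>S\<close> its range is covered by its outputs alone. Further down, a
  live wire meeting this range either was such a wire already or leaves a transistor some input of
  which met the range; inductively all of them descend from \<open>S\<close>, and so does
  \<open>T\<close>.\<close>

lemma overlap_prec:
 assumes c: "charting dg c" and le: "linext dg (Us @ S # Ms @ T # Vs)"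
  and ov: "range (tchart dg c S) \<inter> range (tchart dg c T) ~= {}"
 shows "(T, S) \<in> (prec dg)\<^sup>+"
proof -
 have S: "S \<in> transistors dg" using linext_step(1)[OF le] .
 have desc: "(S', S) \<in> (prec dg)\<^sup>+"
  if inv: "!!x. x \<in> live dg (Us @ S # Ns) ==> range (c x) \<inter> range (tchart dg c S) ~= {} ==>
    \<exists>S'. (S', S) \<in> (prec dg)\<^sup>* & S' \<in> transistors dg & x \<in> set (tbot dg S')"
   and l: "linext dg (Us @ S # Ns @ S' # Ws)" and ov: "range (tchart dg c S) \<inter> range (tchart dg c S') ~= {}" for Ns S' Ws
 proof -
  have s: "S' \<in> transistors dg" "set (ttop dg S') \<subseteq> live dg (Us @ S # Ns)" using linext_step(1,4)[of "Us @ S # Ns" S' Ws] l by auto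
  have "range (tchart dg c S) \<inter> (\<Union>x\<in>set (ttop dg S'). range (c x)) ~= {}" using ov range_tchart[OF s(1), of c] by simp
  then obtain x where x: "x \<in> set (ttop dg S')" "range (c x) \<inter> range (tchart dg c S) ~= {}" by blast
  then obtain X where X: "(X, S) \<in> (prec dg)\<^sup>*" "X \<in> transistors dg" "x \<in> set (tbot dg X)" using inv[of x] s(2) by blast
  then have "(S', X) \<in> prec dg" using x s unfolding prec_def by blast
  then show ?thesis using X(1) by (rule rtrancl_into_trancl2)
 qed
 have inv: "\<exists>S'. (S', S) \<in> (prec dg)\<^sup>* & S' \<in> transistors dg & x \<in> set (tbot dg S')"
  if "linext dg (Us @ S # Ns @ Ws)" "x \<in> live dg (Us @ S # Ns)" "range (c x) \<inter> range (tchart dg c S) ~= {}"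
  for Ns Ws x using that
 proof (induction Ns arbitrary: Ws x rule: rev_induct)
  case Nil
  note s = linext_step[of Us S Ws]
  have le': "linext dg (Us @ S # Ws)" using Nil by simp
  have "x \<in> set (tbot dg S)"
  proof (rule ccontr)
   assume "x \<notin> set (tbot dg S)"
   then have x: "x \<in> live dg Us - set (ttop dg S)" using s(7)[OF le'] Nil(2) by auto
   obtain y p q where "y \<in> set (ttop dg S)" "c x p = c y q" using Nil(3) range_tchart[OF S, of c] by blast
   then show False using tilingD[OF charting_tiling[OF c, of Us "S # Ws"], of x y p q] le' x s(4)[OF le'] by blast
  qed
  then show ?case using S by blast
 next
  case (snoc S' Ns)
  have le': "linext dg ((Us @ S # Ns) @ S' # Ws)" using snoc.prems by simp
  note s = linext_step[OF le']
  have IH: "\<exists>S'. (S', S) \<in> (prec dg)\<^sup>* & S' \<in> transistors dg & x \<in> set (tbot dg S')"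
   if "x \<in> live dg (Us @ S # Ns)" "range (c x) \<inter> range (tchart dg c S) ~= {}" for x using snoc.IH[of "S' # Ws" x] that le' by simp
  show ?case
  proof (cases "x \<in> set (tbot dg S')")
   case True
   then have "range (tchart dg c S) \<inter> range (tchart dg c S') ~= {}" using snoc.prems(3) range_tchart_tbot[OF c s(1)] by blast
   then have "(S', S) \<in> (prec dg)\<^sup>+" using desc[OF IH, of Ns S' Ws] le' by simp
   then have "(S', S) \<in> (prec dg)\<^sup>*" by (rule trancl_into_rtrancl)
   then show ?thesis using True s(1) by blast
  next
   case False
   then have "x \<in> live dg (Us @ S # Ns)" using s(7) snoc.prems(2) by auto
   then show ?thesis using IH snoc.prems(3) by blast
  qed
 qed
 show ?thesis using desc[of Ms T Vs] inv[of Ms "T # Vs"] le ov by simp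
qed

lemma linext_trancl:
 assumes "linext dg Ts" "(T, S) \<in> (prec dg)\<^sup>+"
 shows "\<exists>Us Ms Vs. Ts = Us @ S # Ms @ T # Vs"
proof -
 have ne: "T ~= S" using acyc assms(2) unfolding acyclic_def by blast
 have T: "T \<in> set Ts" "S \<in> set Ts" using assms(2) trancl_subset_Sigma[of "prec dg" "transistors dg"] assms(1)
  unfolding linext_def prec_def by auto
 have split: "(\<exists>Us Ms Vs. Ts = Us @ X # Ms @ Y # Vs) | (\<exists>Us Ms Vs. Ts = Us @ Y # Ms @ X # Vs)"
  if "X \<in> set Ts" "Y \<in> set Ts" "X ~= Y" for X Y
 proof -
  obtain Us Vs where U: "Ts = Us @ X # Vs" using \<open>X \<in> set Ts\<close> by (meson split_list)
  then have "Y \<in> set Us | Y \<in> set Vs" using that by auto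
  then consider "Y \<in> set Us" | "Y \<in> set Vs" by blast
  then show ?thesis
  proof cases
   case 1
   then obtain Us1 Us2 where "Us = Us1 @ Y # Us2" by (meson split_list)
   then have "Ts = Us1 @ Y # Us2 @ X # Vs" using U by simp
   then show ?thesis by blast
  next
   case 2
   then obtain Us1 Us2 where "Vs = Us1 @ Y # Us2" by (meson split_list)
   then have "Ts = Us @ X # Us1 @ Y # Us2" using U by simp
   then show ?thesis by blast
  qed
 qed
 define idx where "idx X = (THE i. i < length Ts & Ts ! i = X)" for X
 have idx: "idx (Ts ! i) = i" if "i < length Ts" for i
  unfolding idx_def using assms(1) that by (intro the_equality) (auto simp: linext_def nth_eq_iff_index_eq)
 have step: "idx Y < idx X" if "(X, Y) \<in> prec dg" for X Y
 proof -
  have "X \<in> set Ts" "Y \<in> set Ts" using that assms(1) unfolding prec_def linext_def by auto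
  then obtain i j where ij: "i < length Ts" "Ts ! i = X" "j < length Ts" "Ts ! j = Y" unfolding in_set_conv_nth by blast
  have "~ i < j" using ij that assms(1) unfolding linext_def sorted_wrt_iff_nth_less by blast
  moreover have "i ~= j" using ij that acyc unfolding acyclic_def by blast
  ultimately show ?thesis using ij idx by auto
 qed
 have "idx S < idx T" using assms(2) by (induction rule: trancl_induct) (use step in force)+
 then have "~ (\<exists>Us Ms Vs. Ts = Us @ T # Ms @ S # Vs)"
 proof (intro notI)
  assume a: "idx S < idx T" "\<exists>Us Ms Vs. Ts = Us @ T # Ms @ S # Vs"
  then obtain Us Ms Vs where U: "Ts = Us @ T # Ms @ S # Vs" by blast
  then have "idx T = length Us" "idx S = length Us + 1 + length Ms"
   using idx[of "length Us"] idx[of "length Us + 1 + length Ms"] by (simp_all add: nth_append)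
  then show False using a by simp
 qed
 then show ?thesis using split[OF T(1,2) ne] by blast
qed

text \<open>Transistors over a pair of non-commuting vertices have pairwise overlapping ranges,
  hence are linearly ordered by the transitive closure of \<open>prec\<close>. Every sweep lists
  them in that order, which is what equality of projections asks.\<close>

lemma linext_teq:
 assumes c: "charting dg c" and l: "linext dg Ts" "linext dg Us"
 shows "teq (map (dletter R dg c) Ts) (map (dletter R dg c) Us)" unfolding teq_def
proof (intro allI impI)
 fix x y assume xy: "(x, y) \<notin> edges R"
 define P where "P T \<longleftrightarrow> fst (dletter R dg c T) = x | fst (dletter R dg c T) = y" for T
 define Q where "Q S T \<longleftrightarrow> (T, S) \<in> (prec dg)\<^sup>+" for S T
 have nc: "(fst (dletter R dg c S), fst (dletter R dg c T)) \<notin> edges R" if "P S" "P T" for S T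
  using that xy comm_sym comm_irrefl unfolding P_def by metis
 have so: "sorted_wrt Q (filter P Ts)" if l: "linext dg Ts" for Ts
 proof -
  have "sorted_wrt (%S T. P S --> P T --> Q S T) Ts" unfolding sorted_wrt_iff_nth_less
  proof (intro allI impI)
   fix i j assume ij: "i < j" "j < length Ts" and PP: "P (Ts ! i)" "P (Ts ! j)"
   have tr: "Ts ! i \<in> transistors dg" "Ts ! j \<in> transistors dg" using ij l nth_mem[of i Ts] nth_mem[of j Ts] unfolding linext_def by auto
   have U: "Ts = take i Ts @ Ts ! i # drop (Suc i) Ts" using ij by (intro id_take_nth_drop) simp
   have "Ts ! j \<in> set (drop (Suc i) Ts)" using ij by (auto simp: in_set_conv_nth intro!: exI[of _ "j - Suc i"])
   then obtain Ms Vs where "drop (Suc i) Ts = Ms @ Ts ! j # Vs" by (meson split_list)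
   then have "linext dg (take i Ts @ Ts ! i # Ms @ Ts ! j # Vs)" using l U by simp
   then show "Q (Ts ! i) (Ts ! j)" unfolding Q_def using overlap_prec[OF c] nc[OF PP] dletter_comm_iff[OF c tr] by blast
  qed
  then have "sorted_wrt (%S T. P S --> P T --> Q S T) (filter P Ts)" by (rule sorted_wrt_filter)
  then show ?thesis by (rule sorted_wrt_mono_rel[rotated]) simp
 qed
 have "filter P Ts = filter P Us"
 proof (rule sorted_wrt_unique[of Q])
  show "~ Q b a" if "Q a b" for a b using that acyc trancl_trans unfolding Q_def acyclic_def by metis
  show "set (filter P Ts) = set (filter P Us)" using l unfolding linext_def by simp
 qed (use so l in auto)
 then show "proj x y (map (dletter R dg c) Ts) = proj x y (map (dletter R dg c) Us)" unfolding proj_def filter_map P_def o_def by simp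
qed

lemma tchart_agree: "charting dg c ==> charting dg d ==> T \<in> transistors dg ==> tchart dg c T = tchart dg d T"
 unfolding tchart_def using charting_agree[of c d] bots(5) by (intro arg_cong[of _ _ joinl]) auto

lemma evals_unique:
 assumes "evals R dg f u" "evals R dg g v"
 shows "f = g" "teq u v"
proof -
 obtain c Ts where c: "charting dg c" "linext dg Ts" "f = joinl (map c (fbot dg))" "u = map (dletter R dg c) Ts"
  using assms unfolding evals_def by blast
 obtain d Us where d: "charting dg d" "linext dg Us" "g = joinl (map d (fbot dg))" "v = map (dletter R dg d) Us"
  using assms unfolding evals_def by blast
 have "map c (fbot dg) = map d (fbot dg)" using charting_agree[OF c(1) d(1)] bots(5) by auto
 then show "f = g" unfolding c(3) d(3) by (rule arg_cong)
 have "dletter R dg c T = dletter R dg d T" if "T \<in> transistors dg" for T unfolding dletter_def using tchart_agree[OF c(1) d(1) that] by simp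
 then have "v = map (dletter R dg c) Us" using d(2,4) unfolding linext_def by auto
 then show "teq u v" using linext_teq[OF c(1,2) d(2)] c(4) by simp
qed

lemma ex_evals: "\<exists>f u. evals R dg f u" unfolding evals_def using ex_charting ex_linext by blast

lemma evals_props:
 assumes "evals R dg f u"
 shows "bij f" "chart f" "u \<in> lists (vertices R \<times> UNIV)"
proof -
 obtain c Ts where c: "charting dg c" "linext dg Ts" "f = joinl (map c (fbot dg))" "u = map (dletter R dg c) Ts"
  using assms unfolding evals_def by blast
 show "bij f" "chart f" using frame_chart[OF c(1)] c(3) by simp_all
 show "u \<in> lists (vertices R \<times> UNIV)" using dletter_vertex[OF c(1)] c(2,4) unfolding linext_def in_lists_conv_set by auto
qed

text \<open>Conversely, every rearranged word comes from a sweep: a letter that can be pulled to the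
  front belongs to a transistor whose range is disjoint from those listed before it, so none of
  these lies directly above it.\<close>

lemma reorder:
 assumes c: "charting dg c"
 shows "teq u (map (dletter R dg c) Ts) ==> distinct Ts ==> set Ts \<subseteq> transistors dg ==>
  sorted_wrt (%S T. (S, T) \<notin> prec dg) Ts ==>
  \<exists>Us. map (dletter R dg c) Us = u & distinct Us & set Us = set Ts & sorted_wrt (%S T. (S, T) \<notin> prec dg) Us"
proof (induction u arbitrary: Ts)
 case Nil
 then show ?case using teq_nil teq_sym by blast
next
 case (Cons a u)
 have "starts a (map (dletter R dg c) Ts)" using starts_cong[OF Cons.prems(1)] starts_Cons_same by blast
 then obtain r where r: "pull a (map (dletter R dg c) Ts) = Some r" using starts_imp_pull by blast
 obtain Us T Vs where T: "Ts = Us @ T # Vs" "dletter R dg c T = a"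
  "\<forall>S\<in>set Us. (fst a, fst (dletter R dg c S)) \<in> edges R" "r = map (dletter R dg c) (Us @ Vs)" using pull_map[OF r] by blast
 have "teq (a # u) (a # r)" using Cons.prems(1) pull_teq[OF r] by (rule teq_trans)
 then have tu: "teq u (map (dletter R dg c) (Us @ Vs))" using T(4) by (simp only: teq_Cons)
 have "\<exists>Ws. map (dletter R dg c) Ws = u & distinct Ws & set Ws = set (Us @ Vs) &
  sorted_wrt (%S T. (S, T) \<notin> prec dg) Ws" by (rule Cons.IH[OF tu]) (use T(1) Cons.prems in \<open>auto simp: sorted_wrt_append\<close>)
 then obtain Ws where W: "map (dletter R dg c) Ws = u" "distinct Ws" "set Ws = set (Us @ Vs)"
  "sorted_wrt (%S T. (S, T) \<notin> prec dg) Ws" by blast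
 have Us: "(T, S) \<notin> prec dg" if "S \<in> set Us" for S
 proof
  assume "(T, S) \<in> prec dg"
  then have "range (tchart dg c S) \<inter> range (tchart dg c T) ~= {}" by (rule prec_overlap[OF c])
  moreover have "range (tchart dg c T) \<inter> range (tchart dg c S) = {}" using T that Cons.prems(3) dletter_comm_iff[OF c, of T S] by auto
  ultimately show False by blast
 qed
 have Vs: "(T, S) \<notin> prec dg" if "S \<in> set Vs" for S using Cons.prems(4) T(1) that by (auto simp: sorted_wrt_append)
 have "sorted_wrt (%S T. (S, T) \<notin> prec dg) (T # Ws)" using W Us Vs by auto
 moreover have "distinct (T # Ws)" "set (T # Ws) = set Ts" using W T(1) Cons.prems(2) by auto
 moreover have "map (dletter R dg c) (T # Ws) = a # u" using W T(2) by simp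
 ultimately show ?case by (intro exI[of _ "T # Ws"] conjI)
qed

lemma evals_teq:
 assumes "evals R dg f v" "teq u v"
 shows "evals R dg f u"
proof -
 obtain c Ts where c: "charting dg c" "linext dg Ts" "f = joinl (map c (fbot dg))" "v = map (dletter R dg c) Ts"
  using assms unfolding evals_def by blast
 obtain Us where "map (dletter R dg c) Us = u & distinct Us & set Us = set Ts & sorted_wrt (%S T. (S, T) \<notin> prec dg) Us"
  using reorder[OF c(1), of u Ts] assms(2) c(2,4) unfolding linext_def by blast
 then show ?thesis using c unfolding evals_def linext_def by auto
qed

text \<open>In a non-reduced word some \<open>S\<close> is followed by a \<open>T\<close> with the
  inverse letter, and everything between has range disjoint from that of \<open>S\<close>. The
  outputs of \<open>S\<close> therefore survive down to \<open>T\<close>; having the same charts as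
  the inputs of \<open>T\<close>, they are these inputs in the same order, and a dipole
  appears.\<close>

lemma dipole_free_reduced:
 assumes "evals R dg f u" "dipole_free dg"
 shows "reduced u"
proof (rule ccontr)
 assume nr: "~ reduced u"
 obtain c Ts where c: "charting dg c" "linext dg Ts" "f = joinl (map c (fbot dg))" "u = map (dletter R dg c) Ts"
  using assms unfolding evals_def by blast
 obtain Us S Ms T Vs where Ts: "Ts = Us @ S # Ms @ T # Vs"
  and inv: "dletter R dg c T = inv_letter (dletter R dg c S)"
  and Ms: "\<forall>M\<in>set Ms. (fst (dletter R dg c S), fst (dletter R dg c M)) \<in> edges R"
  using not_reduced_map[of "dletter R dg c" Ts] nr c(4) by blast
 have tr: "S \<in> transistors dg" "T \<in> transistors dg" "set Ms \<subseteq> transistors dg" using c(2) unfolding linext_def Ts by auto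
 note sS = linext_step[OF c(2)[unfolded Ts]]
 have lT: "linext dg ((Us @ S # Ms) @ T # Vs)" using c(2) unfolding Ts by simp
 note sT = linext_step[OF lT]
 have "rletter R (word dg (ttop dg T)) (word dg (tbot dg T)) (tchart dg c T) =
  rletter R (word dg (tbot dg S)) (word dg (ttop dg S)) (tchart dg c S)"
  using inv rletter_inv[OF pres rels[OF tr(1)]] unfolding dletter_def by simp
 then have eq: "word dg (ttop dg T) = word dg (tbot dg S)" "word dg (tbot dg T) = word dg (ttop dg S)"
  "tchart dg c T = tchart dg c S"
  using rletter_eq_iff[OF rels[OF tr(2)] rels[OF tr(1), unfolded disj_commute[of "(word dg (ttop dg S), _) \<in> R"]]]
   charting_chart(2)[OF c(1)] tr by auto
 have len: "length (ttop dg T) = length (tbot dg S)" using arg_cong[OF eq(1), of length] by (simp add: word_def)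
 have "set (tbot dg S) \<inter> set (ttop dg M) = {}" if M: "M \<in> set Ms" for M
 proof -
  have "range (tchart dg c S) \<inter> range (tchart dg c M) = {}" using Ms M tr dletter_comm_iff[OF c(1), of S M] by blast
  moreover have "range (c x) \<subseteq> range (tchart dg c S)" if "x \<in> set (tbot dg S)" for x
   using that range_tchart_tbot[OF c(1) tr(1)] by auto
  moreover have "range (c x) \<subseteq> range (tchart dg c M)" if "x \<in> set (ttop dg M)" for x using that range_tchart[of M c] M tr by auto
  ultimately show ?thesis by blast
 qed
 then have liveS: "set (tbot dg S) \<subseteq> live dg (Us @ S # Ms)" using sS(6) unfolding live_def seen_def by auto
 have "map c (ttop dg T) = pieces (length (ttop dg T)) (tchart dg c T)" using pieces_joinl[of "map c (ttop dg T)"] unfolding tchart_def by simp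
 also have "\<dots> = map c (tbot dg S)" using c(1) tr(1) len eq(3) unfolding charting_def by simp
 finally have mc: "map c (ttop dg T) = map c (tbot dg S)" .
 have "ttop dg T = tbot dg S"
 proof (rule nth_equalityI[OF len])
  fix i assume i: "i < length (ttop dg T)"
  have "c (ttop dg T ! i) = c (tbot dg S ! i)" using arg_cong[OF mc, of "%l. l ! i"] i len by simp
  then show "ttop dg T ! i = tbot dg S ! i" using tilingD[OF charting_tiling[OF c(1) lT], of "ttop dg T ! i" "tbot dg S ! i"] sT(4) liveS i len
   by (metis nth_mem subsetD)
 qed
 moreover from this have "(T, S) \<in> prec dg" using tr nonempty(3)[OF tr(1)] unfolding prec_def by auto
 ultimately have "dipole dg T S" unfolding dipole_def using eq(2) by simp
 then show False using assms(2) unfolding dipole_free_def by blast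
qed

end

section \<open>Reduced diagrams are determined by their evaluation\<close>

lemma map_eq_concat_blocks:
 assumes "map \<phi> (concat xss) = concat yss" "map length xss = map length yss"
 shows "map (map \<phi>) xss = yss" using assms
proof (induction xss arbitrary: yss)
 case (Cons xs xss)
 then obtain ys yss' where "yss = ys # yss'" by (cases yss) auto
 then show ?case using Cons by auto
qed simp

lemma distinct_concat_map:
 assumes "distinct Ts" "!!T. T \<in> set Ts ==> distinct (g T)"
  "!!S T. S \<in> set Ts ==> T \<in> set Ts ==> S ~= T ==> set (g S) \<inter> set (g T) = {}"
 shows "distinct (concat (map g Ts))" using assms
proof (induction Ts)
 case (Cons T Ts)
 have "set (g T) \<inter> set (g S) = {}" if "S \<in> set Ts" for S using Cons.prems(1) Cons.prems(3)[of T S] that by auto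
 then show ?case using Cons by auto
qed simp

lemma (in ww_diagram) distinct_tops:
 assumes "linext dg Ts"
 shows "distinct (concat (ftop dg # map (tbot dg) Ts))"
proof -
 have Ts: "distinct Ts" "set Ts = transistors dg" using assms unfolding linext_def by auto
 have "distinct (concat (map (tbot dg) Ts))" using tops(2,4) Ts by (intro distinct_concat_map) simp_all
 moreover have "set (ftop dg) \<inter> set (concat (map (tbot dg) Ts)) = {}" using tops(3) Ts(2) by fastforce
 ultimately show ?thesis using tops(1) by simp
qed

locale ww_pair = D: ww_diagram A R w dg + D': ww_diagram A R w dg'
 for A :: "'a set" and R w and dg dg' :: "'a diagram"
begin

text \<open>Wires are matched by the place where their upper end is attached, which the common word
  makes possible. That lower ends correspond as well is not part of this choice; it is forced by the
  charts, since live wires with equal charts coincide.\<close>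

lemma iso_if_evals_eq:
 assumes "evals R dg f u" "evals R dg' f u"
 shows "diagram_iso dg dg'"
proof -
 obtain c Ts where c: "charting dg c" "linext dg Ts" "f = joinl (map c (fbot dg))" "u = map (dletter R dg c) Ts"
  using assms(1) unfolding evals_def by blast
 obtain c' Ts' where c': "charting dg' c'" "linext dg' Ts'" "f = joinl (map c' (fbot dg'))"
  "u = map (dletter R dg' c') Ts'" using assms(2) unfolding evals_def by blast
 have len: "length Ts = length Ts'" using c(4) c'(4) by (metis length_map)
 let ?n = "length Ts"
 have tr: "Ts ! i \<in> transistors dg" "Ts' ! i \<in> transistors dg'" if "i < ?n" for i using c(2) c'(2) that len unfolding linext_def by auto
 have eq: "word dg (ttop dg (Ts ! i)) = word dg' (ttop dg' (Ts' ! i))"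
  "word dg (tbot dg (Ts ! i)) = word dg' (tbot dg' (Ts' ! i))"
  "tchart dg c (Ts ! i) = tchart dg' c' (Ts' ! i)" if i: "i < ?n" for i
 proof -
  have "dletter R dg c (Ts ! i) = dletter R dg' c' (Ts' ! i)" using c(4) c'(4) i len by (metis nth_map)
  then show "word dg (ttop dg (Ts ! i)) = word dg' (ttop dg' (Ts' ! i))"
   "word dg (tbot dg (Ts ! i)) = word dg' (tbot dg' (Ts' ! i))"
   "tchart dg c (Ts ! i) = tchart dg' c' (Ts' ! i)" using rletter_eq_iff[OF D.rels[OF tr(1)[OF i]] D'.rels[OF tr(2)[OF i]]
     D.charting_chart(2)[OF c(1) tr(1)[OF i]] D'.charting_chart(2)[OF c'(1) tr(2)[OF i]]] unfolding dletter_def by blast+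
 qed
 have lens: "length (ttop dg (Ts ! i)) = length (ttop dg' (Ts' ! i))"
  "length (tbot dg (Ts ! i)) = length (tbot dg' (Ts' ! i))" if "i < ?n" for i
  using arg_cong[OF eq(1)[OF that], of length] arg_cong[OF eq(2)[OF that], of length] by (simp_all add: word_def)
 define W where "W = ftop dg # map (tbot dg) Ts"
 define W' where "W' = ftop dg' # map (tbot dg') Ts'"
 have blocks: "map length W = map length W'" unfolding W_def W'_def using lens(2) len D.length_frame D'.length_frame
  by (auto intro: nth_equalityI)
 have dW: "distinct (concat W)" unfolding W_def by (rule D.distinct_tops[OF c(2)])
 have dW': "distinct (concat W')" unfolding W'_def by (rule D'.distinct_tops[OF c'(2)])
 have sW: "set (concat W) = wires dg" "set (concat W') = wires dg'"
  unfolding W_def W'_def using D.tops(5) D'.tops(5) c(2) c'(2) by (auto simp: linext_def)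
 have lW: "length (concat W) = length (concat W')" using blocks by (simp add: length_concat)
 define \<phi> where "\<phi> = the \<circ> map_of (zip (concat W) (concat W'))"
 have \<phi>W: "map \<phi> (concat W) = concat W'" unfolding \<phi>_def using dW lW by (intro nth_equalityI) (auto simp: map_of_zip_nth)
 then have \<phi>_blocks: "map (map \<phi>) W = W'" using blocks by (rule map_eq_concat_blocks)
 have \<phi>top: "map \<phi> (ftop dg) = ftop dg'" using \<phi>_blocks unfolding W_def W'_def by simp
 have \<phi>bot: "map \<phi> (tbot dg (Ts ! i)) = tbot dg' (Ts' ! i)" if "i < ?n" for i
  using arg_cong[OF \<phi>_blocks, of "%l. l ! Suc i"] that len unfolding W_def W'_def by simp
 have \<phi>inj: "inj_on \<phi> (wires dg)" using dW' \<phi>W sW by (metis distinct_map)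
 have bij: "bij_betw \<phi> (wires dg) (wires dg')" using \<phi>inj arg_cong[OF \<phi>W, of set] sW unfolding bij_betw_def by simp
 have cd: "c' (\<phi> x) = c x & label dg' (\<phi> x) = label dg x" if x: "x \<in> wires dg" for x
 proof -
  have *: "c' (\<phi> x) = c x & label dg' (\<phi> x) = label dg x"
   if "map c' (map \<phi> xs) = map c xs" "map (label dg') (map \<phi> xs) = map (label dg) xs" "x \<in> set xs" for xs using that by auto
  consider "x \<in> set (ftop dg)" | i where "i < ?n" "x \<in> set (tbot dg (Ts ! i))"
   using D.tops(5) x c(2) unfolding linext_def by (metis UN_E Un_iff in_set_conv_nth)
  then show ?thesis
  proof cases
   case 1
   then show ?thesis by (intro *[of "ftop dg"])
     (use \<phi>top c(1) c'(1) D.tw D'.tw D.length_frame D'.length_frame in \<open>auto simp: charting_def simp del: map_map\<close>)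
  next
   case 2
   then show ?thesis by (intro *[of "tbot dg (Ts ! i)"])
     (use \<phi>bot[OF 2(1)] c(1) c'(1) tr[OF 2(1)] eq[OF 2(1)] lens[OF 2(1)] in \<open>auto simp: charting_def word_def simp del: map_map\<close>)
  qed
 qed
 \<comment> \<open>Live wires are mapped to live wires only as far as the inputs of the first
   \<open>k\<close> transistors are known to correspond. The two facts therefore advance together,
   in the induction for \<open>\<phi>ttop\<close>.\<close>
 have live_map: "\<phi> ` live dg (take k Ts) \<subseteq> live dg' (take k Ts')"
  if k: "k <= ?n" and top: "!!i. i < k ==> map \<phi> (ttop dg (Ts ! i)) = ttop dg' (Ts' ! i)" for k
 proof
  fix y assume "y \<in> \<phi> ` live dg (take k Ts)"
  then obtain x where x: "x \<in> live dg (take k Ts)" "y = \<phi> x" by blast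
  have st: "S \<in> set (take k Ts) \<longleftrightarrow> (\<exists>i<k. S = Ts ! i)" "S \<in> set (take k Ts') \<longleftrightarrow> (\<exists>i<k. S = Ts' ! i)" for S
   using k len by (auto simp: in_set_conv_nth)
  have xw: "x \<in> wires dg"
  proof -
   have "set (take k Ts) \<subseteq> transistors dg" using c(2) set_take_subset[of k Ts] unfolding linext_def by auto
   then show ?thesis using x(1) D.tops(5) unfolding live_def seen_def by blast
  qed
  have "y \<in> seen dg' (take k Ts')"
  proof -
   consider "x \<in> set (ftop dg)" | S where "S \<in> set (take k Ts)" "x \<in> set (tbot dg S)" using x(1) unfolding live_def seen_def by blast
   then show ?thesis
   proof cases
    case 1
    then have "y \<in> set (ftop dg')" unfolding \<phi>top[symmetric] x(2) by simp
    then show ?thesis unfolding seen_def by blast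
   next
    case 2
    then obtain i where i: "i < k" "S = Ts ! i" using st(1) by blast
    have "y \<in> set (map \<phi> (tbot dg (Ts ! i)))" using 2 i(2) x(2) by simp
    then have "y \<in> set (tbot dg' (Ts' ! i))" using \<phi>bot[of i] k i(1) by simp
    moreover have "Ts' ! i \<in> set (take k Ts')" unfolding st(2) using i(1) by blast
    ultimately show ?thesis unfolding seen_def by blast
   qed
  qed
  moreover have "y \<notin> set (ttop dg' (Ts' ! i))" if i: "i < k" for i
  proof
   assume "y \<in> set (ttop dg' (Ts' ! i))"
   then have "y \<in> set (map \<phi> (ttop dg (Ts ! i)))" by (simp only: top[OF i])
   then obtain z where z: "z \<in> set (ttop dg (Ts ! i))" "\<phi> z = \<phi> x" using x(2) by auto
   then have "z \<in> wires dg" using D.bots(5) tr(1)[of i] i k by auto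
   then have "z = x" using \<phi>inj z xw by (metis inj_onD)
   moreover have "Ts ! i \<in> set (take k Ts)" unfolding st(1) using i by blast
   ultimately show False using x(1) z(1) unfolding live_def by blast
  qed
  then have "y \<notin> set (ttop dg' S)" if "S \<in> set (take k Ts')" for S using that st(2) by auto
  ultimately show "y \<in> live dg' (take k Ts')" unfolding live_def by blast
 qed
 have split: "linext dg (take k Ts @ drop k Ts)" "linext dg' (take k Ts' @ drop k Ts')" for k using c(2) c'(2) by simp_all
 have match: "map \<phi> xs = ys"
  if "set xs \<subseteq> live dg (take k Ts)" "set ys \<subseteq> live dg' (take k Ts')" "map c xs = map c' ys" "k <= ?n"
   "!!i. i < k ==> map \<phi> (ttop dg (Ts ! i)) = ttop dg' (Ts' ! i)" for xs ys k
 proof (rule nth_equalityI)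
  show l: "length (map \<phi> xs) = length ys" using that(3) by (metis length_map)
  fix i assume i: "i < length (map \<phi> xs)"
  then have x: "xs ! i \<in> live dg (take k Ts)" using that(1) by auto
  then have "xs ! i \<in> wires dg" using D.tops(5) c(2) set_take_subset[of k Ts] unfolding live_def seen_def linext_def by blast
  then have "c' (\<phi> (xs ! i)) = c (xs ! i)" using cd by blast
  also have "\<dots> = c' (ys ! i)" using that(3) i l by (metis length_map nth_map)
  finally have "c' (\<phi> (xs ! i)) = c' (ys ! i)" .
  moreover have "\<phi> (xs ! i) \<in> live dg' (take k Ts')" using live_map[OF that(4,5)] x by blast
  moreover have "ys ! i \<in> live dg' (take k Ts')" using that(2) i l by auto
  ultimately have "\<phi> (xs ! i) = ys ! i" using tilingD[OF D'.charting_tiling[OF c'(1) split(2)]] by metis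
  then show "map \<phi> xs ! i = ys ! i" using i by simp
 qed
 have \<phi>ttop: "k <= ?n ==> \<forall>i<k. map \<phi> (ttop dg (Ts ! i)) = ttop dg' (Ts' ! i)" for k
 proof (induction k)
  case (Suc k)
  have k: "k < ?n" using Suc by simp
  have l: "linext dg (take k Ts @ Ts ! k # drop (Suc k) Ts)" "linext dg' (take k Ts' @ Ts' ! k # drop (Suc k) Ts')"
   using c(2) c'(2) id_take_nth_drop[OF k] id_take_nth_drop[of k Ts'] k len by simp_all
  have "map c (ttop dg (Ts ! k)) = map c' (ttop dg' (Ts' ! k))"
   using pieces_joinl[of "map c (ttop dg (Ts ! k))"] pieces_joinl[of "map c' (ttop dg' (Ts' ! k))"]
    eq(3)[OF k] lens(1)[OF k] unfolding tchart_def by simp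
  moreover have "!!i. i < k ==> map \<phi> (ttop dg (Ts ! i)) = ttop dg' (Ts' ! i)" using Suc by simp
  ultimately have "map \<phi> (ttop dg (Ts ! k)) = ttop dg' (Ts' ! k)"
   using k match[OF D.linext_step(4)[OF l(1)] D'.linext_step(4)[OF l(2)]] by simp
  then show ?case using Suc by (auto simp: less_Suc_eq)
 qed simp
 have \<phi>ttop': "map \<phi> (ttop dg (Ts ! i)) = ttop dg' (Ts' ! i)" if "i < ?n" for i using \<phi>ttop[of ?n] that by simp
 have \<phi>fbot: "map \<phi> (fbot dg) = fbot dg'"
 proof (rule match[of _ ?n])
  show "set (fbot dg) \<subseteq> live dg (take ?n Ts)" using D.live_all[OF c(2)] by simp
  show "set (fbot dg') \<subseteq> live dg' (take ?n Ts')" using D'.live_all[OF c'(2)] len by simp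
  show "map c (fbot dg) = map c' (fbot dg')" using pieces_joinl[of "map c (fbot dg)"] pieces_joinl[of "map c' (fbot dg')"] c(3) c'(3)
    D.length_frame D'.length_frame by simp
 qed (use \<phi>ttop' in auto)
 define \<psi> where "\<psi> = the \<circ> map_of (zip Ts Ts')"
 have \<psi>i: "\<psi> (Ts ! i) = Ts' ! i" if "i < ?n" for i unfolding \<psi>_def using c(2) len that by (simp add: linext_def map_of_zip_nth)
 then have \<psi>: "map \<psi> Ts = Ts'" using len by (intro nth_equalityI) auto
 have \<psi>b: "bij_betw \<psi> (transistors dg) (transistors dg')"
  using c(2) c'(2) \<psi> unfolding linext_def bij_betw_def by (metis distinct_map list.set_map)
 have ex: "\<exists>i<?n. T = Ts ! i" if "T \<in> transistors dg" for T using that c(2) unfolding linext_def by (metis in_set_conv_nth)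
 show ?thesis unfolding diagram_iso_def
 proof (intro exI conjI ballI)
  show "bij_betw \<phi> (wires dg) (wires dg')" "bij_betw \<psi> (transistors dg) (transistors dg')" by fact+
  show "label dg' (\<phi> x) = label dg x" if "x \<in> wires dg" for x using cd[OF that] by blast
  show "ttop dg' (\<psi> T) = map \<phi> (ttop dg T)" if "T \<in> transistors dg" for T using ex[OF that] \<psi>i \<phi>ttop' by auto
  show "tbot dg' (\<psi> T) = map \<phi> (tbot dg T)" if "T \<in> transistors dg" for T using ex[OF that] \<psi>i \<phi>bot by auto
  show "ftop dg' = map \<phi> (ftop dg)" "fbot dg' = map \<phi> (fbot dg)" using \<phi>top \<phi>fbot by simp_all
 qed
qed

text \<open>The evaluation of an isomorphic diagram is obtained by transporting charts and linear extensions.\<close>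

lemma evals_iso:
 assumes "diagram_iso dg dg'" "evals R dg' f u"
 shows "evals R dg f u"
proof -
 obtain \<phi> \<psi> where b: "bij_betw \<phi> (wires dg) (wires dg')" "bij_betw \<psi> (transistors dg) (transistors dg')"
  and lab: "!!x. x \<in> wires dg ==> label dg' (\<phi> x) = label dg x"
  and tt: "!!T. T \<in> transistors dg ==> ttop dg' (\<psi> T) = map \<phi> (ttop dg T)"
  and tb: "!!T. T \<in> transistors dg ==> tbot dg' (\<psi> T) = map \<phi> (tbot dg T)"
  and ff: "ftop dg' = map \<phi> (ftop dg)" "fbot dg' = map \<phi> (fbot dg)" using assms(1) unfolding diagram_iso_def by blast
 obtain c Us where c: "charting dg' c" "linext dg' Us" "f = joinl (map c (fbot dg'))" "u = map (dletter R dg' c) Us"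
  using assms(2) unfolding evals_def by blast
 define Ts where "Ts = map (inv_into (transistors dg) \<psi>) Us"
 have Us: "set Us = transistors dg'" "distinct Us" "sorted_wrt (%S T. (S, T) \<notin> prec dg') Us" using c(2) unfolding linext_def by auto
 have \<psi>Ts: "map \<psi> Ts = Us" unfolding Ts_def map_map
  by (rule map_idI) (use Us(1) b(2) in \<open>simp add: bij_betw_inv_into_right\<close>)
 have Ts: "set Ts = transistors dg" "distinct Ts"
  unfolding Ts_def using Us bij_betw_inv_into[OF b(2)] by (simp_all add: distinct_map bij_betw_def)
 have pr: "(\<psi> S, \<psi> T) \<in> prec dg'" if "(S, T) \<in> prec dg" for S T
 proof -
  have "S \<in> transistors dg" "T \<in> transistors dg" "set (ttop dg S) \<inter> set (tbot dg T) ~= {}" using that unfolding prec_def by auto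
  then show ?thesis unfolding prec_def using tt tb b(2) by (auto dest: bij_betwE)
 qed
 have "sorted_wrt (%S T. (\<psi> S, \<psi> T) \<notin> prec dg') Ts" using Us(3) unfolding \<psi>Ts[symmetric] sorted_wrt_map .
 then have le: "linext dg Ts" unfolding linext_def using Ts pr by (auto elim: sorted_wrt_mono_rel[rotated])
 have tc: "tchart dg (c \<circ> \<phi>) T = tchart dg' c (\<psi> T)" if "T \<in> transistors dg" for T
  unfolding tchart_def using tt[OF that] by simp
 have ch: "charting dg (c \<circ> \<phi>)" unfolding charting_def
 proof (intro conjI ballI)
  show "map (c \<circ> \<phi>) (ftop dg) = pieces (length (ftop dg)) id" using c(1) unfolding charting_def ff by simp
  fix T assume T: "T \<in> transistors dg"
  then have "\<psi> T \<in> transistors dg'" using b(2) bij_betwE by blast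
  then have "map c (tbot dg' (\<psi> T)) = pieces (length (tbot dg' (\<psi> T))) (tchart dg' c (\<psi> T))"
   using c(1) unfolding charting_def by blast
  then show "map (c \<circ> \<phi>) (tbot dg T) = pieces (length (tbot dg T)) (tchart dg (c \<circ> \<phi>) T)" by (simp add: tc[OF T] tb[OF T])
 qed
 have wd: "word dg' (map \<phi> xs) = word dg xs" if "set xs \<subseteq> wires dg" for xs unfolding word_def using that lab by auto
 have "dletter R dg (c \<circ> \<phi>) T = dletter R dg' c (\<psi> T)" if T: "T \<in> transistors dg" for T
 proof -
  have "set (ttop dg T) \<subseteq> wires dg" "set (tbot dg T) \<subseteq> wires dg" using D.tops(5) D.bots(5) T by blast+
  then show ?thesis unfolding dletter_def tc[OF T] tt[OF T] tb[OF T] using wd by simp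
 qed
 then have "u = map (dletter R dg (c \<circ> \<phi>)) Ts" unfolding c(4) \<psi>Ts[symmetric] using Ts(1) by simp
 then show ?thesis unfolding evals_def using ch le c(3) ff(2) by (intro exI[of _ "c \<circ> \<phi>"] exI[of _ Ts]) simp
qed

end

section \<open>Reducing dipoles\<close>

lemma (in ww_diagram) sets_in_wires:
 "set (ftop dg) \<subseteq> wires dg" "set (fbot dg) \<subseteq> wires dg"
 "T \<in> transistors dg ==> set (ttop dg T) \<subseteq> wires dg" "T \<in> transistors dg ==> set (tbot dg T) \<subseteq> wires dg"
 using tops(5) bots(5) by auto

lemma diagram_iso_refl: "diagram_iso dg dg" unfolding diagram_iso_def by (intro exI[of _ id]) auto

lemma diagram_iso_trans:
 assumes "diagram_iso dg dg'" "diagram_iso dg' dg''"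
 shows "diagram_iso dg dg''"
proof -
 obtain \<phi> \<psi> where 1: "bij_betw \<phi> (wires dg) (wires dg')" "bij_betw \<psi> (transistors dg) (transistors dg')"
  "\<forall>x\<in>wires dg. label dg' (\<phi> x) = label dg x"
  "\<forall>T\<in>transistors dg. ttop dg' (\<psi> T) = map \<phi> (ttop dg T) & tbot dg' (\<psi> T) = map \<phi> (tbot dg T)"
  "ftop dg' = map \<phi> (ftop dg)" "fbot dg' = map \<phi> (fbot dg)" using assms(1) unfolding diagram_iso_def by blast
 obtain \<phi>' \<psi>' where 2: "bij_betw \<phi>' (wires dg') (wires dg'')" "bij_betw \<psi>' (transistors dg') (transistors dg'')"
  "\<forall>x\<in>wires dg'. label dg'' (\<phi>' x) = label dg' x"
  "\<forall>T\<in>transistors dg'. ttop dg'' (\<psi>' T) = map \<phi>' (ttop dg' T) & tbot dg'' (\<psi>' T) = map \<phi>' (tbot dg' T)"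
  "ftop dg'' = map \<phi>' (ftop dg')" "fbot dg'' = map \<phi>' (fbot dg')" using assms(2) unfolding diagram_iso_def by blast
 show ?thesis unfolding diagram_iso_def
 proof (intro exI conjI)
  show "bij_betw (\<phi>' \<circ> \<phi>) (wires dg) (wires dg'')" using 1(1) 2(1) by (rule bij_betw_trans)
  show "bij_betw (\<psi>' \<circ> \<psi>) (transistors dg) (transistors dg'')" using 1(2) 2(2) by (rule bij_betw_trans)
  show "\<forall>x\<in>wires dg. label dg'' ((\<phi>' \<circ> \<phi>) x) = label dg x" using 1(1,3) 2(3) by (simp add: bij_betwE)
  show "\<forall>T\<in>transistors dg. ttop dg'' ((\<psi>' \<circ> \<psi>) T) = map (\<phi>' \<circ> \<phi>) (ttop dg T) &
   tbot dg'' ((\<psi>' \<circ> \<psi>) T) = map (\<phi>' \<circ> \<phi>) (tbot dg T)" using 1(2,4) 2(4) by (simp add: bij_betwE)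
 qed (simp_all add: 1 2)
qed

text \<open>Inverting the bijections on the sides uses that every attached wire is a wire of the
  diagram; elsewhere the maps are arbitrary.\<close>

lemma (in ww_diagram) diagram_iso_sym:
 assumes "diagram_iso dg dg'"
 shows "diagram_iso dg' dg"
proof -
 obtain \<phi> \<psi> where 1: "bij_betw \<phi> (wires dg) (wires dg')" "bij_betw \<psi> (transistors dg) (transistors dg')"
  "\<forall>x\<in>wires dg. label dg' (\<phi> x) = label dg x"
  "\<forall>T\<in>transistors dg. ttop dg' (\<psi> T) = map \<phi> (ttop dg T) & tbot dg' (\<psi> T) = map \<phi> (tbot dg T)"
  "ftop dg' = map \<phi> (ftop dg)" "fbot dg' = map \<phi> (fbot dg)" using assms(1) unfolding diagram_iso_def by blast
 let ?\<phi> = "inv_into (wires dg) \<phi>" and ?\<psi> = "inv_into (transistors dg) \<psi>"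
 have inv: "map ?\<phi> (map \<phi> xs) = xs" if "set xs \<subseteq> wires dg" for xs
  unfolding map_map using that 1(1) by (intro map_idI) (auto simp: bij_betw_inv_into_left)
 have T: "?\<psi> T \<in> transistors dg & \<psi> (?\<psi> T) = T" if "T \<in> transistors dg'" for T
  using that 1(2) by (metis bij_betw_def bij_betw_inv_into_right inv_into_into)
 have X: "?\<phi> x \<in> wires dg & \<phi> (?\<phi> x) = x" if "x \<in> wires dg'" for x
  using that 1(1) by (metis bij_betw_def bij_betw_inv_into_right inv_into_into)
 show ?thesis unfolding diagram_iso_def
 proof (intro exI conjI ballI)
  show "bij_betw ?\<phi> (wires dg') (wires dg)" "bij_betw ?\<psi> (transistors dg') (transistors dg)" by (rule bij_betw_inv_into, rule 1)+
  show "label dg (?\<phi> x) = label dg' x" if "x \<in> wires dg'" for x using X[OF that] 1(3) by metis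
  show "ttop dg (?\<psi> T) = map ?\<phi> (ttop dg' T)" "tbot dg (?\<psi> T) = map ?\<phi> (tbot dg' T)"
   if "T \<in> transistors dg'" for T
  proof -
   have "ttop dg' T = map \<phi> (ttop dg (?\<psi> T))" "tbot dg' T = map \<phi> (tbot dg (?\<psi> T))" using T[OF that] 1(4) by metis+
   then show "ttop dg (?\<psi> T) = map ?\<phi> (ttop dg' T)" "tbot dg (?\<psi> T) = map ?\<phi> (tbot dg' T)"
    using inv sets_in_wires T[OF that] by simp_all
  qed
  show "ftop dg = map ?\<phi> (ftop dg')" "fbot dg = map ?\<phi> (fbot dg')" unfolding 1 using inv sets_in_wires by simp_all
 qed
qed

lemma (in partial_commutation) teq_move:
 "(!!b. b \<in> set M ==> comm (fst a) (fst b)) ==> teq (a # M @ z) (M @ a # z)"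
proof (induction M)
 case (Cons b M)
 have "teq (a # b # M @ z) (b # a # M @ z)" using Cons.prems by (intro teq_swap) simp
 also have "teq (b # a # M @ z) (b # M @ a # z)" using Cons by (simp add: teq_Cons)
 finally show ?case by simp
qed simp

text \<open>Called for because removing a dipole can create relations that were only composite
  before.\<close>

lemma (in ww_diagram) linext_not_trancl:
 assumes "linext dg Ts"
 shows "sorted_wrt (%S T. (S, T) \<notin> (prec dg)\<^sup>+) Ts" unfolding sorted_wrt_iff_nth_less
proof (intro allI impI notI)
 fix i j assume ij: "i < j" "j < length Ts" and p: "(Ts ! i, Ts ! j) \<in> (prec dg)\<^sup>+"
 obtain Us Ms Vs where U: "Ts = Us @ Ts ! j # Ms @ Ts ! i # Vs" using linext_trancl[OF assms p] by blast
 let ?a = "length Us" and ?b = "length Us + 1 + length Ms"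
 have d: "distinct Ts" using assms unfolding linext_def by blast
 have l: "?b < length Ts" by (subst U) simp
 have "Ts ! ?a = Ts ! j" "Ts ! ?b = Ts ! i" by (subst U, simp add: nth_append)+
 then have "?a = j" "?b = i" using d l ij nth_eq_iff_index_eq[OF d] by auto
 then show False using ij by simp
qed

locale ww_dipole = ww_diagram +
 fixes T1 T2 :: nat
 assumes dipole: "dipole dg T1 T2"
begin

abbreviation "dgr \<equiv> reduce_dipole dg T1 T2"
abbreviation "J \<equiv> joined_name dg T1 T2"

lemma dip: "(T1, T2) \<in> prec dg" "ttop dg T1 = tbot dg T2" "word dg (ttop dg T2) = word dg (tbot dg T1)"
 and T12: "T1 \<in> transistors dg" "T2 \<in> transistors dg" using dipole unfolding dipole_def prec_def by auto

lemma T_neq: "T1 ~= T2" using dip(1) acyc unfolding acyclic_def by blast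

lemma no_prec: "(T2, T1) \<notin> prec dg" "(T2, T2) \<notin> prec dg" "(T1, T1) \<notin> prec dg"
 using dip(1) acyc unfolding acyclic_def by (meson trancl.simps)+

lemma disj: "set (tbot dg T1) \<inter> set (ttop dg T2) = {}" "set (tbot dg T2) \<inter> set (ttop dg T2) = {}"
 "set (tbot dg T2) \<inter> set (tbot dg T1) = {}" using no_prec T12 dip(2) unfolding prec_def by auto

lemma len: "length (tbot dg T1) = length (ttop dg T2)" using arg_cong[OF dip(3), of length] by (simp add: word_def)

lemma J_map: "map J (tbot dg T1) = ttop dg T2"
 by (rule nth_equalityI) (use len tops(2)[OF T12(1)] in \<open>auto simp: joined_name_def map_of_zip_nth\<close>)

lemma J_other: "x \<notin> set (tbot dg T1) ==> J x = x"
proof -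
 assume "x \<notin> set (tbot dg T1)"
 then have "map_of (zip (tbot dg T1) (ttop dg T2)) x = None" using len by (simp add: map_of_zip_is_None)
 then show ?thesis by (simp add: joined_name_def)
qed

text \<open>Meant for labels and for charts, both of which agree on wires that get joined.\<close>

lemma J_invariant: "map h (tbot dg T1) = map h (ttop dg T2) ==> h (J x) = h x"
proof (cases "x \<in> set (tbot dg T1)")
 case True
 assume e: "map h (tbot dg T1) = map h (ttop dg T2)"
 obtain i where i: "i < length (tbot dg T1)" "tbot dg T1 ! i = x" using True by (auto simp: in_set_conv_nth)
 have "J x = ttop dg T2 ! i" using arg_cong[OF J_map, of "%l. l ! i"] i by simp
 then show ?thesis using arg_cong[OF e, of "%l. l ! i"] i len by simp
qed (simp add: J_other)

lemma label_J: "label dg (J x) = label dg x" by (rule J_invariant) (use dip(3) in \<open>simp add: word_def\<close>)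

lemma fields: "wires dgr = wires dg - set (tbot dg T2) - set (tbot dg T1)" "label dgr = label dg"
 "transistors dgr = transistors dg - {T1, T2}" "ttop dgr = (%T. map J (ttop dg T))" "tbot dgr = tbot dg"
 "ftop dgr = ftop dg" "fbot dgr = map J (fbot dg)" unfolding reduce_dipole_def dip(2) by simp_all

lemma word_J: "word dgr xs = word dg xs" "word dg (map J xs) = word dg xs" unfolding word_def fields by (simp_all add: label_J)

lemma mset_remove:
 assumes "X + (\<Sum>T\<in>transistors dg. mset (g T)) = mset_set (wires dg)"
  "distinct (g T1)" "distinct (g T2)" "set (g T1) \<inter> set (g T2) = {}" "set (g T1) \<union> set (g T2) \<subseteq> wires dg"
 shows "X + (\<Sum>T\<in>transistors dg - {T1, T2}. mset (g T)) = mset_set (wires dg - set (g T1) - set (g T2))"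
proof -
 have "(\<Sum>T\<in>transistors dg. mset (g T)) = (\<Sum>T\<in>transistors dg - {T1, T2}. mset (g T)) + (\<Sum>T\<in>{T1, T2}. mset (g T))"
  using fin(2) T12 by (subst sum.subset_diff[of "{T1, T2}"]) auto
 also have "(\<Sum>T\<in>{T1, T2}. mset (g T)) = mset_set (set (g T1) \<union> set (g T2))"
  using T_neq assms by (simp add: mset_set_Union mset_set_set)
 finally have e: "(\<Sum>T\<in>transistors dg. mset (g T)) =
  (\<Sum>T\<in>transistors dg - {T1, T2}. mset (g T)) + mset_set (set (g T1) \<union> set (g T2))" .
 have "mset_set (wires dg) = mset_set ((wires dg - set (g T1) - set (g T2)) \<union> (set (g T1) \<union> set (g T2)))"
  by (rule arg_cong[of _ _ mset_set]) (use assms(5) in blast)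
 also have "\<dots> = mset_set (wires dg - set (g T1) - set (g T2)) + mset_set (set (g T1) \<union> set (g T2))"
  using fin(1) by (intro mset_set_Union) auto
 finally show ?thesis using assms(1) e by (simp add: add.assoc[symmetric])
qed

text \<open>The domain consists of the wires whose lower end is attached to neither
  \<open>T1\<close> nor \<open>T2\<close>. These ends survive, and the renaming moves those of the
  wires below \<open>T1\<close> onto the wires above \<open>T2\<close>.\<close>

lemma J_inj: "inj_on J (wires dg - set (tbot dg T2) - set (ttop dg T2))"
 and J_image: "J ` (wires dg - set (tbot dg T2) - set (ttop dg T2)) = wires dg - set (tbot dg T2) - set (tbot dg T1)"
proof -
 let ?Y = "wires dg - set (tbot dg T2) - set (ttop dg T2) - set (tbot dg T1)"
 let ?X = "wires dg - set (tbot dg T2) - set (ttop dg T2)"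
 have X: "?X = ?Y \<union> set (tbot dg T1)" using disj sets_in_wires(4)[OF T12(1)] by blast
 have J1: "J ` set (tbot dg T1) = set (ttop dg T2)" using arg_cong[OF J_map, of set] by simp
 have J2: "J ` ?Y = ?Y" by (simp add: J_other)
 have "inj_on J (set (tbot dg T1))" using J_map bots(2)[OF T12(2)] by (metis distinct_map)
 moreover have "inj_on J ?Y" by (auto simp: inj_on_def J_other)
 moreover have "J ` ?Y \<inter> J ` set (tbot dg T1) = {}" unfolding J1 J2 by blast
 ultimately have "inj_on J (?Y \<union> set (tbot dg T1))" unfolding inj_on_Un by blast
 then show "inj_on J ?X" by (simp only: X[symmetric])
 have "J ` ?X = J ` (?Y \<union> set (tbot dg T1))" by (rule arg_cong[OF X])
 also have "\<dots> = ?Y \<union> set (ttop dg T2)" by (simp only: image_Un J1 J2)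
 also have "\<dots> = wires dg - set (tbot dg T2) - set (tbot dg T1)" using disj sets_in_wires(3)[OF T12(2)] by blast
 finally show "J ` ?X = wires dg - set (tbot dg T2) - set (tbot dg T1)" .
qed

text \<open>A joined wire from \<open>T\<close> down to \<open>S\<close> stands for the chain
  \<open>S\<close>, \<open>T1\<close>, \<open>T2\<close>, \<open>T\<close> in the old diagram;
  acyclicity therefore survives.\<close>

lemma prec_reduced: "prec dgr \<subseteq> (prec dg)\<^sup>+"
proof
 fix p assume "p \<in> prec dgr"
 then obtain S T x where p: "p = (S, T)" "S \<in> transistors dg" "T \<in> transistors dg" "x \<in> set (ttop dg S)" "J x \<in> set (tbot dg T)"
  unfolding prec_def fields by auto
 show "p \<in> (prec dg)\<^sup>+"
 proof (cases "x \<in> set (tbot dg T1)")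
  case True
  then have "J x \<in> set (ttop dg T2)" using arg_cong[OF J_map, of set] by auto
  then have "(T2, T) \<in> prec dg" "(S, T1) \<in> prec dg" using p True T12 unfolding prec_def by auto
  then show ?thesis using dip(1) p(1) by (meson trancl.simps)
 next
  case False
  then have "(S, T) \<in> prec dg" using p J_other unfolding prec_def by auto
  then show ?thesis using p(1) by blast
 qed
qed

lemma reduced_in_ww: "dgr \<in> ww_diagrams A R w"
proof -
 have t: "mset (ftop dg) + (\<Sum>T\<in>transistors dg - {T1, T2}. mset (tbot dg T)) =
  mset_set (wires dg - set (tbot dg T1) - set (tbot dg T2))" using tops T12 T_neq sets_in_wires(4) by (intro mset_remove tops_eq) auto
 have b: "mset (fbot dg) + (\<Sum>T\<in>transistors dg - {T1, T2}. mset (ttop dg T)) =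
  mset_set (wires dg - set (ttop dg T1) - set (ttop dg T2))" using bots T12 T_neq sets_in_wires(3) by (intro mset_remove bots_eq) auto
 have "mset (fbot dgr) + (\<Sum>T\<in>transistors dgr. mset (ttop dgr T)) =
  image_mset J (mset (fbot dg) + (\<Sum>T\<in>transistors dg - {T1, T2}. mset (ttop dg T)))"
  unfolding fields using fin(2) sum_comp_morphism[of "image_mset J" "%T. mset (ttop dg T)"] by (simp add: o_def)
 also have "\<dots> = mset_set (J ` (wires dg - set (tbot dg T2) - set (ttop dg T2)))" unfolding b dip(2) by (rule image_mset_mset_set[OF J_inj])
 finally have b': "mset (fbot dgr) + (\<Sum>T\<in>transistors dgr. mset (ttop dgr T)) = mset_set (wires dgr)" unfolding J_image fields(1) .
 have "((prec dg)\<^sup>+)\<^sup>+ = (prec dg)\<^sup>+" by (simp add: trancl_id trans_trancl)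
 then have "acyclic ((prec dg)\<^sup>+)" using acyc unfolding acyclic_def by simp
 then have ac: "acyclic (prec dgr)" using prec_reduced by (rule acyclic_subset)
 have ne: "wires dgr ~= {}"
 proof -
  have "set (ftop dg) \<subseteq> wires dgr" unfolding fields using sets_in_wires(1) tops(3)[OF T12(1)] tops(3)[OF T12(2)] by auto
  then show ?thesis using nonempty(1) by auto
 qed
 have "braided_diagram A R dgr" unfolding braided_diagram_def
 proof (intro conjI)
  show "finite (wires dgr)" "finite (transistors dgr)" unfolding fields using fin by auto
  show "label dgr ` wires dgr \<subseteq> A" unfolding fields using labels by auto
  show "mset (ftop dgr) + (\<Sum>T\<in>transistors dgr. mset (tbot dgr T)) = mset_set (wires dgr)"
   unfolding fields t by (simp add: Diff_eq Int_assoc Int_left_commute Int_commute)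
  show "\<forall>T\<in>transistors dgr. (word dgr (ttop dgr T), word dgr (tbot dgr T)) \<in> R \<or>
   (word dgr (tbot dgr T), word dgr (ttop dgr T)) \<in> R" using rels by (simp add: fields(3,4,5) word_J)
 qed fact+
 moreover have "top_word dgr = w" "bot_word dgr = w"
  unfolding top_word_def bot_word_def fields(6,7) word_J using tw bw by (simp_all add: word_def)
 ultimately show ?thesis unfolding ww_diagrams_def by simp
qed

sublocale r: ww_diagram A R w dgr using pres w_nonempty reduced_in_ww by unfold_locales

text \<open>The old charting serves unchanged: the two transistors share their chart, so joined
  wires had equal charts already. The word loses two inverse letters. Those between them commute
  with both, because the wires inside the dipole stay live throughout and occupy the whole
  range.\<close>

lemma evals_reduce:
 assumes "evals R dg f u"
 shows "\<exists>v. evals R dgr f v & aeq u v"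
proof -
 obtain c Ts where c: "charting dg c" "linext dg Ts" "f = joinl (map c (fbot dg))" "u = map (dletter R dg c) Ts"
  using assms(1) unfolding evals_def by blast
 have tc12: "tchart dg c T1 = tchart dg c T2" using tchart_tbot[OF c(1) T12(2)] unfolding tchart_def dip(2) .
 have "map c (tbot dg T1) = map c (ttop dg T2)"
  using c(1) T12(1) tc12 len pieces_joinl[of "map c (ttop dg T2)"] unfolding charting_def tchart_def[of _ _ T2] by simp
 then have cJ: "c (J x) = c x" for x by (rule J_invariant)
 then have cJm: "map c (map J xs) = map c xs" for xs by simp
 have tcr: "tchart dgr c T = tchart dg c T" for T unfolding tchart_def fields cJm ..
 have ch: "charting dgr c"  using c(1) unfolding charting_def tcr fields by simp
 have dl: "dletter R dgr c T = dletter R dg c T" for T unfolding dletter_def tcr fields(4,5) word_J ..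
 obtain Us Ms Vs where Ts: "Ts = Us @ T2 # Ms @ T1 # Vs" using linext_trancl[OF c(2)] dip(1) by blast
 have dTs: "distinct Ts" "set Ts = transistors dg" using c(2) unfolding linext_def by auto
 let ?Ts = "Us @ Ms @ Vs"
 have le: "linext dgr ?Ts" unfolding linext_def
 proof (intro conjI)
  show "distinct ?Ts" "set ?Ts = transistors dgr" using dTs unfolding Ts fields by auto
  have "sorted_wrt (%S T. (S, T) \<notin> (prec dg)\<^sup>+) ?Ts" using linext_not_trancl[OF c(2)] unfolding Ts by (simp add: sorted_wrt_append)
  then show "sorted_wrt (%S T. (S, T) \<notin> prec dgr) ?Ts" by (rule sorted_wrt_mono_rel[rotated]) (use prec_reduced in blast)
 qed
 have comm: "(fst (dletter R dg c T2), fst (dletter R dg c M)) \<in> edges R" if "M \<in> set Ms" for M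
 proof -
  obtain Ms1 Ms2 where Ms: "Ms = Ms1 @ M # Ms2" using split_list[OF \<open>M \<in> set Ms\<close>] by blast
  let ?P = "Us @ T2 # Ms1"
  have l: "linext dg (?P @ M # Ms2 @ T1 # Vs)" using c(2) unfolding Ts Ms by simp
  have MT: "M \<in> transistors dg" "M ~= T1" using dTs unfolding Ts Ms by auto
  have P: "X \<in> transistors dg" "X ~= T1" if "X \<in> set ?P" for X using that dTs unfolding Ts Ms by auto
  have n: "set (tbot dg T2) \<inter> set (ttop dg X) = {}" if "X \<in> transistors dg" "X ~= T1" for X
   using bots(4)[OF T12(1) that(1)] that(2) dip(2) by auto
  have "set (tbot dg T2) \<subseteq> seen dg ?P" unfolding seen_def by auto
  moreover have "set (tbot dg T2) \<inter> set (ttop dg X) = {}" if "X \<in> set ?P" for X using n P that by blast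
  ultimately have lv: "set (tbot dg T2) \<subseteq> live dg ?P" unfolding live_def by blast
  have "c x s ~= c y t" if xy: "x \<in> set (tbot dg T2)" "y \<in> set (ttop dg M)" for x y s t
  proof
   assume "c x s = c y t"
   moreover have "x \<in> live dg ?P" "y \<in> live dg ?P" using lv linext_step(4)[OF l] xy by blast+
   ultimately have "x = y" using tilingD[OF charting_tiling[OF c(1) l]] by blast
   then show False using n[OF MT] xy by blast
  qed
  then have "range (tchart dg c T2) \<inter> range (tchart dg c M) = {}"
   unfolding range_tchart[OF MT(1)] range_tchart_tbot[OF c(1) T12(2)] by blast
  then show ?thesis using dletter_comm_iff[OF c(1) T12(2) MT(1)] by blast
 qed
 have inv: "dletter R dg c T1 = inv_letter (dletter R dg c T2)"
  unfolding dletter_def tc12 dip(2) dip(3)[symmetric] by (rule rletter_inv[OF pres rels[OF T12(2)], symmetric])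
 let ?l = "map (dletter R dg c)" and ?a = "dletter R dg c T2"
 have L: "?l xs \<in> lists (vertices R \<times> UNIV)" if "set xs \<subseteq> transistors dg" for xs
  unfolding in_lists_conv_set using that dletter_vertex[OF c(1)] by auto
 have u: "u = ?l Us @ ?a # ?l Ms @ inv_letter ?a # ?l Vs" unfolding c(4) Ts by (simp add: inv)
 have "teq (?a # ?l Ms @ inv_letter ?a # ?l Vs) (?l Ms @ ?a # inv_letter ?a # ?l Vs)" by (rule teq_move) (use comm in auto)
 then have "teq u (?l Us @ ?l Ms @ ?a # inv_letter ?a # ?l Vs)" unfolding u by (intro teq_append teq_refl)
 moreover have LU: "?l Us \<in> lists (vertices R \<times> UNIV)" "?l Ms \<in> lists (vertices R \<times> UNIV)"
  "?l Vs \<in> lists (vertices R \<times> UNIV)" "?a \<in> vertices R \<times> UNIV"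
  using dTs(2) unfolding Ts by (intro L dletter_vertex[OF c(1) T12(2)]; auto)+
 moreover from LU(4) have "inv_letter ?a \<in> vertices R \<times> UNIV" by (auto simp: mem_Times_iff)
 ultimately have "aeq u (?l Us @ ?l Ms @ ?a # inv_letter ?a # ?l Vs)" unfolding u by (intro teq_imp_aeq) simp_all
 moreover have "aeq ((?l Us @ ?l Ms) @ [(fst ?a, snd ?a), (fst ?a, ~ snd ?a)] @ ?l Vs) ((?l Us @ ?l Ms) @ ?l Vs)"
  using LU by (intro presentation_rel.cancel) (auto simp: mem_Times_iff)
 ultimately have "aeq u (?l Us @ ?l Ms @ ?l Vs)" by (auto intro: presentation_rel.trans)
 moreover have "evals R dgr f (?l Us @ ?l Ms @ ?l Vs)" unfolding evals_def
 proof (intro exI conjI)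
  show "f = joinl (map c (fbot dgr))" unfolding c(3) fields cJm ..
  show "?l Us @ ?l Ms @ ?l Vs = map (dletter R dgr c) ?Ts" by (simp add: dl)
 qed fact+
 ultimately show ?thesis by blast
qed

end

context
 fixes A :: "'a set" and R :: "('a list \<times> 'a list) set" and w :: "'a list"
 assumes pres: "semigroup_presentation A R" and wne: "w ~= []"
begin

interpretation raag "vertices R" "edges R" by (rule raag_vertices_edges)

lemma ww_diagramI: "dg \<in> ww_diagrams A R w ==> ww_diagram A R w dg" using pres wne by unfold_locales

lemma ww_pairI: "dg \<in> ww_diagrams A R w ==> dg' \<in> ww_diagrams A R w ==> ww_pair A R w dg dg'"
 unfolding ww_pair_def using ww_diagramI by blast

lemma ww_dipoleI: "dg \<in> ww_diagrams A R w ==> dipole dg T1 T2 ==> ww_dipole A R w dg T1 T2"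
 unfolding ww_dipole_def ww_dipole_axioms_def using ww_diagramI by blast

text \<open>A reduction ends with an isomorphism onto a target about which nothing else is assumed.
  The statement therefore keeps the last diagram before it, which lies in \<open>ww_diagrams\<close>
  and can be evaluated.\<close>

lemma reduces_to_evals:
 assumes "reduces_to dg dg0" "dg \<in> ww_diagrams A R w" "evals R dg f u"
 shows "\<exists>dg1\<in>ww_diagrams A R w. diagram_iso dg1 dg0 & (\<exists>v. evals R dg1 f v & aeq u v)" using assms
proof (induction arbitrary: u)
 case (iso dg dg')
 have "u \<in> lists (vertices R \<times> UNIV)" using ww_diagram.evals_props(3)[OF ww_diagramI] iso by blast
 then have "aeq u u" by (rule presentation_rel.refl)
 then show ?case using iso by blast
next
 case (reduce dg T1 T2 dg')
 interpret d: ww_dipole A R w dg T1 T2 using reduce ww_dipoleI by blast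
 obtain v where v: "evals R d.dgr f v" "aeq u v" using d.evals_reduce[OF reduce.prems(2)] by blast
 obtain dg1 v' where 1: "dg1\<in>ww_diagrams A R w" "diagram_iso dg1 dg'" "evals R dg1 f v'" "aeq v v'"
  using reduce.IH[OF d.reduced_in_ww v(1)] by blast
 then show ?case using presentation_rel.trans[OF v(2) 1(4)] by blast
qed

lemma ex_dipole_free:
 assumes "dg \<in> ww_diagrams A R w" "evals R dg f u"
 shows "\<exists>dg0\<in>ww_diagrams A R w. dipole_free dg0 & (\<exists>v. evals R dg0 f v & aeq u v) &
  (\<forall>X. diagram_iso dg0 X --> reduces_to dg X)" using assms
proof (induction "card (transistors dg)" arbitrary: dg u rule: less_induct)
 case less
 interpret d: ww_diagram A R w dg using less ww_diagramI by blast
 show ?case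
 proof (cases "dipole_free dg")
  case True
  have "aeq u u" using d.evals_props(3)[OF less.prems(2)] by (rule presentation_rel.refl)
  then show ?thesis using True less.prems reduces_to.iso by blast
 next
  case False
  then obtain T1 T2 where dp: "dipole dg T1 T2" unfolding dipole_free_def by blast
  interpret e: ww_dipole A R w dg T1 T2 using less dp ww_dipoleI by blast
  obtain v where v: "evals R e.dgr f v" "aeq u v" using e.evals_reduce[OF less.prems(2)] by blast
  have "card (transistors e.dgr) < card (transistors dg)" unfolding e.fields using e.T12 d.fin(2) by (intro psubset_card_mono) auto
  from less.hyps[OF this e.reduced_in_ww v(1)] obtain dg0 v' where *: "dg0\<in>ww_diagrams A R w" "dipole_free dg0"
   "evals R dg0 f v'" "aeq v v'" "\<forall>X. diagram_iso dg0 X --> reduces_to e.dgr X" by blast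
  have "aeq u v'" using v(2) *(4) by (rule presentation_rel.trans)
  moreover have "\<forall>X. diagram_iso dg0 X --> reduces_to dg X" using *(5) reduces_to.reduce[OF dp] by blast
  ultimately show ?thesis using * by blast
 qed
qed

text \<open>Dipole-free diagrams have reduced words. If these agree in the Artin group they agree up
  to \<open>teq\<close>, so a sweep of one diagram spells the word of the other, and equal
  evaluations give an isomorphism. Uniqueness of the dipole-free form thus comes from normal forms
  in the Artin group rather than from local confluence.\<close>

theorem eq_mod_dipoles_iff:
 assumes "dg \<in> ww_diagrams A R w" "dg' \<in> ww_diagrams A R w" "evals R dg f u" "evals R dg' g v"
 shows "eq_mod_dipoles dg dg' \<longleftrightarrow> f = g & aeq u v"
proof
 assume "eq_mod_dipoles dg dg'"
 then obtain dg0 where "reduces_to dg dg0" "reduces_to dg' dg0" unfolding eq_mod_dipoles_def by blast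
 obtain dg1 u' where 1: "dg1\<in>ww_diagrams A R w" "diagram_iso dg1 dg0" "evals R dg1 f u'" "aeq u u'"
  using reduces_to_evals[OF \<open>reduces_to dg dg0\<close> assms(1,3)] by blast
 obtain dg2 v' where 2: "dg2\<in>ww_diagrams A R w" "diagram_iso dg2 dg0" "evals R dg2 g v'" "aeq v v'"
  using reduces_to_evals[OF \<open>reduces_to dg' dg0\<close> assms(2,4)] by blast
 interpret p: ww_pair A R w dg1 dg2 using 1(1) 2(1) by (rule ww_pairI)
 have "diagram_iso dg1 dg2" using diagram_iso_trans[OF 1(2) p.D'.diagram_iso_sym[OF 2(2)]] .
 then have "evals R dg1 g v'" using 2(3) by (rule p.evals_iso)
 from p.D.evals_unique[OF 1(3) this] have "f = g" "teq u' v'" by auto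
 moreover have "aeq u' v'" using \<open>teq u' v'\<close> p.D.evals_props(3)[OF 1(3)] p.D'.evals_props(3)[OF 2(3)] by (rule teq_imp_aeq)
 ultimately show "f = g & aeq u v" using 1(4) 2(4) presentation_rel.trans presentation_rel.sym by blast
next
 assume fg: "f = g & aeq u v"
 obtain dg1 u' where 1: "dg1\<in>ww_diagrams A R w" "dipole_free dg1" "evals R dg1 f u'" "aeq u u'"
  "\<forall>X. diagram_iso dg1 X --> reduces_to dg X" using ex_dipole_free[OF assms(1,3)] by blast
 obtain dg2 v' where 2: "dg2\<in>ww_diagrams A R w" "dipole_free dg2" "evals R dg2 g v'" "aeq v v'"
  "\<forall>X. diagram_iso dg2 X --> reduces_to dg' X" using ex_dipole_free[OF assms(2,4)] by blast
 interpret p: ww_pair A R w dg2 dg1 using 2(1) 1(1) by (rule ww_pairI)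
 have "reduced u'" "reduced v'" using p.D'.dipole_free_reduced[OF 1(3,2)] p.D.dipole_free_reduced[OF 2(3,2)] .
 moreover have "aeq v' u'" using 1(4) 2(4) fg presentation_rel.trans presentation_rel.sym by blast
 ultimately have "teq v' u'" using reduced_aeq_imp_teq by blast
 then have "evals R dg1 g v'" using p.D'.evals_teq[OF 1(3)] fg by blast
 then have "diagram_iso dg2 dg1" using p.iso_if_evals_eq[OF 2(3)] by blast
 then have "reduces_to dg' dg1" using 2(5) by blast
 moreover have "reduces_to dg dg1" using 1(5) diagram_iso_refl by blast
 ultimately show "eq_mod_dipoles dg dg'" unfolding eq_mod_dipoles_def using 1(2) by blast
qed

end

section \<open>Concatenation and inversion\<close>

lemma presentation_rel_map:
 assumes "(u, v) \<in> presentation_rel X L" "!!x. x \<in> X ==> h x \<in> X'" "!!l. l \<in> L ==> map (apfst h) l \<in> L'"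
 shows "(map (apfst h) u, map (apfst h) v) \<in> presentation_rel X' L'" using assms(1)
proof (induction rule: presentation_rel.induct)
 case (refl u)
 then show ?case using assms(2) by (intro presentation_rel.refl) (auto simp: in_lists_conv_set)
next
 case (sym u v)
 then show ?case by (blast intro: presentation_rel.sym)
next
 case (trans u v z)
 then show ?case by (blast intro: presentation_rel.trans)
next
 case (cancel u v x b)
 let ?m = "map (apfst h)"
 have "(?m u @ [(h x, b), (h x, ~ b)] @ ?m v, ?m u @ ?m v) \<in> presentation_rel X' L'"
  using cancel assms(2) by (intro presentation_rel.cancel) (auto simp: in_lists_conv_set)
 then show ?case by simp
next
 case (relator u v l)
 let ?m = "map (apfst h)"
 have "(?m u @ ?m l @ ?m v, ?m u @ ?m v) \<in> presentation_rel X' L'"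
  using relator assms(2,3) by (intro presentation_rel.relator) (auto simp: in_lists_conv_set)
 then show ?case by simp
qed

text \<open>Post-composition moves the chart of a vertex and keeps its relation. The choice operator
  decodes the vertex, unambiguously because \<open>vcode\<close> is injective on charts.\<close>

definition vact :: "(ivl => ivl) => 'a diagram => 'a diagram" where
 "vact f x = (SOME y. \<exists>u v m. x = vcode u v m & chart m & y = vcode u v (f \<circ> m))"

abbreviation act :: "(ivl => ivl) => ('a diagram \<times> bool) list => ('a diagram \<times> bool) list" where
 "act f \<equiv> map (apfst (vact f))"

lemma vact_vcode: "chart m ==> vact f (vcode u v m) = vcode u v (f \<circ> m)"
 unfolding vact_def by (rule someI2[of _ "vcode u v (f \<circ> m)"]) (auto simp: vcode_eq_iff comp_def)

lemma vact_vertices: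
 assumes "chart f" "x \<in> vertices R"
 shows "vact f x \<in> vertices R"
proof -
 obtain u v m where "x = vcode u v m" "(u, v) \<in> R" "chart m" using assms(2) unfolding vertices_def by blast
 then show ?thesis unfolding vertices_def mem_Collect_eq using assms(1) vact_vcode chart_comp by metis
qed

lemma act_rletter: "chart m ==> apfst (vact f) (rletter R u v m) = rletter R u v (f \<circ> m)" unfolding rletter_def by (simp add: vact_vcode)

lemma act_comp:
 assumes "chart g" "u \<in> lists (vertices R \<times> UNIV)"
 shows "act f (act g u) = act (f \<circ> g) u"
proof -
 have "vact f (vact g x) = vact (f \<circ> g) x" if "x \<in> vertices R" for x
  using that assms(1) unfolding vertices_def by (auto simp: vact_vcode chart_comp comp_assoc)
 then show ?thesis using assms(2) by (auto simp: in_lists_conv_set)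
qed

lemma act_id:
 assumes "u \<in> lists (vertices R \<times> UNIV)"
 shows "act id u = u"
proof -
 have "vact id x = x" if "x \<in> vertices R" for x using that unfolding vertices_def by (auto simp: vact_vcode)
 then show ?thesis using assms by (intro map_idI) (auto simp: in_lists_conv_set)
qed

text \<open>An injective map preserves disjointness of ranges, hence edges of the graph, hence
  relators.\<close>

lemma act_aeq:
 assumes "chart f" "inj f" "(u, v) \<in> presentation_rel (vertices R) (commutators (edges R))"
 shows "(act f u, act f v) \<in> presentation_rel (vertices R) (commutators (edges R))" using assms(3)
proof (rule presentation_rel_map)
 show "vact f x \<in> vertices R" if "x \<in> vertices R" for x using assms(1) that by (rule vact_vertices)
 fix l assume "l \<in> commutators (edges R)"
 then obtain x y where xy: "(x, y) \<in> edges R" "l = [(x, True), (y, True), (x, False), (y, False)]" unfolding commutators_def by auto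
 have "(vact f x, vact f y) \<in> edges R" using xy(1)
 proof (rule edgesE)
  fix u v m u' v' m'
  assume *: "x = vcode u v m" "y = vcode u' v' m'" "(u, v) \<in> R" "(u', v') \<in> R"
   "chart m" "chart m'" "range m \<inter> range m' = {}"
  have "range (f \<circ> m) \<inter> range (f \<circ> m') = {}" using *(7) assms(2) by (auto dest: injD)
  then show ?thesis using * assms(1) by (auto simp: vact_vcode intro!: edgesI chart_comp)
 qed
 then show "act f l \<in> commutators (edges R)" unfolding commutators_def xy(2) by auto
qed

context
 fixes A :: "'a set" and R :: "('a list \<times> 'a list) set" and w :: "'a list"
 assumes wA: "w \<in> lists A" and wne: "w ~= []"
begin

lemma id_in_ww: "id_diagram w \<in> ww_diagrams A R w"
proof -
 have "mset [0..<length w] = mset_set {..<length w}" by (metis mset_set_set distinct_upt atLeast_upt)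
 moreover have "label (id_diagram w) ` {..<length w} \<subseteq> A" using wA by (auto simp: id_diagram_def in_lists_conv_set)
 ultimately have "braided_diagram A R (id_diagram w)" unfolding braided_diagram_def using wne by (auto simp: id_diagram_def prec_def acyclic_def)
 then show ?thesis unfolding ww_diagrams_def top_word_def bot_word_def word_def id_diagram_def by (auto intro: nth_equalityI)
qed

lemma id_evals: "evals R (id_diagram w) id []" unfolding evals_def
proof (intro exI conjI)
 let ?c = "%i. pieces (length w) id ! i"
 have m: "map ?c [0..<length w] = pieces (length w) (id :: ivl => ivl)" by (intro nth_equalityI) auto
 show "charting (id_diagram w) ?c" using m unfolding charting_def id_diagram_def by simp
 show "linext (id_diagram w) []" unfolding linext_def id_diagram_def by simp
 show "id = joinl (map ?c (fbot (id_diagram w)))" using m wne by (simp add: id_diagram_def joinl_pieces)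
qed simp

end

section \<open>Turning a diagram upside down\<close>

definition flip :: "'a diagram => 'a diagram" where
 "flip dg = dg\<lparr>ttop := tbot dg, tbot := ttop dg, ftop := fbot dg, fbot := ftop dg\<rparr>"

context ww_diagram
begin

lemma flip_fields: "wires (flip dg) = wires dg" "label (flip dg) = label dg" "transistors (flip dg) = transistors dg"
 "ttop (flip dg) = tbot dg" "tbot (flip dg) = ttop dg" "ftop (flip dg) = fbot dg" "fbot (flip dg) = ftop dg"
 "word (flip dg) = word dg" unfolding flip_def word_def by (auto simp: fun_eq_iff)

lemma prec_flip: "prec (flip dg) = (prec dg)\<inverse>" unfolding prec_def flip_fields by auto

lemma flip_in_ww: "flip dg \<in> ww_diagrams A R w"
proof -
 have "braided_diagram A R (flip dg)" using bd unfolding braided_diagram_def prec_flip flip_fields by auto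
 then show ?thesis using tw bw unfolding ww_diagrams_def top_word_def bot_word_def by (simp add: word_def flip_fields)
qed

text \<open>Composing all charts with the inverse of the frame map makes the former bottom side
  carry the standard pieces, as the top side of the flipped diagram must.\<close>

lemma flip_charting:
 assumes c: "charting dg c" and fc: "f = joinl (map c (fbot dg))"
 shows "\<exists>d. charting (flip dg) d & (\<forall>T\<in>transistors dg. tchart (flip dg) d T = inv_into UNIV f \<circ> tchart dg c T) &
  inv_into UNIV f = joinl (map d (fbot (flip dg)))"
proof -
 let ?g = "inv_into UNIV f"
 have f: "bij f" using frame_chart(2)[OF c] fc by simp
 then have gf: "?g \<circ> f = id" by (simp add: bij_is_inj)
 define d where "d x = ?g \<circ> c x" for x
 have md: "map d xs = map ((\<circ>) ?g) (map c xs)" for xs unfolding d_def by simp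
 have tc: "tchart (flip dg) d T = ?g \<circ> tchart dg c T" if "T \<in> transistors dg" for T
 proof -
  have "tchart (flip dg) d T = ?g \<circ> joinl (map c (tbot dg T))"
   unfolding tchart_def flip_fields md using nonempty(3)[OF that] by (intro joinl_comp) simp
  then show ?thesis using tchart_tbot[OF c that] by simp
 qed
 have "map d (fbot dg) = map ((\<circ>) ?g) (pieces (length (fbot dg)) f)" unfolding md fc using pieces_joinl[of "map c (fbot dg)"] by simp
 then have b: "map d (fbot dg) = pieces (length (fbot dg)) id" by (simp only: pieces_comp[symmetric] gf)
 have ch: "charting (flip dg) d" unfolding charting_def flip_fields
 proof (intro conjI ballI b)
  fix T assume T: "T \<in> transistors dg"
  have "map d (ttop dg T) = map ((\<circ>) ?g) (pieces (length (ttop dg T)) (tchart dg c T))"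
   unfolding md tchart_def using pieces_joinl[of "map c (ttop dg T)"] by simp
  then show "map d (ttop dg T) = pieces (length (ttop dg T)) (tchart (flip dg) d T)" by (simp only: pieces_comp[symmetric] tc[OF T])
 qed
 have t: "joinl (map c (ftop dg)) = id" using c nonempty(1) unfolding charting_def by (simp add: joinl_pieces)
 have "joinl (map d (ftop dg)) = ?g \<circ> joinl (map c (ftop dg))" unfolding md using nonempty(1) by (intro joinl_comp) simp
 then have fr: "?g = joinl (map d (fbot (flip dg)))" unfolding flip_fields t by simp
 then show ?thesis using ch tc by blast
qed

text \<open>Inversion in a semidirect product: the word is inverted and then moved by the inverse of
  the frame map, because charts are now measured from the former bottom side.\<close>

lemma flip_evals:
 assumes "evals R dg f u"
 shows "evals R (flip dg) (inv_into UNIV f) (act (inv_into UNIV f) (rev (map inv_letter u)))"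
proof -
 obtain c Ts where c: "charting dg c" "linext dg Ts" "f = joinl (map c (fbot dg))" "u = map (dletter R dg c) Ts"
  using assms unfolding evals_def by blast
 let ?g = "inv_into UNIV f"
 obtain d where ch: "charting (flip dg) d" and tc: "!!T. T \<in> transistors dg ==> tchart (flip dg) d T = ?g \<circ> tchart dg c T"
  and fr: "?g = joinl (map d (fbot (flip dg)))" using flip_charting[OF c(1,3)] by blast
 have le: "linext (flip dg) (rev Ts)" using c(2) unfolding linext_def prec_flip flip_fields by (simp add: sorted_wrt_rev)
 have "dletter R (flip dg) d T = apfst (vact ?g) (inv_letter (dletter R dg c T))" if T: "T \<in> transistors dg" for T
  unfolding dletter_def flip_fields rletter_inv[OF pres rels[OF T]] tc[OF T] by (rule act_rletter[OF charting_chart(2)[OF c(1) T], symmetric])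
 then have "act ?g (rev (map inv_letter u)) = map (dletter R (flip dg) d) (rev Ts)" unfolding c(4) using c(2) by (simp add: rev_map linext_def)
 then show ?thesis unfolding evals_def using ch le fr by blast
qed

text \<open>Counts the transistors above a given one; a numerical witness of acyclicity that can be
  combined for two diagrams.\<close>

lemma ex_rank: "\<exists>rk :: nat => nat. (\<forall>S T. (S, T) \<in> prec dg --> rk T < rk S)"
proof -
 define rk where "rk T = card {S. (T, S) \<in> (prec dg)\<^sup>+}" for T
 have "rk T < rk S" if "(S, T) \<in> prec dg" for S T unfolding rk_def
 proof (rule psubset_card_mono)
  have "{X. (S, X) \<in> (prec dg)\<^sup>+} \<subseteq> transistors dg"
   using trancl_subset_Sigma[of "prec dg" "transistors dg"] unfolding prec_def by auto
  then show "finite {X. (S, X) \<in> (prec dg)\<^sup>+}" using fin(2) finite_subset by blast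
  have "T \<notin> {X. (T, X) \<in> (prec dg)\<^sup>+}" using acyc unfolding acyclic_def by blast
  then show "{X. (T, X) \<in> (prec dg)\<^sup>+} \<subset> {X. (S, X) \<in> (prec dg)\<^sup>+}" using that by (auto intro: trancl_into_trancl2)
 qed
 then show ?thesis by blast
qed

end

section \<open>Concatenation of diagrams\<close>

context ww_pair
begin

abbreviation "dgc \<equiv> concat_diagram dg dg'"
abbreviation "gl \<equiv> glued_name dg dg'"
abbreviation "ev \<equiv> (%x::nat. 2 * x)"
abbreviation "od \<equiv> (%x::nat. 2 * x + 1)"

lemma glen: "length (ftop dg') = length (fbot dg)" using D.length_frame D'.length_frame by simp

lemma gl_map: "map gl (ftop dg') = map ev (fbot dg)"
 by (rule nth_equalityI) (use glen D'.tops(1) in \<open>auto simp: glued_name_def map_of_zip_nth\<close>)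

lemma gl_nth: "i < length (fbot dg) ==> gl (ftop dg' ! i) = 2 * (fbot dg ! i)" using arg_cong[OF gl_map, of "%l. l ! i"] glen by simp

lemma gl_other: "x \<notin> set (ftop dg') ==> gl x = od x"
proof -
 assume "x \<notin> set (ftop dg')"
 then have "map_of (zip (ftop dg') (fbot dg)) x = None" using glen by (simp add: map_of_zip_is_None)
 then show ?thesis by (simp add: glued_name_def)
qed

lemma gl_cases:
 obtains i where "i < length (fbot dg)" "x = ftop dg' ! i" "gl x = 2 * (fbot dg ! i)"
 | "x \<notin> set (ftop dg')" "gl x = od x"
proof (cases "x \<in> set (ftop dg')")
 case True
 then obtain i where "i < length (fbot dg)" "x = ftop dg' ! i" using glen by (auto simp: in_set_conv_nth)
 then show ?thesis using that(1) gl_nth by blast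
qed (use that(2) gl_other in blast)

lemma gl_inj: "inj_on gl (wires dg')"
proof (rule inj_onI)
 fix x y assume e: "gl x = gl y"
 show "x = y"
 proof (cases rule: gl_cases[of x]; cases rule: gl_cases[of y])
  fix i j assume *: "i < length (fbot dg)" "x = ftop dg' ! i" "gl x = 2 * (fbot dg ! i)"
   "j < length (fbot dg)" "y = ftop dg' ! j" "gl y = 2 * (fbot dg ! j)"
  then have "fbot dg ! i = fbot dg ! j" using e by simp
  then show ?thesis using * nth_eq_iff_index_eq[OF D.bots(1)] by simp
 next
  fix i assume "gl x = 2 * (fbot dg ! i)" "gl y = od y"
  then show ?thesis using e by presburger
 next
  fix i assume "gl x = od x" "gl y = 2 * (fbot dg ! i)"
  then show ?thesis using e by presburger
 next
  assume "gl x = od x" "gl y = od y"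
  then show ?thesis using e by presburger
 qed
qed

lemma cfields: "wires dgc = ev ` wires dg \<union> gl ` wires dg'"
 "label dgc = (%n. if even n then label dg (n div 2) else label dg' (n div 2))"
 "transistors dgc = ev ` transistors dg \<union> od ` transistors dg'"
 "ttop dgc (2 * T) = map ev (ttop dg T)" "ttop dgc (2 * T + 1) = map gl (ttop dg' T)"
 "tbot dgc (2 * T) = map ev (tbot dg T)" "tbot dgc (2 * T + 1) = map gl (tbot dg' T)"
 "ftop dgc = map ev (ftop dg)" "fbot dgc = map gl (fbot dg')" unfolding concat_diagram_def by simp_all

lemma gl_image: "gl ` wires dg' = ev ` set (fbot dg) \<union> od ` (wires dg' - set (ftop dg'))"
proof -
 have "wires dg' = set (ftop dg') \<union> (wires dg' - set (ftop dg'))" using D'.sets_in_wires(1) by blast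
 then have "gl ` wires dg' = gl ` set (ftop dg') \<union> gl ` (wires dg' - set (ftop dg'))" by (metis image_Un)
 also have "gl ` set (ftop dg') = ev ` set (fbot dg)" using arg_cong[OF gl_map, of set] by simp
 also have "gl ` (wires dg' - set (ftop dg')) = od ` (wires dg' - set (ftop dg'))" by (intro image_cong HOL.refl) (auto simp: gl_other)
 finally show ?thesis .
qed

lemma label_ev: "label dgc (2 * x) = label dg x" and label_gl: "label dgc (gl x) = label dg' x"
proof -
 show "label dgc (2 * x) = label dg x" unfolding cfields by simp
 show "label dgc (gl x) = label dg' x"
 proof (cases rule: gl_cases[of x])
  case (1 i)
  have "label dg (fbot dg ! i) = w ! i" "label dg' (ftop dg' ! i) = w ! i" using D.bw D'.tw 1(1) glen by (metis nth_map)+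
  then show ?thesis using 1 unfolding cfields by simp
 qed (simp add: cfields)
qed

lemma cword: "word dgc (map ev xs) = word dg xs" "word dgc (map gl xs) = word dg' xs" unfolding word_def by (simp_all add: label_ev label_gl)

lemma sum_split: "(\<Sum>T\<in>transistors dgc. h T) = (\<Sum>T\<in>transistors dg. h (2 * T)) + (\<Sum>T\<in>transistors dg'. h (2 * T + 1))"
 for h :: "nat => nat multiset"
proof -
 have "ev ` transistors dg \<inter> od ` transistors dg' = {}" by (auto, presburger)
 then have "(\<Sum>T\<in>transistors dgc. h T) = (\<Sum>T\<in>ev ` transistors dg. h T) + (\<Sum>T\<in>od ` transistors dg'. h T)"
  unfolding cfields using D.fin D'.fin by (intro sum.union_disjoint) auto
 also have "(\<Sum>T\<in>ev ` transistors dg. h T) = (\<Sum>T\<in>transistors dg. h (2 * T))"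
  by (subst sum.reindex) (auto simp: inj_on_def o_def)
 also have "(\<Sum>T\<in>od ` transistors dg'. h T) = (\<Sum>T\<in>transistors dg'. h (2 * T + 1))"
  by (subst sum.reindex) (auto simp: inj_on_def o_def)
 finally show ?thesis .
qed

lemma prec_concat:
 "(2 * S, 2 * T) \<in> prec dgc ==> (S, T) \<in> prec dg"
 "(2 * S + 1, 2 * T + 1) \<in> prec dgc ==> (S, T) \<in> prec dg'"
 "(2 * S, 2 * T + 1) \<notin> prec dgc"
proof -
 have odd_tr: "2 * T + 1 \<in> transistors dgc ==> T \<in> transistors dg'"
  and even_tr: "2 * T \<in> transistors dgc ==> T \<in> transistors dg" for T unfolding cfields by (auto, presburger+)
 assume "(2 * S, 2 * T) \<in> prec dgc"
 then show "(S, T) \<in> prec dg" using even_tr unfolding prec_def by (auto simp: cfields(4,6))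
next
 have odd_tr: "2 * T + 1 \<in> transistors dgc ==> T \<in> transistors dg'" for T unfolding cfields by (auto, presburger+)
 assume p: "(2 * S + 1, 2 * T + 1) \<in> prec dgc"
 then have ST: "S \<in> transistors dg'" "T \<in> transistors dg'" using odd_tr unfolding prec_def by auto
 obtain x y where xy: "x \<in> set (ttop dg' S)" "y \<in> set (tbot dg' T)" "gl x = gl y"
  using p unfolding prec_def cfields(5,7)[symmetric] by (auto simp: cfields(5,7) simp del: One_nat_def)
 then have "x = y" using gl_inj D'.sets_in_wires(3)[OF ST(1)] D'.sets_in_wires(4)[OF ST(2)] by (meson inj_onD subsetD)
 then show "(S, T) \<in> prec dg'" using xy ST unfolding prec_def by auto
next
 have odd_tr: "2 * T + 1 \<in> transistors dgc ==> T \<in> transistors dg'" for T unfolding cfields by (auto, presburger+)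
 show "(2 * S, 2 * T + 1) \<notin> prec dgc"
 proof
  assume p: "(2 * S, 2 * T + 1) \<in> prec dgc"
  then have T: "T \<in> transistors dg'" using odd_tr unfolding prec_def by auto
  have "set (ttop dgc (2 * S)) \<inter> set (tbot dgc (2 * T + 1)) ~= {}" using p unfolding prec_def by simp
  then obtain x y where xy: "y \<in> set (tbot dg' T)" "2 * x = gl y" unfolding cfields by auto
  have "y \<notin> set (ftop dg')" using D'.tops(3)[OF T] xy by blast
  then show False using gl_other xy(2) by presburger
 qed
qed

lemma concat_in_ww: "dgc \<in> ww_diagrams A R w"
proof -
 have ie: "inj_on ev X" and io: "inj_on od X" for X by (auto simp: inj_on_def)
 have im: "(\<Sum>T\<in>X. mset (map h (g T))) = image_mset h (\<Sum>T\<in>X. mset (g T))" for h :: "nat => nat" and g and X :: "nat set"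
  using sum_comp_morphism[of "image_mset h" "%T. mset (g T)" X] by (simp add: o_def)
 have cancel: "(\<Sum>T\<in>X. mset (g T)) = mset_set (W - set xs)"
  if "mset xs + (\<Sum>T\<in>X. mset (g T)) = mset_set W" "distinct xs" "set xs \<subseteq> W" "finite W" for xs g and X W :: "nat set"
 proof -
  have "mset_set W = mset_set (set xs \<union> (W - set xs))" using that(3) by (simp add: Un_absorb1)
  also have "\<dots> = mset xs + mset_set (W - set xs)" using that by (subst mset_set_Union) (auto simp: mset_set_set)
  finally show ?thesis using that(1) by simp
 qed
 have t: "mset (ftop dgc) + (\<Sum>T\<in>transistors dgc. mset (tbot dgc T)) = mset_set (wires dgc)"
 proof -
  have "mset (ftop dgc) + (\<Sum>T\<in>transistors dgc. mset (tbot dgc T)) =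
   image_mset ev (mset (ftop dg) + (\<Sum>T\<in>transistors dg. mset (tbot dg T))) + image_mset gl (\<Sum>T\<in>transistors dg'. mset (tbot dg' T))"
   unfolding sum_split unfolding cfields im by simp
  also have "\<dots> = mset_set (ev ` wires dg) + image_mset gl (mset_set (wires dg' - set (ftop dg')))"
   unfolding D.tops_eq cancel[OF D'.tops_eq D'.tops(1) D'.sets_in_wires(1) D'.fin(1)] by (simp only: image_mset_mset_set[OF ie])
  also have "image_mset gl (mset_set (wires dg' - set (ftop dg'))) = mset_set (gl ` (wires dg' - set (ftop dg')))"
   by (rule image_mset_mset_set) (rule inj_on_subset[OF gl_inj], blast)
  also have "gl ` (wires dg' - set (ftop dg')) = od ` (wires dg' - set (ftop dg'))" by (intro image_cong HOL.refl) (auto simp: gl_other)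
  also have "mset_set (ev ` wires dg) + mset_set (od ` (wires dg' - set (ftop dg'))) =
   mset_set (ev ` wires dg \<union> od ` (wires dg' - set (ftop dg')))"
   using D.fin D'.fin by (intro mset_set_Union[symmetric]) (auto, presburger)
  also have "ev ` wires dg \<union> od ` (wires dg' - set (ftop dg')) = wires dgc" unfolding cfields gl_image using D.sets_in_wires(2) by blast
  finally show ?thesis .
 qed
 have b: "mset (fbot dgc) + (\<Sum>T\<in>transistors dgc. mset (ttop dgc T)) = mset_set (wires dgc)"
 proof -
  have "mset (fbot dgc) + (\<Sum>T\<in>transistors dgc. mset (ttop dgc T)) =
   image_mset ev (\<Sum>T\<in>transistors dg. mset (ttop dg T)) + image_mset gl (mset (fbot dg') + (\<Sum>T\<in>transistors dg'. mset (ttop dg' T)))"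
   unfolding sum_split unfolding cfields im by simp
  also have "\<dots> = mset_set (ev ` (wires dg - set (fbot dg))) + mset_set (gl ` wires dg')"
   unfolding D'.bots_eq cancel[OF D.bots_eq D.bots(1) D.sets_in_wires(2) D.fin(1)]
   by (simp only: image_mset_mset_set[OF ie] image_mset_mset_set[OF gl_inj])
  also have "\<dots> = mset_set (ev ` (wires dg - set (fbot dg)) \<union> gl ` wires dg')"
   unfolding gl_image using D.fin D'.fin by (intro mset_set_Union[symmetric]) (auto, presburger)
  also have "ev ` (wires dg - set (fbot dg)) \<union> gl ` wires dg' = wires dgc" unfolding cfields gl_image by blast
  finally show ?thesis .
 qed
 obtain rk where rk: "!!S T. (S, T) \<in> prec dg ==> rk T < (rk S :: nat)" using D.ex_rank by blast
 obtain rk' where rk': "!!S T. (S, T) \<in> prec dg' ==> rk' T < (rk' S :: nat)" using D'.ex_rank by blast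
 \<comment> \<open>Larger than every rank in the upper diagram, so that the transistors of the lower
   diagram outrank all of them.\<close>
 define N where "N = Suc (\<Sum>T\<in>transistors dg. rk T)"
 define rc where "rc n = (if even n then rk (n div 2) else N + rk' (n div 2))" for n
 have "rc T < rc S" if p: "(S, T) \<in> prec dgc" for S T
 proof -
  have tr: "S \<in> transistors dgc" "T \<in> transistors dgc" using p unfolding prec_def by auto
  have ltN: "rk X < N" if "X \<in> transistors dg" for X unfolding N_def using D.fin(2) that by (simp add: less_Suc_eq_le member_le_sum)
  consider S' where "S = 2 * S'" "S' \<in> transistors dg" | S' where "S = 2 * S' + 1" "S' \<in> transistors dg'"
   using tr(1) unfolding cfields by blast
  then show ?thesis
  proof cases
   case 1
   consider T' where "T = 2 * T'" | T' where "T = 2 * T' + 1" using tr(2) unfolding cfields by blast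
   then show ?thesis by cases (use 1 p rk prec_concat in \<open>auto simp: rc_def\<close>)
  next
   case 2
   consider T' where "T = 2 * T'" "T' \<in> transistors dg" | T' where "T = 2 * T' + 1" using tr(2) unfolding cfields by blast
   then show ?thesis
   proof cases
    case 1
    then show ?thesis using 2 ltN[of T'] by (simp add: rc_def)
   next
    case (2 T')
    then have "(S', T') \<in> prec dg'" using p \<open>S = 2 * S' + 1\<close> prec_concat(2) by blast
    then show ?thesis using 2 \<open>S = 2 * S' + 1\<close> rk' by (simp add: rc_def)
   qed
  qed
 qed
 then have ac: "acyclic (prec dgc)" by (rule acyclicI_order)
 have rl: "(word dgc (ttop dgc T), word dgc (tbot dgc T)) \<in> R | (word dgc (tbot dgc T), word dgc (ttop dgc T)) \<in> R"
  if T: "T \<in> transistors dgc" for T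
 proof -
  consider S where "T = 2 * S" "S \<in> transistors dg" | S where "T = 2 * S + 1" "S \<in> transistors dg'" using T unfolding cfields by blast
  then show ?thesis
  proof cases
   case 1
   show ?thesis using D.rels[OF 1(2)] unfolding 1 cfields cword .
  next
   case 2
   show ?thesis using D'.rels[OF 2(2)] unfolding 2 cfields cword .
  qed
 qed
 have "label dgc ` wires dgc \<subseteq> A" unfolding cfields(1) using D.labels D'.labels label_ev label_gl by auto
 moreover have "wires dgc ~= {}" "finite (wires dgc)" "finite (transistors dgc)"
  unfolding cfields using D.fin D'.fin D.nonempty(1) D.sets_in_wires(1) by auto
 ultimately have "braided_diagram A R dgc" unfolding braided_diagram_def using t b ac rl by blast
 moreover have "top_word dgc = w" "bot_word dgc = w"
  unfolding top_word_def bot_word_def cfields cword using D.tw D'.bw by (simp_all add: word_def)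
 ultimately show ?thesis unfolding ww_diagrams_def by blast
qed

text \<open>Charts of the lower diagram are seen through the frame map \<open>f\<close> of the upper
  one. On glued wires both prescriptions agree, since these wires carry the pieces of
  \<open>f\<close>.\<close>

definition concat_chart :: "(nat => ivl => 'b) => (ivl => 'b) => (nat => ivl => ivl) => nat => ivl => 'b" where
 "concat_chart c f d n = (if even n then c (n div 2) else f \<circ> d (n div 2))"

lemma concat_charting:
 assumes c: "charting dg c" and f: "f = joinl (map c (fbot dg))" and d: "charting dg' d"
 defines "e \<equiv> concat_chart c f d"
 shows "charting dgc e" "e (2 * x) = c x" "e (gl x) = f \<circ> d x"
  "tchart dgc e (2 * T) = tchart dg c T"
  "T \<in> transistors dg' ==> tchart dgc e (2 * T + 1) = f \<circ> tchart dg' d T"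
proof -
 show ev: "e (2 * x) = c x" for x unfolding e_def concat_chart_def by simp
 show gl: "e (gl x) = f \<circ> d x" for x
 proof (cases rule: gl_cases[of x])
  case (1 i)
  have "d (ftop dg' ! i) = pieces (length (ftop dg')) id ! i" using d 1(1) glen unfolding charting_def by (metis nth_map)
  moreover have "c (fbot dg ! i) = pieces (length (fbot dg)) f ! i" using pieces_joinl[of "map c (fbot dg)"] f 1(1) by (metis length_map nth_map)
  ultimately show ?thesis using 1 glen ev pieces_comp[of "length (fbot dg)" f id] by simp
 qed (simp add: e_def concat_chart_def)
 have me: "map e (map ev xs) = map c xs" "map e (map gl xs) = map ((\<circ>) f) (map d xs)" for xs using ev gl by simp_all
 show t1: "tchart dgc e (2 * T) = tchart dg c T" for T unfolding tchart_def cfields me ..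
 show t2: "tchart dgc e (2 * T + 1) = f \<circ> tchart dg' d T" if "T \<in> transistors dg'" for T
  unfolding tchart_def cfields me using D'.nonempty(3)[OF that] by (intro joinl_comp) simp
 show "charting dgc e" unfolding charting_def
 proof (intro conjI ballI)
  show "map e (ftop dgc) = pieces (length (ftop dgc)) id" using c unfolding cfields me charting_def by simp
  fix T assume "T \<in> transistors dgc"
  then consider S where "T = 2 * S" "S \<in> transistors dg" | S where "T = 2 * S + 1" "S \<in> transistors dg'" unfolding cfields by blast
  then show "map e (tbot dgc T) = pieces (length (tbot dgc T)) (tchart dgc e T)"
  proof cases
   case 1
   show ?thesis using c 1(2) unfolding 1(1) t1 cfields me charting_def by simp
  next
   case 2
   have "map d (tbot dg' S) = pieces (length (tbot dg' S)) (tchart dg' d S)" using d 2(2) unfolding charting_def by blast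
   then show ?thesis unfolding 2(1) t2[OF 2(2)] cfields me by (simp only: pieces_comp length_map)
  qed
 qed
qed

text \<open>Multiplication in a semidirect product. Sweeping the upper diagram and then the lower
  one sweeps the concatenation, because no upper transistor lies below a lower one.\<close>

lemma concat_evals:
 assumes "evals R dg f u" "evals R dg' g v"
 shows "evals R dgc (f \<circ> g) (u @ act f v)"
proof -
 obtain c Ts where c: "charting dg c" "linext dg Ts" "f = joinl (map c (fbot dg))" "u = map (dletter R dg c) Ts"
  using assms(1) unfolding evals_def by blast
 obtain d Us where d: "charting dg' d" "linext dg' Us" "g = joinl (map d (fbot dg'))" "v = map (dletter R dg' d) Us"
  using assms(2) unfolding evals_def by blast
 define e where "e = concat_chart c f d"
 note e = concat_charting[OF c(1,3) d(1), folded e_def]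
 have "map e (fbot dgc) = map ((\<circ>) f) (map d (fbot dg'))" unfolding cfields using e(3) by simp
 then have 1: "f \<circ> g = joinl (map e (fbot dgc))" unfolding d(3) using D'.nonempty(2) joinl_comp[of "map d (fbot dg')" f] by simp
 have 2: "linext dgc (map ev Ts @ map od Us)" unfolding linext_def
 proof (intro conjI)
  show "distinct (map ev Ts @ map od Us)" using c(2) d(2) unfolding linext_def by (auto simp: distinct_map inj_on_def, presburger)
  show "set (map ev Ts @ map od Us) = transistors dgc" using c(2) d(2) unfolding linext_def cfields by simp
  have "sorted_wrt (%S T. (2 * S, 2 * T) \<notin> prec dgc) Ts"
   using c(2) prec_concat(1) unfolding linext_def by (auto elim: sorted_wrt_mono_rel[rotated])
  moreover have "sorted_wrt (%S T. (2 * S + 1, 2 * T + 1) \<notin> prec dgc) Us"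
   using d(2) prec_concat(2) unfolding linext_def by (auto elim: sorted_wrt_mono_rel[rotated])
  ultimately show "sorted_wrt (%S T. (S, T) \<notin> prec dgc) (map ev Ts @ map od Us)"
   using prec_concat(3) unfolding sorted_wrt_append sorted_wrt_map by auto
 qed
 have "dletter R dgc e (2 * T) = dletter R dg c T" for T unfolding dletter_def cfields cword e ..
 moreover have "dletter R dgc e (2 * T + 1) = apfst (vact f) (dletter R dg' d T)" if "T \<in> transistors dg'" for T
  unfolding dletter_def cfields cword e(5)[OF that] act_rletter[OF D'.charting_chart(2)[OF d(1) that]] ..
 ultimately have 3: "u @ act f v = map (dletter R dgc e) (map ev Ts @ map od Us)" unfolding c(4) d(4) using d(2) by (simp add: linext_def)
 show ?thesis unfolding evals_def using e(1) 1 2 3 by blast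
qed

end

section \<open>The extension associated with a class of diagrams\<close>

text \<open>The three cases of the theorem at once. The class \<open>G\<close> has to be closed
  under the group operations, and \<open>e\<close> turns a self-map of [0,1) into a permutation of
  \<open>S\<close>, where \<open>S\<close> is [0,1) for V and T and [0,1] for F.\<close>

locale diagram_class =
 fixes A :: "'a set" and R :: "('a list \<times> 'a list) set" and w :: "'a list"
  and G :: "'a diagram set" and S :: "real set" and C :: "(real => real) set"
  and e :: "(ivl => ivl) => real => real"
 assumes pres: "semigroup_presentation A R" and wA: "w \<in> lists A" and wne: "w ~= []"
  and G_ww: "G \<subseteq> ww_diagrams A R w"
  and G_id: "id_diagram w \<in> G"
  and G_concat: "dg \<in> G ==> dg' \<in> G ==> concat_diagram dg dg' \<in> G"
  and G_flip: "dg \<in> G ==> flip dg \<in> G"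
  and C_Bij: "C \<subseteq> Bij S"
  and e_C: "dg \<in> G ==> evals R dg f u ==> e f \<in> C"
  and e_comp: "e f \<in> C ==> e g \<in> C ==> e (f \<circ> g) = compose S (e f) (e g)"
  and e_id: "e id = (\<lambda>x\<in>S. x)"
  and e_inj: "e f = e g ==> f = g"
begin

interpretation raag "vertices R" "edges R" by (rule raag_vertices_edges)

abbreviation "cl dg \<equiv> dipole_rel A R w `` {dg}"
abbreviation "D \<equiv> (braided_diagram_group A R w)\<lparr>carrier := G // dipole_rel A R w\<rparr>"
abbreviation "Th \<equiv> (BijGroup S)\<lparr>carrier := C\<rparr>"

lemmas wwI = ww_diagramI[OF pres wne]

lemma evals_ex: "dg \<in> ww_diagrams A R w ==> \<exists>f u. evals R dg f u" by (rule ww_diagram.ex_evals[OF wwI])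

lemma evals_bij: "dg \<in> ww_diagrams A R w ==> evals R dg f u ==> bij f & chart f & u \<in> lists (vertices R \<times> UNIV)"
 using ww_diagram.evals_props[OF wwI] by blast

lemma dipole_rel_iff:
 assumes "dg \<in> ww_diagrams A R w" "dg' \<in> ww_diagrams A R w" "evals R dg f u" "evals R dg' g v"
 shows "(dg, dg') \<in> dipole_rel A R w \<longleftrightarrow> f = g & aeq u v"
 using eq_mod_dipoles_iff[OF pres wne assms] assms unfolding dipole_rel_def by simp

lemma equiv_dipole_rel: "equiv (ww_diagrams A R w) (dipole_rel A R w)"
proof (rule equivI)
 show "dipole_rel A R w \<subseteq> ww_diagrams A R w \<times> ww_diagrams A R w" unfolding dipole_rel_def by auto
 show "refl_on (ww_diagrams A R w) (dipole_rel A R w)"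
 proof (rule refl_onI)
  fix dg :: "'a diagram" assume d: "dg \<in> ww_diagrams A R w"
  then obtain f u where "evals R dg f u" using evals_ex by blast
  then show "(dg, dg) \<in> dipole_rel A R w" using dipole_rel_iff[OF d d] evals_bij[OF d] presentation_rel.refl by blast
 qed
 show "sym_on UNIV (dipole_rel A R w)" unfolding dipole_rel_def eq_mod_dipoles_def by (rule symI) auto
 show "trans_on UNIV (dipole_rel A R w)"
 proof (rule transI)
  fix x y z :: "'a diagram" assume xy: "(x, y) \<in> dipole_rel A R w" and yz: "(y, z) \<in> dipole_rel A R w"
  then have ww: "x \<in> ww_diagrams A R w" "y \<in> ww_diagrams A R w" "z \<in> ww_diagrams A R w" unfolding dipole_rel_def by auto
  obtain f u g v h t where *: "evals R x f u" "evals R y g v" "evals R z h t" using ww evals_ex by metis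
  have "f = g & aeq u v" "g = h & aeq v t" using xy yz dipole_rel_iff[OF ww(1,2) *(1,2)] dipole_rel_iff[OF ww(2,3) *(2,3)] by simp_all
  then show "(x, z) \<in> dipole_rel A R w" using dipole_rel_iff[OF ww(1,3) *(1,3)] presentation_rel.trans by blast
 qed
qed

lemma cl_eq_iff:
 assumes "dg \<in> ww_diagrams A R w" "dg' \<in> ww_diagrams A R w" "evals R dg f u" "evals R dg' g v"
 shows "cl dg = cl dg' \<longleftrightarrow> f = g & aeq u v"
 using eq_equiv_class_iff[OF equiv_dipole_rel assms(1,2)] dipole_rel_iff[OF assms] by simp

lemma cl_self: "dg \<in> ww_diagrams A R w ==> dg \<in> cl dg" by (rule equiv_class_self[OF equiv_dipole_rel])

lemma carrier_D: "X \<in> carrier D \<longleftrightarrow> (\<exists>dg\<in>G. X = cl dg)" unfolding quotient_def by auto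

lemma concat_props:
 assumes "dg \<in> ww_diagrams A R w" "dg' \<in> ww_diagrams A R w" "evals R dg f u" "evals R dg' g v"
 shows "concat_diagram dg dg' \<in> ww_diagrams A R w" "evals R (concat_diagram dg dg') (f \<circ> g) (u @ act f v)"
 using ww_pair.concat_in_ww[OF ww_pairI[OF pres wne assms(1,2)]]
  ww_pair.concat_evals[OF ww_pairI[OF pres wne assms(1,2)] assms(3,4)] by auto

lemma flip_props:
 assumes "dg \<in> ww_diagrams A R w" "evals R dg f u"
 shows "flip dg \<in> ww_diagrams A R w" "evals R (flip dg) (inv_into UNIV f) (act (inv_into UNIV f) (rev (map inv_letter u)))"
 using ww_diagram.flip_in_ww[OF wwI[OF assms(1)]] ww_diagram.flip_evals[OF wwI[OF assms(1)] assms(2)] by auto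

lemmas id_props = id_in_ww[OF wA wne, of R] id_evals[OF wA wne, of R]

lemma aeq_append: "aeq u u' ==> aeq v v' ==> aeq (u @ v) (u' @ v')"
proof -
 assume 1: "aeq u u'" "aeq v v'"
 note l = presentation_rel_lists[OF 1(1)] presentation_rel_lists[OF 1(2)]
 have "aeq ([] @ u @ v) ([] @ u' @ v)" "aeq (u' @ v @ []) (u' @ v' @ [])" using 1 l by (intro presentation_rel_append; simp)+
 then show ?thesis by (auto intro: presentation_rel.trans)
qed

text \<open>The product of two classes is a union over representatives. All of these give the same
  class, because the evaluation of a concatenation depends only on the two evaluations modulo the
  Artin relations.\<close>

lemma cl_mult:
 assumes "dg \<in> ww_diagrams A R w" "dg' \<in> ww_diagrams A R w"
 shows "cl dg \<otimes>\<^bsub>D\<^esub> cl dg' = cl (concat_diagram dg dg')"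
proof -
 have eq: "cl (concat_diagram x y) = cl (concat_diagram dg dg')" if "x \<in> cl dg" "y \<in> cl dg'" for x y
 proof -
  have ww: "x \<in> ww_diagrams A R w" "y \<in> ww_diagrams A R w" using that unfolding dipole_rel_def by auto
  obtain f u where x: "evals R x f u" using ww evals_ex by blast
  obtain g v where y: "evals R y g v" using ww evals_ex by blast
  obtain f' u' where d: "evals R dg f' u'" using assms evals_ex by blast
  obtain g' v' where d': "evals R dg' g' v'" using assms evals_ex by blast
  have "f' = f" "aeq u' u" using that(1) dipole_rel_iff[OF assms(1) ww(1) d x] by auto
  moreover have "g' = g" "aeq v' v" using that(2) dipole_rel_iff[OF assms(2) ww(2) d' y] by auto
  moreover have "aeq (act f v') (act f v)" using \<open>aeq v' v\<close> evals_bij[OF ww(1) x] by (intro act_aeq) (auto simp: bij_is_inj)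
  ultimately have "f \<circ> g = f' \<circ> g'" "aeq (u @ act f v) (u' @ act f' v')" by (auto intro!: presentation_rel.sym[OF aeq_append])
  then show ?thesis using cl_eq_iff[OF concat_props(1)[OF ww x y] concat_props(1)[OF assms d d']
     concat_props(2)[OF ww x y] concat_props(2)[OF assms d d']] by blast
 qed
 have "(\<Union>x\<in>cl dg. \<Union>y\<in>cl dg'. cl (concat_diagram x y)) = (\<Union>x\<in>cl dg. \<Union>y\<in>cl dg'. cl (concat_diagram dg dg'))"
  by (rule SUP_cong[OF HOL.refl], rule SUP_cong[OF HOL.refl], rule eq)
 moreover have "(\<Union>x\<in>cl dg. \<Union>y\<in>cl dg'. cl (concat_diagram dg dg')) = cl (concat_diagram dg dg')"
  using cl_self assms by (metis UN_constant empty_iff)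
 ultimately show ?thesis by (simp add: braided_diagram_group_def)
qed

lemma one_D: "\<one>\<^bsub>D\<^esub> = cl (id_diagram w)" by (simp add: braided_diagram_group_def)

lemma GW: "dg \<in> G ==> dg \<in> ww_diagrams A R w" using G_ww by blast

lemma group_D: "group D"
proof (rule groupI)
 fix X Y assume "X \<in> carrier D" "Y \<in> carrier D"
 then show "X \<otimes>\<^bsub>D\<^esub> Y \<in> carrier D" unfolding carrier_D using cl_mult[OF GW GW] G_concat by metis
next
 show "\<one>\<^bsub>D\<^esub> \<in> carrier D" unfolding carrier_D one_D using G_id by blast
next
 fix X Y Z assume "X \<in> carrier D" "Y \<in> carrier D" "Z \<in> carrier D"
 then obtain x y z where g: "x \<in> G" "y \<in> G" "z \<in> G" and X: "X = cl x" "Y = cl y" "Z = cl z" unfolding carrier_D by blast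
 note W = g[THEN GW]
 obtain f u where x: "evals R x f u" using W evals_ex by blast
 obtain g v where y: "evals R y g v" using W evals_ex by blast
 obtain h t where z: "evals R z h t" using W evals_ex by blast
 note xy = concat_props[OF W(1,2) x y] and yz = concat_props[OF W(2,3) y z]
 note l = concat_props[OF xy(1) W(3) xy(2) z] and r = concat_props[OF W(1) yz(1) x yz(2)]
 have "act f (act g t) = act (f \<circ> g) t" using act_comp[of g t R f] evals_bij[OF W(2) y] evals_bij[OF W(3) z] by blast
 then have e: "(u @ act f v) @ act (f \<circ> g) t = u @ act f (v @ act g t)" by simp
 have "aeq (u @ act f (v @ act g t)) (u @ act f (v @ act g t))" using evals_bij[OF r] by (intro presentation_rel.refl) blast
 then have "cl (concat_diagram (concat_diagram x y) z) = cl (concat_diagram x (concat_diagram y z))"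
  using cl_eq_iff[OF l(1) r(1) l(2) r(2)] e comp_assoc by metis
 then show "X \<otimes>\<^bsub>D\<^esub> Y \<otimes>\<^bsub>D\<^esub> Z = X \<otimes>\<^bsub>D\<^esub> (Y \<otimes>\<^bsub>D\<^esub> Z)"
  unfolding X cl_mult[OF W(1,2)] cl_mult[OF W(2,3)] cl_mult[OF xy(1) W(3)] cl_mult[OF W(1) yz(1)] .
next
 fix X assume "X \<in> carrier D"
 then obtain x where g: "x \<in> G" and X: "X = cl x" unfolding carrier_D by blast
 note W = GW[OF g]
 obtain f u where x: "evals R x f u" using W evals_ex by blast
 note p = evals_bij[OF W x]
 note l = concat_props[OF id_props(1) W id_props(2) x]
 have "act id u = u" using act_id p by blast
 moreover have "aeq u u" using p presentation_rel.refl by blast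
 ultimately have "cl (concat_diagram (id_diagram w) x) = cl x" using cl_eq_iff[OF l(1) W l(2) x] by simp
 then show "\<one>\<^bsub>D\<^esub> \<otimes>\<^bsub>D\<^esub> X = X" unfolding X one_D cl_mult[OF id_props(1) W] .
 note fl = flip_props[OF W x]
 note fx = concat_props[OF fl(1) W fl(2) x]
 let ?i = "inv_into UNIV f"
 have i: "?i \<circ> f = id" using p by (simp add: bij_is_inj)
 have pi: "bij ?i" "chart ?i" using evals_bij[OF fl] by blast+
 have "aeq (act ?i (rev (map inv_letter u) @ u)) (act ?i [])"
  using p pi inverse_word[of u "vertices R" "commutators (edges R)"] by (intro act_aeq) (auto simp: bij_is_inj)
 then have "cl (concat_diagram (flip x) x) = cl (id_diagram w)" using cl_eq_iff[OF fx(1) id_props(1) fx(2) id_props(2)] i by simp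
 then have "cl (flip x) \<otimes>\<^bsub>D\<^esub> X = \<one>\<^bsub>D\<^esub>" unfolding X one_D cl_mult[OF fl(1) W] .
 then show "\<exists>Y\<in>carrier D. Y \<otimes>\<^bsub>D\<^esub> X = \<one>\<^bsub>D\<^esub>" using G_flip[OF g] carrier_D by blast
qed

section \<open>The homomorphism to Thompson's group\<close>

definition fmap :: "'a diagram set => ivl => ivl" where
 "fmap X = (THE f. \<exists>dg\<in>X. \<exists>u. evals R dg f u)"

lemma fmap_cl:
 assumes "dg \<in> ww_diagrams A R w" "evals R dg f u"
 shows "fmap (cl dg) = f" unfolding fmap_def
proof (rule the_equality)
 show "\<exists>dg'\<in>cl dg. \<exists>u. evals R dg' f u" using assms cl_self by blast
 fix g assume "\<exists>dg'\<in>cl dg. \<exists>u. evals R dg' g u"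
 then obtain dg' v where *: "(dg, dg') \<in> dipole_rel A R w" "evals R dg' g v" by auto
 then have "dg' \<in> ww_diagrams A R w" unfolding dipole_rel_def by auto
 then show "g = f" using dipole_rel_iff[OF assms(1) _ assms(2) *(2)] *(1) by blast
qed

definition K :: "(real => real) set" where "K = {e f | f. \<exists>dg\<in>G. \<exists>u. evals R dg f u}"

lemma K_subset: "K \<subseteq> C" using e_C unfolding K_def by auto

lemma K_props:
 shows "!!x y. x \<in> K ==> y \<in> K ==> compose S x y \<in> K"
  and "(\<lambda>x\<in>S. x) \<in> K"
  and "!!x. x \<in> K ==> \<exists>y\<in>K. compose S x y = (\<lambda>x\<in>S. x) & compose S y x = (\<lambda>x\<in>S. x)"
proof -
 fix x y assume "x \<in> K" "y \<in> K"
 then obtain f dg u g dg' v where *: "x = e f" "dg \<in> G" "evals R dg f u" "y = e g" "dg' \<in> G" "evals R dg' g v" unfolding K_def by blast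
 have "evals R (concat_diagram dg dg') (f \<circ> g) (u @ act f v)" using concat_props(2)[OF GW GW] * by blast
 then have "e (f \<circ> g) \<in> K" unfolding K_def using G_concat * by blast
 then show "compose S x y \<in> K" using e_comp[of f g] * e_C by metis
next
 show "(\<lambda>x\<in>S. x) \<in> K" unfolding K_def e_id[symmetric] using G_id id_props(2) by blast
next
 fix x assume "x \<in> K"
 then obtain f dg u where *: "x = e f" "dg \<in> G" "evals R dg f u" unfolding K_def by blast
 note fl = flip_props[OF GW[OF *(2)] *(3)]
 have b: "bij f" using evals_bij[OF GW[OF *(2)] *(3)] by blast
 have k: "e (inv_into UNIV f) \<in> K" unfolding K_def using fl(2) G_flip[OF *(2)] by blast
 then have C: "e (inv_into UNIV f) \<in> C" "e f \<in> C" using K_subset e_C[OF *(2,3)] by auto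
 have i: "inv_into UNIV f \<circ> f = id" "f \<circ> inv_into UNIV f = id" using b by (simp_all add: bij_is_inj surj_iff[symmetric] bij_is_surj)
 have "compose S x (e (inv_into UNIV f)) = (\<lambda>x\<in>S. x)" using e_comp[OF C(2,1)] unfolding i e_id *(1) by simp
 moreover have "compose S (e (inv_into UNIV f)) x = (\<lambda>x\<in>S. x)" using e_comp[OF C] unfolding i e_id *(1) by simp
 ultimately show "\<exists>y\<in>K. compose S x y = (\<lambda>x\<in>S. x) & compose S y x = (\<lambda>x\<in>S. x)" using k by blast
qed

lemma Th_mult: "x \<in> C ==> y \<in> C ==> x \<otimes>\<^bsub>Th\<^esub> y = compose S x y"
 and Th_one: "\<one>\<^bsub>Th\<^esub> = (\<lambda>x\<in>S. x)" using C_Bij by (auto simp: BijGroup_def)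

lemma subgroup_K: "subgroup K Th"
proof
 show "K \<subseteq> carrier Th" using K_subset by simp
 show "x \<otimes>\<^bsub>Th\<^esub> y \<in> K" if "x \<in> K" "y \<in> K" for x y
  using Th_mult[OF subsetD[OF K_subset that(1)] subsetD[OF K_subset that(2)]] K_props(1)[OF that] by simp
 show "\<one>\<^bsub>Th\<^esub> \<in> K" unfolding Th_one by (rule K_props)
 fix x assume x: "x \<in> K"
 then obtain y where y: "y \<in> K" "compose S x y = (\<lambda>x\<in>S. x)" "compose S y x = (\<lambda>x\<in>S. x)" using K_props(3) by blast
 have xC: "x \<in> C" "y \<in> C" using x y K_subset by auto
 have "inv\<^bsub>Th\<^esub> x = y" unfolding m_inv_def
 proof (rule the_equality)
  show "y \<in> carrier Th & x \<otimes>\<^bsub>Th\<^esub> y = \<one>\<^bsub>Th\<^esub> & y \<otimes>\<^bsub>Th\<^esub> x = \<one>\<^bsub>Th\<^esub>"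
   using y xC Th_mult Th_one by simp
  fix z assume z: "z \<in> carrier Th & x \<otimes>\<^bsub>Th\<^esub> z = \<one>\<^bsub>Th\<^esub> & z \<otimes>\<^bsub>Th\<^esub> x = \<one>\<^bsub>Th\<^esub>"
  then have zC: "z \<in> C" "compose S x z = (\<lambda>x\<in>S. x)" using Th_mult Th_one xC by auto
  \<comment> \<open>Uniqueness of inverses is taken from the full permutation group of
    \<open>S\<close>, to which all elements involved belong.\<close>
  interpret B: group "BijGroup S" by (rule group_BijGroup)
  have "x \<otimes>\<^bsub>BijGroup S\<^esub> z = \<one>\<^bsub>BijGroup S\<^esub>" "y \<otimes>\<^bsub>BijGroup S\<^esub> x = \<one>\<^bsub>BijGroup S\<^esub>"
   using zC y xC C_Bij by (auto simp: BijGroup_def)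
  moreover have "x \<in> carrier (BijGroup S)" "y \<in> carrier (BijGroup S)" "z \<in> carrier (BijGroup S)"
   using xC zC C_Bij by (auto simp: BijGroup_def)
  ultimately show "z = y" using B.inv_unique by metis
 qed
 then show "inv\<^bsub>Th\<^esub> x \<in> K" using y by simp
qed

lemma group_K: "group (Th\<lparr>carrier := K\<rparr>)"
proof (rule groupI)
 show "\<one>\<^bsub>Th\<lparr>carrier := K\<rparr>\<^esub> \<in> carrier (Th\<lparr>carrier := K\<rparr>)" using K_props(2) Th_one by simp
 fix x assume x: "x \<in> carrier (Th\<lparr>carrier := K\<rparr>)"
 then have xB: "x \<in> K" "x \<in> Bij S" using K_subset C_Bij by auto
 show "\<one>\<^bsub>Th\<lparr>carrier := K\<rparr>\<^esub> \<otimes>\<^bsub>Th\<lparr>carrier := K\<rparr>\<^esub> x = x"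
  using group.is_monoid[OF group_BijGroup, THEN monoid.l_one, of x S] xB by (simp add: BijGroup_def)
 obtain y where "y \<in> K" "compose S y x = (\<lambda>x\<in>S. x)" using K_props(3) xB(1) by blast
 then show "\<exists>y\<in>carrier (Th\<lparr>carrier := K\<rparr>). y \<otimes>\<^bsub>Th\<lparr>carrier := K\<rparr>\<^esub> x = \<one>\<^bsub>Th\<lparr>carrier := K\<rparr>\<^esub>"
  using xB Th_mult[of y x] Th_one K_subset by auto
next
 fix x y assume "x \<in> carrier (Th\<lparr>carrier := K\<rparr>)" "y \<in> carrier (Th\<lparr>carrier := K\<rparr>)"
 then have xy: "x \<in> K" "y \<in> K" by simp_all
 then show "x \<otimes>\<^bsub>Th\<lparr>carrier := K\<rparr>\<^esub> y \<in> carrier (Th\<lparr>carrier := K\<rparr>)"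
  using Th_mult[OF subsetD[OF K_subset xy(1)] subsetD[OF K_subset xy(2)]] K_props(1)[OF xy] by simp
next
 fix x y z assume "x \<in> carrier (Th\<lparr>carrier := K\<rparr>)" "y \<in> carrier (Th\<lparr>carrier := K\<rparr>)" "z \<in> carrier (Th\<lparr>carrier := K\<rparr>)"
 then have "x \<in> carrier (BijGroup S)" "y \<in> carrier (BijGroup S)" "z \<in> carrier (BijGroup S)"
  using K_subset C_Bij by (auto simp: BijGroup_def)
 then show "x \<otimes>\<^bsub>Th\<lparr>carrier := K\<rparr>\<^esub> y \<otimes>\<^bsub>Th\<lparr>carrier := K\<rparr>\<^esub> z =
   x \<otimes>\<^bsub>Th\<lparr>carrier := K\<rparr>\<^esub> (y \<otimes>\<^bsub>Th\<lparr>carrier := K\<rparr>\<^esub> z)"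
  using group.is_monoid[OF group_BijGroup, THEN monoid.m_assoc, of x S y z] by simp
qed

lemma epi_p: "(%X. e (fmap X)) \<in> epi D (Th\<lparr>carrier := K\<rparr>)"
proof -
 have "(%X. e (fmap X)) \<in> hom D (Th\<lparr>carrier := K\<rparr>)"
 proof (rule homI)
  fix X assume "X \<in> carrier D"
  then obtain x where g: "x \<in> G" and X: "X = cl x" unfolding carrier_D by blast
  obtain f u where x: "evals R x f u" using GW[OF g] evals_ex by blast
  then show "e (fmap X) \<in> carrier (Th\<lparr>carrier := K\<rparr>)" unfolding X using fmap_cl[OF GW[OF g] x] g by (auto simp: K_def)
  fix Y assume "Y \<in> carrier D"
  then obtain y where g': "y \<in> G" and Y: "Y = cl y" unfolding carrier_D by blast
  obtain h v where y: "evals R y h v" using GW[OF g'] evals_ex by blast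
  note xy = concat_props[OF GW[OF g] GW[OF g'] x y]
  have C: "e f \<in> C" "e h \<in> C" using e_C g g' x y by blast+
  have "e (fmap (X \<otimes>\<^bsub>D\<^esub> Y)) = e (f \<circ> h)" unfolding X Y cl_mult[OF GW[OF g] GW[OF g']] fmap_cl[OF xy] ..
  also have "\<dots> = e (fmap X) \<otimes>\<^bsub>Th\<lparr>carrier := K\<rparr>\<^esub> e (fmap Y)"
   unfolding X Y fmap_cl[OF GW[OF g] x] fmap_cl[OF GW[OF g'] y] using e_comp[OF C] Th_mult[OF C] by simp
  finally show "e (fmap (X \<otimes>\<^bsub>D\<^esub> Y)) = e (fmap X) \<otimes>\<^bsub>Th\<lparr>carrier := K\<rparr>\<^esub> e (fmap Y)" .
 qed
 moreover have "K \<subseteq> (%X. e (fmap X)) ` carrier D"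
 proof
  fix k assume "k \<in> K"
  then obtain f dg u where *: "k = e f" "dg \<in> G" "evals R dg f u" unfolding K_def by blast
  have "cl dg \<in> carrier D" using *(2) carrier_D by blast
  then show "k \<in> (%X. e (fmap X)) ` carrier D" using fmap_cl[OF GW[OF *(2)] *(3)] *(1) by force
 qed
 ultimately show ?thesis unfolding epi_def hom_def by auto
qed

text \<open>The words of diagrams with trivial frame map. For these the action in the product law is
  by the identity, so words multiply as diagrams do.\<close>

definition H :: "('a diagram \<times> bool) list set set" where
 "H = {acls u | u. \<exists>dg\<in>G. evals R dg id u}"

text \<open>Definite, because among diagrams with trivial frame map the class modulo dipoles is
  determined by the class of the word.\<close>

definition imap :: "('a diagram \<times> bool) list set => 'a diagram set" where
 "imap U = (THE X. \<exists>dg\<in>G. \<exists>u. evals R dg id u & U = acls u & X = cl dg)"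

lemma imap_cls:
 assumes "dg \<in> G" "evals R dg id u"
 shows "imap (acls u) = cl dg" unfolding imap_def
proof (rule the_equality)
 show "\<exists>dg'\<in>G. \<exists>u'. evals R dg' id u' & acls u = acls u' & cl dg = cl dg'" using assms by blast
 fix X assume "\<exists>dg'\<in>G. \<exists>u'. evals R dg' id u' & acls u = acls u' & X = cl dg'"
 then obtain dg' u' where *: "dg' \<in> G" "evals R dg' id u'" "acls u = acls u'" "X = cl dg'" by blast
 have "aeq u' u" using *(3) evals_bij[OF GW[OF *(1)] *(2)] evals_bij[OF GW[OF assms(1)] assms(2)] cls_eq_iff by metis
 then show "X = cl dg" unfolding *(4) using cl_eq_iff[OF GW[OF *(1)] GW[OF assms(1)] *(2) assms(2)] by blast
qed

lemma subgroup_H: "subgroup H AG"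
proof (rule group.subgroupI[OF group_presented])
 show "H \<subseteq> carrier AG" unfolding H_def using evals_bij[OF GW] cls_in_carrier by blast
 show "H ~= {}" unfolding H_def using G_id id_props(2) by blast
next
 fix U assume "U \<in> H"
 then obtain u dg where u: "U = acls u" "dg \<in> G" "evals R dg id u" unfolding H_def by blast
 have l: "u \<in> lists (vertices R \<times> UNIV)" using evals_bij[OF GW[OF u(2)] u(3)] by blast
 have "evals R (flip dg) id (act id (rev (map inv_letter u)))" using flip_props(2)[OF GW[OF u(2)] u(3)] by simp
 then have "evals R (flip dg) id (rev (map inv_letter u))" using act_id[OF inv_word_lists[OF l]] by simp
 then show "inv\<^bsub>AG\<^esub> U \<in> H" unfolding u(1) cls_inverse[OF l, symmetric] H_def using G_flip[OF u(2)] by blast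
next
 fix U U' assume "U \<in> H" "U' \<in> H"
 then obtain u dg v dg' where u: "U = acls u" "dg \<in> G" "evals R dg id u" "U' = acls v" "dg' \<in> G" "evals R dg' id v"
  unfolding H_def by blast
 have l: "u \<in> lists (vertices R \<times> UNIV)" "v \<in> lists (vertices R \<times> UNIV)" using evals_bij[OF GW] u by blast+
 have "evals R (concat_diagram dg dg') id (u @ v)" using concat_props(2)[OF GW[OF u(2)] GW[OF u(5)] u(3,6)] act_id[OF l(2)] by simp
 then show "U \<otimes>\<^bsub>AG\<^esub> U' \<in> H" unfolding u(1,4) cls_append[OF l] H_def using G_concat[OF u(2,5)] by blast
qed

lemma mon_i: "imap \<in> mon (AG\<lparr>carrier := H\<rparr>) D"
proof -
 have "imap \<in> hom (AG\<lparr>carrier := H\<rparr>) D"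
 proof (rule homI)
  fix U assume "U \<in> carrier (AG\<lparr>carrier := H\<rparr>)"
  then obtain u dg where u: "U = acls u" "dg \<in> G" "evals R dg id u" unfolding H_def by auto
  show "imap U \<in> carrier D" unfolding u(1) imap_cls[OF u(2,3)] carrier_D using u(2) by blast
  fix U' assume "U' \<in> carrier (AG\<lparr>carrier := H\<rparr>)"
  then obtain v dg' where v: "U' = acls v" "dg' \<in> G" "evals R dg' id v" unfolding H_def by auto
  have l: "u \<in> lists (vertices R \<times> UNIV)" "v \<in> lists (vertices R \<times> UNIV)" using evals_bij[OF GW] u v by blast+
  have ev: "evals R (concat_diagram dg dg') id (u @ v)" using concat_props(2)[OF GW[OF u(2)] GW[OF v(2)] u(3) v(3)] act_id[OF l(2)] by simp
  have "U \<otimes>\<^bsub>AG\<lparr>carrier := H\<rparr>\<^esub> U' = acls (u @ v)" unfolding u(1) v(1) using cls_append[OF l] by simp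
  then show "imap (U \<otimes>\<^bsub>AG\<lparr>carrier := H\<rparr>\<^esub> U') = imap U \<otimes>\<^bsub>D\<^esub> imap U'"
   unfolding u(1) v(1) imap_cls[OF u(2,3)] imap_cls[OF v(2,3)] cl_mult[OF GW[OF u(2)] GW[OF v(2)]]
   using imap_cls[OF G_concat[OF u(2) v(2)] ev] by simp
 qed
 moreover have "inj_on imap H"
 proof (rule inj_onI)
  fix U U' assume "U \<in> H" "U' \<in> H" and eq: "imap U = imap U'"
  then obtain u dg v dg' where u: "U = acls u" "dg \<in> G" "evals R dg id u" "U' = acls v" "dg' \<in> G" "evals R dg' id v"
   unfolding H_def by blast
  have "cl dg = cl dg'" using eq unfolding u(1,4) imap_cls[OF u(2,3)] imap_cls[OF u(5,6)] .
  then have "aeq u v" using cl_eq_iff[OF GW[OF u(2)] GW[OF u(5)] u(3,6)] by blast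
  moreover have "u \<in> lists (vertices R \<times> UNIV)" "v \<in> lists (vertices R \<times> UNIV)" using evals_bij[OF GW] u by blast+
  ultimately show "U = U'" unfolding u(1,4) using cls_eq_iff by blast
 qed
 ultimately show ?thesis unfolding mon_def by simp
qed

lemma exact: "imap ` H = kernel D (Th\<lparr>carrier := K\<rparr>) (%X. e (fmap X))"
proof
 show "imap ` H \<subseteq> kernel D (Th\<lparr>carrier := K\<rparr>) (%X. e (fmap X))"
 proof
  fix X assume "X \<in> imap ` H"
  then obtain u dg where u: "X = imap (acls u)" "dg \<in> G" "evals R dg id u" unfolding H_def by blast
  have "X = cl dg" using u imap_cls by blast
  then have "e (fmap X) = (\<lambda>x\<in>S. x)" "X \<in> carrier D" using fmap_cl[OF GW[OF u(2)] u(3)] e_id u(2) carrier_D by auto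
  then show "X \<in> kernel D (Th\<lparr>carrier := K\<rparr>) (%X. e (fmap X))" using Th_one unfolding kernel_def by simp
 qed
 show "kernel D (Th\<lparr>carrier := K\<rparr>) (%X. e (fmap X)) \<subseteq> imap ` H"
 proof
  fix X assume "X \<in> kernel D (Th\<lparr>carrier := K\<rparr>) (%X. e (fmap X))"
  then have X: "X \<in> carrier D" "e (fmap X) = e id" using Th_one e_id unfolding kernel_def by auto
  then obtain x where g: "x \<in> G" and x: "X = cl x" unfolding carrier_D by blast
  obtain f u where ev: "evals R x f u" using GW[OF g] evals_ex by blast
  have "f = id" using X(2) e_inj fmap_cl[OF GW[OF g] ev] unfolding x by simp
  then have "X = imap (acls u)" "acls u \<in> H" using imap_cls[OF g] ev g unfolding x H_def by blast+
  then show "X \<in> imap ` H" by blast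
 qed
qed

theorem ex_extension:
 "\<exists>(V :: 'a diagram set) E H K i p. simple_graph V E & subgroup H (right_angled_Artin_group V E) &
   subgroup K Th & group_extension ((right_angled_Artin_group V E)\<lparr>carrier := H\<rparr>) D (Th\<lparr>carrier := K\<rparr>) i p"
proof (intro exI conjI)
 show "simple_graph (vertices R) (edges R)" by (rule graph)
 show "subgroup H (right_angled_Artin_group (vertices R) (edges R))" unfolding right_angled_Artin_group_eq by (rule subgroup_H)
 show "subgroup K Th" by (rule subgroup_K)
 have "group (AG\<lparr>carrier := H\<rparr>)" using subgroup_H by (rule subgroup.subgroup_is_group) (rule group_presented)
 then show "group_extension ((right_angled_Artin_group (vertices R) (edges R))\<lparr>carrier := H\<rparr>) D (Th\<lparr>carrier := K\<rparr>)
   imap (%X. e (fmap X))" unfolding group_extension_def right_angled_Artin_group_eq using group_D group_K mon_i epi_p exact by simp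
qed

end

section \<open>The two sides of a closed curve\<close>

text \<open>The sign of \<open>side e x z\<close> tells whether \<open>z\<close> lies to the left of the line directed from \<open>e\<close> to \<open>x\<close>.\<close>

definition side :: "complex => complex => complex => real" where
 "side e x z = Im ((x - e) * cnj (x - z))"

lemma side_ends [simp]: "side e x e = 0" "side e x x = 0" by (simp_all add: side_def algebra_simps)

lemma side_affine: "u + v = 1 ==> side e x (u *\<^sub>R y + v *\<^sub>R z) = u * side e x y + v * side e x z"
proof -
 assume "u + v = 1"
 then have v: "v = 1 - u" by simp
 show ?thesis unfolding side_def v by (simp add: algebra_simps)
qed

lemma convex_side: "convex {z. side e x z > 0}" "convex {z. side e x z < 0}" "convex {z. side e x z \<ge> 0}" "convex {z. side e x z <= 0}"
proof -
 have "convex {z. r * side e x z > 0}" "convex {z. r * side e x z \<ge> 0}" for r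
 proof -
  have aff: "r * side e x (u *\<^sub>R y + v *\<^sub>R z) = u * (r * side e x y) + v * (r * side e x z)" if "u + v = 1" for u v y z
   using side_affine[OF that, of e x y z] by (simp add: algebra_simps)
  show "convex {z. r * side e x z > 0}"
  proof (rule convexI)
   fix y z and u v :: real
   assume "y \<in> {z. r * side e x z > 0}" "z \<in> {z. r * side e x z > 0}" "0 <= u" "0 <= v" "u + v = 1"
   then show "u *\<^sub>R y + v *\<^sub>R z \<in> {z. r * side e x z > 0}" unfolding mem_Collect_eq aff[OF \<open>u + v = 1\<close>]
    by (cases "u = 0") (auto intro!: add_pos_nonneg simp: mult_nonneg_nonneg less_imp_le)
  qed
  show "convex {z. r * side e x z \<ge> 0}" by (rule convexI) (simp add: aff)
 qed
 from this[of 1] this[of "-1"] show "convex {z. side e x z > 0}" "convex {z. side e x z < 0}"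
  "convex {z. side e x z \<ge> 0}" "convex {z. side e x z <= 0}" by simp_all
qed

lemma side_segment: "z \<in> closed_segment e x ==> side e x z = 0" unfolding closed_segment_def by (auto simp: side_affine)

text \<open>Replacing the edge from \<open>e\<close> to \<open>x\<close> by the detour over
  \<open>c\<close> changes the curve by the boundary of a triangle. The detour avoids a
  neighbourhood of the midpoint, so its winding number is constant there, while the triangle
  contributes 1 or -1 on the side of \<open>c\<close> and 0 on the other.\<close>

lemma winding_number_jump:
 fixes e x c :: complex
 assumes rest: "path rest" "pathstart rest = x" "pathfinish rest = e"
  and c: "side e x c ~= 0" and disj: "path_image rest \<inter> convex hull {e, x, c} \<subseteq> {e, x}"
 shows "\<exists>\<epsilon>>0. ball (midpoint e x) \<epsilon> \<inter> path_image rest = {} &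
  (\<forall>z1 z2. z1 \<in> ball (midpoint e x) \<epsilon> --> z2 \<in> ball (midpoint e x) \<epsilon> --> side e x z1 > 0 --> side e x z2 < 0 -->
   winding_number (linepath e x +++ rest) z1 = winding_number (linepath e x +++ rest) z2 + 1)"
proof -
 define m where "m = midpoint e x"
 let ?J = "linepath e x +++ rest"
 let ?J1 = "(linepath e c +++ linepath c x) +++ rest"
 let ?T = "linepath e x +++ linepath x c +++ linepath c e"
 have m: "m = (1/2) *\<^sub>R e + (1/2) *\<^sub>R x" by (simp add: m_def midpoint_def scaleR_add_right)
 have sm: "side e x m = 0" unfolding m by (subst side_affine) simp_all
 have ex: "e ~= x" using c by (auto simp: side_def)
 have mne: "m ~= e" "m ~= x" using ex by (auto simp: m_def)
 have "m \<in> convex hull {e, x, c}" unfolding m convex_hull_3 by (force intro: exI[of _ "1/2"])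
 then have "m \<notin> path_image rest" using disj mne by blast
 moreover have nseg: "m \<notin> closed_segment c y" if "y = e | y = x" for y
 proof
  assume "m \<in> closed_segment c y"
  then obtain u where u: "0 <= u" "u <= 1" "m = (1 - u) *\<^sub>R c + u *\<^sub>R y" unfolding closed_segment_def by blast
  then have "(1 - u) * side e x c = 0" using that sm side_affine[of "1 - u" u e x c y] by auto
  then have "m = y" using c u(3) by simp
  then show False using mne that by blast
 qed
 ultimately have "m \<notin> path_image rest \<union> closed_segment c e \<union> closed_segment c x" by blast
 moreover have "closed (path_image rest \<union> closed_segment c e \<union> closed_segment c x)"
  using rest(1) by (intro closed_Un closed_path_image closed_segment)
 ultimately obtain \<epsilon> where \<epsilon>: "\<epsilon> > 0" "ball m \<epsilon> \<inter> (path_image rest \<union> closed_segment c e \<union> closed_segment c x) = {}"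
  by (metis open_contains_ball_eq open_Compl ComplI disjoint_eq_subset_Compl)
 have J: "path ?J" "pathfinish ?J = pathstart ?J" "path_image ?J = closed_segment e x \<union> path_image rest"
  using rest by (simp_all add: path_image_join)
 have J1: "path ?J1" "pathfinish ?J1 = pathstart ?J1" "path_image ?J1 = closed_segment c e \<union> closed_segment c x \<union> path_image rest"
  using rest by (simp_all add: path_image_join closed_segment_commute)
 have halfJ: "winding_number ?J z1 = winding_number ?J z2"
  if "z1 \<in> ball m \<epsilon>" "z2 \<in> ball m \<epsilon>" "side e x z1 * side e x z2 > 0" for z1 z2
 proof -
  have "\<exists>S. z1 \<in> S & z2 \<in> S & convex S & S \<inter> closed_segment e x = {} & S \<subseteq> ball m \<epsilon>"
  proof (cases "side e x z1 > 0")
   case True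
   then show ?thesis using that side_segment
    by (intro exI[of _ "ball m \<epsilon> \<inter> {z. side e x z > 0}"]) (auto intro!: convex_Int convex_side simp: zero_less_mult_iff)
  next
   case False
   then show ?thesis using that side_segment
    by (intro exI[of _ "ball m \<epsilon> \<inter> {z. side e x z < 0}"]) (auto intro!: convex_Int convex_side simp: zero_less_mult_iff)
  qed
  then obtain S where S: "z1 \<in> S" "z2 \<in> S" "convex S" "S \<inter> closed_segment e x = {}" "S \<subseteq> ball m \<epsilon>" by blast
  then show ?thesis using \<epsilon>(2) J by (intro winding_number_eq[of ?J z1 S z2]) (auto intro: convex_connected)
 qed
 define d where "d = c - m"
 have d: "d ~= 0" using c sm by (auto simp: d_def)
 \<comment> \<open>So small that the point \<open>a\<close> towards \<open>c\<close> and its mirror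
   image \<open>b\<close> stay in the ball, and below 1, so that \<open>a\<close> lies inside the
   triangle.\<close>
 define t where "t = min (1/2) (\<epsilon> / (2 * norm d))"
 have t: "0 < t" "t < 1" "t * norm d < \<epsilon>" using \<epsilon>(1) d by (auto simp: t_def min_def field_simps)
 define a where "a = m + t *\<^sub>R d"
 define b where "b = m - t *\<^sub>R d"
 have ab: "a \<in> ball m \<epsilon>" "b \<in> ball m \<epsilon>" using t by (auto simp: a_def b_def dist_norm)
 have a_eq: "a = (1 - t) *\<^sub>R m + t *\<^sub>R c" and b_eq: "b = (1 + t) *\<^sub>R m + (- t) *\<^sub>R c"
  unfolding a_def b_def d_def by (simp_all add: algebra_simps)
 have sa: "side e x a = t * side e x c" and sb: "side e x b = - (t * side e x c)"
   unfolding a_eq b_eq using sm side_affine[of "1 - t" t e x m c] side_affine[of "1 + t" "- t" e x m c] by simp_all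
 have nab: "z \<notin> closed_segment e x" "z \<notin> closed_segment c e" "z \<notin> closed_segment c x" "z \<notin> path_image rest"
  "z \<notin> closed_segment x c" "z \<notin> closed_segment e c"
  if "z = a | z = b" for z using that \<epsilon>(2) ab c t side_segment[of z e x] sa sb by (auto simp: closed_segment_commute)
 have diff: "winding_number ?J z = winding_number ?J1 z + winding_number ?T z" if "z = a | z = b" for z
 proof -
  note n = nab[OF that]
  have "winding_number (linepath e c) z = - winding_number (linepath c e) z"
   "winding_number (linepath c x) z = - winding_number (linepath x c) z"
   using winding_number_reversepath[of "linepath c e" z] winding_number_reversepath[of "linepath x c" z] n by auto
  then show ?thesis using n rest by (simp add: winding_number_join path_image_join)
 qed
 have J1ab: "winding_number ?J1 a = winding_number ?J1 b"
  using ab \<epsilon>(2) J1 by (intro winding_number_eq[of ?J1 a "ball m \<epsilon>" b]) auto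
 have Tb: "winding_number ?T b = 0"
 proof (rule winding_number_zero_outside)
  show "convex (convex hull {e, x, c})" by (rule convex_convex_hull)
  show "path ?T" "pathfinish ?T = pathstart ?T" by simp_all
  show "path_image ?T \<subseteq> convex hull {e, x, c}" by (simp add: path_image_join segment_convex_hull hull_mono)
  show "b \<notin> convex hull {e, x, c}"
  proof (cases "side e x c > 0")
   case True
   then have "convex hull {e, x, c} \<subseteq> {z. side e x z \<ge> 0}" by (intro hull_minimal convex_side) auto
   moreover have "side e x b < 0" using sb True t by simp
   ultimately show ?thesis by force
  next
   case False
   then have "convex hull {e, x, c} \<subseteq> {z. side e x z <= 0}" by (intro hull_minimal convex_side) auto
   moreover have "side e x b > 0" using sb False c t by (simp add: mult_less_0_iff)
   ultimately show ?thesis by force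
  qed
 qed
 have "~ collinear {e, c, x}" unfolding collinear_3_expand using ex c side_affine[of _ _ e x e x] by fastforce
 then have nc: "~ collinear {e, x, c}" by (simp add: insert_commute)
 have "a \<in> interior (convex hull {e, x, c})" unfolding interior_convex_hull_3_minimal[OF nc DIM_complex] mem_Collect_eq
  by (rule exI[of _ "(1 - t) / 2"], rule exI[of _ "(1 - t) / 2"], rule exI[of _ t])
   (use t in \<open>auto simp: a_eq m scaleR_add_right\<close>)
 then have Ta: "winding_number ?T a = (if 0 < side e x a then 1 else -1)" by (simp add: winding_number_triangle side_def)
 have main: "winding_number ?J a = winding_number ?J b + (if 0 < side e x c then 1 else -1)"
  using diff[of a] diff[of b] J1ab Ta Tb sa t by (simp add: zero_less_mult_iff)
 have "winding_number ?J z1 = winding_number ?J z2 + 1"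
  if z: "z1 \<in> ball m \<epsilon>" "z2 \<in> ball m \<epsilon>" "side e x z1 > 0" "side e x z2 < 0" for z1 z2
 proof (cases "side e x c > 0")
  case True
  then have "side e x a > 0" "side e x b < 0" using sa sb t by simp_all
  then have "winding_number ?J z1 = winding_number ?J a" "winding_number ?J z2 = winding_number ?J b"
   using halfJ[OF z(1) ab(1) mult_pos_pos[OF z(3)]] halfJ[OF z(2) ab(2) mult_neg_neg[OF z(4)]] by auto
  then show ?thesis using main True by simp
 next
  case False
  then have "side e x c < 0" using c by simp
  then have "side e x a < 0" "side e x b > 0" using sa sb t by (simp_all add: mult_less_0_iff)
  then have "winding_number ?J z1 = winding_number ?J b" "winding_number ?J z2 = winding_number ?J a"
   using halfJ[OF z(1) ab(2) mult_pos_pos[OF z(3)]] halfJ[OF z(2) ab(1) mult_neg_neg[OF z(4)]] by auto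
  then show ?thesis using main False by simp
 qed
 then show ?thesis using \<epsilon> unfolding m_def[symmetric] by (intro exI[of _ \<epsilon>]) auto
qed

section \<open>Joining lists of paths\<close>

fun chain :: "(real => complex) list => bool" where
 "chain [] = False"
| "chain [p] = path p"
| "chain (p # r # ps) = (path p & pathfinish p = pathstart r & chain (r # ps))"

fun joinps :: "(real => complex) list => real => complex" where
 "joinps [] = undefined"
| "joinps [p] = p"
| "joinps (p # r # ps) = p +++ joinps (r # ps)"

lemma joinps_props:
 "chain ps ==> path (joinps ps) & pathstart (joinps ps) = pathstart (hd ps) &
  pathfinish (joinps ps) = pathfinish (last ps) & path_image (joinps ps) = (\<Union>p\<in>set ps. path_image p)"
 by (induction ps rule: chain.induct) (auto simp: path_image_join)

lemma winding_number_joinps: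
 "chain ps ==> z \<notin> (\<Union>p\<in>set ps. path_image p) ==> winding_number (joinps ps) z = (\<Sum>p\<leftarrow>ps. winding_number p z)"
proof (induction ps rule: chain.induct)
 case (3 p r ps)
 then have c: "chain (r # ps)" by simp
 show ?case
 proof -
  have "path p" "pathfinish p = pathstart (joinps (r # ps))" "z \<notin> path_image p" "z \<notin> path_image (joinps (r # ps))"
   using 3(2,3) joinps_props[OF c] by auto
  moreover have "winding_number (joinps (r # ps)) z = (\<Sum>p\<leftarrow>r # ps. winding_number p z)" using 3(3) by (intro 3(1)[OF c]) auto
  ultimately show ?thesis using joinps_props[OF c] by (simp add: winding_number_join)
 qed
qed auto

lemma chain_append:
 "ps ~= [] ==> qs ~= [] ==> chain (ps @ qs) \<longleftrightarrow> chain ps & chain qs & pathfinish (last ps) = pathstart (hd qs)"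
proof (induction ps rule: chain.induct)
 case (2 p)
 then show ?case by (cases qs) auto
qed auto

lemma arc_joinps:
 assumes "chain ps" "!!i. i < length ps ==> arc (ps ! i)"
  "!!i j. i < j ==> j < length ps ==>
   path_image (ps ! i) \<inter> path_image (ps ! j) \<subseteq> (if j = Suc i then {pathstart (ps ! j)} else {})"
 shows "arc (joinps ps)" using assms
proof (induction ps rule: chain.induct)
 case (3 p r ps)
 have c: "chain (r # ps)" using 3 by simp
 have "arc (joinps (r # ps))"
 proof (rule 3(1)[OF c])
  fix i assume "i < length (r # ps)"
  then show "arc ((r # ps) ! i)" using "3.prems"(2)[of "Suc i"] by simp
 next
  fix i j assume "i < j" "j < length (r # ps)"
  then show "path_image ((r # ps) ! i) \<inter> path_image ((r # ps) ! j) \<subseteq> (if j = Suc i then {pathstart ((r # ps) ! j)} else {})"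
   using "3.prems"(3)[of "Suc i" "Suc j"] by (simp only: nth_Cons_Suc Suc_less_eq length_Cons nat.inject)
 qed
 moreover have "path_image p \<inter> path_image (joinps (r # ps)) \<subseteq> {pathstart (joinps (r # ps))}"
 proof -
  have "path_image p \<inter> path_image ((r # ps) ! j) \<subseteq> {pathstart r}" if "j < length (r # ps)" for j
   using "3.prems"(3)[of 0 "Suc j"] that by (cases j) auto
  then have "path_image p \<inter> path_image s \<subseteq> {pathstart r}" if "s \<in> set (r # ps)" for s using that by (metis in_set_conv_nth)
  then show ?thesis using joinps_props[OF c] by auto
 qed
 moreover have "arc p" using "3.prems"(2)[of 0] by simp
 ultimately show ?case using 3(2) joinps_props[OF c] by (auto intro!: arc_join)
qed auto

text \<open>The Jordan curve theorem: 0 outside and a constant \<open>s\<close> inside, the sign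
  being the orientation of the curve.\<close>

lemma simple_closed_path_winding_number_values:
 assumes "simple_path \<gamma>" "pathfinish \<gamma> = pathstart \<gamma>"
 shows "\<exists>s\<in>{1, -1}. \<forall>z. z \<notin> path_image \<gamma> --> winding_number \<gamma> z \<in> {0, s}"
proof -
 have o: "winding_number \<gamma> z = 0" if "z \<notin> path_image \<gamma>" "z \<notin> inside (path_image \<gamma>)" for z
 proof (rule winding_number_zero_in_outside)
  show "path \<gamma>" using assms by (simp add: simple_path_imp_path)
  show "z \<in> outside (path_image \<gamma>)" using that inside_Un_outside by blast
 qed (rule assms(2))
 show ?thesis
 proof (rule simple_closed_path_winding_number_inside[OF assms(1)])
  assume "!!z. z \<in> inside (path_image \<gamma>) ==> winding_number \<gamma> z = 1"
  then show ?thesis using o by (intro bexI[of _ 1]) auto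
 next
  assume "!!z. z \<in> inside (path_image \<gamma>) ==> winding_number \<gamma> z = -1"
  then show ?thesis using o by (intro bexI[of _ "-1"]) auto
 qed
qed

text \<open>A polygon of five edges: down from height -1 to -2, left beyond \<open>- M\<close>, up
  to height 3, right, and down to height 2. It passes around everything that lies between the
  heights -1 and 2 with real part at least \<open>- M\<close>.\<close>

lemma closing_arc:
 assumes "\<bar>r0\<bar> < M" "\<bar>r1\<bar> < M"
 shows "\<exists>K. arc K & pathstart K = Complex r1 (-1) & pathfinish K = Complex r0 2 &
  (\<forall>z\<in>path_image K. Im z < -1 | Im z > 2 | Re z < - M | z = Complex r1 (-1) | z = Complex r0 2)"
proof -
 define c where "c = - M - 1"
 let ?K4 = "linepath (Complex r0 3) (Complex r0 2)"
 let ?K3 = "linepath (Complex c 3) (Complex r0 3)"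
 let ?K2 = "linepath (Complex c (-2)) (Complex c 3)"
 let ?K1 = "linepath (Complex r1 (-2)) (Complex c (-2))"
 let ?K0 = "linepath (Complex r1 (-1)) (Complex r1 (-2))"
 have v: "Re z = r & min a b <= Im z & Im z <= max a b" if "z \<in> closed_segment (Complex r a) (Complex r b)" for z r a b
  using that by (auto simp: closed_segment_same_Re closed_segment_eq_real_ivl split: if_splits)
 have h: "Im z = r & min a b <= Re z & Re z <= max a b" if "z \<in> closed_segment (Complex a r) (Complex b r)" for z r a b
  using that by (auto simp: closed_segment_same_Im closed_segment_eq_real_ivl split: if_splits)
 have c: "c < r0" "c < r1" "c < - M" using assms by (auto simp: c_def)
 have 4: "arc ?K4" by (simp add: complex_eq_iff)
 have 34: "arc (?K3 +++ ?K4)" using c by (intro arc_join 4) (auto simp: complex_eq_iff dest!: v h)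
 have 234: "arc (?K2 +++ ?K3 +++ ?K4)" using c by (intro arc_join 34) (auto simp: complex_eq_iff path_image_join dest!: v h)
 have 1234: "arc (?K1 +++ ?K2 +++ ?K3 +++ ?K4)" using c by (intro arc_join 234) (auto simp: complex_eq_iff path_image_join dest!: v h)
 have 01234: "arc (?K0 +++ ?K1 +++ ?K2 +++ ?K3 +++ ?K4)" using c by (intro arc_join 1234) (auto simp: complex_eq_iff path_image_join dest!: v h)
 moreover have "Im z < -1 | Im z > 2 | Re z < - M | z = Complex r1 (-1) | z = Complex r0 2"
  if "z \<in> path_image (?K0 +++ ?K1 +++ ?K2 +++ ?K3 +++ ?K4)" for z using that c by (auto simp: path_image_join complex_eq_iff dest!: v h)
 ultimately show ?thesis by (intro exI[of _ "?K0 +++ ?K1 +++ ?K2 +++ ?K3 +++ ?K4"]) auto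
qed

text \<open>A closed curve runs downwards through boxes \<open>0, \<dots>, n\<close>, along the segment from \<open>e i\<close> to \<open>x i\<close> in
 the box \<open>i\<close>, and along \<open>K\<close> back to the first box. Since it is simple, crossing it from left to right
 has the same effect in all boxes.\<close>

locale box_curve =
 fixes n :: nat and p q e x :: "nat => complex" and \<delta> :: "nat => real => complex" and K :: "real => complex"
 assumes npos: "0 < n"
  and pq: "!!i. i <= n ==> Re (p i) < Re (q i) & Im (p i) < Im (q i)"
  and e: "!!i. i <= n ==> Im (e i) = Im (q i) & Re (p i) <= Re (e i) & Re (e i) <= Re (q i)"
  and x: "!!i. i <= n ==> Im (x i) = Im (p i) & Re (p i) <= Re (x i) & Re (x i) <= Re (q i)"
  and bb: "!!i j. i < j ==> j <= n ==> cbox (p i) (q i) \<inter> cbox (p j) (q j) = {}"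
  and \<delta>: "!!i. i < n ==> arc (\<delta> i) & pathstart (\<delta> i) = x i & pathfinish (\<delta> i) = e (Suc i)"
  and \<delta>\<delta>: "!!i j. i < j ==> j < n ==> path_image (\<delta> i) \<inter> path_image (\<delta> j) = {}"
  and \<delta>b: "!!i j. i < n ==> j <= n ==> path_image (\<delta> i) \<inter> cbox (p j) (q j) \<subseteq>
   (if j = i then {x i} else if j = Suc i then {e (Suc i)} else {})"
  and K: "arc K" "pathstart K = x n" "pathfinish K = e 0"
  and Kb: "!!j. j <= n ==> path_image K \<inter> cbox (p j) (q j) \<subseteq> (if j = n then {x n} else if j = 0 then {e 0} else {})"
  and K\<delta>: "!!i. i < n ==> path_image K \<inter> path_image (\<delta> i) = {}"
begin

definition seg :: "nat => real => complex" where "seg i = linepath (e i) (x i)"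

text \<open>Numbering the pieces of the closed curve cyclically, segments at even and arcs at odd
  indices, lets continuity, disjointness and rotation of the curve be expressed by indices.\<close>

definition P :: "nat => real => complex" where
 "P k = (if k = 2 * n + 1 then K else if even k then seg (k div 2) else \<delta> (k div 2))"

definition N :: nat where "N = 2 * n + 2"

definition L :: "(real => complex) list" where "L = map P [0..<N]"

definition \<Gamma> :: "complex set" where
 "\<Gamma> = (\<Union>i\<le>n. closed_segment (e i) (x i)) \<union> (\<Union>i<n. path_image (\<delta> i)) \<union> path_image K"

lemma P_simps: "i <= n ==> P (2 * i) = seg i" "i < n ==> P (2 * i + 1) = \<delta> i" "P (2 * n + 1) = K" unfolding P_def by auto

lemma P_cases:
 assumes "k < N"
 obtains i where "i <= n" "k = 2 * i" "P k = seg i" | i where "i < n" "k = 2 * i + 1" "P k = \<delta> i" | "k = 2 * n + 1" "P k = K"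
proof -
 have k: "k = 2 * (k div 2) | k = 2 * (k div 2) + 1" by presburger
 show ?thesis
 proof (cases "k = 2 * n + 1")
  case False
  from k show ?thesis
  proof
   assume 1: "k = 2 * (k div 2)"
   then have "k div 2 <= n" using assms by (simp add: N_def)
   then show ?thesis using that(1)[of "k div 2"] 1 P_simps(1) by metis
  next
   assume 1: "k = 2 * (k div 2) + 1"
   then have "k div 2 < n" using assms False by (simp add: N_def)
   then show ?thesis using that(2)[of "k div 2"] 1 P_simps(2) by metis
  qed
 qed (use that(3) P_simps(3) in blast)
qed

lemma in_box: "i <= n ==> e i \<in> cbox (p i) (q i)" "i <= n ==> x i \<in> cbox (p i) (q i)"
 using pq[of i] e[of i] x[of i] by (auto simp: in_cbox_complex_iff)

lemma ex_neq: "i <= n ==> e i ~= x i" using pq[of i] e[of i] x[of i] by auto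

lemma seg_box: "i <= n ==> path_image (seg i) \<subseteq> cbox (p i) (q i)"
 unfolding seg_def using in_box[of i] by (simp add: closed_segment_subset)

lemma P_path: "k < N ==> arc (P k)" by (erule P_cases) (use ex_neq \<delta> K in \<open>auto simp: seg_def\<close>)

lemma P_next: "Suc k < N ==> pathfinish (P k) = pathstart (P (Suc k))"
proof -
 assume k: "Suc k < N"
 then have "k < N" by simp
 then show ?thesis
 proof (cases rule: P_cases)
  case (1 i)
  show ?thesis
  proof (cases "i = n")
   case True
   then show ?thesis using 1 P_simps(3) K by (simp add: seg_def)
  next
   case False
   then show ?thesis using 1 P_simps(2)[of i] \<delta>[of i] by (simp add: seg_def)
  qed
 next
  case (2 i)
  then show ?thesis using P_simps(1)[of "Suc i"] \<delta>[of i] by (simp add: seg_def)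
 qed (use k in \<open>simp add: N_def\<close>)
qed

lemma chain_map: "a < b ==> b <= N ==> chain (map P [a..<b])"
proof (induction "b - a" arbitrary: a)
 case (Suc d)
 have s: "[a..<b] = a # [Suc a..<b]" using Suc by (simp add: upt_conv_Cons)
 show ?case
 proof (cases "Suc a = b")
  case True
  then show ?thesis using s P_path[of a] Suc.prems by (simp add: arc_imp_path)
 next
  case False
  then have "chain (map P [Suc a..<b])" using Suc by simp
  moreover have "[Suc a..<b] = Suc a # [Suc (Suc a)..<b]" using False Suc.prems by (simp add: upt_conv_Cons)
  ultimately show ?thesis using s P_path[of a] P_next[of a] Suc.prems False by (simp add: arc_imp_path)
 qed
qed simp

lemma image_L: "(\<Union>r\<in>set L. path_image r) = \<Gamma>"
proof
 show "(\<Union>r\<in>set L. path_image r) \<subseteq> \<Gamma>"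
 proof
  fix z assume "z \<in> (\<Union>r\<in>set L. path_image r)"
  then obtain k where k: "k < N" "z \<in> path_image (P k)" unfolding L_def by auto
  from k(1) show "z \<in> \<Gamma>" by (cases rule: P_cases) (use k(2) in \<open>auto simp: \<Gamma>_def seg_def\<close>)
 qed
 have PL: "P k \<in> set L" if "k < N" for k unfolding L_def using that by simp
 have 1: "seg i \<in> set L" if "i <= n" for i using PL[of "2 * i"] P_simps(1)[OF that] that by (simp add: N_def)
 have 2: "\<delta> i \<in> set L" if "i < n" for i using PL[of "2 * i + 1"] P_simps(2)[OF that] that by (simp add: N_def)
 have 3: "K \<in> set L" using PL[of "2 * n + 1"] P_simps(3) by (simp add: N_def)
 show "\<Gamma> \<subseteq> (\<Union>r\<in>set L. path_image r)"
 proof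
  fix z assume "z \<in> \<Gamma>"
  then consider i where "i <= n" "z \<in> path_image (seg i)" | i where "i < n" "z \<in> path_image (\<delta> i)" | "z \<in> path_image K"
   unfolding \<Gamma>_def seg_def by auto
  then show "z \<in> (\<Union>r\<in>set L. path_image r)" by cases (use 1 2 3 in blast)+
 qed
qed

lemma P_disjoint:
 assumes "k < l" "l < N"
 shows "path_image (P k) \<inter> path_image (P l) \<subseteq>
  (if l = Suc k then {pathstart (P l)} else if k = 0 & l = 2 * n + 1 then {e 0} else {})"
proof -
 have "k < N" using assms by simp
 then show ?thesis
 proof (cases rule: P_cases)
  case k: (1 i)
  note si = seg_box[OF k(1)]
  from assms(2) show ?thesis
  proof (cases rule: P_cases)
   case (1 j)
   then have "i < j" using k assms by simp
   then show ?thesis using bb[of i j] si seg_box[OF 1(1)] 1 k by auto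
  next
   case (2 j)
   then have "i <= j" "l = Suc k \<longleftrightarrow> j = i" using k assms by auto
   then show ?thesis using \<delta>b[OF 2(1) k(1)] si \<delta>[OF 2(1)] 2 k by (auto split: if_splits)
  next
   case 3
   then show ?thesis using Kb[OF k(1)] si K k npos by (auto split: if_splits)
  qed
 next
  case k: (2 i)
  from assms(2) show ?thesis
  proof (cases rule: P_cases)
   case (1 j)
   then have "i < j" "l = Suc k \<longleftrightarrow> j = Suc i" using k assms by auto
   then show ?thesis using \<delta>b[OF k(1) 1(1)] seg_box[OF 1(1)] 1 k by (auto simp: seg_def split: if_splits)
  next
   case (2 j)
   then have "i < j" using k assms by simp
   then show ?thesis using \<delta>\<delta>[of i j] 2 k by auto
  next
   case 3
   then show ?thesis using K\<delta>[OF k(1)] k by auto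
  qed
 next
  case 3
  then show ?thesis using assms by (simp add: N_def)
 qed
qed

definition W :: "complex => complex" where "W = winding_number (joinps L)"

lemma L_Cons: "L = seg 0 # map P [1..<N]" unfolding L_def using P_simps(1)[of 0] by (subst upt_conv_Cons) (auto simp: N_def)

lemma joinps_Cons: "ps ~= [] ==> joinps (r # ps) = r +++ joinps ps" by (cases ps) auto

lemma simple_L: "simple_path (joinps L)" "pathfinish (joinps L) = pathstart (joinps L)" "path_image (joinps L) = \<Gamma>"
proof -
 let ?r = "map P [1..<N]"
 have N: "1 < N" "0 < N" "N - 1 = 2 * n + 1" by (simp_all add: N_def)
 have c: "chain ?r" "chain L" unfolding L_def using N by (auto intro: chain_map)
 have ne: "?r ~= []" using N by simp
 have hd: "hd ?r = P 1" and la: "last ?r = K" using P_simps(3) N by (simp_all add: hd_map last_map)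
 have P1: "pathstart (P 1) = x 0" using P_next[of 0] P_simps(1)[of 0] N by (simp add: seg_def)
 note r = joinps_props[OF c(1), unfolded hd la]
 have "arc (joinps ?r)"
 proof (rule arc_joinps[OF c(1)])
  fix i assume "i < length ?r"
  then show "arc (?r ! i)" using P_path[of "Suc i"] by simp
 next
  fix i j assume "i < j" "j < length ?r"
  then show "path_image (?r ! i) \<inter> path_image (?r ! j) \<subseteq> (if j = Suc i then {pathstart (?r ! j)} else {})"
   using P_disjoint[of "Suc i" "Suc j"] by (cases "j = Suc i") auto
 qed
 moreover have "path_image (seg 0) \<inter> path_image (joinps ?r) \<subseteq> {pathstart (seg 0), pathstart (joinps ?r)}"
 proof -
  have "path_image (seg 0) \<inter> path_image (P k) \<subseteq> {e 0, x 0}" if "1 <= k" "k < N" for k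
   using P_disjoint[of 0 k] that P_simps(1)[of 0] P1 by (auto split: if_splits)
  then show ?thesis using r P1 by (fastforce simp: seg_def)
 qed
 ultimately show "simple_path (joinps L)" unfolding L_Cons joinps_Cons[OF ne] using r P1 K P_path[OF N(2)] P_simps(1)[of 0]
  by (intro simple_path_join_loop) (simp_all add: seg_def)
 show "pathfinish (joinps L) = pathstart (joinps L)" unfolding L_Cons joinps_Cons[OF ne] using r K by (simp add: seg_def)
 show "path_image (joinps L) = \<Gamma>" using joinps_props[OF c(2)] image_L by simp
qed

lemma W_const: "connected C ==> C \<inter> \<Gamma> = {} ==> y \<in> C ==> z \<in> C ==> W y = W z"
 unfolding W_def using simple_L by (intro winding_number_eq) (auto simp: simple_path_imp_path)

text \<open>The winding number is a sum over the pieces and does not depend on where the curve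
  starts. With the list rotated to begin at box \<open>i\<close>, its segment is the edge of
  \<open>winding_number_jump\<close>; the box contains the triangle, and the rest of the curve meets
  the box at most in the two ends.\<close>

lemma box_jump:
 assumes i: "i <= n"
 shows "\<exists>r. r \<in> W ` (- \<Gamma>) & r - 1 \<in> W ` (- \<Gamma>) &
  (\<forall>z\<in>cbox (p i) (q i). (side (e i) (x i) z > 0 --> W z = r) & (side (e i) (x i) z < 0 --> W z = r - 1))"
proof -
 let ?r = "map P [Suc (2 * i)..<N] @ map P [0..<2 * i]"
 let ?s = "side (e i) (x i)"
 have split: "L = map P [0..<2 * i] @ seg i # map P [Suc (2 * i)..<N]"
 proof -
  have "[0..<N] = [0..<2 * i] @ [2 * i..<N]" using i upt_add_eq_append[of 0 "2 * i" "N - 2 * i"] by (simp add: N_def del: upt_Suc)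
  also have "[2 * i..<N] = 2 * i # [Suc (2 * i)..<N]" using i by (subst upt_conv_Cons) (auto simp: N_def)
  finally show ?thesis unfolding L_def using P_simps(1)[OF i] by simp
 qed
 have N: "Suc (2 * i) < N" "N - 1 = 2 * n + 1" "2 * i <= N" "0 < N" using i by (simp_all add: N_def)
 have c1: "chain (map P [Suc (2 * i)..<N])" using N by (intro chain_map) auto
 have ne1: "map P [Suc (2 * i)..<N] ~= []" using N by simp
 have h1: "hd (map P [Suc (2 * i)..<N]) = P (Suc (2 * i))" "last (map P [Suc (2 * i)..<N]) = K"
  using N P_simps(3) by (simp_all add: hd_map last_map)
 have s1: "pathstart (P (Suc (2 * i))) = x i" using P_next[of "2 * i"] P_simps(1)[OF i] N by (simp add: seg_def)
 have cr: "chain ?r & pathstart (hd ?r) = x i & pathfinish (last ?r) = e i"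
 proof (cases "i = 0")
  case True
  then show ?thesis using c1 h1 s1 K ne1 by (simp add: hd_map last_map P_simps(3)[simplified])
 next
  case False
  then have c0: "chain (map P [0..<2 * i])" "map P [0..<2 * i] ~= []" using N by (auto intro!: chain_map)
  have h0: "hd (map P [0..<2 * i]) = seg 0" "last (map P [0..<2 * i]) = P (2 * i - 1)"
   using False P_simps(1)[of 0] by (simp_all add: hd_map last_map)
  have "pathfinish (P (2 * i - 1)) = e i" using P_next[of "2 * i - 1"] P_simps(1)[OF i] N False by (simp add: seg_def)
  then show ?thesis using chain_append[OF ne1 c0(2)] c0 c1 h0 h1 s1 K ne1 by (auto simp: seg_def)
 qed
 have rne: "?r ~= []" using N by simp
 note jr = joinps_props[OF conjunct1[OF cr]]
 have setr: "\<exists>k<N. k ~= 2 * i & r = P k" if "r \<in> set ?r" for r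
 proof -
  have "r \<in> P ` (set [Suc (2 * i)..<N] \<union> set [0..<2 * i])" using that by (simp add: image_Un)
  then obtain k where "k \<in> set [Suc (2 * i)..<N] \<union> set [0..<2 * i]" "r = P k" by blast
  then show ?thesis using N by (intro exI[of _ k]) auto
 qed
 have rb: "path_image (joinps ?r) \<inter> cbox (p i) (q i) \<subseteq> {e i, x i}"
 proof
  fix z assume z: "z \<in> path_image (joinps ?r) \<inter> cbox (p i) (q i)"
  then obtain r where "r \<in> set ?r" "z \<in> path_image r" using jr by blast
  then obtain k where k: "k < N" "k ~= 2 * i" "z \<in> path_image (P k)" using setr by blast
  from k(1) show "z \<in> {e i, x i}"
  proof (cases rule: P_cases)
   case (1 j)
   then have "z \<in> cbox (p j) (q j)" "i ~= j" using seg_box[OF 1(1)] k by auto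
   then show ?thesis using bb[of i j] bb[of j i] i 1(1) z by (metis IntD2 IntI empty_iff linorder_neqE_nat)
  next
   case (2 j)
   then show ?thesis using \<delta>b[OF 2(1) i] z k by (auto split: if_splits)
  next
   case 3
   then show ?thesis using Kb[OF i] z k by (auto split: if_splits)
  qed
 qed
 have box: "convex (cbox (p i) (q i))" by (rule convex_box)
 have s_eq: "?s (Complex a (Im (q i))) = (a - Re (e i)) * (Im (q i) - Im (p i))" for a
  using e[OF i] x[OF i] by (simp add: side_def algebra_simps)
 \<comment> \<open>A corner on the top side different from \<open>e i\<close>. It is off the line
   through \<open>e i\<close> and \<open>x i\<close>, because \<open>x i\<close> lies on the bottom
   side.\<close>
 obtain c where c: "c \<in> cbox (p i) (q i)" "?s c ~= 0"
 proof (cases "Re (e i) = Re (p i)")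
  case True
  then show ?thesis using that[of "Complex (Re (q i)) (Im (q i))"] pq[OF i] s_eq[of "Re (q i)"] by (auto simp: in_cbox_complex_iff)
 next
  case False
  then show ?thesis using that[of "Complex (Re (p i)) (Im (q i))"] pq[OF i] s_eq[of "Re (p i)"] by (auto simp: in_cbox_complex_iff)
 qed
 have "convex hull {e i, x i, c} \<subseteq> cbox (p i) (q i)" using c in_box[OF i] by (intro hull_minimal box) auto
 then have d: "path_image (joinps ?r) \<inter> convex hull {e i, x i, c} \<subseteq> {e i, x i}" using rb by blast
 let ?m = "midpoint (e i) (x i)" and ?J = "seg i +++ joinps ?r"
 obtain \<epsilon> where \<epsilon>: "\<epsilon> > 0" "ball ?m \<epsilon> \<inter> path_image (joinps ?r) = {}" and
  jump: "!!z1 z2. z1 \<in> ball ?m \<epsilon> ==> z2 \<in> ball ?m \<epsilon> ==> ?s z1 > 0 ==> ?s z2 < 0 ==>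
   winding_number ?J z1 = winding_number ?J z2 + 1"
  using winding_number_jump[of "joinps ?r" "x i" "e i" c] jr cr c(2) d unfolding seg_def by metis

 have \<Gamma>_eq: "\<Gamma> = closed_segment (e i) (x i) \<union> path_image (joinps ?r)"
  using jr image_L unfolding split by (auto simp: seg_def)
 have WJ: "W z = winding_number ?J z" if "z \<notin> \<Gamma>" for z
 proof -
  have cL: "chain L" unfolding L_def using N by (intro chain_map) auto
  have cc: "chain (seg i # ?r)" using rne cr ex_neq[OF i] by (cases ?r) (auto simp: seg_def)
  have "W z = (\<Sum>r\<leftarrow>L. winding_number r z)" unfolding W_def using cL that image_L by (intro winding_number_joinps) auto
  also have "\<dots> = (\<Sum>r\<leftarrow>seg i # ?r. winding_number r z)" unfolding split by simp
  also have "\<dots> = winding_number (joinps (seg i # ?r)) z"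
   using cc that image_L unfolding split by (intro winding_number_joinps[symmetric]) auto
  finally show ?thesis unfolding joinps_Cons[OF rne] .
 qed
 have m0: "?s ?m = 0" by (rule side_segment) simp
 have mbox: "?m \<in> cbox (p i) (q i)"
  using closed_segment_subset[OF in_box(1)[OF i] in_box(2)[OF i] box] by (metis midpoint_in_closed_segment subsetD)
 have pos: "\<exists>z\<in>ball ?m \<epsilon>. ?s z > 0 & z \<notin> \<Gamma>" and neg: "\<exists>z\<in>ball ?m \<epsilon>. ?s z < 0 & z \<notin> \<Gamma>"
  and near: "!!z. ?s z ~= 0 ==> \<exists>t. 0 < t & t <= 1 & ?m + t *\<^sub>R (z - ?m) \<in> ball ?m \<epsilon>"
 proof -
  show near: "\<exists>t. 0 < t & t <= 1 & ?m + t *\<^sub>R (z - ?m) \<in> ball ?m \<epsilon>" if "?s z ~= 0" for z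
  proof -
   have d: "z - ?m ~= 0" using that m0 by auto
   define t where "t = min 1 (\<epsilon> / (2 * norm (z - ?m)))"
   have "0 < t" "t <= 1" "t * norm (z - ?m) < \<epsilon>" using \<epsilon>(1) d by (auto simp: t_def min_def field_simps)
   then show ?thesis by (intro exI[of _ t]) (auto simp: dist_norm)
  qed
  have st: "?s (?m + t *\<^sub>R (z - ?m)) = t * ?s z" for t z
  proof -
   have "?m + t *\<^sub>R (z - ?m) = (1 - t) *\<^sub>R ?m + t *\<^sub>R z" by (simp add: algebra_simps)
   then show ?thesis using side_affine[of "1 - t" t "e i" "x i" ?m z] m0 by simp
  qed
  obtain t where t: "0 < t" "?m + t *\<^sub>R (c - ?m) \<in> ball ?m \<epsilon>" using near[OF c(2)] by blast
  then have t': "?m + (- t) *\<^sub>R (c - ?m) \<in> ball ?m \<epsilon>" by (simp add: dist_norm)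
  have n\<Gamma>: "z \<notin> \<Gamma>" if "z \<in> ball ?m \<epsilon>" "?s z ~= 0" for z
   using that \<epsilon>(2) side_segment unfolding \<Gamma>_eq by blast
  show "\<exists>z\<in>ball ?m \<epsilon>. ?s z > 0 & z \<notin> \<Gamma>"
  proof (cases "?s c > 0")
   case True
   then have "?s (?m + t *\<^sub>R (c - ?m)) > 0" unfolding st using t by simp
   then show ?thesis using t n\<Gamma>[OF t(2)] by (intro bexI[OF _ t(2)]) auto
  next
   case False
   then have "?s (?m + (- t) *\<^sub>R (c - ?m)) > 0" unfolding st using t c(2) by (simp add: mult_less_0_iff)
   then show ?thesis using n\<Gamma>[OF t'] by (intro bexI[OF _ t']) auto
  qed
  show "\<exists>z\<in>ball ?m \<epsilon>. ?s z < 0 & z \<notin> \<Gamma>"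
  proof (cases "?s c > 0")
   case True
   then have "?s (?m + (- t) *\<^sub>R (c - ?m)) < 0" unfolding st using t by simp
   then show ?thesis using n\<Gamma>[OF t'] by (intro bexI[OF _ t']) auto
  next
   case False
   then have "?s (?m + t *\<^sub>R (c - ?m)) < 0" unfolding st using t c(2) by (simp add: mult_less_0_iff)
   then show ?thesis using t n\<Gamma>[OF t(2)] by (intro bexI[OF _ t(2)]) auto
  qed
 qed
 obtain zp zn where zp: "zp \<in> ball ?m \<epsilon>" "?s zp > 0" "zp \<notin> \<Gamma>" and zn: "zn \<in> ball ?m \<epsilon>" "?s zn < 0" "zn \<notin> \<Gamma>"
  using pos neg by blast
 \<comment> \<open>Contract towards the midpoint inside the box, staying on one side of the segment,
   until the small ball is reached.\<close>
 have half: "W z = W z'" if z: "z \<in> cbox (p i) (q i)" "z' \<in> ball ?m \<epsilon>" and s: "?s z * ?s z' > 0" for z z'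
 proof -
  have "?s z ~= 0" using s by auto
  then obtain t where t: "0 < t" "t <= 1" "?m + t *\<^sub>R (z - ?m) \<in> ball ?m \<epsilon>" using near by blast
  define y where "y = ?m + t *\<^sub>R (z - ?m)"
  have y_eq: "y = (1 - t) *\<^sub>R ?m + t *\<^sub>R z" by (simp add: y_def algebra_simps)
  have sy: "?s y = t * ?s z" unfolding y_eq using side_affine[of "1 - t" t] m0 by simp
  have yb: "y \<in> cbox (p i) (q i)" unfolding y_eq using t mbox z(1) by (intro convexD[OF box]) auto
  obtain H where H: "convex H" "H \<inter> closed_segment (e i) (x i) = {}" "z \<in> H" "y \<in> H" "z' \<in> H"
  proof (cases "?s z > 0")
   case True
   then have "?s y > 0" "?s z' > 0" using sy t s by (auto simp: zero_less_mult_iff)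
   moreover have "{z. ?s z > 0} \<inter> closed_segment (e i) (x i) = {}" using side_segment by fastforce
   ultimately show ?thesis using that[OF convex_side(1)] True by simp
  next
   case False
   then have "?s z < 0" "?s y < 0" "?s z' < 0" using sy t s by (auto simp: zero_less_mult_iff mult_less_0_iff)
   moreover have "{z. ?s z < 0} \<inter> closed_segment (e i) (x i) = {}" using side_segment by fastforce
   ultimately show ?thesis using that[OF convex_side(2)] by simp
  qed
  have "W z = W y" by (rule W_const[of "cbox (p i) (q i) \<inter> H"])
    (use H z yb box rb in_box \<Gamma>_eq in \<open>auto intro!: convex_connected convex_Int simp: disjoint_iff\<close>)
  also have "W y = W z'" by (rule W_const[of "ball ?m \<epsilon> \<inter> H"])
    (use H z t \<epsilon>(2) \<Gamma>_eq y_def in \<open>auto intro!: convex_connected convex_Int simp: disjoint_iff\<close>)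
  finally show ?thesis .
 qed
 have "W zn = W zp - 1" using jump[OF zp(1) zn(1) zp(2) zn(2)] WJ zp zn by simp
 then show ?thesis using zp zn half by (intro exI[of _ "W zp"]) (auto simp: mult_neg_neg image_iff Bex_def)
qed

text \<open>In every box the winding number drops from some \<open>r\<close> to
  \<open>r - 1\<close>. A simple closed curve admits only the values 0 and \<open>s\<close>, with
  \<open>s\<close> equal to 1 or -1, so \<open>r\<close> is 1 or 0 according to \<open>s\<close>,
  the same in all boxes.\<close>

theorem sides:
 "\<exists>\<rho>. \<forall>i\<le>n. \<forall>z\<in>cbox (p i) (q i). (side (e i) (x i) z > 0 --> W z = \<rho>) & (side (e i) (x i) z < 0 --> W z = \<rho> - 1)"
proof -
 obtain s :: complex where s: "s \<in> {1, -1}" "!!z. z \<notin> \<Gamma> ==> W z \<in> {0, s}"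
  using simple_closed_path_winding_number_values[OF simple_L(1,2)] unfolding W_def simple_L(3) by blast
 have r: "r = (if s = 1 then 1 else 0)" if "r \<in> W ` (- \<Gamma>)" "r - 1 \<in> W ` (- \<Gamma>)" for r
 proof -
  have "r \<in> {0, s}" "r - 1 \<in> {0, s}" using that by (elim imageE; use s(2) in simp)+
  then show ?thesis using s(1) by (auto simp: algebra_simps)
 qed
 show ?thesis
 proof (intro exI allI impI)
  fix i assume "i <= n"
  from box_jump[OF this] obtain r' where r': "r' \<in> W ` (- \<Gamma>)" "r' - 1 \<in> W ` (- \<Gamma>)" and
   "\<forall>z\<in>cbox (p i) (q i). (side (e i) (x i) z > 0 --> W z = r') & (side (e i) (x i) z < 0 --> W z = r' - 1)" by blast
  then show "\<forall>z\<in>cbox (p i) (q i). (side (e i) (x i) z > 0 --> W z = (if s = 1 then 1 else 0)) &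
   (side (e i) (x i) z < 0 --> W z = (if s = 1 then 1 else 0) - 1)" by (simp only: r[OF r'])
 qed
qed

end

section \<open>Flow lines of a periodic drawing\<close>

text \<open>An order isomorphism onto an interval of the line: strictly increasing, with no gaps in
  the image.\<close>

definition lift_ok :: "(ivl => real) => bool" where
 "lift_ok g \<longleftrightarrow> (\<forall>s t. pt s < pt t --> g s < g t) & (\<forall>s t y. g s < y --> y < g t --> y \<in> range g)"

lemma lift_ok_less: "lift_ok g ==> g s < g t \<longleftrightarrow> pt s < pt t"
 unfolding lift_ok_def by (metis less_asym linorder_neqE_linordered_idom pt_eq_iff)

text \<open>A drawing in the strip \<open>0 <= Im z <= 1\<close> invariant under \<open>z \<mapsto> z + 1\<close>: the boxes and wires below
 represent the orbits, and the lower end of the wire \<open>x\<close> lies on the translate by \<open>a x\<close> of the box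
 (or of the bottom side of the frame) to which it is attached.\<close>

locale strip = ww_diagram A R w dg for A :: "'a set" and R w dg +
 fixes p q :: "nat => complex" and g :: "nat => real => complex" and a :: "nat => int" and X0 X1 :: "nat => real"
 assumes box: "!!T. T \<in> transistors dg ==> Re (p T) < Re (q T) & 0 < Im (p T) & Im (p T) < Im (q T) & Im (q T) < 1"
  and wire: "!!x. x \<in> wires dg ==> arc (g x)"
  and wire_strip: "!!x s. x \<in> wires dg ==> s \<in> {0<..<1} ==> 0 < Im (g x s) & Im (g x s) < 1"
  and top_T: "!!T x. T \<in> transistors dg ==> x \<in> set (ttop dg T) ==>
   Re (p T) <= X0 x & X0 x <= Re (q T) & pathstart (g x) = Complex (X0 x + a x) (Im (q T))"
  and top_T_sorted: "!!T. T \<in> transistors dg ==> sorted_wrt (<) (map X0 (ttop dg T))"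
  and bot_T: "!!T x. T \<in> transistors dg ==> x \<in> set (tbot dg T) ==>
   Re (p T) <= X1 x & X1 x <= Re (q T) & pathfinish (g x) = Complex (X1 x) (Im (p T))"
  and bot_T_sorted: "!!T. T \<in> transistors dg ==> sorted_wrt (<) (map X1 (tbot dg T))"
  and top_F: "!!x. x \<in> set (ftop dg) ==> pathfinish (g x) = Complex (X1 x) 1"
  and top_F_sorted: "sorted_wrt (<) (map X1 (ftop dg))"
  and top_F_width: "!!x y. x \<in> set (ftop dg) ==> y \<in> set (ftop dg) ==> X1 x < X1 y + 1"
  and bot_F: "!!x. x \<in> set (fbot dg) ==> pathstart (g x) = Complex (X0 x + a x) 0"
  and bot_F_sorted: "sorted_wrt (<) (map X0 (fbot dg))"
  and bot_F_width: "!!x y. x \<in> set (fbot dg) ==> y \<in> set (fbot dg) ==> X0 x < X0 y + 1"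
  and box_box: "!!S T z j. S \<in> transistors dg ==> T \<in> transistors dg ==> z \<in> cbox (p S) (q S) ==>
   z + of_int j \<in> cbox (p T) (q T) ==> S = T & j = 0"
  and wire_wire: "!!x y s t j. x \<in> wires dg ==> y \<in> wires dg ==> s \<in> {0..1} ==> t \<in> {0..1} ==>
   g x s = g y t + of_int j ==> x = y & j = 0"
  and wire_box: "!!x T s j. x \<in> wires dg ==> T \<in> transistors dg ==> s \<in> {0<..<1} ==>
   g x s + of_int j \<notin> cbox (p T) (q T)"
begin

text \<open>Real-valued lifts of the charts. A wire may lead down to another translate of a box, so
  \<open>a x\<close> is subtracted before its chart enters the box; modulo 1 this is
  invisible.\<close>

definition C :: "nat => ivl => real" where
 "C = (SOME c. map c (ftop dg) = pieces (length (ftop dg)) pt & (\<forall>T\<in>transistors dg.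
  map c (tbot dg T) = pieces (length (tbot dg T)) (joinl (map (%x t. c x t - a x) (ttop dg T)))))"

definition M :: "nat => ivl => real" where "M T = joinl (map (%x t. C x t - a x) (ttop dg T))"
definition F :: "ivl => real" where "F = joinl (map (%x t. C x t - a x) (fbot dg))"

lemma C_props: "map C (ftop dg) = pieces (length (ftop dg)) pt"
 "T \<in> transistors dg ==> map C (tbot dg T) = pieces (length (tbot dg T)) (M T)"
 using someI_ex[OF ex_general_charting[of pt "%x c t. c t - a x"], folded C_def] unfolding M_def by auto

lemma C_ftop: "i < length (ftop dg) ==> C (ftop dg ! i) t = pt (emb (length (ftop dg)) i t)"
 using arg_cong[OF C_props(1), of "%l. (l ! i) t"] by (simp add: pieces_nth)

lemma C_tbot: "T \<in> transistors dg ==> i < length (tbot dg T) ==> C (tbot dg T ! i) t = M T (emb (length (tbot dg T)) i t)"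
 using arg_cong[OF C_props(2), of T "%l. (l ! i) t"] by (simp add: pieces_nth)

lemma M_emb: "i < length (ttop dg T) ==> M T (emb (length (ttop dg T)) i t) = C (ttop dg T ! i) t - a (ttop dg T ! i)"
 using joinl_emb[of i "map (%x t. C x t - a x) (ttop dg T)" t] by (simp add: M_def)

lemma F_emb: "i < length (fbot dg) ==> F (emb (length (fbot dg)) i t) = C (fbot dg ! i) t - a (fbot dg ! i)"
 using joinl_emb[of i "map (%x t. C x t - a x) (fbot dg)" t] by (simp add: F_def)

definition red :: "real => ivl" where "red r = mk (frac r)"

lemma pt_red: "pt (red r) = frac r" unfolding red_def by (intro pt_mk) (simp_all add: frac_lt_1)

lemma red_minus: "red (r - of_int k) = red r" unfolding red_def frac_def by simp

definition c0 :: "nat => ivl => ivl" where "c0 x = red \<circ> C x"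

lemma c0_joinl: "xs ~= [] ==> joinl (map c0 xs) = red \<circ> joinl (map (%x t. C x t - a x) xs)"
proof -
 assume "xs ~= []"
 then have "red \<circ> joinl (map (%x t. C x t - a x) xs) = joinl (map ((\<circ>) red) (map (%x t. C x t - a x) xs))"
  by (intro joinl_comp[symmetric]) simp
 also have "map ((\<circ>) red) (map (%x t. C x t - a x) xs) = map c0 xs" by (simp add: c0_def red_minus comp_def)
 finally show ?thesis by (rule HOL.sym)
qed

text \<open>Shifts are integers, so the lifts reduced modulo 1 satisfy the equations of a charting.
  What is known about tilings of [0,1) thus transfers to translates on the line.\<close>

lemma charting_c0: "charting dg c0" and tchart_c0: "T \<in> transistors dg ==> tchart dg c0 T = red \<circ> M T"
 and frame_c0: "joinl (map c0 (fbot dg)) = red \<circ> F"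
proof -
 show t: "tchart dg c0 T = red \<circ> M T" if "T \<in> transistors dg" for T
  unfolding tchart_def M_def using nonempty(3)[OF that] by (intro c0_joinl) simp
 show "joinl (map c0 (fbot dg)) = red \<circ> F" unfolding F_def using nonempty(2) by (rule c0_joinl)
 have m: "map c0 xs = map ((\<circ>) red) (map C xs)" for xs by (simp add: c0_def)
 have "red \<circ> pt = id" by (auto simp: red_def fun_eq_iff frac_eq pt_bounds pt_inverse)
 then have "map c0 (ftop dg) = pieces (length (ftop dg)) id" unfolding m C_props(1) pieces_comp[symmetric] by simp
 moreover have "map c0 (tbot dg T) = pieces (length (tbot dg T)) (tchart dg c0 T)" if "T \<in> transistors dg" for T
  unfolding m C_props(2)[OF that] pieces_comp[symmetric] t[OF that] ..
 ultimately show "charting dg c0" unfolding charting_def by blast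
qed

lemma tiling_C:
 assumes "linext dg (Us @ Vs)" "x \<in> live dg Us" "y \<in> live dg Us" "C x s + of_int j = C y t + of_int k"
 shows "x = y & s = t & j = k"
proof -
 have "C x s = C y t - of_int (j - k)" using assms(4) by simp
 then have "c0 x s = c0 y t" using red_minus[of "C y t" "j - k"] by (simp add: c0_def)
 then have "x = y & s = t" using tilingD[OF charting_tiling[OF charting_c0 assms(1)] assms(2,3)] by blast
 then show ?thesis using assms(4) by simp
qed

lemma M_inj: "T \<in> transistors dg ==> M T s + of_int j = M T t + of_int k ==> s = t & j = k"
proof -
 assume T: "T \<in> transistors dg" and e: "M T s + of_int j = M T t + of_int k"
 have "M T s = M T t - of_int (j - k)" using e by simp
 then have "tchart dg c0 T s = tchart dg c0 T t" using red_minus[of "M T t" "j - k"] T by (simp add: tchart_c0)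
 then have "s = t" using tchart_inj[OF charting_c0 T] by (simp add: injD)
 then show ?thesis using e by simp
qed

lemma F_inj: "F s + of_int j = F t + of_int k ==> s = t & j = k"
proof -
 assume e: "F s + of_int j = F t + of_int k"
 have "F s = F t - of_int (j - k)" using e by simp
 then have "(red \<circ> F) s = (red \<circ> F) t" using red_minus[of "F t" "j - k"] by simp
 moreover have "inj (red \<circ> F)" using frame_chart(2)[OF charting_c0] unfolding frame_c0 by (rule bij_is_inj)
 ultimately have "s = t" by (meson injD)
 then show ?thesis using e by simp
qed

lemma F_surj: "\<exists>s k. y = F s + of_int k"
proof -
 obtain s where "red (F s) = red y" using frame_chart(2)[OF charting_c0] unfolding frame_c0 by (metis bij_pointE comp_apply)
 then have "frac (F s) = frac y" using pt_red by metis
 then have "y = F s + of_int (\<lfloor>y\<rfloor> - \<lfloor>F s\<rfloor>)" unfolding frac_def by simp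
 then show ?thesis by blast
qed

definition on :: "real => nat => int => bool" where "on u x j \<longleftrightarrow> (\<exists>t. C x t + of_int j = u)"

text \<open>The flow line of \<open>u\<close> runs from the top side of the frame through the translates of wires and boxes
 whose charts take the value \<open>u\<close>.\<close>

definition flow :: "real => nat list => (nat \<times> int) list => (nat \<times> int) list => bool" where
 "flow u Us ws bs \<longleftrightarrow> length ws = Suc (length bs) & fst (ws ! 0) \<in> set (ftop dg) &
   (\<forall>i<length bs. fst (ws ! i) \<in> set (ttop dg (fst (bs ! i))) & snd (bs ! i) = snd (ws ! i) + a (fst (ws ! i)) &
    fst (ws ! Suc i) \<in> set (tbot dg (fst (bs ! i))) & snd (ws ! Suc i) = snd (bs ! i)) &
   set (map fst bs) \<subseteq> set Us & distinct (map fst bs) & fst ` set ws \<subseteq> seen dg Us & distinct (map fst ws) &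
   fst (last ws) \<in> live dg Us & (\<forall>(x, j)\<in>set ws. on u x j) &
   (\<forall>x\<in>seen dg Us. \<forall>j. on u x j --> (x, j) \<in> set ws) &
   (\<forall>T\<in>set Us. \<forall>s k. M T s + of_int k = u --> (T, k) \<in> set bs)"

lemma ex_first:
 obtains i t where "i < length (ftop dg)" "C (ftop dg ! i) t + of_int \<lfloor>u\<rfloor> = u"
proof -
 obtain i t where it: "i < length (ftop dg)" "red u = emb (length (ftop dg)) i t" using emb_surj[of "length (ftop dg)"] nonempty(1) by blast
 then have "C (ftop dg ! i) t = frac u" using C_ftop[OF it(1)] pt_red by metis
 then show ?thesis by (intro that[OF it(1), of t]) (simp add: frac_def)
qed

lemma on_tbot:
 assumes T: "T \<in> transistors dg" and y: "y \<in> set (tbot dg T)" and "on u y j"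
 shows "\<exists>s. M T s + of_int j = u"
proof -
 obtain i where "i < length (tbot dg T)" "tbot dg T ! i = y" using y by (auto simp: in_set_conv_nth)
 then show ?thesis using assms(3) C_tbot[OF T] unfolding on_def by metis
qed

lemma on_ttop:
 assumes x: "x \<in> set (ttop dg T)" and "on u x j"
 shows "\<exists>s. M T s + of_int (j + a x) = u"
proof -
 obtain i t where "i < length (ttop dg T)" "ttop dg T ! i = x" "C x t + of_int j = u"
  using assms unfolding on_def by (auto simp: in_set_conv_nth)
 then show ?thesis using M_emb[of i T t] by (intro exI[of _ "emb (length (ttop dg T)) i t"]) simp
qed

lemma M_on_ttop:
 assumes T: "T \<in> transistors dg" and "M T s + of_int k = u"
 shows "\<exists>x\<in>set (ttop dg T). on u x (k - a x)"
proof -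
 obtain i t where it: "i < length (ttop dg T)" "s = emb (length (ttop dg T)) i t"
  using emb_surj[of "length (ttop dg T)"] nonempty(3)[OF T] by blast
 then have "C (ttop dg T ! i) t + of_int (k - a (ttop dg T ! i)) = u" using M_emb assms(2) by simp
 then show ?thesis using it(1) unfolding on_def by (intro bexI[of _ "ttop dg T ! i"]) auto
qed

lemma M_on_tbot:
 assumes T: "T \<in> transistors dg" and "M T s + of_int k = u"
 shows "\<exists>y\<in>set (tbot dg T). on u y k"
proof -
 obtain i t where it: "i < length (tbot dg T)" "s = emb (length (tbot dg T)) i t"
  using emb_surj[of "length (tbot dg T)"] nonempty(3)[OF T] by blast
 then show ?thesis using C_tbot[OF T it(1)] assms(2) unfolding on_def by (intro bexI[of _ "tbot dg T ! i"]) auto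
qed

lemma on_unique:
 assumes "linext dg (Us @ Vs)" "x \<in> live dg Us" "y \<in> live dg Us" "on u x j" "on u y k"
 shows "x = y & j = k" using assms(4,5) tiling_C[OF assms(1-3)] unfolding on_def by metis

text \<open>The line is extended along a sweep. By the tiling only one live translate carries
  \<open>u\<close>; if that wire enters \<open>T\<close>, the line continues through
  \<open>T\<close> and one of its outputs, and otherwise it misses all translates of
  \<open>T\<close>.\<close>

lemma ex_flow_prefix:
 assumes "linext dg (Ts @ Vs)"
 shows "\<exists>ws bs. flow u Ts ws bs" using assms
proof (induction rule: linext_induct)
 case Nil
 obtain i t where it: "i < length (ftop dg)" "C (ftop dg ! i) t + of_int \<lfloor>u\<rfloor> = u" using ex_first by blast
 let ?x = "ftop dg ! i"
 have x: "?x \<in> live dg []" "on u ?x \<lfloor>u\<rfloor>" using it unfolding live_Nil on_def by auto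
 have un: "y = ?x & j = \<lfloor>u\<rfloor>" if "y \<in> seen dg []" "on u y j" for y j
  using on_unique[of "[]" Ts y ?x u j] that x linext_induct[of _ _ "%_. True"] ex_linext
  using on_unique[of "[]" _ y ?x u j "\<lfloor>u\<rfloor>"] by (metis append_Nil live_Nil seen_Nil)
 have A: "\<forall>z\<in>seen dg []. \<forall>j. on u z j --> (z, j) \<in> set [(?x, \<lfloor>u\<rfloor>)]"
 proof (intro ballI allI impI)
  fix z j assume "z \<in> seen dg []" "on u z j"
  then show "(z, j) \<in> set [(?x, \<lfloor>u\<rfloor>)]" using un[of z j] by simp
 qed
 have "flow u [] [(?x, \<lfloor>u\<rfloor>)] []" unfolding flow_def using x A it(1) by (simp add: live_Nil seen_Nil)
 then show ?case by blast
next
 case (step Us T Ws)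
 note s = linext_step[OF step(1)]
 have le': "linext dg ((Us @ [T]) @ Ws)" using step(1) by simp
 from step(2) obtain ws bs where f: "flow u Us ws bs" by blast
 obtain x j where l: "last ws = (x, j)" by (cases "last ws") auto
 have wne: "ws ~= []" using f unfolding flow_def by auto
 have x: "x \<in> live dg Us" "on u x j" using f l last_in_set[OF wne] unfolding flow_def by auto
 have Tcase: "y = x & k = j + a x" if "y \<in> set (ttop dg T)" "on u y (k - a y)" for y k
 proof -
  have "y = x & k - a y = j" using on_unique[OF step(1) _ x(1) that(2) x(2)] s(4) that(1) by blast
  then show ?thesis by auto
 qed
 show ?case
 proof (cases "x \<in> set (ttop dg T)")
  case True
  obtain r where r: "M T r + of_int (j + a x) = u" using on_ttop[OF True x(2)] by blast
  obtain y where y: "y \<in> set (tbot dg T)" "on u y (j + a x)" using M_on_tbot[OF s(1) r] by blast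
  have yl: "y \<in> live dg (Us @ [T])" using y s(7) by blast
  have yT: "z = y & k = j + a x" if "z \<in> set (tbot dg T)" "on u z k" for z k using on_unique[OF le' _ yl that(2) y(2)] s(7) that(1) by blast
  let ?ws = "ws @ [(y, j + a x)]" and ?bs = "bs @ [(T, j + a x)]"
  have len: "length ws = Suc (length bs)" using f unfolding flow_def by blast
  have lw: "ws ! length bs = (x, j)" using l len wne by (simp add: last_conv_nth)
  have ynew: "y \<notin> fst ` set ws" using f y(1) s(5) unfolding flow_def by blast
  have "flow u (Us @ [T]) ?ws ?bs" unfolding flow_def
  proof (intro conjI allI impI ballI)
   show "length ?ws = Suc (length ?bs)" using len by simp
   show "fst (?ws ! 0) \<in> set (ftop dg)" using f len unfolding flow_def by (simp add: nth_append)
   fix i assume i: "i < length ?bs"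
   have *: "fst (?ws ! i) \<in> set (ttop dg (fst (?bs ! i))) & snd (?bs ! i) = snd (?ws ! i) + a (fst (?ws ! i)) &
    fst (?ws ! Suc i) \<in> set (tbot dg (fst (?bs ! i))) & snd (?ws ! Suc i) = snd (?bs ! i)"
   proof (cases "i < length bs")
    case True
    then show ?thesis using f len unfolding flow_def by (simp add: nth_append)
   next
    case False
    then have "i = length bs" using i by simp
    then show ?thesis using len lw True y by (simp add: nth_append)
   qed
   then show "fst (?ws ! i) \<in> set (ttop dg (fst (?bs ! i)))" "snd (?bs ! i) = snd (?ws ! i) + a (fst (?ws ! i))"
    "fst (?ws ! Suc i) \<in> set (tbot dg (fst (?bs ! i)))" "snd (?ws ! Suc i) = snd (?bs ! i)" by blast+
  next
   show "set (map fst ?bs) \<subseteq> set (Us @ [T])" "distinct (map fst ?bs)" using f s(2) unfolding flow_def by auto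
   show "fst ` set ?ws \<subseteq> seen dg (Us @ [T])" using f y(1) s(8) unfolding flow_def by auto
   show "distinct (map fst ?ws)" using f ynew unfolding flow_def by auto
   show "fst (last ?ws) \<in> live dg (Us @ [T])" using yl by simp
   show "case z of (x, j) => on u x j" if "z \<in> set ?ws" for z using that f y(2) unfolding flow_def by auto
   show "(z, k) \<in> set ?ws" if "z \<in> seen dg (Us @ [T])" "on u z k" for z k using that f yT s(8) unfolding flow_def by auto
   show "(S, k) \<in> set ?bs" if S: "S \<in> set (Us @ [T])" "M S r' + of_int k = u" for S r' k
   proof (cases "S = T")
    case True
    then show ?thesis using M_on_ttop[OF s(1), of r' k u] S(2) Tcase by auto
   next
    case False
    then show ?thesis using S f unfolding flow_def by auto
   qed
  qed
  then show ?thesis by blast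
 next
  case False
  have no: "M T r + of_int k ~= u" for r k using M_on_ttop[OF s(1), of r k u] Tcase False by blast
  then have no': "~ on u z k" if "z \<in> set (tbot dg T)" for z k using on_tbot[OF s(1) that] by blast
  have "flow u (Us @ [T]) ws bs" unfolding flow_def
  proof (intro conjI)
   show "fst (last ws) \<in> live dg (Us @ [T])" using s(7) x(1) l False by simp
   show "\<forall>z\<in>seen dg (Us @ [T]). \<forall>j. on u z j --> (z, j) \<in> set ws" using f no' s(8) unfolding flow_def by auto
   show "\<forall>S\<in>set (Us @ [T]). \<forall>s k. M S s + of_int k = u --> (S, k) \<in> set bs" using f no unfolding flow_def by auto
  qed (use f s(8) in \<open>auto simp: flow_def\<close>)
  then show ?thesis by blast
 qed
qed

end

section \<open>Flow lines do not cross\<close>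

text \<open>On the horizontal sides of a box, the side of the segment is read off from real
  parts.\<close>

lemma side_level:
 "Im z = Im e ==> side e x z = (Re z - Re e) * (Im e - Im x)"
 "Im z = Im x ==> side e x z = (Re z - Re x) * (Im e - Im x)" by (simp_all add: side_def algebra_simps)

lemma sorted_nth_iff:
 fixes h :: "nat => real"
 assumes "sorted_wrt (<) (map h xs)" "i < length xs" "j < length xs"
 shows "h (xs ! i) < h (xs ! j) \<longleftrightarrow> i < j"
 using sorted_wrt_nth_less[OF assms(1), of i j] sorted_wrt_nth_less[OF assms(1), of j i] assms(2,3) by (cases i j rule: linorder_cases) auto

section \<open>Translates of wires and boxes\<close>

context strip
begin

definition gs :: "nat \<times> int => real => complex" where "gs y s = g (fst y) s + of_int (snd y)"

definition tbox :: "nat \<times> int => complex set" where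
 "tbox b = cbox (p (fst b) + of_int (snd b)) (q (fst b) + of_int (snd b))"

lemma tbox_iff: "z \<in> tbox (T, k) \<longleftrightarrow> z - of_int k \<in> cbox (p T) (q T)"
 unfolding tbox_def by (auto simp: in_cbox_complex_iff)

lemma tbox_Im: "T \<in> transistors dg ==> z \<in> tbox (T, k) ==> 0 < Im z & Im z < 1"
 using box[of T] unfolding tbox_def by (auto simp: in_cbox_complex_iff)

lemma gs_arc: "x \<in> wires dg ==> arc (gs (x, j))"
proof -
 assume "x \<in> wires dg"
 then have "arc ((%z. of_int j + z) \<circ> g x)" using wire by (simp add: arc_translation_eq)
 moreover have "(%z. of_int j + z) \<circ> g x = gs (x, j)" by (auto simp: gs_def)
 ultimately show ?thesis by simp
qed

lemma gs_ends: "pathstart (gs (x, j)) = pathstart (g x) + of_int j" "pathfinish (gs (x, j)) = pathfinish (g x) + of_int j"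
 by (simp_all add: gs_def pathstart_def pathfinish_def)

lemma gs_top_T: "T \<in> transistors dg ==> x \<in> set (ttop dg T) ==> pathstart (gs (x, j)) = Complex (X0 x + a x + j) (Im (q T)) &
  pathstart (gs (x, j)) \<in> tbox (T, j + a x)"
 using top_T[of T x] box[of T] by (auto simp: gs_ends tbox_def in_cbox_complex_iff complex_eq_iff)

lemma gs_bot_T: "T \<in> transistors dg ==> x \<in> set (tbot dg T) ==> pathfinish (gs (x, j)) = Complex (X1 x + j) (Im (p T)) &
  pathfinish (gs (x, j)) \<in> tbox (T, j)" using bot_T[of T x] box[of T] by (auto simp: gs_ends tbox_def in_cbox_complex_iff complex_eq_iff)

lemma gs_top_F: "x \<in> set (ftop dg) ==> pathfinish (gs (x, j)) = Complex (X1 x + j) 1"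
 using top_F[of x] by (auto simp: gs_ends complex_eq_iff)

lemma gs_bot_F: "x \<in> set (fbot dg) ==> pathstart (gs (x, j)) = Complex (X0 x + a x + j) 0"
 using bot_F[of x] by (auto simp: gs_ends complex_eq_iff)

lemma gs_cases:
 assumes x: "x \<in> wires dg" and z: "z \<in> path_image (gs (x, j))"
 obtains "z = pathstart (gs (x, j))" | "z = pathfinish (gs (x, j))"
 | "0 < Im z" "Im z < 1" "!!T k. T \<in> transistors dg ==> z \<notin> tbox (T, k)"
proof -
 obtain s where s: "s \<in> {0..1}" "z = gs (x, j) s" using z by (auto simp: path_image_def)
 then consider "s = 0" | "s = 1" | "s \<in> {0<..<1}" by force
 then show ?thesis
 proof cases
  case 3
  have "z \<notin> tbox (T, k)" if "T \<in> transistors dg" for T k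
   using wire_box[OF x that 3, of "j - k"] s(2) by (simp add: tbox_iff gs_def algebra_simps)
  then show ?thesis using that(3) wire_strip[OF x 3] s(2) by (simp add: gs_def)
 qed (use that s in \<open>simp_all add: pathstart_def pathfinish_def\<close>)
qed

lemma wire_bottom_cases:
 assumes "x \<in> wires dg"
 obtains "x \<in> set (fbot dg)" | T where "T \<in> transistors dg" "x \<in> set (ttop dg T)" using bots(5) assms by blast

lemma wire_top_cases:
 assumes "x \<in> wires dg"
 obtains "x \<in> set (ftop dg)" | T where "T \<in> transistors dg" "x \<in> set (tbot dg T)" using tops(5) assms by blast

lemma gs_Im: "x \<in> wires dg ==> z \<in> path_image (gs (x, j)) ==> 0 <= Im z & Im z <= 1"
proof -
 assume x: "x \<in> wires dg" and z: "z \<in> path_image (gs (x, j))"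
 from x z show ?thesis
 proof (cases rule: gs_cases)
  case 1
  from x show ?thesis
  proof (cases rule: wire_bottom_cases)
   case (2 T)
   then show ?thesis using 1 gs_top_T[OF 2, of j] box[OF 2(1)] by (metis complex.sel(2) less_imp_le less_trans)
  qed (use 1 gs_bot_F[of x j] in simp)
 next
  case 2
  from x show ?thesis
  proof (cases rule: wire_top_cases)
   case b: (2 T)
   then show ?thesis using 2 gs_bot_T[OF b, of j] box[OF b(1)] by (metis complex.sel(2) less_imp_le less_trans)
  qed (use 2 gs_top_F[of x j] in simp)
 qed auto
qed

lemma gs_disjoint:
 assumes "x \<in> wires dg" "y \<in> wires dg" "z \<in> path_image (gs (x, j))" "z \<in> path_image (gs (y, k))"
 shows "x = y & j = k"
proof -
 obtain s t where "s \<in> {0..1}" "t \<in> {0..1}" "gs (x, j) s = gs (y, k) t" using assms(3,4) unfolding path_image_def by auto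
 then show ?thesis using wire_wire[OF assms(1,2), of s t "k - j"] by (auto simp: gs_def algebra_simps)
qed

lemma tbox_disjoint:
 assumes "S \<in> transistors dg" "T \<in> transistors dg" "z \<in> tbox (S, j)" "z \<in> tbox (T, k)"
 shows "S = T & j = k" using box_box[OF assms(1,2), of "z - of_int j" "j - k"] assms(3,4) by (auto simp: tbox_iff)

end

section \<open>A flow line closed up to a simple curve\<close>

locale strip_base = strip +
 fixes Ts :: "nat list" and u0 :: real and ws bs :: "(nat \<times> int) list" and B :: real
 assumes le: "linext dg Ts" and fl: "flow u0 Ts ws bs"
  and Bw: "!!y z. y \<in> set ws ==> z \<in> path_image (gs y) ==> \<bar>Re z\<bar> < B"
  and Bb: "!!b z. b \<in> set bs ==> z \<in> tbox b ==> \<bar>Re z\<bar> < B"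
begin

abbreviation "n \<equiv> length ws"

lemma n: "n = Suc (length bs)" "0 < n" using fl unfolding flow_def by auto

lemma bs_tr: "i < length bs ==> fst (bs ! i) \<in> transistors dg"
 using fl le unfolding flow_def linext_def by (metis image_eqI list.set_map nth_mem subsetD)

lemma ws_wire: "i < n ==> fst (ws ! i) \<in> wires dg" using fl seen_all[OF le] unfolding flow_def by auto

lemma ws_step:
 assumes "i < length bs"
 shows "fst (ws ! i) \<in> set (ttop dg (fst (bs ! i)))" "snd (bs ! i) = snd (ws ! i) + a (fst (ws ! i))"
  "fst (ws ! Suc i) \<in> set (tbot dg (fst (bs ! i)))" "snd (ws ! Suc i) = snd (bs ! i)" using fl assms unfolding flow_def by auto

lemma ws_first: "fst (ws ! 0) \<in> set (ftop dg)" and ws_last: "fst (ws ! (n - 1)) \<in> set (fbot dg)"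
proof -
 have "last ws = ws ! (n - 1)" using n(2) by (intro last_conv_nth) simp
 then show "fst (ws ! 0) \<in> set (ftop dg)" "fst (ws ! (n - 1)) \<in> set (fbot dg)" using fl live_all[OF le] unfolding flow_def by metis+
qed

text \<open>The boxes met by the flow line, completed by a wide box above the frame and another
  below it. Thanks to these two, the order of wires on the frame is tested in the same way as on a
  transistor.\<close>

definition bp :: "nat => complex" where
 "bp i = (if i = 0 then Complex (- B) 1 else if i = n then Complex (- B) (-1) else p (fst (bs ! (i - 1))) + of_int (snd (bs ! (i - 1))))"
definition bq :: "nat => complex" where
 "bq i = (if i = 0 then Complex B 2 else if i = n then Complex B 0 else q (fst (bs ! (i - 1))) + of_int (snd (bs ! (i - 1))))"
definition ee :: "nat => complex" where
 "ee i = (if i = 0 then Complex (Re (pathfinish (gs (ws ! 0)))) 2 else pathstart (gs (ws ! (i - 1))))"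
definition xx :: "nat => complex" where
 "xx i = (if i < n then pathfinish (gs (ws ! i)) else Complex (Re (pathstart (gs (ws ! (n - 1))))) (-1))"
text \<open>Reversed, because wires are parametrised upwards and the flow line runs
  downwards.\<close>

definition dd :: "nat => real => complex" where "dd i = reversepath (gs (ws ! i))"
definition K :: "real => complex" where
 "K = (SOME K. arc K & pathstart K = xx n & pathfinish K = ee 0 &
   (\<forall>z\<in>path_image K. Im z < -1 | Im z > 2 | Re z < - B | z = xx n | z = ee 0))"

lemmas ends_in = pathstart_in_path_image pathfinish_in_path_image

lemma wsB: "i < n ==> z \<in> path_image (gs (ws ! i)) ==> \<bar>Re z\<bar> < B" using Bw nth_mem by blast

lemma Bpos: "0 < B" using wsB[OF n(2) ends_in(1)] by linarith

lemma mid_box: "0 < i ==> i < n ==> cbox (bp i) (bq i) = tbox (bs ! (i - 1)) & i - 1 < length bs" using n by (auto simp: bp_def bq_def tbox_def)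

lemma top_box: "z \<in> cbox (bp 0) (bq 0) \<longleftrightarrow> \<bar>Re z\<bar> <= B & 1 <= Im z & Im z <= 2"
 and bot_box: "z \<in> cbox (bp n) (bq n) \<longleftrightarrow> \<bar>Re z\<bar> <= B & -1 <= Im z & Im z <= 0"
 using n by (auto simp: bp_def bq_def in_cbox_complex_iff)

lemma ee_in: "i <= n ==> ee i \<in> cbox (bp i) (bq i) & Im (ee i) = Im (bq i)"
proof -
 assume i: "i <= n"
 consider "i = 0" | "0 < i" "i < n" | "i = n" "i ~= 0" using i by linarith
 then show ?thesis
 proof cases
  case 1
  have "Re (ee 0) = Re (pathfinish (gs (ws ! 0)))" "Im (ee 0) = 2" "Im (bq 0) = 2" by (simp_all add: ee_def bq_def)
  then show ?thesis unfolding 1 using wsB[OF n(2) ends_in(2)] top_box[of "ee 0"] by simp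
 next
  case 2
  note m = mid_box[OF 2]
  note s = ws_step[OF conjunct2[OF m]]
  have "pathstart (gs (fst (ws ! (i - 1)), snd (ws ! (i - 1)))) = Complex (X0 (fst (ws ! (i - 1))) + a (fst (ws ! (i - 1))) + snd (ws ! (i - 1))) (Im (q (fst (bs ! (i - 1))))) &
   pathstart (gs (fst (ws ! (i - 1)), snd (ws ! (i - 1)))) \<in> tbox (fst (bs ! (i - 1)), snd (ws ! (i - 1)) + a (fst (ws ! (i - 1))))"
   using gs_top_T[OF bs_tr[OF conjunct2[OF m]] s(1)] by blast
  then have "pathstart (gs (ws ! (i - 1))) \<in> tbox (bs ! (i - 1))" "Im (pathstart (gs (ws ! (i - 1)))) = Im (q (fst (bs ! (i - 1))))"
   unfolding s(2)[symmetric] prod.collapse by (metis, metis complex.sel(2))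
  then show ?thesis using m 2 by (simp add: ee_def bq_def)
 next
  case 3
  have "pathstart (gs (ws ! (n - 1))) = Complex (X0 (fst (ws ! (n - 1))) + a (fst (ws ! (n - 1))) + snd (ws ! (n - 1))) 0"
   using gs_bot_F[OF ws_last, of "snd (ws ! (n - 1))"] by simp
  then have "Re (ee n) = Re (pathstart (gs (ws ! (n - 1))))" "Im (ee n) = 0" "Im (bq n) = 0" using n(2) by (simp_all add: ee_def bq_def)
  then show ?thesis unfolding 3 using wsB[of "n - 1", OF _ ends_in(1)] n(2) bot_box[of "ee n"] by simp
 qed
qed

lemma xx_in: "i <= n ==> xx i \<in> cbox (bp i) (bq i) & Im (xx i) = Im (bp i)"
proof -
 assume i: "i <= n"
 consider "i = 0" | "0 < i" "i < n" | "i = n" "i ~= 0" using i by linarith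
 then show ?thesis
 proof cases
  case 1
  have "pathfinish (gs (ws ! 0)) = Complex (X1 (fst (ws ! 0)) + snd (ws ! 0)) 1" using gs_top_F[OF ws_first, of "snd (ws ! 0)"] by simp
  then have "Re (xx 0) = Re (pathfinish (gs (ws ! 0)))" "Im (xx 0) = 1" "Im (bp 0) = 1" using n(2) by (simp_all add: xx_def bp_def)
  then show ?thesis unfolding 1 using wsB[OF n(2) ends_in(2)] top_box[of "xx 0"] by simp
 next
  case 2
  note m = mid_box[OF 2]
  note s = ws_step[OF conjunct2[OF m]]
  have si: "Suc (i - 1) = i" using 2 by simp
  have "pathfinish (gs (fst (ws ! i), snd (ws ! i))) = Complex (X1 (fst (ws ! i)) + snd (ws ! i)) (Im (p (fst (bs ! (i - 1))))) &
   pathfinish (gs (fst (ws ! i), snd (ws ! i))) \<in> tbox (fst (bs ! (i - 1)), snd (ws ! i))"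
   using gs_bot_T[OF bs_tr[OF conjunct2[OF m]] s(3)] unfolding si by blast
  moreover have "(fst (bs ! (i - 1)), snd (ws ! i)) = bs ! (i - 1)" using s(4) unfolding si by simp
  ultimately have "pathfinish (gs (ws ! i)) \<in> tbox (bs ! (i - 1))" "Im (pathfinish (gs (ws ! i))) = Im (p (fst (bs ! (i - 1))))"
   unfolding prod.collapse by (metis, metis complex.sel(2))
  then show ?thesis using m 2 by (simp add: xx_def bp_def)
 next
  case 3
  then have "Re (xx n) = Re (pathstart (gs (ws ! (n - 1))))" "Im (xx n) = -1" "Im (bp n) = -1" using n(2) by (simp_all add: xx_def bp_def)
  then show ?thesis unfolding 3 using wsB[of "n - 1", OF _ ends_in(1)] n(2) bot_box[of "xx n"] by simp
 qed
qed

text \<open>A flow line visits no transistor twice, not even in different translates, since the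
  sweep passes each transistor once; boxes of different transistors are disjoint by the
  drawing.\<close>

lemma boxes_disjoint: "i < j ==> j <= n ==> cbox (bp i) (bq i) \<inter> cbox (bp j) (bq j) = {}"
proof (rule ccontr)
 assume ij: "i < j" "j <= n" and "cbox (bp i) (bq i) \<inter> cbox (bp j) (bq j) ~= {}"
 then obtain z where z: "z \<in> cbox (bp i) (bq i)" "z \<in> cbox (bp j) (bq j)" by blast
 have mid: "0 < Im z & Im z < 1" if "0 < k" "k < n" "z \<in> cbox (bp k) (bq k)" for k
  using mid_box[OF that(1,2)] tbox_Im[of "fst (bs ! (k - 1))" z "snd (bs ! (k - 1))"] bs_tr[of "k - 1"] that(3) by simp
 show False
 proof (cases "i = 0 | j = n")
  case True
  then show False using mid[of i] mid[of j] z ij top_box[of z] bot_box[of z] by (cases "i = 0"; cases "j = n") auto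
 next
  case False
  then have m: "z \<in> tbox (bs ! (i - 1))" "i - 1 < length bs" "z \<in> tbox (bs ! (j - 1))" "j - 1 < length bs"
   using z mid_box[of i] mid_box[of j] ij by auto
  then have "fst (bs ! (i - 1)) = fst (bs ! (j - 1))"
   using tbox_disjoint[OF bs_tr[OF m(2)] bs_tr[OF m(4)], of z "snd (bs ! (i - 1))" "snd (bs ! (j - 1))"] by simp
  moreover have "distinct (map fst bs)" using fl unfolding flow_def by blast
  ultimately have "i - 1 = j - 1" using m by (metis distinct_conv_nth length_map nth_map)
  then show False using False ij by linarith
 qed
qed

lemma not_in_box:
 assumes "0 < Im z" "Im z < 1" "!!T k. T \<in> transistors dg ==> z \<notin> tbox (T, k)" "i <= n"
 shows "z \<notin> cbox (bp i) (bq i)"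
proof -
 consider "i = 0" | "0 < i" "i < n" | "i = n" using assms(4) by linarith
 then show ?thesis
 proof cases
  case 2
  then show ?thesis using mid_box[OF 2] assms(3)[OF bs_tr[of "i - 1"], of "snd (bs ! (i - 1))"] by simp
 qed (use assms top_box[of z] bot_box[of z] in auto)
qed

lemma K_props: "arc K" "pathstart K = xx n" "pathfinish K = ee 0"
 "!!z. z \<in> path_image K ==> Im z < -1 | Im z > 2 | Re z < - B | z = xx n | z = ee 0"
proof -
 have "\<bar>Re (ee 0)\<bar> < B" "ee 0 = Complex (Re (ee 0)) 2" using wsB[of 0 "pathfinish (gs (ws ! 0))"] n by (auto simp: ee_def)
 moreover have "\<bar>Re (xx n)\<bar> < B" "xx n = Complex (Re (xx n)) (-1)"
  using wsB[of "n - 1" "pathstart (gs (ws ! (n - 1)))"] n by (auto simp: xx_def)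
 ultimately have "\<exists>K. arc K & pathstart K = xx n & pathfinish K = ee 0 &
   (\<forall>z\<in>path_image K. Im z < -1 | Im z > 2 | Re z < - B | z = xx n | z = ee 0)"
  using closing_arc[of "Re (ee 0)" B "Re (xx n)"] by metis
 from someI_ex[OF this] show "arc K" "pathstart K = xx n" "pathfinish K = ee 0"
  "!!z. z \<in> path_image K ==> Im z < -1 | Im z > 2 | Re z < - B | z = xx n | z = ee 0" unfolding K_def by blast+
qed

lemma dd_image: "path_image (dd i) = path_image (gs (ws ! i))" by (simp add: dd_def)

lemma K_box:
 assumes "j <= n"
 shows "path_image K \<inter> cbox (bp j) (bq j) \<subseteq> (if j = n then {xx n} else if j = 0 then {ee 0} else {})"
proof
 fix z assume z: "z \<in> path_image K \<inter> cbox (bp j) (bq j)"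
 have "-1 <= Im z & Im z <= 2 & - B <= Re z"
 proof -
  consider "j = 0" | "0 < j" "j < n" | "j = n" using assms by linarith
  then show ?thesis
  proof cases
   case 2
   then have "z \<in> tbox (bs ! (j - 1))" "j - 1 < length bs" using mid_box z by auto
   then show ?thesis using Bb[of "bs ! (j - 1)" z] tbox_Im[OF bs_tr[of "j - 1"], of z "snd (bs ! (j - 1))"] by auto
  qed (use z top_box[of z] bot_box[of z] in auto)
 qed
 then have "z = xx n | z = ee 0" using K_props(4)[of z] z by auto
 then show "z \<in> (if j = n then {xx n} else if j = 0 then {ee 0} else {})" (is ?thesis)
 proof
  assume e: "z = xx n"
  then have "z \<in> cbox (bp n) (bq n)" using xx_in[of n] by simp
  then have "j = n" using boxes_disjoint[of j n] z assms by (meson IntE disjoint_iff le_neq_implies_less order_refl)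
  then show ?thesis using e by simp
 next
  assume e: "z = ee 0"
  then have "z \<in> cbox (bp 0) (bq 0)" using ee_in[of 0] by simp
  then have "j = 0" using boxes_disjoint[of 0 j] z assms by (meson IntE disjoint_iff gr0I)
  then show ?thesis using e n(2) by simp
 qed
qed

lemma dd_box:
 assumes "i < n" "j <= n"
 shows "path_image (dd i) \<inter> cbox (bp j) (bq j) \<subseteq> (if j = i then {xx i} else if j = Suc i then {ee (Suc i)} else {})"
proof
 fix z assume z: "z \<in> path_image (dd i) \<inter> cbox (bp j) (bq j)"
 then have "z \<in> path_image (gs (fst (ws ! i), snd (ws ! i)))" by (simp add: dd_image)
 with ws_wire[OF assms(1)] show "z \<in> (if j = i then {xx i} else if j = Suc i then {ee (Suc i)} else {})"
 proof (cases rule: gs_cases)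
  case 1
  then have zz: "z = ee (Suc i)" by (simp add: ee_def)
  then have "z \<in> cbox (bp (Suc i)) (bq (Suc i))" using ee_in[of "Suc i"] assms(1) by simp
  then have "j = Suc i" using z boxes_disjoint[of j "Suc i"] boxes_disjoint[of "Suc i" j] assms by (cases j "Suc i" rule: linorder_cases) auto
  then show ?thesis using zz by simp
 next
  case 2
  then have zz: "z = xx i" using assms(1) by (simp add: xx_def)
  then have "z \<in> cbox (bp i) (bq i)" using xx_in[of i] assms(1) by simp
  then have "j = i" using z boxes_disjoint[of j i] boxes_disjoint[of i j] assms by (cases j i rule: linorder_cases) auto
  then show ?thesis using zz by simp
 next
  case 3
  then show ?thesis using not_in_box[OF 3 assms(2)] z by blast
 qed
qed

sublocale bc: box_curve n bp bq ee xx dd K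
proof
 show "0 < n" by (rule n)
 fix i assume i: "i <= n"
 consider "i = 0" | "0 < i" "i < n" | "i = n" "i ~= 0" using i by linarith
 then show "Re (bp i) < Re (bq i) & Im (bp i) < Im (bq i)"
  by cases (use Bpos box[OF bs_tr[of "i - 1"]] mid_box[of i] in \<open>auto simp: bp_def bq_def\<close>)
 show "Im (ee i) = Im (bq i) & Re (bp i) <= Re (ee i) & Re (ee i) <= Re (bq i)" using ee_in[OF i] by (auto simp: in_cbox_complex_iff)
 show "Im (xx i) = Im (bp i) & Re (bp i) <= Re (xx i) & Re (xx i) <= Re (bq i)" using xx_in[OF i] by (auto simp: in_cbox_complex_iff)
next
 show "cbox (bp i) (bq i) \<inter> cbox (bp j) (bq j) = {}" if "i < j" "j <= n" for i j using boxes_disjoint[OF that] .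
 show "arc (dd i) & pathstart (dd i) = xx i & pathfinish (dd i) = ee (Suc i)" if "i < n" for i
  using gs_arc[OF ws_wire[OF that], of "snd (ws ! i)"] that by (simp add: dd_def arc_reversepath xx_def ee_def)
 show "path_image (dd i) \<inter> path_image (dd j) = {}" if "i < j" "j < n" for i j
 proof (rule ccontr)
  assume "path_image (dd i) \<inter> path_image (dd j) ~= {}"
  then obtain z where "z \<in> path_image (gs (fst (ws ! i), snd (ws ! i)))" "z \<in> path_image (gs (fst (ws ! j), snd (ws ! j)))"
   unfolding dd_image by auto
  then have "fst (ws ! i) = fst (ws ! j)" using gs_disjoint[OF ws_wire ws_wire] that by (meson less_trans)
  moreover have "distinct (map fst ws)" using fl unfolding flow_def by blast
  ultimately show False using that by (simp add: distinct_conv_nth)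
 qed
 show "path_image (dd i) \<inter> cbox (bp j) (bq j) \<subseteq> (if j = i then {xx i} else if j = Suc i then {ee (Suc i)} else {})"
  if "i < n" "j <= n" for i j using dd_box[OF that] .
 show "arc K" "pathstart K = xx n" "pathfinish K = ee 0" by (rule K_props)+
 show "path_image K \<inter> cbox (bp j) (bq j) \<subseteq> (if j = n then {xx n} else if j = 0 then {ee 0} else {})" if "j <= n" for j
  using K_box[OF that] .
 show "path_image K \<inter> path_image (dd i) = {}" if "i < n" for i
 proof (rule ccontr)
  assume "path_image K \<inter> path_image (dd i) ~= {}"
  then obtain z where z: "z \<in> path_image K" "z \<in> path_image (gs (fst (ws ! i), snd (ws ! i)))" unfolding dd_image by auto
  have "0 <= Im z & Im z <= 1" using gs_Im[OF ws_wire[OF that] z(2)] .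
  moreover have "- B < Re z" using wsB[OF that] z(2) by fastforce
  moreover have "Im (xx n) = -1" "Im (ee 0) = 2" by (auto simp: xx_def ee_def)
  ultimately show False using K_props(4)[OF z(1)] by auto
 qed
qed

lemma seg_end:
 assumes "i <= n" "z \<in> closed_segment (ee i) (xx i)" "Im z = Im (bp i) | Im z = Im (bq i)"
 shows "z = xx i | z = ee i"
proof -
 obtain t where t: "0 <= t" "t <= 1" "z = (1 - t) *\<^sub>R ee i + t *\<^sub>R xx i" using assms(2) unfolding closed_segment_def by blast
 have im: "Im (ee i) = Im (bq i)" "Im (xx i) = Im (bp i)" "Im (bp i) < Im (bq i)"
  using bc.e[OF assms(1)] bc.x[OF assms(1)] bc.pq[OF assms(1)] by auto
 have e: "Im z = Im (bq i) + t * (Im (bp i) - Im (bq i))" using im unfolding t(3) by (simp add: algebra_simps)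
 have "t = 1 | t = 0" using assms(3)
 proof
  assume "Im z = Im (bp i)"
  then have "(t - 1) * (Im (bp i) - Im (bq i)) = 0" using e by (simp add: algebra_simps)
  then show ?thesis using im(3) by simp
 qed (use e im(3) in simp)
 then show ?thesis using t(3) by auto
qed

lemma wire_end_box:
 assumes y: "y \<in> wires dg" and i: "i <= n" and z: "z = pathstart (gs (y, k)) | z = pathfinish (gs (y, k))" "z \<in> cbox (bp i) (bq i)"
 shows "Im z = Im (bp i) | Im z = Im (bq i)"
proof -
 have T: "Im z = Im (bp i) | Im z = Im (bq i)"
  if T: "T \<in> transistors dg" "z \<in> tbox (T, l)" "Im z = Im (p T) | Im z = Im (q T)" for T l
 proof -
  have "0 < Im z & Im z < 1" using tbox_Im T by blast
  then have "i ~= 0" "i ~= n" using z(2) top_box[of z] bot_box[of z] by fastforce+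
  then have m: "z \<in> tbox (bs ! (i - 1))" "i - 1 < length bs" using mid_box[of i] i z(2) by auto
  then have "fst (bs ! (i - 1)) = T" using tbox_disjoint[OF bs_tr[OF m(2)] T(1), of z "snd (bs ! (i - 1))" l] T(2) by simp
  then show ?thesis using T(3) \<open>i ~= 0\<close> \<open>i ~= n\<close> by (simp add: bp_def bq_def)
 qed
 have Fr: "Im z = Im (bp i) | Im z = Im (bq i)" if "Im z = 0 | Im z = 1"
 proof -
  consider "i = 0" | "0 < i" "i < n" | "i = n" using i by linarith
  then show ?thesis
  proof cases
   case 2
   then show ?thesis using mid_box[OF 2] z(2) tbox_Im[OF bs_tr[of "i - 1"], of z "snd (bs ! (i - 1))"] that by auto
  qed (use that z(2) top_box[of z] bot_box[of z] n in \<open>auto simp: bp_def bq_def\<close>)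
 qed
 from z(1) show ?thesis
 proof
  assume z: "z = pathstart (gs (y, k))"
  from y show ?thesis
  proof (cases rule: wire_bottom_cases)
   case (2 T')
   then show ?thesis using T[OF 2(1), of "k + a y"] gs_top_T[OF 2, of k] z by (metis complex.sel(2))
  qed (use z gs_bot_F[of y k] Fr in simp)
 next
  assume z: "z = pathfinish (gs (y, k))"
  from y show ?thesis
  proof (cases rule: wire_top_cases)
   case (2 T')
   then show ?thesis using T[OF 2(1), of k] gs_bot_T[OF 2, of k] z by (metis complex.sel(2))
  qed (use z gs_top_F[of y k] Fr in simp)
 qed
qed

lemma \<Gamma>_cases:
 assumes "z \<in> bc.\<Gamma>"
 obtains i where "i <= n" "z \<in> closed_segment (ee i) (xx i)" "z \<in> cbox (bp i) (bq i)"
 | i where "i < n" "z \<in> path_image (gs (fst (ws ! i), snd (ws ! i)))" | "z \<in> path_image K"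
proof -
 have "closed_segment (ee i) (xx i) \<subseteq> cbox (bp i) (bq i)" if "i <= n" for i using bc.seg_box[OF that] by (simp add: bc.seg_def)
 then show ?thesis using assms that unfolding bc.\<Gamma>_def dd_image by (auto 4 4)
qed

text \<open>Away from its ends a wire meets neither boxes nor other wires. An end could hit a
  segment only at an end point of that segment, hence on a wire of the flow line or outside the
  strip; and the return arc stays outside the strip or to the left of \<open>- B\<close>.\<close>

lemma wire_off:
 assumes y: "y \<in> wires dg" "(y, k) \<notin> set ws" and b: "!!z. z \<in> path_image (gs (y, k)) ==> \<bar>Re z\<bar> < B"
 shows "path_image (gs (y, k)) \<inter> bc.\<Gamma> = {}"
proof (rule ccontr)
 assume "path_image (gs (y, k)) \<inter> bc.\<Gamma> ~= {}"
 then obtain z where z: "z \<in> path_image (gs (y, k))" "z \<in> bc.\<Gamma>" by blast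
 have im: "0 <= Im z" "Im z <= 1" using gs_Im[OF y(1) z(1)] by auto
 have nw: "z \<notin> path_image (gs (fst (ws ! i), snd (ws ! i)))" if "i < n" for i
  using gs_disjoint[OF y(1) ws_wire[OF that] z(1)] y(2) nth_mem[OF that] by (metis prod.collapse)
 have ims: "Im (xx n) = -1" "Im (ee 0) = 2" by (auto simp: xx_def ee_def)
 from z(2) show False
 proof (cases rule: \<Gamma>_cases)
  case (1 i)
  have "z = pathstart (gs (y, k)) | z = pathfinish (gs (y, k))" using y(1) z(1) by (cases rule: gs_cases) (use not_in_box[of z i] 1 in auto)
  then have "z = xx i | z = ee i" using seg_end[OF 1(1,2)] wire_end_box[OF y(1) 1(1) _ 1(3)] by blast
  then show False
  proof
   assume "z = xx i"
   then show False using nw[of i] im ims 1(1) by (cases "i = n") (auto simp: xx_def)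
  next
   assume "z = ee i"
   then show False
   proof (cases "i = 0")
    case False
    then have "z = pathstart (gs (fst (ws ! (i - 1)), snd (ws ! (i - 1))))" using \<open>z = ee i\<close> by (simp add: ee_def)
    then have "z \<in> path_image (gs (fst (ws ! (i - 1)), snd (ws ! (i - 1))))" by (metis ends_in(1))
    moreover have "i - 1 < n" using 1(1) False by linarith
    ultimately show False using nw by blast
   qed (use im ims in simp)
  qed
 next
  case (2 i)
  then show False using nw by blast
 next
  case 3
  have "- B < Re z" using b[OF z(1)] by linarith
  then show False using K_props(4)[OF 3] im ims by auto
 qed
qed

lemma box_off:
 assumes T: "T \<in> transistors dg" "(T, k) \<notin> set bs" and b: "!!z. z \<in> tbox (T, k) ==> \<bar>Re z\<bar> < B"
 shows "tbox (T, k) \<inter> bc.\<Gamma> = {}"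
proof (rule ccontr)
 assume "tbox (T, k) \<inter> bc.\<Gamma> ~= {}"
 then obtain z where z: "z \<in> tbox (T, k)" "z \<in> bc.\<Gamma>" by blast
 have im: "0 < Im z" "Im z < 1" using tbox_Im[OF T(1) z(1)] by auto
 have nb: "z \<notin> cbox (bp i) (bq i)" if "i <= n" for i
 proof
  assume zi: "z \<in> cbox (bp i) (bq i)"
  then have "i ~= 0" "i ~= n" using im top_box[of z] bot_box[of z] by fastforce+
  then have "0 < i" "i < n" using that by auto
  then have m: "z \<in> tbox (bs ! (i - 1))" "i - 1 < length bs" using mid_box zi by auto
  then have "bs ! (i - 1) = (T, k)" using tbox_disjoint[OF bs_tr[OF m(2)] T(1), of z "snd (bs ! (i - 1))" k] z(1) by (simp add: prod_eq_iff)
  then show False using T(2) nth_mem[OF m(2)] by simp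
 qed
 from z(2) show False
 proof (cases rule: \<Gamma>_cases)
  case (1 i)
  then show False using nb by blast
 next
  case (2 i)
  from ws_wire[OF 2(1)] 2(2) show False
  proof (cases rule: gs_cases)
   case 1
   then have "z = ee (Suc i)" by (simp add: ee_def)
   then show False using nb[of "Suc i"] ee_in[of "Suc i"] 2(1) by simp
  next
   case c: 2
   then have "z = xx i" using 2(1) by (simp add: xx_def)
   then show False using nb[of i] xx_in[of i] 2(1) by simp
  qed (use T(1) z(1) in blast)
 next
  case 3
  have "- B < Re z" using b[OF z(1)] by linarith
  moreover have "Im (xx n) = -1" "Im (ee 0) = 2" by (auto simp: xx_def ee_def)
  ultimately show False using K_props(4)[OF 3] im by auto
 qed
qed

lemma W_connected: "connected S ==> S \<inter> bc.\<Gamma> = {} ==> y \<in> S ==> z \<in> S ==> bc.W y = bc.W z" by (rule bc.W_const)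

definition \<rho> :: complex where
 "\<rho> = (SOME \<rho>. \<forall>i\<le>n. \<forall>z\<in>cbox (bp i) (bq i). (side (ee i) (xx i) z > 0 --> bc.W z = \<rho>) &
   (side (ee i) (xx i) z < 0 --> bc.W z = \<rho> - 1))"

lemma W_side:
 assumes i: "i <= n" and z: "z \<in> cbox (bp i) (bq i)"
 shows "Im z = Im (bq i) ==> Re z ~= Re (ee i) ==> bc.W z = (if Re (ee i) < Re z then \<rho> else \<rho> - 1)"
  "Im z = Im (bp i) ==> Re z ~= Re (xx i) ==> bc.W z = (if Re (xx i) < Re z then \<rho> else \<rho> - 1)"
proof -
 have *: "(side (ee i) (xx i) z > 0 --> bc.W z = \<rho>) & (side (ee i) (xx i) z < 0 --> bc.W z = \<rho> - 1)"
  using someI_ex[OF bc.sides, folded \<rho>_def] i z by blast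
 have im: "Im (ee i) = Im (bq i)" "Im (xx i) = Im (bp i)" "Im (bp i) < Im (bq i)" using bc.e[OF i] bc.x[OF i] bc.pq[OF i] by auto
 show "bc.W z = (if Re (ee i) < Re z then \<rho> else \<rho> - 1)" if "Im z = Im (bq i)" "Re z ~= Re (ee i)"
  using * that im side_level(1)[of z "ee i" "xx i"] by (auto simp: zero_less_mult_iff mult_less_0_iff)
 show "bc.W z = (if Re (xx i) < Re z then \<rho> else \<rho> - 1)" if "Im z = Im (bp i)" "Re z ~= Re (xx i)"
  using * that im side_level(2)[of z "xx i" "ee i"] by (auto simp: zero_less_mult_iff mult_less_0_iff)
qed

end

context strip
begin

lemma ttop_pos:
 assumes "x \<in> set (ttop dg T)"
 obtains i where "i < length (ttop dg T)" "ttop dg T ! i = x"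
  "!!t j. M T (emb (length (ttop dg T)) i t) + of_int (j + a x) = C x t + of_int j"
proof -
 obtain i where i: "i < length (ttop dg T)" "ttop dg T ! i = x" using assms by (auto simp: in_set_conv_nth)
 show ?thesis by (rule that[OF i]) (use M_emb[OF i(1)] i(2) in simp)
qed

lemma tbot_pos:
 assumes "T \<in> transistors dg" "x \<in> set (tbot dg T)"
 obtains i where "i < length (tbot dg T)" "tbot dg T ! i = x" "!!t. C x t = M T (emb (length (tbot dg T)) i t)"
proof -
 obtain i where i: "i < length (tbot dg T)" "tbot dg T ! i = x" using assms(2) by (auto simp: in_set_conv_nth)
 show ?thesis by (rule that[OF i]) (use C_tbot[OF assms(1) i(1)] i(2) in simp)
qed

lemma fbot_pos:
 assumes "x \<in> set (fbot dg)"
 obtains i where "i < length (fbot dg)" "fbot dg ! i = x"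
  "!!t j. F (emb (length (fbot dg)) i t) + of_int (j + a x) = C x t + of_int j"
proof -
 obtain i where i: "i < length (fbot dg)" "fbot dg ! i = x" using assms by (auto simp: in_set_conv_nth)
 show ?thesis by (rule that[OF i]) (use F_emb[OF i(1)] i(2) in simp)
qed

lemma ftop_pos:
 assumes "x \<in> set (ftop dg)"
 obtains i where "i < length (ftop dg)" "ftop dg ! i = x" "!!t. C x t = pt (emb (length (ftop dg)) i t)"
proof -
 obtain i where i: "i < length (ftop dg)" "ftop dg ! i = x" using assms by (auto simp: in_set_conv_nth)
 show ?thesis by (rule that[OF i]) (use C_ftop[OF i(1)] i(2) in simp)
qed

end

section \<open>Comparison of two flow lines\<close>

locale strip_pair = strip_base +
 fixes u :: real and ws' bs' :: "(nat \<times> int) list"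
 assumes fl': "flow u Ts ws' bs'"
  and Bw': "!!y z. y \<in> set ws' ==> z \<in> path_image (gs y) ==> \<bar>Re z\<bar> < B"
  and Bb': "!!b z. b \<in> set bs' ==> z \<in> tbox b ==> \<bar>Re z\<bar> < B"
begin

sublocale other: strip_base A R w dg p q g a X0 X1 Ts u ws' bs' B by unfold_locales (rule le fl' Bw' Bb'; assumption?)+

definition val :: complex where "val = (if u0 < u then \<rho> else \<rho> - 1)"

lemma val_iff: "(if P then \<rho> else \<rho> - 1) = val \<longleftrightarrow> (P \<longleftrightarrow> u0 < u)" by (simp add: val_def)

lemma M_bs: "T \<in> transistors dg ==> M T s + of_int k = u0 ==> (T, k) \<in> set bs" using fl le unfolding flow_def linext_def by blast

text \<open>The flow line of \<open>u0\<close> is closed up to a simple curve, and \<open>val\<close> is the winding number that a point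
 to the left or to the right of it has to have, according as \<open>u < u0\<close> or \<open>u0 < u\<close>. Following the flow line
 of \<open>u\<close> downwards, we check that it stays on its side and, where both lines run through the same wire
 or transistor, that the order of the parameters is the right one.\<close>

definition wire_claim :: "nat => int => bool" where
 "wire_claim x j \<longleftrightarrow> (\<forall>t t0. C x t + of_int j = u --> C x t0 + of_int j = u0 --> (pt t0 < pt t \<longleftrightarrow> u0 < u)) &
   ((x, j) \<notin> set ws --> (\<forall>z\<in>path_image (gs (x, j)). bc.W z = val))"

definition box_claim :: "nat => int => bool" where
 "box_claim T k \<longleftrightarrow> (\<forall>s s0. M T s + of_int k = u --> M T s0 + of_int k = u0 --> (pt s0 < pt s \<longleftrightarrow> u0 < u)) &
   ((T, k) \<notin> set bs --> (\<forall>z\<in>tbox (T, k). bc.W z = val))"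

text \<open>A wire off the closed curve lies in one component of the complement, so the winding
  number has to be checked at one point only.\<close>

lemma wire_spread:
 assumes "(x, j) \<in> set ws'" "(x, j) \<notin> set ws" "z \<in> path_image (gs (x, j))" "bc.W z = val"
 shows "\<forall>z\<in>path_image (gs (x, j)). bc.W z = val"
proof
 fix y assume y: "y \<in> path_image (gs (x, j))"
 have x: "x \<in> wires dg" using assms(1) other.ws_wire by (metis fst_conv in_set_conv_nth)
 have "path_image (gs (x, j)) \<inter> bc.\<Gamma> = {}" using x assms(2) by (rule wire_off) (rule Bw'[OF assms(1)])
 moreover have "connected (path_image (gs (x, j)))" by (intro connected_path_image arc_imp_path gs_arc x)
 ultimately show "bc.W y = val" using W_connected y assms(3,4) by metis
qed

lemma box_spread:
 assumes "(T, k) \<in> set bs'" "(T, k) \<notin> set bs" "z \<in> tbox (T, k)" "bc.W z = val"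
 shows "\<forall>z\<in>tbox (T, k). bc.W z = val"
proof
 fix y assume y: "y \<in> tbox (T, k)"
 have T: "T \<in> transistors dg" using assms(1) other.bs_tr by (metis fst_conv in_set_conv_nth)
 have "tbox (T, k) \<inter> bc.\<Gamma> = {}" using T assms(2) by (rule box_off) (rule Bb'[OF assms(1)])
 moreover have "connected (tbox (T, k))" unfolding tbox_def by (intro convex_connected convex_box)
 ultimately show "bc.W y = val" using W_connected y assms(3,4) by metis
qed

lemma bs_index:
 assumes "(T, k) \<in> set bs"
 obtains i where "i < length bs" "i < n" "Suc i < n" "bs ! i = (T, k)" "cbox (bp (Suc i)) (bq (Suc i)) = tbox (T, k)"
  "Im (bq (Suc i)) = Im (q T)" "Im (bp (Suc i)) = Im (p T)"
  "ee (Suc i) = pathstart (gs (ws ! i))" "xx (Suc i) = pathfinish (gs (ws ! Suc i))"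
proof -
 obtain i where i: "i < length bs" "bs ! i = (T, k)" using assms by (auto simp: in_set_conv_nth)
 then have s: "Suc i < n" using n(1) by simp
 then show ?thesis by (intro that[of i]) (use i mid_box[of "Suc i"] in \<open>auto simp: bp_def bq_def ee_def xx_def\<close>)
qed

lemma ws'_on: "(x, j) \<in> set ws' ==> \<exists>t. C x t + of_int j = u" using fl' unfolding flow_def on_def by auto

lemma ws_on: "(x, j) \<in> set ws ==> \<exists>t. C x t + of_int j = u0" using fl unfolding flow_def on_def by auto

text \<open>If the base line runs through this translate of \<open>T\<close> too, it enters either
  by the same wire, and the order of parameters is inherited, or by another wire, and the winding
  number at the lower end of \<open>x\<close> tells which wire comes first. If it misses the box,
  the winding number spreads over the whole box.\<close>

lemma wire_to_box:
 assumes T: "T \<in> transistors dg" and x: "x \<in> set (ttop dg T)" and xw: "(x, j) \<in> set ws'" and kb: "(T, j + a x) \<in> set bs'"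
  and claim: "wire_claim x j"
 shows "box_claim T (j + a x)"
proof -
 let ?N = "length (ttop dg T)" and ?k = "j + a x"
 obtain i1 where i1: "i1 < ?N" "ttop dg T ! i1 = x" "!!t j. M T (emb ?N i1 t) + of_int (j + a x) = C x t + of_int j"
  using ttop_pos[OF x] by blast
 have xwire: "x \<in> wires dg" using xw other.ws_wire by (metis fst_conv in_set_conv_nth)
 obtain t where t: "C x t + of_int j = u" using ws'_on[OF xw] by blast
 let ?z = "pathstart (gs (x, j))"
 have z: "?z = Complex (X0 x + a x + j) (Im (q T))" "?z \<in> tbox (T, ?k)" "?z \<in> path_image (gs (x, j))"
  using gs_top_T[OF T x, of j] ends_in(1)[of "gs (x, j)"] by blast+
 have s: "s = emb ?N i1 t" if "M T s + of_int ?k = u" for s using M_inj[OF T, of s ?k "emb ?N i1 t" ?k] that i1(3)[of t j] t by simp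
 show ?thesis
 proof (cases "(T, ?k) \<in> set bs")
  case True
  then obtain i where i: "i < length bs" "i < n" "Suc i < n" "bs ! i = (T, ?k)" "cbox (bp (Suc i)) (bq (Suc i)) = tbox (T, ?k)"
   "Im (bq (Suc i)) = Im (q T)" "ee (Suc i) = pathstart (gs (ws ! i))" using bs_index by metis
  obtain x0 j0 where wi: "ws ! i = (x0, j0)" by fastforce
  have x0: "x0 \<in> set (ttop dg T)" "?k = j0 + a x0" "(x0, j0) \<in> set ws" using ws_step(1,2)[OF i(1)] wi i(4) nth_mem[OF i(2)] by auto
  obtain i0 where i0: "i0 < ?N" "ttop dg T ! i0 = x0" "!!t j. M T (emb ?N i0 t) + of_int (j + a x0) = C x0 t + of_int j"
   using ttop_pos[OF x0(1)] by blast
  obtain t0 where t0: "C x0 t0 + of_int j0 = u0" using ws_on[OF x0(3)] by blast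
  have s0: "s = emb ?N i0 t0" if "M T s + of_int ?k = u0" for s
   using M_inj[OF T, of s ?k "emb ?N i0 t0" ?k] that i0(3)[of t0 j0] t0 x0(2) by simp
  have "pt (emb ?N i0 t0) < pt (emb ?N i1 t) \<longleftrightarrow> u0 < u"
  proof (cases "i0 = i1")
   case True
   then have "x0 = x" "j0 = j" using i0 i1 x0(2) by auto
   then show ?thesis using claim t t0 True i1(1) unfolding wire_claim_def by (simp add: emb_less)
  next
   case False
   \<comment> \<open>Otherwise \<open>u0\<close> would be taken on two different pieces of the
     injective map \<open>M T\<close>.\<close>
   have "(x, j) \<notin> set ws"
   proof
    assume "(x, j) \<in> set ws"
    then obtain t' where "C x t' + of_int j = u0" using ws_on by blast
    then have "emb ?N i1 t' = emb ?N i0 t0" using s0[of "emb ?N i1 t'"] i1(3)[of t' j] by simp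
    then show False using emb_eq_iff[OF i1(1) i0(1)] False by simp
   qed
   then have "bc.W ?z = val" using claim z(3) unfolding wire_claim_def by blast
   moreover have e: "ee (Suc i) = Complex (X0 x0 + a x0 + j0) (Im (q T))" using gs_top_T[OF T x0(1), of j0] i(7) wi by simp
   moreover have X: "X0 x0 < X0 x \<longleftrightarrow> i0 < i1" "X0 x < X0 x0 \<longleftrightarrow> i1 < i0"
    using sorted_nth_iff[OF top_T_sorted[OF T]] i0(1,2) i1(1,2) by auto
   moreover have k: "a x + j = a x0 + j0" using x0(2) by simp
   then have kk: "real_of_int (a x) + real_of_int j = real_of_int (a x0) + real_of_int j0" by (metis of_int_add)
   moreover have "Re ?z ~= Re (ee (Suc i))" using X False kk unfolding z(1) e by (auto simp: nat_neq_iff)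
   moreover have "Re (ee (Suc i)) < Re ?z \<longleftrightarrow> X0 x0 < X0 x" unfolding z(1) e using kk by (simp add: add.assoc)
   ultimately have "i0 < i1 \<longleftrightarrow> u0 < u"
    using W_side(1)[of "Suc i" ?z] i(3,5,6) z(1,2) val_iff[of "Re (ee (Suc i)) < Re ?z"] by simp
   then show ?thesis using False i0(1) i1(1) by (simp add: emb_less)
  qed
  then show ?thesis using True s s0 unfolding box_claim_def by blast
 next
  case False
  have "(x, j) \<notin> set ws" using ws_on i1(3) M_bs[OF T] False by metis
  then have "bc.W ?z = val" using claim z(3) unfolding wire_claim_def by blast
  then show ?thesis using False M_bs[OF T] box_spread[OF kb False z(2)] unfolding box_claim_def by blast
 qed
qed

lemma box_to_wire:
 assumes T: "T \<in> transistors dg" and y: "y \<in> set (tbot dg T)" and yw: "(y, k) \<in> set ws'" and claim: "box_claim T k"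
 shows "wire_claim y k"
proof -
 let ?N = "length (tbot dg T)"
 obtain i1 where i1: "i1 < ?N" "tbot dg T ! i1 = y" "!!t. C y t = M T (emb ?N i1 t)" using tbot_pos[OF T y] by blast
 have A: "pt t0 < pt t \<longleftrightarrow> u0 < u" if "C y t + of_int k = u" "C y t0 + of_int k = u0" for t t0
 proof -
  have "pt (emb ?N i1 t0) < pt (emb ?N i1 t) \<longleftrightarrow> u0 < u" using claim that unfolding box_claim_def i1(3) by blast
  then show ?thesis using emb_less[OF i1(1) i1(1)] by simp
 qed
 obtain t where t: "C y t + of_int k = u" using ws'_on[OF yw] by blast
 let ?z = "pathfinish (gs (y, k))"
 have z: "?z = Complex (X1 y + k) (Im (p T))" "?z \<in> tbox (T, k)" "?z \<in> path_image (gs (y, k))"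
  using gs_bot_T[OF T y, of k] ends_in(2)[of "gs (y, k)"] by blast+
 have "bc.W ?z = val" if nws: "(y, k) \<notin> set ws"
 proof (cases "(T, k) \<in> set bs")
  case True
  then obtain i where i: "i < length bs" "i < n" "Suc i < n" "bs ! i = (T, k)" "cbox (bp (Suc i)) (bq (Suc i)) = tbox (T, k)"
   "Im (bp (Suc i)) = Im (p T)" "xx (Suc i) = pathfinish (gs (ws ! Suc i))" using bs_index by metis
  obtain y0 j0 where wi: "ws ! Suc i = (y0, j0)" by fastforce
  have y0: "y0 \<in> set (tbot dg T)" "j0 = k" "(y0, j0) \<in> set ws" using ws_step(3,4)[OF i(1)] wi i(4) nth_mem[OF i(3)] by auto
  obtain i0 where i0: "i0 < ?N" "tbot dg T ! i0 = y0" "!!t. C y0 t = M T (emb ?N i0 t)" using tbot_pos[OF T y0(1)] by blast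
  obtain t0 where t0: "C y0 t0 + of_int k = u0" using ws_on[OF y0(3)] y0(2) by blast
  have ne: "i0 ~= i1" using i0 i1 nws y0 by auto
  have "pt (emb ?N i0 t0) < pt (emb ?N i1 t) \<longleftrightarrow> u0 < u" using claim t t0 unfolding box_claim_def i1(3) i0(3) by blast
  then have "i0 < i1 \<longleftrightarrow> u0 < u" using emb_less[OF i0(1) i1(1)] ne by simp
  moreover have "X1 y0 < X1 y \<longleftrightarrow> i0 < i1" "X1 y < X1 y0 \<longleftrightarrow> i1 < i0"
   using sorted_nth_iff[OF bot_T_sorted[OF T]] i0(1,2) i1(1,2) by auto
  moreover have "xx (Suc i) = Complex (X1 y0 + k) (Im (p T))" using gs_bot_T[OF T y0(1), of k] i(7) wi y0(2) by simp
  ultimately show ?thesis using W_side(2)[of "Suc i" ?z] i(3,5,6) z(1,2) ne by (auto simp: val_def)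
 next
  case False
  then show ?thesis using claim z(2) unfolding box_claim_def by blast
 qed
 then show ?thesis using A wire_spread[OF yw _ z(3)] unfolding wire_claim_def by blast
qed

text \<open>On the top side of the frame both the chart values and the ends of the wires lie within
  one period. Hence for values as well as for positions the translate decides first, and the order
  of the wires second.\<close>

lemma first_claim: "wire_claim (fst (ws' ! 0)) (snd (ws' ! 0))"
proof -
 let ?N = "length (ftop dg)"
 obtain x j where w: "ws' ! 0 = (x, j)" by fastforce
 obtain x0 j0 where w0: "ws ! 0 = (x0, j0)" by fastforce
 have x: "x \<in> set (ftop dg)" "(x, j) \<in> set ws'" using other.ws_first w nth_mem[OF other.n(2)] by auto
 have x0: "x0 \<in> set (ftop dg)" "(x0, j0) \<in> set ws" using ws_first w0 nth_mem[OF n(2)] by auto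
 obtain i1 where i1: "i1 < ?N" "ftop dg ! i1 = x" "!!t. C x t = pt (emb ?N i1 t)" using ftop_pos[OF x(1)] by blast
 obtain i0 where i0: "i0 < ?N" "ftop dg ! i0 = x0" "!!t. C x0 t = pt (emb ?N i0 t)" using ftop_pos[OF x0(1)] by blast
 obtain t where t: "C x t + of_int j = u" using ws'_on[OF x(2)] by blast
 obtain t0 where t0: "C x0 t0 + of_int j0 = u0" using ws_on[OF x0(2)] by blast
 have A: "pt r0 < pt r \<longleftrightarrow> u0 < u" if "C x r + of_int j = u" "C x r0 + of_int j = u0" for r r0
  using that emb_less[OF i1(1) i1(1), of r0 r] unfolding i1(3) by auto
 let ?z = "pathfinish (gs (x, j))"
 have z: "?z = Complex (X1 x + j) 1" "?z \<in> path_image (gs (x, j))" using gs_top_F[OF x(1), of j] ends_in(2)[of "gs (x, j)"] by blast+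
 have "\<bar>Re ?z\<bar> < B" using Bw'[OF x(2) z(2)] .
 then have zb: "?z \<in> cbox (bp 0) (bq 0)" using top_box[of ?z] z(1) by simp
 have xx0: "xx 0 = Complex (X1 x0 + j0) 1" using gs_top_F[OF x0(1), of j0] n(2) w0 by (simp add: xx_def)
 have "bc.W ?z = val" if nws: "(x, j) \<notin> set ws"
 proof -
  have lt: "0 <= C x t & C x t < 1 & 0 <= C x0 t0 & C x0 t0 < 1" using pt_bounds unfolding i1(3) i0(3) by blast
  have "Re (xx 0) ~= Re ?z & (Re (xx 0) < Re ?z \<longleftrightarrow> u0 < u)"
  proof (cases j0 j rule: linorder_cases)
   case equal
   then have ne: "i0 ~= i1" using nws x0(2) i0(2) i1(2) by auto
   have "X1 x0 < X1 x \<longleftrightarrow> i0 < i1" "X1 x < X1 x0 \<longleftrightarrow> i1 < i0"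
    using sorted_nth_iff[OF top_F_sorted] i0(1,2) i1(1,2) by auto
   moreover have "u0 < u \<longleftrightarrow> i0 < i1" using t t0 equal emb_less[OF i0(1) i1(1), of t0 t] ne unfolding i1(3) i0(3) by auto
   ultimately show ?thesis using equal ne unfolding xx0 z(1) by auto
  next
   case less
   then have "real_of_int j0 + 1 <= j" by linarith
   then show ?thesis using top_F_width[OF x0(1) x(1)] t t0 lt unfolding xx0 z(1) by simp
  next
   case greater
   then have "real_of_int j + 1 <= j0" by linarith
   then show ?thesis using top_F_width[OF x(1) x0(1)] t t0 lt unfolding xx0 z(1) by simp
  qed
  then show ?thesis using W_side(2)[OF _ zb] z(1) by (auto simp: val_def bp_def)
 qed
 then show ?thesis using A wire_spread[OF x(2) _ z(2)] unfolding wire_claim_def w by simp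
qed

lemma step_box:
 assumes "i < length bs'" "wire_claim (fst (ws' ! i)) (snd (ws' ! i))"
 shows "box_claim (fst (bs' ! i)) (snd (bs' ! i))"
proof -
 obtain x j T k where e: "ws' ! i = (x, j)" "bs' ! i = (T, k)" by fastforce
 have "(x, j) \<in> set ws'" using nth_mem[of i ws'] e(1) assms(1) other.n(1) by simp
 moreover have "(T, k) \<in> set bs'" using nth_mem[of i bs'] e(2) assms(1) by simp
 moreover have "T \<in> transistors dg" using other.bs_tr[OF assms(1)] e by simp
 moreover have "x \<in> set (ttop dg T)" "k = j + a x" using other.ws_step(1,2)[OF assms(1)] e by simp_all
 ultimately show ?thesis using wire_to_box[of T x j] assms(2) e by simp
qed

lemma step_wire:
 assumes "i < length bs'" "box_claim (fst (bs' ! i)) (snd (bs' ! i))"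
 shows "wire_claim (fst (ws' ! Suc i)) (snd (ws' ! Suc i))"
proof -
 obtain x j T k where e: "ws' ! Suc i = (x, j)" "bs' ! i = (T, k)" by fastforce
 have "(x, j) \<in> set ws'" using nth_mem[of "Suc i" ws'] e(1) assms(1) other.n(1) by simp
 moreover have "T \<in> transistors dg" using other.bs_tr[OF assms(1)] e by simp
 moreover have "x \<in> set (tbot dg T)" "j = k" using other.ws_step(3,4)[OF assms(1)] e by simp_all
 ultimately show ?thesis using box_to_wire[of T x j] assms(2) e by simp
qed

lemma wire_claims: "i <= length bs' ==> wire_claim (fst (ws' ! i)) (snd (ws' ! i))"
proof (induction i)
 case 0
 show ?case by (rule first_claim)
next
 case (Suc i)
 then show ?case using step_wire[of i] step_box[of i] by simp
qed

lemma box_claims: "T \<in> transistors dg ==> M T s + of_int k = u ==> box_claim T k"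
proof -
 assume "T \<in> transistors dg" "M T s + of_int k = u"
 then have "(T, k) \<in> set bs'" using fl' le unfolding flow_def linext_def by blast
 then obtain i where "i < length bs'" "bs' ! i = (T, k)" by (auto simp: in_set_conv_nth)
 then show ?thesis using step_box[of i] wire_claims[of i] by simp
qed

text \<open>The last wire carries the claim to the bottom side of the frame. There the drawing
  compares its end with the base line, by translates first and then by the order on the
  side.\<close>

lemma frame_order:
 assumes s: "F s + of_int k = u" and s0: "F s0 + of_int k0 = u0"
 shows "u0 < u \<longleftrightarrow> k0 < k | k0 = k & pt s0 < pt s"
proof -
 let ?N = "length (fbot dg)"
 obtain x j where w: "ws' ! (length ws' - 1) = (x, j)" by fastforce
 obtain x0 j0 where w0: "ws ! (n - 1) = (x0, j0)" by fastforce
 have x: "x \<in> set (fbot dg)" "(x, j) \<in> set ws'" using other.ws_last w nth_mem[of "length ws' - 1" ws'] other.n(2) by auto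
 have x0: "x0 \<in> set (fbot dg)" "(x0, j0) \<in> set ws" using ws_last w0 nth_mem[of "n - 1" ws] n(2) by auto
 obtain i1 where i1: "i1 < ?N" "fbot dg ! i1 = x" "!!t j. F (emb ?N i1 t) + of_int (j + a x) = C x t + of_int j" using fbot_pos[OF x(1)] by blast
 obtain i0 where i0: "i0 < ?N" "fbot dg ! i0 = x0" "!!t j. F (emb ?N i0 t) + of_int (j + a x0) = C x0 t + of_int j"
  using fbot_pos[OF x0(1)] by blast
 obtain t where t: "C x t + of_int j = u" using ws'_on[OF x(2)] by blast
 obtain t0 where t0: "C x0 t0 + of_int j0 = u0" using ws_on[OF x0(2)] by blast
 have sk: "s = emb ?N i1 t" "k = j + a x" using F_inj[of s k "emb ?N i1 t" "j + a x"] s i1(3)[of t j] t by simp_all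
 have sk0: "s0 = emb ?N i0 t0" "k0 = j0 + a x0" using F_inj[of s0 k0 "emb ?N i0 t0" "j0 + a x0"] s0 i0(3)[of t0 j0] t0 by simp_all
 have claim: "wire_claim x j" using wire_claims[of "length bs'"] w other.n(1) by simp
 show ?thesis
 proof (cases "(x, j) \<in> set ws")
  case True
  then obtain t' where t': "C x t' + of_int j = u0" using ws_on by blast
  then have "s0 = emb ?N i1 t'" "k0 = k" using F_inj[of s0 k0 "emb ?N i1 t'" "j + a x"] s0 i1(3)[of t' j] sk(2) by simp_all
  moreover have "pt t' < pt t \<longleftrightarrow> u0 < u" using claim t t' unfolding wire_claim_def by blast
  ultimately show ?thesis using emb_less[OF i1(1) i1(1)] sk(1) by simp
 next
  case False
  let ?z = "pathstart (gs (x, j))"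
  have z: "?z = Complex (X0 x + a x + j) 0" "?z \<in> path_image (gs (x, j))" using gs_bot_F[OF x(1), of j] ends_in(1)[of "gs (x, j)"] by blast+
  have "\<bar>Re ?z\<bar> < B" using Bw'[OF x(2) z(2)] .
  then have zb: "?z \<in> cbox (bp n) (bq n)" using bot_box[of ?z] z(1) by simp
  have een: "ee n = Complex (X0 x0 + a x0 + j0) 0" using gs_bot_F[OF x0(1), of j0] n(2) w0 by (simp add: ee_def)
  have W: "bc.W ?z = val" using claim z(2) False unfolding wire_claim_def by blast
  have kk: "real_of_int k = a x + j" "real_of_int k0 = a x0 + j0" using sk(2) sk0(2) by simp_all
  have "Re (ee n) ~= Re ?z & (Re (ee n) < Re ?z \<longleftrightarrow> k0 < k | k0 = k & pt s0 < pt s)"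
  proof (cases k0 k rule: linorder_cases)
   case equal
   then have ne: "i0 ~= i1" using False x0(2) i0(2) i1(2) sk(2) sk0(2) by auto
   have "X0 x0 < X0 x \<longleftrightarrow> i0 < i1" "X0 x < X0 x0 \<longleftrightarrow> i1 < i0"
    using sorted_nth_iff[OF bot_F_sorted] i0(1,2) i1(1,2) by auto
   moreover have "pt s0 < pt s \<longleftrightarrow> i0 < i1" using emb_less[OF i0(1) i1(1), of t0 t] ne sk sk0 by auto
   ultimately show ?thesis using equal ne kk unfolding een z(1) by auto
  next
   case less
   then have "real_of_int k0 + 1 <= k" by linarith
   then show ?thesis using bot_F_width[OF x0(1) x(1)] less kk unfolding een z(1) by simp
  next
   case greater
   then have "real_of_int k + 1 <= k0" by linarith
   then show ?thesis using bot_F_width[OF x(1) x0(1)] greater kk unfolding een z(1) by simp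
  qed
  moreover have "Im ?z = Im (bq n)" using z(1) n(2) by (simp add: bq_def)
  ultimately show ?thesis using W_side(1)[OF _ zb] W val_iff by (metis order_refl)
 qed
qed

end

section \<open>Monotonicity of the lifts\<close>

context strip
begin

lemma bounded_images: "finite (Y :: (nat \<times> int) set) ==> fst ` Y \<subseteq> wires dg ==> \<exists>B. \<forall>y\<in>Y. \<forall>z\<in>path_image (gs y). \<bar>Re z\<bar> < B"
proof -
 assume Y: "finite Y" "fst ` Y \<subseteq> wires dg"
 have "bounded (path_image (gs y))" if "y \<in> Y" for y
 proof -
  have "arc (gs (fst y, snd y))" using Y(2) that by (intro gs_arc) auto
  then show ?thesis by (simp add: arc_imp_path bounded_path_image)
 qed
 then have "bounded (\<Union>y\<in>Y. path_image (gs y))" using Y(1) by (intro bounded_UN) auto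
 then obtain B where "\<forall>z\<in>(\<Union>y\<in>Y. path_image (gs y)). norm z <= B" unfolding bounded_iff by blast
 then have "\<forall>y\<in>Y. \<forall>z\<in>path_image (gs y). \<bar>Re z\<bar> < B + 1"
  using abs_Re_le_cmod by (metis UN_I add.commute add_strict_increasing less_numeral_extra(1) order_trans)
 then show ?thesis by blast
qed

lemma bounded_boxes: "finite (Y :: (nat \<times> int) set) ==> \<exists>B. \<forall>y\<in>Y. \<forall>z\<in>tbox y. \<bar>Re z\<bar> < B"
proof -
 assume Y: "finite Y"
 then have "bounded (\<Union>y\<in>Y. tbox y)" by (intro bounded_UN) (auto simp: tbox_def)
 then obtain B where "\<forall>z\<in>(\<Union>y\<in>Y. tbox y). norm z <= B" unfolding bounded_iff by blast
 then have "\<forall>y\<in>Y. \<forall>z\<in>tbox y. \<bar>Re z\<bar> < B + 1"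
  using abs_Re_le_cmod by (metis UN_I add.commute add_strict_increasing less_numeral_extra(1) order_trans)
 then show ?thesis by blast
qed

text \<open>Two lines are compared with the same base line under a common bound \<open>B\<close>, so
  that both comparisons refer to literally the same closed curve.\<close>

lemma ex_pairs:
 "\<exists>Ts ws bs B ws1 bs1 ws2 bs2. strip_pair A R w dg p q g a X0 X1 Ts u0 ws bs B u1 ws1 bs1 &
  strip_pair A R w dg p q g a X0 X1 Ts u0 ws bs B u2 ws2 bs2"
proof -
 obtain Ts where Ts: "linext dg Ts" using ex_linext by blast
 have ex: "\<exists>ws bs. flow u Ts ws bs" for u using ex_flow_prefix[of Ts "[]"] Ts by simp
 obtain ws bs ws1 bs1 ws2 bs2 where f: "flow u0 Ts ws bs" "flow u1 Ts ws1 bs1" "flow u2 Ts ws2 bs2" using ex by metis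
 let ?Y = "set ws \<union> set ws1 \<union> set ws2" and ?Z = "set bs \<union> set bs1 \<union> set bs2"
 have "fst ` ?Y \<subseteq> wires dg" using f seen_all[OF Ts] unfolding flow_def by auto
 then obtain B1 where B1: "!!y z. y \<in> ?Y ==> z \<in> path_image (gs y) ==> \<bar>Re z\<bar> < B1" using bounded_images[of ?Y] by auto
 obtain B2 where B2: "!!y z. y \<in> ?Z ==> z \<in> tbox y ==> \<bar>Re z\<bar> < B2" using bounded_boxes[of ?Z] by auto
 have Bw: "\<bar>Re z\<bar> < max B1 B2" if "y \<in> ?Y" "z \<in> path_image (gs y)" for y z using B1[OF that] by simp
 have Bb: "\<bar>Re z\<bar> < max B1 B2" if "y \<in> ?Z" "z \<in> tbox y" for y z using B2[OF that] by simp
 have base: "strip_base A R w dg p q g a X0 X1 Ts u0 ws bs (max B1 B2)" by unfold_locales (use Ts f(1) Bw Bb in blast)+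
 have "strip_pair A R w dg p q g a X0 X1 Ts u0 ws bs (max B1 B2) u1 ws1 bs1"
  by (intro strip_pair.intro base strip_pair_axioms.intro f(2)) (use Bw Bb in blast)+
 moreover have "strip_pair A R w dg p q g a X0 X1 Ts u0 ws bs (max B1 B2) u2 ws2 bs2"
  by (intro strip_pair.intro base strip_pair_axioms.intro f(3)) (use Bw Bb in blast)+
 ultimately show ?thesis by blast
qed

text \<open>Order is \<open>frame_order\<close>. For the absence of gaps, a number \<open>y\<close>
  between two values of \<open>F\<close> is an integer translate of some value, and comparing it
  with its two neighbours leaves only the shift 0.\<close>

theorem F_ok: "lift_ok F"
proof -
 have ord: "F s0 + of_int k0 < F s + of_int k \<longleftrightarrow> k0 < k | k0 = k & pt s0 < pt s"
  if ne: "F s + of_int k ~= F s0 + of_int k0" for s k s0 k0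
 proof -
  obtain Ts ws bs B ws1 bs1 where "strip_pair A R w dg p q g a X0 X1 Ts (F s0 + of_int k0) ws bs B (F s + of_int k) ws1 bs1"
   using ex_pairs by blast
  then show ?thesis by (rule strip_pair.frame_order) simp_all
 qed
 show ?thesis unfolding lift_ok_def
 proof (intro conjI allI impI)
  fix s t assume st: "pt s < pt t"
  have "F t + of_int 0 ~= F s + of_int 0" using F_inj[of t 0 s 0] st by auto
  then show "F s < F t" using ord[of t 0 s 0] st by simp
 next
  fix s t y assume y: "F s < y" "y < F t"
  obtain r k where r: "y = F r + of_int k" using F_surj by blast
  have "~ k < 0" using ord[of r k s 0] y r by auto
  moreover have "~ k > 0" using ord[of t 0 r k] y r by auto
  ultimately show "y \<in> range F" using r by auto
 qed
qed

text \<open>For a gap \<open>y\<close> in the image, the flow line of \<open>y\<close> misses the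
  box of \<open>T\<close>. The lines of a smaller and of a larger value both run through that box,
  yet they demand different winding numbers at the same point of it.\<close>

theorem M_ok:
 assumes T: "T \<in> transistors dg"
 shows "lift_ok (M T)" unfolding lift_ok_def
proof (intro conjI allI impI)
 fix s t assume st: "pt s < pt t"
 have ne: "M T t ~= M T s" using M_inj[OF T, of t 0 s 0] st by auto
 then obtain Ts ws bs B ws1 bs1 where pr: "strip_pair A R w dg p q g a X0 X1 Ts (M T s) ws bs B (M T t) ws1 bs1" using ex_pairs by blast
 interpret strip_pair A R w dg p q g a X0 X1 Ts "M T s" ws bs B "M T t" ws1 bs1 by (rule pr)
 show "M T s < M T t" using box_claims[OF T, of t 0] st unfolding box_claim_def by simp
next
 fix s t y assume y: "M T s < y" "y < M T t"
 show "y \<in> range (M T)"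
 proof (rule ccontr)
  assume nr: "y \<notin> range (M T)"
  have ne: "M T s ~= y" "M T t ~= y" using y by auto
  obtain Ts ws bs B ws1 bs1 ws2 bs2 where pr: "strip_pair A R w dg p q g a X0 X1 Ts y ws bs B (M T s) ws1 bs1"
   "strip_pair A R w dg p q g a X0 X1 Ts y ws bs B (M T t) ws2 bs2" using ex_pairs by blast
  interpret S: strip_pair A R w dg p q g a X0 X1 Ts y ws bs B "M T s" ws1 bs1 by (rule pr)
  interpret T: strip_pair A R w dg p q g a X0 X1 Ts y ws bs B "M T t" ws2 bs2 by (rule pr)
  have nb: "(T, 0) \<notin> set bs"
  proof
   assume "(T, 0) \<in> set bs"
   then obtain i where i: "i < length bs" "bs ! i = (T, 0)" by (auto simp: in_set_conv_nth)
   obtain x j where wi: "ws ! i = (x, j)" by fastforce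
   have "(x, j) \<in> set ws" using nth_mem[of i ws] i(1) wi S.n(1) by simp
   then have "on y x j" using S.fl unfolding flow_def by auto
   moreover have "x \<in> set (ttop dg T)" "0 = j + a x" using S.ws_step(1,2)[OF i(1)] i(2) wi by simp_all
   ultimately show False using on_ttop nr by (metis add.right_neutral of_int_0 rangeI)
  qed
  have z: "p T \<in> tbox (T, 0)" using box[OF T] by (simp add: tbox_def in_cbox_complex_iff)
  have "S.bc.W (p T) = S.val" using S.box_claims[OF T, of s 0] nb z unfolding S.box_claim_def by simp
  moreover have "S.bc.W (p T) = T.val" using T.box_claims[OF T, of t 0] nb z unfolding T.box_claim_def by simp
  ultimately show False using y unfolding S.val_def T.val_def by simp
 qed
qed

end

section \<open>Monotone charts\<close>

definition lifts :: "(ivl => real) => (ivl => ivl) => bool" where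
 "lifts g c \<longleftrightarrow> lift_ok g & (\<forall>t. frac (g t) = pt (c t))"

text \<open>\<open>b\<close> distinguishes the planar case from the annular one.\<close>

definition monotone_chart :: "bool => (ivl => ivl) => bool" where
 "monotone_chart b c \<longleftrightarrow> (\<exists>g. lifts g c & (b --> (\<forall>t. 0 <= g t & g t < 1)))"

text \<open>The extension of a lift to a map of the whole line commuting with translation by 1. In
  this form lifts can be composed and inverted.\<close>

definition degree_one :: "(ivl => real) => real => real" where
 "degree_one g x = g (mk (frac x)) + of_int \<lfloor>x\<rfloor>"

lemma pt_mk_frac: "pt (mk (frac x)) = frac x" by (intro pt_mk) (simp_all add: frac_lt_1)

lemma degree_one_pt: "degree_one g (pt t + of_int k) = g t + of_int k"
proof -
 have "frac (pt t + of_int k) = pt t" "\<lfloor>pt t + of_int k\<rfloor> = k" using pt_bounds[of t] by (auto simp: frac_eq floor_unique)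
 then show ?thesis by (simp add: degree_one_def pt_inverse)
qed

lemma real_as_pt:
 obtains t k where "x = pt t + of_int k" by (rule that[of "mk (frac x)" "\<lfloor>x\<rfloor>"], unfold pt_mk_frac) (simp add: frac_def)

lemma frac_degree_one:
 assumes "lifts g f"
 shows "frac (degree_one g x) = pt (f (mk (frac x)))" using assms unfolding lifts_def degree_one_def by (simp add: frac_def)

text \<open>Were two values at least 1 apart, the image, having no gaps, would contain
  \<open>g t + 1\<close>, and its preimage would be a second point with the same value of
  \<open>f\<close>.\<close>

lemma lift_width:
 assumes "inj f" and l: "lifts g f"
 shows "g s < g t + 1"
proof (rule ccontr)
 assume "~ g s < g t + 1"
 then have "g t < g t + 1" "g t + 1 <= g s" by auto
 then have "g t + 1 \<in> range g" using l unfolding lifts_def lift_ok_def by (metis order_le_less rangeI)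
 then obtain r where r: "g r = g t + 1" by auto
 then have "frac (g r) = frac (g t)" by (simp add: frac_def)
 then have "f r = f t" using l unfolding lifts_def by (simp add: pt_eq_iff)
 then have "r = t" using assms(1) by (meson injD)
 then show False using r by simp
qed

context
 fixes f g
 assumes bij: "bij f" and l: "lifts g f"
begin

lemma degree_one_strict_mono: "strict_mono (degree_one g)"
proof
 fix x y :: real assume "x < y"
 obtain s j where x: "x = pt s + of_int j" using real_as_pt by blast
 obtain t k where y: "y = pt t + of_int k" using real_as_pt by blast
 have "j < k | j = k & pt s < pt t" using \<open>x < y\<close> pt_bounds[of s] pt_bounds[of t] unfolding x y by linarith
 then have "g s + of_int j < g t + of_int k"
 proof
  assume "j < k"
  then have "real_of_int j + 1 <= of_int k" by linarith
  then show ?thesis using lift_width[OF bij_is_inj[OF bij] l, of s t] by linarith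
 qed (use l in \<open>auto simp: lifts_def lift_ok_def\<close>)
 then show "degree_one g x < degree_one g y" unfolding x y degree_one_pt .
qed

lemma degree_one_less: "degree_one g x < degree_one g y \<longleftrightarrow> x < y" by (rule strict_mono_less[OF degree_one_strict_mono])

lemma degree_one_surj: "\<exists>x. degree_one g x = y"
proof -
 obtain t where t: "f t = mk (frac y)" using bij by (metis bij_pointE)
 then have "frac (g t) = frac y" using l unfolding lifts_def by (simp add: pt_mk_frac)
 then have "degree_one g (pt t + of_int (\<lfloor>y\<rfloor> - \<lfloor>g t\<rfloor>)) = y" unfolding degree_one_pt frac_def by simp
 then show ?thesis by blast
qed

lemma lifts_comp:
 assumes "lifts h m"
 shows "lifts (degree_one g \<circ> h) (f \<circ> m)" unfolding lifts_def lift_ok_def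
proof (intro conjI allI impI)
 fix s t assume "pt s < pt t"
 then show "(degree_one g \<circ> h) s < (degree_one g \<circ> h) t" using assms unfolding lifts_def lift_ok_def by (simp add: degree_one_less)
next
 fix s t y assume y: "(degree_one g \<circ> h) s < y" "y < (degree_one g \<circ> h) t"
 obtain x where x: "degree_one g x = y" using degree_one_surj by blast
 have "h s < x" "x < h t" using y unfolding x[symmetric] by (simp_all add: degree_one_less)
 then obtain r where "x = h r" using assms unfolding lifts_def lift_ok_def by blast
 then show "y \<in> range (degree_one g \<circ> h)" using x by auto
next
 fix t show "frac ((degree_one g \<circ> h) t) = pt ((f \<circ> m) t)"
  using assms frac_degree_one[OF l, of "h t"] unfolding lifts_def by (simp add: pt_inverse)
qed

definition inverse_lift :: "ivl => real" where "inverse_lift t = (SOME x. degree_one g x = pt t)"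

lemma inverse_lift: "degree_one g (inverse_lift t) = pt t" unfolding inverse_lift_def by (rule someI_ex) (rule degree_one_surj)

lemma lifts_inverse: "lifts inverse_lift (inv_into UNIV f)" unfolding lifts_def lift_ok_def
proof (intro conjI allI impI)
 fix s t assume "pt s < pt t"
 then show "inverse_lift s < inverse_lift t" using degree_one_less[of "inverse_lift s" "inverse_lift t"] by (simp add: inverse_lift)
next
 fix s t y assume "inverse_lift s < y" "y < inverse_lift t"
 then have "degree_one g (inverse_lift s) < degree_one g y" "degree_one g y < degree_one g (inverse_lift t)" by (simp_all add: degree_one_less)
 then have "0 <= degree_one g y" "degree_one g y < 1" using pt_bounds[of s] pt_bounds[of t] by (simp_all add: inverse_lift)
 then have "degree_one g (inverse_lift (mk (degree_one g y))) = degree_one g y" by (simp add: inverse_lift pt_mk)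
 then have "inverse_lift (mk (degree_one g y)) = y" using strict_mono_eq[OF degree_one_strict_mono] by blast
 then show "y \<in> range inverse_lift" by (metis rangeI)
next
 fix t
 have "frac (pt t) = pt t" using pt_bounds[of t] by (simp add: frac_eq)
 then have "t = f (mk (frac (inverse_lift t)))" using frac_degree_one[OF l, of "inverse_lift t"] unfolding inverse_lift by (simp add: pt_eq_iff)
 then have "inv_into UNIV f t = mk (frac (inverse_lift t))" using bij by (metis bij_is_inj inv_f_f)
 then show "frac (inverse_lift t) = pt (inv_into UNIV f t)" by (simp add: pt_mk_frac)
qed

end

text \<open>In the planar case the lift of \<open>m\<close> has values in [0,1), where
  \<open>degree_one g\<close> adds no integer, so the bounds on \<open>g\<close> carry over.\<close>

lemma monotone_chart_comp:
 assumes "bij f" "monotone_chart b f" "monotone_chart b m"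
 shows "monotone_chart b (f \<circ> m)"
proof -
 obtain g h where g: "lifts g f" "b --> (\<forall>t. 0 <= g t & g t < 1)" and h: "lifts h m" "b --> (\<forall>t. 0 <= h t & h t < 1)"
  using assms unfolding monotone_chart_def by blast
 have "0 <= (degree_one g \<circ> h) t & (degree_one g \<circ> h) t < 1" if b for t
 proof -
  have "0 <= h t" "h t < 1" using h(2) that by auto
  then have "\<lfloor>h t\<rfloor> = 0" by (simp add: floor_eq_iff)
  then show ?thesis using g(2) that by (simp add: degree_one_def)
 qed
 then show ?thesis using lifts_comp[OF assms(1) g(1) h(1)] unfolding monotone_chart_def by blast
qed

lemma monotone_chart_inverse:
 assumes "bij f" "monotone_chart b f"
 shows "monotone_chart b (inv_into UNIV f)"
proof -
 obtain g where g: "lifts g f" "b --> (\<forall>t. 0 <= g t & g t < 1)" using assms unfolding monotone_chart_def by blast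
 note il = inverse_lift[OF assms(1) g(1)]
 have "0 <= inverse_lift g t & inverse_lift g t < 1" if b for t
 proof -
  let ?x = "inverse_lift g t"
  have "g (mk (frac ?x)) + of_int \<lfloor>?x\<rfloor> = pt t" using il[of t] unfolding degree_one_def .
  moreover have "0 <= g (mk (frac ?x))" "g (mk (frac ?x)) < 1" using g(2) that by auto
  ultimately have "\<lfloor>?x\<rfloor> = 0" using pt_bounds[of t] by linarith
  then show ?thesis by (simp add: floor_eq_iff)
 qed
 then show ?thesis using lifts_inverse[OF assms(1) g(1)] unfolding monotone_chart_def by blast
qed

lemma lifts_id: "lifts pt id" unfolding lifts_def lift_ok_def
proof (intro conjI allI impI)
 fix s t y assume "pt s < y" "y < pt t"
 then have "y = pt (mk y)" using pt_bounds[of s] pt_bounds[of t] by (intro pt_mk[symmetric]) auto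
 then show "y \<in> range pt" by (metis rangeI)
qed (use pt_bounds in \<open>auto simp: frac_eq\<close>)

lemma monotone_chart_id: "monotone_chart b id" unfolding monotone_chart_def using lifts_id pt_bounds by blast

text \<open>Chartings agree on all wires of a diagram, so the quantifier over \<open>c\<close>
  merely names the charting.\<close>

definition monotone_diagram :: "bool => 'a diagram => bool" where
 "monotone_diagram b dg \<longleftrightarrow> (\<exists>c. charting dg c & (\<forall>T\<in>transistors dg. monotone_chart b (tchart dg c T)) &
   monotone_chart b (joinl (map c (fbot dg))))"

lemma monotone_id: "w ~= [] ==> monotone_diagram b (id_diagram w)"
proof -
 assume w: "w ~= []"
 let ?c = "%i. pieces (length w) id ! i"
 have m: "map ?c [0..<length w] = pieces (length w) (id :: ivl => ivl)" by (intro nth_equalityI) auto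
 have "charting (id_diagram w) ?c" using m unfolding charting_def id_diagram_def by simp
 moreover have "joinl (map ?c (fbot (id_diagram w))) = id" using m w by (simp add: id_diagram_def joinl_pieces)
 moreover have "transistors (id_diagram w) = {}" by (simp add: id_diagram_def)
 ultimately show ?thesis unfolding monotone_diagram_def using monotone_chart_id by auto
qed

context ww_diagram
begin

lemma monotone_flip:
 assumes "monotone_diagram b dg"
 shows "monotone_diagram b (flip dg)"
proof -
 obtain c where c: "charting dg c" "!!T. T \<in> transistors dg ==> monotone_chart b (tchart dg c T)"
  "monotone_chart b (joinl (map c (fbot dg)))" using assms unfolding monotone_diagram_def by blast
 define f where "f = joinl (map c (fbot dg))"
 obtain d where d: "charting (flip dg) d" "!!T. T \<in> transistors dg ==> tchart (flip dg) d T = inv_into UNIV f \<circ> tchart dg c T"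
  "inv_into UNIV f = joinl (map d (fbot (flip dg)))" using flip_charting[OF c(1) f_def] by blast
 have f: "bij f" using frame_chart(2)[OF c(1)] f_def by simp
 have mi: "monotone_chart b (inv_into UNIV f)" using monotone_chart_inverse[OF f] c(3) f_def by simp
 show ?thesis unfolding monotone_diagram_def
 proof (rule exI[of _ d], intro conjI ballI)
  show "charting (flip dg) d" by (rule d(1))
  fix T assume "T \<in> transistors (flip dg)"
  then have T: "T \<in> transistors dg" by (simp add: flip_fields)
  show "monotone_chart b (tchart (flip dg) d T)" unfolding d(2)[OF T] by (intro monotone_chart_comp bij_imp_bij_inv f mi c(2) T)
 next
  show "monotone_chart b (joinl (map d (fbot (flip dg))))" using mi unfolding d(3) .
 qed
qed

end

context ww_pair
begin

lemma monotone_concat: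
 assumes "monotone_diagram b dg" "monotone_diagram b dg'"
 shows "monotone_diagram b dgc"
proof -
 obtain c where c: "charting dg c" "!!T. T \<in> transistors dg ==> monotone_chart b (tchart dg c T)"
  "monotone_chart b (joinl (map c (fbot dg)))" using assms(1) unfolding monotone_diagram_def by blast
 obtain d where d: "charting dg' d" "!!T. T \<in> transistors dg' ==> monotone_chart b (tchart dg' d T)"
  "monotone_chart b (joinl (map d (fbot dg')))" using assms(2) unfolding monotone_diagram_def by blast
 define f where "f = joinl (map c (fbot dg))"
 have f: "bij f" "monotone_chart b f" using D.frame_chart(2)[OF c(1)] c(3) f_def by simp_all
 define e where "e = concat_chart c f d"
 note e = concat_charting[OF c(1) f_def d(1), folded e_def]
 have "map e (fbot dgc) = map ((\<circ>) f) (map d (fbot dg'))" unfolding cfields using e(3) by simp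
 then have fr: "joinl (map e (fbot dgc)) = f \<circ> joinl (map d (fbot dg'))" using D'.nonempty(2) joinl_comp[of "map d (fbot dg')" f] by simp
 show ?thesis unfolding monotone_diagram_def
 proof (rule exI[of _ e], intro conjI ballI)
  show "charting dgc e" by (rule e(1))
  show "monotone_chart b (joinl (map e (fbot dgc)))" unfolding fr by (rule monotone_chart_comp[OF f d(3)])
  fix S assume "S \<in> transistors dgc"
  then consider T where "S = 2 * T" "T \<in> transistors dg" | T where "S = 2 * T + 1" "T \<in> transistors dg'" unfolding cfields by blast
  then show "monotone_chart b (tchart dgc e S)"
  proof cases
   case 1
   then show ?thesis using c(2) e(4) by simp
  next
   case 2
   show ?thesis unfolding 2(1) e(5)[OF 2(2)] by (rule monotone_chart_comp[OF f d(2)[OF 2(2)]])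
  qed
 qed
qed

end

context strip
begin

text \<open>Without shifts the lifts never leave [0,1), because the sweep starts with the inclusion
  of [0,1) in the line and only cuts and joins; this gives the stronger form for planar
  diagrams.\<close>

lemma monotone_strip:
 assumes "b --> (\<forall>x. a x = 0)"
 shows "monotone_diagram b dg"
proof -
 have mc: "monotone_chart b (red \<circ> g)" if "lift_ok g" "b --> (\<forall>t. 0 <= g t & g t < 1)" for g
  unfolding monotone_chart_def lifts_def using that by (auto simp: pt_red)
 have C01: "0 <= C x t & C x t < 1" if b "x \<in> wires dg" for x t
 proof -
  have a: "a x = 0" for x using that(1) assms by blast
  have C: "map C (ftop dg) = pieces (length (ftop dg)) pt"
   "!!T. T \<in> transistors dg ==> map C (tbot dg T) = pieces (length (tbot dg T)) (joinl (map C (ttop dg T)))"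
   using C_props unfolding M_def a by (simp_all del: o_apply)
  obtain Ts where Ts: "linext dg Ts" using ex_linext by blast
  then have "linext dg (Ts @ [])" by simp
  then have "\<forall>x\<in>seen dg Ts. \<forall>t. 0 <= C x t & C x t < 1"
  proof (induction rule: linext_induct)
   case Nil
   have "0 <= C (ftop dg ! i) t & C (ftop dg ! i) t < 1" if "i < length (ftop dg)" for i t using C_ftop[OF that] pt_bounds by simp
   then show ?case unfolding seen_Nil by (metis in_set_conv_nth)
  next
   case (step Us T Ws)
   note s = linext_step[OF step(1)]
   have M: "0 <= M T t & M T t < 1" for t
   proof -
    obtain i r where r: "i < length (ttop dg T)" "t = emb (length (ttop dg T)) i r"
     using emb_surj[of "length (ttop dg T)"] nonempty(3)[OF s(1)] by blast
    have "ttop dg T ! i \<in> seen dg Us" using s(4) nth_mem[OF r(1)] unfolding live_def by blast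
    then have "0 <= C (ttop dg T ! i) r & C (ttop dg T ! i) r < 1" using step(2) by blast
    then show ?thesis using M_emb[OF r(1), of r] a[of "ttop dg T ! i"] r(2) by simp
   qed
   have "0 <= C (tbot dg T ! i) t & C (tbot dg T ! i) t < 1" if "i < length (tbot dg T)" for i t using C_tbot[OF s(1) that] M by simp
   then have "\<forall>x\<in>set (tbot dg T). \<forall>t. 0 <= C x t & C x t < 1" by (metis in_set_conv_nth)
   then show ?case using step(2) unfolding s(8) by blast
  qed
  then show ?thesis using \<open>x \<in> wires dg\<close> seen_all[OF Ts] by blast
 qed
 have M01: "0 <= M T t & M T t < 1" if tb: b "T \<in> transistors dg" for T t
 proof -
  obtain i r where r: "i < length (ttop dg T)" "t = emb (length (ttop dg T)) i r"
   using emb_surj[of "length (ttop dg T)"] nonempty(3)[OF tb(2)] by blast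
  have "ttop dg T ! i \<in> wires dg" using bots(5) nth_mem[OF r(1)] tb(2) by blast
  then show ?thesis using C01[OF tb(1), of "ttop dg T ! i" r] M_emb[OF r(1), of r] assms tb(1) r(2) by simp
 qed
 have F01: "0 <= F t & F t < 1" if b for t
 proof -
  obtain i r where r: "i < length (fbot dg)" "t = emb (length (fbot dg)) i r" using emb_surj[of "length (fbot dg)"] nonempty(2) by blast
  have "fbot dg ! i \<in> wires dg" using bots(5) nth_mem[OF r(1)] by blast
  then show ?thesis using C01[OF that, of "fbot dg ! i" r] F_emb[OF r(1), of r] assms that r(2) by simp
 qed
 show ?thesis unfolding monotone_diagram_def
 proof (rule exI[of _ c0], intro conjI ballI)
  show "charting dg c0" by (rule charting_c0)
  show "monotone_chart b (joinl (map c0 (fbot dg)))" unfolding frame_c0 using mc[OF F_ok] F01 by blast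
  fix T assume T: "T \<in> transistors dg"
  show "monotone_chart b (tchart dg c0 T)" unfolding tchart_c0[OF T] using mc[OF M_ok[OF T]] M01[OF _ T] by blast
 qed
qed

end

section \<open>Drawing monotone diagrams\<close>

text \<open>A drawing in which wires are vertical segments and transistors are rectangles of disjoint heights. The
  horizontal coordinate is taken modulo \<open>1\<close>.\<close>

locale layout = ww_diagram A R w dg for A :: "'a set" and R w dg +
 fixes b :: bool and X lo hi l r bt tp :: "nat => real"
 assumes box_pos: "T \<in> transistors dg ==> 0 < bt T & bt T < tp T & tp T < 1 & l T < r T & r T < l T + 1 & (b --> 0 <= l T & r T < 1)"
  and wire_pos: "x \<in> wires dg ==> 0 <= X x & X x < 1 & 0 <= lo x & lo x < hi x & hi x <= 1"
  and ttop_height: "T \<in> transistors dg ==> x \<in> set (ttop dg T) ==> lo x = tp T"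
  and tbot_height: "T \<in> transistors dg ==> x \<in> set (tbot dg T) ==> hi x = bt T"
  and ttop_order: "T \<in> transistors dg ==> \<exists>ps. set ps \<subseteq> {l T..r T} & sorted_wrt (<) ps & map X (ttop dg T) = map frac ps"
  and tbot_order: "T \<in> transistors dg ==> \<exists>ps. set ps \<subseteq> {l T..r T} & sorted_wrt (<) ps & map X (tbot dg T) = map frac ps"
  and ftop_height: "x \<in> set (ftop dg) ==> hi x = 1 & 0 < X x"
  and ftop_order: "sorted_wrt (<) (map X (ftop dg))"
  and fbot_height: "x \<in> set (fbot dg) ==> lo x = 0"
  and fbot_order: "\<exists>\<beta> ps. set ps \<subseteq> {\<beta><..<\<beta> + 1} & sorted_wrt (<) ps & map X (fbot dg) = map frac ps & (b --> set ps \<subseteq> {0..<1})"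
  and boxes_apart: "S \<in> transistors dg ==> T \<in> transistors dg ==> S ~= T ==> tp S < bt T | tp T < bt S"
  and wires_apart: "x \<in> wires dg ==> y \<in> wires dg ==> x ~= y ==> X x = X y ==> hi x < lo y | hi y < lo x"
  and wire_box_apart: "x \<in> wires dg ==> T \<in> transistors dg ==> lo x < h ==> h < hi x ==> bt T <= h ==> h <= tp T ==>
   l T <= \<xi> ==> \<xi> <= r T ==> frac \<xi> ~= X x"

text \<open>Placing wires at midpoints keeps them away from abscissa 0 on the top side of the frame:
  in the annulus the basepoint of the inner circle must avoid the wires.\<close>

definition mid :: ivl where "mid = mk (1 / 2)"

lemma pt_mid: "pt mid = 1 / 2" unfolding mid_def by (rule pt_mk) auto

lemma pt_mk0: "pt (mk 0) = 0" by (rule pt_mk) auto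

definition mids :: "nat => ivl set" where "mids n = (%i. emb n i mid) ` {..<n}"

lemma mids_pos: "s \<in> mids n ==> 0 < pt s"
proof -
 assume "s \<in> mids n"
 then obtain i where i: "i < n" "s = emb n i mid" unfolding mids_def by auto
 have "pt (emb n i (mk 0)) < pt s" using emb_less[OF i(1) i(1)] i(2) pt_mk0 pt_mid by simp
 then show "0 < pt s" using pt_bounds(1)[of "emb n i (mk 0)"] by linarith
qed

lemma mids_order:
 assumes g: "lifts g m" and c: "map c xs = pieces (length xs) m"
 shows "\<exists>ps. set ps = g ` mids (length xs) & sorted_wrt (<) ps & map (%x. pt (c x mid)) xs = map frac ps"
proof (intro exI conjI)
 let ?ps = "map (%i. g (emb (length xs) i mid)) [0..<length xs]"
 show "set ?ps = g ` mids (length xs)" unfolding mids_def by (auto simp: image_image)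
 show "sorted_wrt (<) ?ps" unfolding sorted_wrt_iff_nth_less using g emb_less[of _ "length xs" _ mid mid] unfolding lifts_def lift_ok_def by auto
 show "map (%x. pt (c x mid)) xs = map frac ?ps"
 proof (rule nth_equalityI)
  fix i assume "i < length (map (%x. pt (c x mid)) xs)"
  then have i: "i < length xs" by simp
  have "c (xs ! i) = m \<circ> emb (length xs) i" using arg_cong[OF c, of "%l. l ! i"] i pieces_nth[OF i, of m] by simp
  then show "map (%x. pt (c x mid)) xs ! i = map frac ?ps ! i" using g i unfolding lifts_def by simp
 qed simp
qed

section \<open>Heights of wires and transistors\<close>

context ww_diagram
begin

context
 fixes Ts :: "nat list"
 assumes Ts: "linext dg Ts"
begin

abbreviation "N \<equiv> length Ts"

text \<open>With \<open>N\<close> transistors there are \<open>N + 1\<close> horizontal bands. A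
  wire crosses the bands from \<open>tix\<close> to \<open>bix\<close>, band 0 touching the top of
  the frame and band \<open>N\<close> its bottom.\<close>

definition tix :: "nat => nat" where
 "tix x = (if x \<in> set (ftop dg) then 0 else Suc (SOME k. k < N & x \<in> set (tbot dg (Ts ! k))))"
definition bix :: "nat => nat" where
 "bix x = (if x \<in> set (fbot dg) then N else (SOME k. k < N & x \<in> set (ttop dg (Ts ! k))))"

lemma Ts_nth: "k < N ==> Ts ! k \<in> transistors dg" "T \<in> transistors dg ==> \<exists>k<N. Ts ! k = T"
 using Ts unfolding linext_def by (metis nth_mem, metis in_set_conv_nth)

lemma Ts_eq: "j < N ==> k < N ==> Ts ! j = Ts ! k ==> j = k" using Ts unfolding linext_def by (simp add: nth_eq_iff_index_eq)

lemma tix_ftop: "x \<in> set (ftop dg) ==> tix x = 0" and bix_fbot: "x \<in> set (fbot dg) ==> bix x = N" by (simp_all add: tix_def bix_def)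

lemma tix_tbot:
 assumes k: "k < N" "x \<in> set (tbot dg (Ts ! k))"
 shows "tix x = Suc k"
proof -
 have "x \<notin> set (ftop dg)" using tops(3)[OF Ts_nth(1)[OF k(1)]] k(2) by blast
 moreover have "(SOME k. k < N & x \<in> set (tbot dg (Ts ! k))) = k"
 proof (rule some_equality)
  fix j assume j: "j < N & x \<in> set (tbot dg (Ts ! j))"
  then have "Ts ! j = Ts ! k" using tops(4)[OF Ts_nth(1) Ts_nth(1), of j k] k by blast
  then show "j = k" using Ts_eq j k(1) by blast
 qed (use k in blast)
 ultimately show ?thesis by (simp add: tix_def)
qed

lemma bix_ttop:
 assumes k: "k < N" "x \<in> set (ttop dg (Ts ! k))"
 shows "bix x = k"
proof -
 have "x \<notin> set (fbot dg)" using bots(3)[OF Ts_nth(1)[OF k(1)]] k(2) by blast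
 moreover have "(SOME k. k < N & x \<in> set (ttop dg (Ts ! k))) = k"
 proof (rule some_equality)
  fix j assume j: "j < N & x \<in> set (ttop dg (Ts ! j))"
  then have "Ts ! j = Ts ! k" using bots(4)[OF Ts_nth(1) Ts_nth(1), of j k] k by blast
  then show "j = k" using Ts_eq j k(1) by blast
 qed (use k in blast)
 ultimately show ?thesis by (simp add: bix_def)
qed

lemma top_cases:
 assumes "x \<in> wires dg"
 obtains "x \<in> set (ftop dg)" "tix x = 0" | k where "k < N" "x \<in> set (tbot dg (Ts ! k))" "tix x = Suc k"
proof -
 consider "x \<in> set (ftop dg)" | T where "T \<in> transistors dg" "x \<in> set (tbot dg T)" using tops(5) assms by blast
 then show ?thesis
 proof cases
  case (2 T)
  then obtain k where "k < N" "Ts ! k = T" using Ts_nth(2) by blast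
  then show ?thesis using that(2) tix_tbot 2 by blast
 next
  case 1
  then show ?thesis by (intro that(1) tix_ftop)
 qed
qed

lemma bot_cases:
 assumes "x \<in> wires dg"
 obtains "x \<in> set (fbot dg)" "bix x = N" | k where "k < N" "x \<in> set (ttop dg (Ts ! k))" "bix x = k"
proof -
 consider "x \<in> set (fbot dg)" | T where "T \<in> transistors dg" "x \<in> set (ttop dg T)" using bots(5) assms by blast
 then show ?thesis
 proof cases
  case (2 T)
  then obtain k where "k < N" "Ts ! k = T" using Ts_nth(2) by blast
  then show ?thesis using that(2) bix_ttop 2 by blast
 next
  case 1
  then show ?thesis by (intro that(1) bix_fbot)
 qed
qed

lemma tix_le_bix:
 assumes "x \<in> wires dg"
 shows "tix x <= bix x" "bix x <= N"
proof -
 show "bix x <= N" using assms by (cases rule: bot_cases) auto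
 show "tix x <= bix x" using assms
 proof (cases rule: top_cases)
  case k: (2 k)
  from assms show ?thesis
  proof (cases rule: bot_cases)
   case m: (2 m)
   have p: "(Ts ! m, Ts ! k) \<in> prec dg" using k m Ts_nth(1) unfolding prec_def by blast
   have "m ~= k" using p acyc unfolding acyclic_def by blast
   moreover have "~ m < k" using p Ts k(1) unfolding linext_def sorted_wrt_iff_nth_less by blast
   ultimately show ?thesis using k(3) m(3) by simp
  qed (use k in simp)
 qed simp
qed

lemma live_take:
 assumes x: "x \<in> wires dg" and j: "j <= N"
 shows "x \<in> live dg (take j Ts) \<longleftrightarrow> tix x <= j & j <= bix x"
proof -
 have st: "set (take j Ts) = (%k. Ts ! k) ` {..<j}" using j by (simp add: nth_image[symmetric] lessThan_atLeast0)
 have "x \<in> seen dg (take j Ts) \<longleftrightarrow> tix x <= j" using x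
 proof (cases rule: top_cases)
  case (2 k)
  have "x \<notin> set (ftop dg)" using tops(3)[OF Ts_nth(1)[OF 2(1)]] 2(2) by blast
  then have "x \<in> seen dg (take j Ts) \<longleftrightarrow> (\<exists>i<j. x \<in> set (tbot dg (Ts ! i)))" unfolding seen_def st by auto
  also have "\<dots> \<longleftrightarrow> k < j" using tix_tbot 2 j by (metis less_le_trans nat.inject)
  finally show ?thesis using 2(3) by auto
 qed (simp add: seen_def)
 moreover have "x \<in> (\<Union>T\<in>set (take j Ts). set (ttop dg T)) \<longleftrightarrow> bix x < j" using x
 proof (cases rule: bot_cases)
  case 1
  have "x \<notin> set (ttop dg (Ts ! k))" if "k < j" for k using bots(3)[OF Ts_nth(1), of k] 1(1) that j by auto
  then show ?thesis using 1(2) j unfolding st by auto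
 next
  case (2 k)
  have "x \<in> (\<Union>T\<in>set (take j Ts). set (ttop dg T)) \<longleftrightarrow> (\<exists>i<j. x \<in> set (ttop dg (Ts ! i)))" unfolding st by auto
  also have "\<dots> \<longleftrightarrow> k < j" using bix_ttop 2 j by (metis less_le_trans)
  finally show ?thesis using 2(3) by simp
 qed
 ultimately show ?thesis unfolding live_def by auto
qed

text \<open>A band has height \<open>4 * gap\<close>, and \<open>level k\<close> is the lower edge
  of band \<open>k\<close>. Transistor \<open>k\<close> is centred at this edge, between the bands
  \<open>k\<close> and \<open>k + 1\<close>, and extends by \<open>gap\<close> in both
  directions.\<close>

definition gap :: real where "gap = 1 / (4 * (real N + 1))"
definition level :: "nat => real" where "level k = (real N - real k) * (4 * gap)"
definition top_of :: "nat => real" where "top_of x = level (tix x) + 4 * gap - (if tix x = 0 then 0 else gap)"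
definition bot_of :: "nat => real" where "bot_of x = level (bix x) + (if bix x = N then 0 else gap)"
definition pos_of :: "nat => nat" where "pos_of T = (SOME k. k < N & Ts ! k = T)"

lemma gap: "0 < gap" "4 * gap * (real N + 1) = 1" unfolding gap_def by (simp_all add: field_simps add_pos_nonneg)

lemma level_0: "level 0 + 4 * gap = 1" and level_N: "level N = 0" using gap(2) unfolding level_def by (simp_all add: algebra_simps)

lemma level_Suc: "level (Suc k) + 4 * gap = level k" unfolding level_def by (simp add: algebra_simps)

lemma level_mono: "j < k ==> level k + 4 * gap <= level j"
proof -
 assume "j < k"
 then have "(real k - real j - 1) * (4 * gap) \<ge> 0" using gap(1) by (intro mult_nonneg_nonneg) auto
 then show ?thesis unfolding level_def by (simp add: algebra_simps)
qed

lemma pos_of: "T \<in> transistors dg ==> pos_of T < N & Ts ! pos_of T = T" unfolding pos_of_def by (rule someI_ex) (use Ts_nth(2) in blast)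

lemma overlap:
 assumes "x \<in> wires dg" "y \<in> wires dg" "bot_of x <= top_of y"
 shows "tix y <= bix x"
proof (rule ccontr)
 assume n: "~ tix y <= bix x"
 then have "level (tix y) + 4 * gap <= level (bix x)" by (intro level_mono) simp
 moreover have "tix y ~= 0" "bix x ~= N" using n tix_le_bix[OF assms(2)] by auto
 ultimately show False using assms(3) gap(1) unfolding bot_of_def top_of_def by simp
qed

lemma level_bounds: "k <= N ==> 0 <= level k & level k + 4 * gap <= 1"
 using level_mono[of k N] level_mono[of 0 k] level_0 level_N gap(1) by (cases "k = 0"; cases "k = N") auto

lemma wire_heights:
 assumes "x \<in> wires dg"
 shows "0 <= bot_of x" "bot_of x < top_of x" "top_of x <= 1"
proof -
 note t = tix_le_bix[OF assms]
 show "0 <= bot_of x" using level_bounds[of "bix x"] t(2) gap(1) unfolding bot_of_def by auto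
 show "top_of x <= 1" using level_bounds[of "tix x"] t gap(1) unfolding top_of_def by auto
 have "level (bix x) <= level (tix x)" using t(1) level_mono[of "tix x" "bix x"] gap(1) by (cases "tix x = bix x") auto
 then show "bot_of x < top_of x" using gap(1) unfolding bot_of_def top_of_def by auto
qed

lemma overlap_box:
 assumes x: "x \<in> wires dg" and k: "k < N" and y: "bot_of x < y" "y < top_of x" "level k - gap <= y" "y <= level k + gap"
 shows "tix x <= k & k < bix x"
proof -
 have "k < bix x"
 proof (rule ccontr)
  assume n: "~ k < bix x"
  then have "bix x ~= N" using k by simp
  moreover have "level k <= level (bix x)" using n level_mono[of "bix x" k] gap(1) by (cases "k = bix x") auto
  ultimately show False using y unfolding bot_of_def by simp
 qed
 moreover have "tix x <= k"
 proof (rule ccontr)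
  assume n: "~ tix x <= k"
  then have "level (tix x) + 4 * gap <= level k" by (intro level_mono) simp
  then show False using n y unfolding top_of_def by simp
 qed
 ultimately show ?thesis by blast
qed

text \<open>Boxes are separated by their heights. Any other collision would give two different
  wires, live at the same time, with a common value of their charts, against the tiling.\<close>

lemma ex_layout_of_lifts:
 assumes c: "charting dg c" and g: "!!T. T \<in> transistors dg ==> lifts (g T) (tchart dg c T) & (b --> (\<forall>t. 0 <= g T t & g T t < 1))"
  and G: "lifts G (joinl (map c (fbot dg)))" "b --> (\<forall>t. 0 <= G t & G t < 1)"
 shows "\<exists>X lo hi l r bt tp. layout A R w dg b X lo hi l r bt tp"
proof -
 define X where "X x = pt (c x mid)" for x
 define pts where "pts T = mids (length (ttop dg T)) \<union> mids (length (tbot dg T))" for T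
 have "\<exists>s\<in>pts T. \<forall>t\<in>pts T. pt t <= pt s" if "T \<in> transistors dg" for T
 proof -
  have f: "finite (pts T)" "pts T ~= {}" using nonempty(3)[OF that] unfolding pts_def mids_def by auto
  then have "Max (pt ` pts T) \<in> pt ` pts T" "\<forall>t\<in>pts T. pt t <= Max (pt ` pts T)" by auto
  then show ?thesis by (metis imageE)
 qed
 \<comment> \<open>A lift is strictly increasing on a half-open interval and has no greatest value,
   so the right edge of the box is put at the greatest midpoint occurring on its two sides.\<close>
 then obtain last_pt where last_pt: "!!T. T \<in> transistors dg ==> last_pt T \<in> pts T & (\<forall>t\<in>pts T. pt t <= pt (last_pt T))" by metis
 define l where "l T = g T (mk 0)" for T
 define r where "r T = g T (last_pt T)" for T
 have ok: "lift_ok (g T)" if "T \<in> transistors dg" for T using g[OF that] unfolding lifts_def by blast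
 have pos: "0 < pt s" if "s \<in> pts T" for s T using that mids_pos unfolding pts_def by blast
 have in_lr: "g T ` mids k \<subseteq> {l T..r T}" if T: "T \<in> transistors dg" and k: "mids k \<subseteq> pts T" for T k
 proof
  fix z assume "z \<in> g T ` mids k"
  then obtain s where s: "s \<in> pts T" "z = g T s" using k by blast
  have "pt (mk 0) < pt s" using pos[OF s(1)] pt_mk0 by simp
  moreover have "pt s <= pt (last_pt T)" using last_pt[OF T] s(1) by blast
  ultimately show "z \<in> {l T..r T}"
   using lift_ok_less[OF ok[OF T], of "mk 0" s] lift_ok_less[OF ok[OF T], of "last_pt T" s] s(2) unfolding l_def r_def by auto
 qed
 have order: "\<exists>ps. set ps \<subseteq> {l T..r T} & sorted_wrt (<) ps & map X xs = map frac ps"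
  if T: "T \<in> transistors dg" and m: "map c xs = pieces (length xs) (tchart dg c T)" and s: "mids (length xs) \<subseteq> pts T" for T xs
 proof -
  obtain ps where "set ps = g T ` mids (length xs)" "sorted_wrt (<) ps" "map X xs = map frac ps"
   using mids_order[OF conjunct1[OF g[OF T]] m] unfolding X_def by blast
  then show ?thesis using in_lr[OF T s] by blast
 qed
 have mt: "map c (ttop dg T) = pieces (length (ttop dg T)) (tchart dg c T)" for T
  unfolding tchart_def using pieces_joinl[of "map c (ttop dg T)"] by simp
 have mf: "map c (fbot dg) = pieces (length (fbot dg)) (joinl (map c (fbot dg)))" using pieces_joinl[of "map c (fbot dg)"] by simp
 have mtb: "map c (tbot dg T) = pieces (length (tbot dg T)) (tchart dg c T)" if "T \<in> transistors dg" for T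
  using c that unfolding charting_def by blast
 have mft: "map c (ftop dg) = pieces (length (ftop dg)) id" using c unfolding charting_def by blast
 have le: "linext dg (take j Ts @ drop j Ts)" for j using Ts by simp
 have til: "x = y & s = t" if "x \<in> live dg (take j Ts)" "y \<in> live dg (take j Ts)" "c x s = c y t" for x y s t j
  using tilingD[OF charting_tiling[OF c le] that] .
 have "layout A R w dg b X bot_of top_of l r (%T. level (pos_of T) - gap) (%T. level (pos_of T) + gap)"
 proof
  fix T assume T: "T \<in> transistors dg"
  have "l T < r T" using lift_ok_less[OF ok[OF T], of "mk 0" "last_pt T"] pos[of "last_pt T" T] last_pt[OF T] pt_mk0 unfolding l_def r_def by simp
  moreover have "r T < l T + 1" unfolding l_def r_def using tchart_inj[OF c T] g[OF T] by (intro lift_width) auto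
  moreover have "b --> 0 <= l T & r T < 1" using g[OF T] unfolding l_def r_def by blast
  moreover have "4 * gap <= level (pos_of T)" "level (pos_of T) + 4 * gap <= 1"
   using level_mono[of "pos_of T" N] level_N level_bounds[of "pos_of T"] pos_of[OF T] by auto
  ultimately show "0 < level (pos_of T) - gap & level (pos_of T) - gap < level (pos_of T) + gap &
    level (pos_of T) + gap < 1 & l T < r T & r T < l T + 1 & (b --> 0 <= l T & r T < 1)" using gap(1) by linarith
  show "\<exists>ps. set ps \<subseteq> {l T..r T} & sorted_wrt (<) ps & map X (ttop dg T) = map frac ps"
   using order[OF T mt] unfolding pts_def by blast
  show "\<exists>ps. set ps \<subseteq> {l T..r T} & sorted_wrt (<) ps & map X (tbot dg T) = map frac ps"
   using order[OF T mtb[OF T]] unfolding pts_def by blast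
  note p = pos_of[OF T]
  show "bot_of x = level (pos_of T) + gap" if "x \<in> set (ttop dg T)" for x using bix_ttop[of "pos_of T" x] p that unfolding bot_of_def by simp
  show "top_of x = level (pos_of T) - gap" if "x \<in> set (tbot dg T)" for x
   using tix_tbot[of "pos_of T" x] p that level_Suc unfolding top_of_def by simp
  show "level (pos_of S) + gap < level (pos_of T) - gap | level (pos_of T) + gap < level (pos_of S) - gap"
   if S: "S \<in> transistors dg" "S ~= T" for S
  proof -
   have "pos_of S ~= pos_of T" using pos_of[OF S(1)] p S(2) by auto
   then show ?thesis using level_mono[of "pos_of S" "pos_of T"] level_mono[of "pos_of T" "pos_of S"] gap(1) by (cases "pos_of S < pos_of T") auto
  qed
  show "frac \<xi> ~= X x" if x: "x \<in> wires dg" "bot_of x < y" "y < top_of x" "level (pos_of T) - gap <= y" "y <= level (pos_of T) + gap"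
   "l T <= \<xi>" "\<xi> <= r T" for x y \<xi>
  proof
   assume e: "frac \<xi> = X x"
   have ti: "tix x <= pos_of T & pos_of T < bix x" using overlap_box[OF x(1) conjunct1[OF p] x(2-5)] .
   \<comment> \<open>The image of the lift is an interval, so every abscissa over the box is a value
     of the chart of \<open>T\<close>, hence of the chart of one of its inputs.\<close>
   have "\<xi> \<in> range (g T)" using ok[OF T] x(6,7) unfolding lift_ok_def l_def r_def by (metis order_le_less rangeI)
   then obtain s where "\<xi> = g T s" by blast
   then have "tchart dg c T s = c x mid" using e g[OF T] unfolding lifts_def X_def by (metis pt_eq_iff)
   moreover obtain i t where i: "i < length (ttop dg T)" "s = emb (length (ttop dg T)) i t"
    using emb_surj[of "length (ttop dg T)"] nonempty(3)[OF T] by blast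
   moreover have "tchart dg c T s = c (ttop dg T ! i) t" using joinl_emb[of i "map c (ttop dg T)" t] i unfolding tchart_def by simp
   ultimately have e: "c (ttop dg T ! i) t = c x mid" by simp
   have y: "ttop dg T ! i \<in> wires dg" "bix (ttop dg T ! i) = pos_of T" using bots(5) T nth_mem[OF i(1)] bix_ttop[of "pos_of T"] p by auto
   have "ttop dg T ! i \<in> live dg (take (pos_of T) Ts)" using live_take[OF y(1), of "pos_of T"] tix_le_bix[OF y(1)] y(2) by simp
   moreover have "x \<in> live dg (take (pos_of T) Ts)" using live_take[OF x(1), of "pos_of T"] ti p by simp
   ultimately have "ttop dg T ! i = x" using til e by blast
   then show False using y(2) ti by simp
  qed
 next
  fix x assume "x \<in> wires dg"
  then show "0 <= X x & X x < 1 & 0 <= bot_of x & bot_of x < top_of x & top_of x <= 1"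
   using wire_heights[of x] pt_bounds unfolding X_def by blast
 next
  obtain ps where ps: "set ps = pt ` mids (length (ftop dg))" "sorted_wrt (<) ps" "map X (ftop dg) = map frac ps"
   using mids_order[OF lifts_id mft] unfolding X_def by blast
  have "map frac ps = ps" using ps(1) pt_bounds by (intro map_idI) (auto simp: frac_eq)
  then have e: "map X (ftop dg) = ps" using ps(3) by simp
  then show "sorted_wrt (<) (map X (ftop dg))" using ps(2) by simp
  fix x assume x: "x \<in> set (ftop dg)"
  then have "X x \<in> pt ` mids (length (ftop dg))" using arg_cong[OF e, of set] ps(1) by auto
  then show "top_of x = 1 & 0 < X x" using mids_pos tix_ftop[OF x] level_0 unfolding top_of_def by auto
 next
  fix x assume "x \<in> set (fbot dg)"
  then show "bot_of x = 0" using bix_fbot level_N unfolding bot_of_def by simp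
 next
  obtain ps where ps: "set ps = G ` mids (length (fbot dg))" "sorted_wrt (<) ps" "map X (fbot dg) = map frac ps"
   using mids_order[OF G(1) mf] unfolding X_def by blast
  have "set ps \<subseteq> {G (mk 0)<..<G (mk 0) + 1}"
  proof
   fix z assume "z \<in> set ps"
   then obtain s where s: "s \<in> mids (length (fbot dg))" "z = G s" using ps(1) by blast
   have "G (mk 0) < G s" using G(1) mids_pos[OF s(1)] pt_mk0 unfolding lifts_def lift_ok_def by simp
   moreover have "G s < G (mk 0) + 1" using frame_chart(2)[OF c] G(1) by (intro lift_width) (auto simp: bij_is_inj)
   ultimately show "z \<in> {G (mk 0)<..<G (mk 0) + 1}" using s(2) by simp
  qed
  moreover have "b --> set ps \<subseteq> {0..<1}" using G(2) ps(1) by auto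
  ultimately show "\<exists>\<beta> ps. set ps \<subseteq> {\<beta><..<\<beta> + 1} & sorted_wrt (<) ps & map X (fbot dg) = map frac ps & (b --> set ps \<subseteq> {0..<1})"
   using ps(2,3) by blast
 next
  fix x y assume x: "x \<in> wires dg" and y: "y \<in> wires dg" and "x ~= y" "X x = X y"
  show "top_of x < bot_of y | top_of y < bot_of x"
  proof (rule ccontr)
   assume "~ (top_of x < bot_of y | top_of y < bot_of x)"
   then have "tix x <= bix y" "tix y <= bix x" using overlap[OF y x] overlap[OF x y] by auto
   then have "x \<in> live dg (take (max (tix x) (tix y)) Ts)" "y \<in> live dg (take (max (tix x) (tix y)) Ts)"
    using live_take[OF x] live_take[OF y] tix_le_bix[OF x] tix_le_bix[OF y] by auto
   moreover have "c x mid = c y mid" using \<open>X x = X y\<close> unfolding X_def by (simp add: pt_eq_iff)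
   ultimately show False using til \<open>x ~= y\<close> by blast
  qed
 qed
 then show ?thesis by blast
qed

end

lemma ex_layout:
 assumes "monotone_diagram b dg"
 shows "\<exists>X lo hi l r bt tp. layout A R w dg b X lo hi l r bt tp"
proof -
 obtain c where c: "charting dg c" "!!T. T \<in> transistors dg ==> monotone_chart b (tchart dg c T)"
  "monotone_chart b (joinl (map c (fbot dg)))" using assms unfolding monotone_diagram_def by blast
 obtain Ts where "linext dg Ts" using ex_linext by blast
 moreover obtain g where "!!T. T \<in> transistors dg ==> lifts (g T) (tchart dg c T) & (b --> (\<forall>t. 0 <= g T t & g T t < 1))"
  using c(2) unfolding monotone_chart_def by metis
 moreover obtain G where "lifts G (joinl (map c (fbot dg)))" "b --> (\<forall>t. 0 <= G t & G t < 1)"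
  using c(3) unfolding monotone_chart_def by blast
 ultimately show ?thesis using ex_layout_of_lifts[OF _ c(1)] by blast
qed

end

section \<open>Realising a layout in the plane\<close>

context layout
begin

text \<open>Stated for any coordinate map \<open>v\<close> that is injective up to integer shifts of
  the abscissa and sends vertical segments to segments; the planar and the annular drawing are its
  two instances.\<close>

lemma disjoint_drawing_of_layout:
 fixes v :: "real => real => complex"
 assumes v_eq: "!!x y x' y'. 0 <= y ==> y <= 1 ==> 0 <= y' ==> y' <= 1 ==> v x y = v x' y' ==> y = y' & frac x = frac x'"
  and v_line: "!!x y y' s. linepath (v x y) (v x y') s = v x ((1 - s) * y + s * y')"
  and v_U: "!!x y. 0 < y ==> y < 1 ==> (b ==> 0 <= x & x < 1) ==> v x y \<in> U"
  and B: "!!T. T \<in> transistors dg ==> B T = {v x y | x y. l T <= x & x <= r T & bt T <= y & y <= tp T}"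
 shows "disjoint_drawing dg U B (%x. linepath (v (X x) (lo x)) (v (X x) (hi x)))"
proof -
 let ?h = "%x s. (1 - s) * lo x + s * hi x"
 have between: "lo x <= ?h x s & ?h x s <= hi x" if "x \<in> wires dg" "s \<in> {0..1}" for x s
  using wire_pos[OF that(1)] that(2) mult_left_mono[of "lo x" "hi x" s] mult_left_mono[of "lo x" "hi x" "1 - s"] by (auto simp: algebra_simps)
 have strictly: "lo x < ?h x s & ?h x s < hi x" if "x \<in> wires dg" "s \<in> {0<..<1}" for x s
  using wire_pos[OF that(1)] that(2) mult_strict_left_mono[of "lo x" "hi x" s] mult_strict_left_mono[of "lo x" "hi x" "1 - s"]
  by (auto simp: algebra_simps)
 have fX: "frac (X x) = X x" if "x \<in> wires dg" for x using wire_pos[OF that] by (simp add: frac_eq)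
 have boxE: "\<exists>x y. z = v x y & l T <= x & x <= r T & bt T <= y & y <= tp T & 0 < y & y < 1 & (b --> 0 <= x & x < 1)"
  if "T \<in> transistors dg" "z \<in> B T" for T z using that(2) box_pos[OF that(1)] unfolding B[OF that(1)] by fastforce
 show ?thesis unfolding disjoint_drawing_def
 proof (intro conjI ballI)
  fix T assume T: "T \<in> transistors dg"
  show "B T \<subseteq> U"
  proof
   fix z assume "z \<in> B T"
   then obtain x y where "z = v x y" "0 < y" "y < 1" "b --> 0 <= x & x < 1" using boxE[OF T] by blast
   then show "z \<in> U" using v_U[of y x] by simp
  qed
 next
  show "disjoint_family_on B (transistors dg)" unfolding disjoint_family_on_def
  proof (intro ballI impI equals0I)
   fix S T z assume S: "S \<in> transistors dg" "T \<in> transistors dg" "S ~= T" "z \<in> B S \<inter> B T"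
   obtain x y where 1: "z = v x y" "bt S <= y" "y <= tp S" "0 < y" "y < 1" using boxE[OF S(1)] S(4) by blast
   obtain x' y' where 2: "z = v x' y'" "bt T <= y'" "y' <= tp T" "0 < y'" "y' < 1" using boxE[OF S(2)] S(4) by blast
   have "y = y'" using v_eq[of y y' x x'] 1 2 by simp
   then show False using boxes_apart[OF S(1-3)] 1 2 by auto
  qed
 next
  fix x assume x: "x \<in> wires dg"
  have "v (X x) (lo x) ~= v (X x) (hi x)" using wire_pos[OF x] v_eq[of "lo x" "hi x" "X x" "X x"] by auto
  then show "arc (linepath (v (X x) (lo x)) (v (X x) (hi x)))" by (rule arc_linepath)
  show "linepath (v (X x) (lo x)) (v (X x) (hi x)) ` {0<..<1} \<subseteq> U - (\<Union>T\<in>transistors dg. B T)"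
  proof
   fix z assume "z \<in> linepath (v (X x) (lo x)) (v (X x) (hi x)) ` {0<..<1}"
   then obtain s where s: "s \<in> {0<..<1}" "z = v (X x) (?h x s)" using v_line by auto
   note st = strictly[OF x s(1)]
   have h01: "0 < ?h x s" "?h x s < 1" using st wire_pos[OF x] by linarith+
   have "z \<in> U" unfolding s(2) using h01 wire_pos[OF x] by (intro v_U) auto
   moreover have "z \<notin> B T" if T: "T \<in> transistors dg" for T
   proof
    assume "z \<in> B T"
    then obtain x' y' where z: "z = v x' y'" "l T <= x'" "x' <= r T" "bt T <= y'" "y' <= tp T" "0 < y'" "y' < 1" using boxE[OF T] by blast
    have "y' = ?h x s & frac x' = frac (X x)" using v_eq[of y' "?h x s" x' "X x"] z(1,6,7) s(2) h01 by simp
    then show False using wire_box_apart[OF x T _ _ z(4,5,2,3)] st fX[OF x] by simp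
   qed
   ultimately show "z \<in> U - (\<Union>T\<in>transistors dg. B T)" by blast
  qed
 next
  show "disjoint_family_on (%x. path_image (linepath (v (X x) (lo x)) (v (X x) (hi x)))) (wires dg)" unfolding disjoint_family_on_def
  proof (intro ballI impI equals0I)
   fix x y z assume x: "x \<in> wires dg" "y \<in> wires dg" "x ~= y"
    "z \<in> path_image (linepath (v (X x) (lo x)) (v (X x) (hi x))) \<inter> path_image (linepath (v (X y) (lo y)) (v (X y) (hi y)))"
   then obtain s t where st: "s \<in> {0..1}" "t \<in> {0..1}" "z = v (X x) (?h x s)" "z = v (X y) (?h y t)"
    unfolding path_image_def using v_line by auto
   note bt = between[OF x(1) st(1)] between[OF x(2) st(2)]
   have "0 <= ?h x s" "?h x s <= 1" "0 <= ?h y t" "?h y t <= 1" using bt wire_pos[OF x(1)] wire_pos[OF x(2)] by linarith+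
   then have "?h x s = ?h y t & frac (X x) = frac (X y)" by (rule v_eq) (use st in simp)
   then show False using wires_apart[OF x(1-3)] bt fX x by auto
  qed
 qed
qed

lemma planar:
 assumes b
 shows "planar_diagram dg"
proof -
 \<comment> \<open>The abscissa is squeezed into [1/2,1), since a box may reach abscissa 0 while
   boxes have to lie in the open unit square.\<close>
 define v where "v x y = Complex ((1 + x) / 2) y" for x y :: real
 define p where "p T = v (l T) (bt T)" for T
 define q where "q T = v (r T) (tp T)" for T
 define \<gamma> where "\<gamma> x = linepath (v (X x) (lo x)) (v (X x) (hi x))" for x
 have box: "cbox (p T) (q T) = {v x y | x y. l T <= x & x <= r T & bt T <= y & y <= tp T}" for T
 proof (rule Set.set_eqI, rule iffI)
  fix z assume "z \<in> cbox (p T) (q T)"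
  then have "z = v (2 * Re z - 1) (Im z) & l T <= 2 * Re z - 1 & 2 * Re z - 1 <= r T & bt T <= Im z & Im z <= tp T"
   unfolding p_def q_def v_def by (auto simp: in_cbox_complex_iff complex_eq_iff field_simps)
  then show "z \<in> {v x y | x y. l T <= x & x <= r T & bt T <= y & y <= tp T}" by blast
 qed (auto simp: p_def q_def v_def in_cbox_complex_iff)
 have order: "in_order_along (%s. Complex s y) {(1 + a) / 2..(1 + c) / 2} (map f xs)"
  if "set ps \<subseteq> {a..c}" "sorted_wrt (<) ps" "map X xs = map frac ps" "0 <= a" "set ps \<subseteq> {..<1}" "!!x. x \<in> set xs ==> f x = v (X x) y" for ps a c xs f y
  unfolding in_order_along_def
 proof (intro exI conjI)
  have "map frac ps = ps" using that(1,4,5) by (intro map_idI) (force simp: frac_eq)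
  then have e: "map X xs = ps" using that(3) by simp
  show "set (map (%x. (1 + x) / 2) ps) \<subseteq> {(1 + a) / 2..(1 + c) / 2}" using that(1) by auto
  show "sorted_wrt (<) (map (%x. (1 + x) / 2) ps)" using that(2) by (simp add: sorted_wrt_map)
  show "map f xs = map (%s. Complex s y) (map (%x. (1 + x) / 2) ps)" unfolding e[symmetric] using that(6) by (simp add: v_def)
 qed
 have sub: "in_order_along \<sigma> J ps" if "in_order_along \<sigma> I ps" "I \<subseteq> J" for \<sigma> I J and ps :: "complex list"
  using that unfolding in_order_along_def by blast
 have ends: "pathstart (\<gamma> x) = v (X x) (lo x)" "pathfinish (\<gamma> x) = v (X x) (hi x)" for x unfolding \<gamma>_def by simp_all
 have "disjoint_drawing dg (box 0 (Complex 1 1)) (%T. cbox (p T) (q T)) \<gamma>" unfolding \<gamma>_def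
 proof (rule disjoint_drawing_of_layout[where v = v and B = "%T. cbox (p T) (q T)", OF _ _ _ box])
  show "linepath (v x y) (v x y') s = v x ((1 - s) * y + s * y')" for x y y' s
   unfolding linepath_def v_def by (simp add: complex_eq_iff field_simps)
  show "v x y \<in> box 0 (Complex 1 1)" if "0 < y" "y < 1" "b ==> 0 <= x & x < 1" for x y
   using that(1,2) that(3)[OF assms] by (auto simp: v_def in_box_complex_iff)
 qed (auto simp: v_def)
 moreover have "in_order_along (%s. Complex s 1) {0..1} (map (%x. pathfinish (\<gamma> x)) (ftop dg))"
 proof (rule sub)
  have Xb: "set (map X (ftop dg)) \<subseteq> {0..1}" "set (map X (ftop dg)) \<subseteq> {..<1}" using tops(5) wire_pos by fastforce+
  have "map X (ftop dg) = map frac (map X (ftop dg))" using tops(5) wire_pos by (simp add: frac_eq)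
  then show "in_order_along (%s. Complex s 1) {(1 + 0) / 2..(1 + 1) / 2} (map (%x. pathfinish (\<gamma> x)) (ftop dg))"
   using ftop_height by (intro order[OF Xb(1) ftop_order _ _ Xb(2)]) (simp_all add: ends)
 qed auto
 moreover have "in_order_along (%s. Complex s 0) {0..1} (map (%x. pathstart (\<gamma> x)) (fbot dg))"
 proof (rule sub)
  obtain ps where ps: "sorted_wrt (<) ps" "map X (fbot dg) = map frac ps" "set ps \<subseteq> {0..<1}" using fbot_order assms by blast
  have pb: "set ps \<subseteq> {0..1}" "set ps \<subseteq> {..<1}" using ps(3) by auto
  show "in_order_along (%s. Complex s 0) {(1 + 0) / 2..(1 + 1) / 2} (map (%x. pathstart (\<gamma> x)) (fbot dg))"
   using fbot_height by (intro order[OF pb(1) ps(1,2) _ pb(2)]) (simp_all add: ends)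
 qed auto
 moreover have "Re (p T) < Re (q T) & Im (p T) < Im (q T)" if "T \<in> transistors dg" for T
  using box_pos[OF that] unfolding p_def q_def v_def by simp
 moreover have "in_order_along (%s. Complex s (Im (q T))) {Re (p T)..Re (q T)} (map (%x. pathstart (\<gamma> x)) (ttop dg T))"
  if T: "T \<in> transistors dg" for T
 proof -
  obtain ps where ps: "set ps \<subseteq> {l T..r T}" "sorted_wrt (<) ps" "map X (ttop dg T) = map frac ps" using ttop_order[OF T] by blast
  have pb: "0 <= l T" "set ps \<subseteq> {..<1}" using ps(1) box_pos[OF T] assms by auto
  show ?thesis unfolding p_def q_def v_def complex.sel using ttop_height[OF T] by (intro order[OF ps pb]) (simp add: ends)
 qed
 moreover have "in_order_along (%s. Complex s (Im (p T))) {Re (p T)..Re (q T)} (map (%x. pathfinish (\<gamma> x)) (tbot dg T))"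
  if T: "T \<in> transistors dg" for T
 proof -
  obtain ps where ps: "set ps \<subseteq> {l T..r T}" "sorted_wrt (<) ps" "map X (tbot dg T) = map frac ps" using tbot_order[OF T] by blast
  have pb: "0 <= l T" "set ps \<subseteq> {..<1}" using ps(1) box_pos[OF T] assms by auto
  show ?thesis unfolding p_def q_def v_def complex.sel using tbot_height[OF T] by (intro order[OF ps pb]) (simp add: ends)
 qed
 ultimately show ?thesis unfolding planar_diagram_def by blast
qed

end

lemma frac_eq_frac_iff: "frac x = frac y \<longleftrightarrow> (\<exists>k::int. x = y + of_int k)"
proof
 assume "frac x = frac y"
 then have "x = y + of_int (\<lfloor>x\<rfloor> - \<lfloor>y\<rfloor>)" by (simp add: frac_def)
 then show "\<exists>k::int. x = y + of_int k" by blast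
qed (auto simp: frac_def)

lemma cis_2pi_eq: "cis (2 * pi * x) = cis (2 * pi * y) \<longleftrightarrow> (\<exists>k::int. x = y + of_int k)"
proof -
 have "cis (2 * pi * x) = cis (2 * pi * y) \<longleftrightarrow> (\<exists>k::int. \<i> * complex_of_real (2 * pi * x) = \<i> * complex_of_real (2 * pi * y) + of_int (2 * k) * complex_of_real pi * \<i>)"
  unfolding cis_conv_exp exp_eq by simp
 also have "\<dots> \<longleftrightarrow> (\<exists>k::int. x = y + of_int k)"
 proof (intro ex_cong1)
  fix k :: int
  have "\<i> * complex_of_real (2 * pi * x) = \<i> * complex_of_real (2 * pi * y) + of_int (2 * k) * complex_of_real pi * \<i> \<longleftrightarrow>
   2 * pi * x = 2 * pi * (y + of_int k)" by (simp add: complex_eq_iff algebra_simps)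
  then show "(\<i> * complex_of_real (2 * pi * x) = \<i> * complex_of_real (2 * pi * y) + of_int (2 * k) * complex_of_real pi * \<i>) =
   (x = y + of_int k)" by simp
 qed
 finally show ?thesis .
qed

lemma rcis_2pi_eq:
 assumes "0 < s" "0 < t"
 shows "rcis s (2 * pi * x) = rcis t (2 * pi * y) \<longleftrightarrow> s = t & (\<exists>k::int. x = y + of_int k)"
proof -
 have "rcis s (2 * pi * x) = rcis t (2 * pi * y) ==> s = t" using assms complex_mod_rcis by (metis abs_of_pos)
 then show ?thesis using assms cis_2pi_eq[of x y] by (auto simp: rcis_def)
qed

section \<open>Realising a layout in the annulus\<close>

context layout
begin

lemma annular: "annular_diagram dg"
proof -
 \<comment> \<open>Height 1, the top of the frame, becomes the inner circle of radius 1, and height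
   0 the outer circle of radius 2; vertical segments become radial ones.\<close>
 define v where "v x y = rcis (2 - y) (2 * pi * x)" for x y :: real
 define \<gamma> where "\<gamma> x = linepath (v (X x) (lo x)) (v (X x) (hi x))" for x
 define B where "B T = sector (2 - tp T) (2 - bt T) (2 * pi * l T) (2 * pi * r T)" for T
 have box: "B T = {v x y | x y. l T <= x & x <= r T & bt T <= y & y <= tp T}" for T
 proof (rule Set.set_eqI, rule iffI)
  fix z assume "z \<in> B T"
  then obtain \<rho> \<phi> where z: "z = rcis \<rho> \<phi>" "2 - tp T <= \<rho>" "\<rho> <= 2 - bt T" "2 * pi * l T <= \<phi>" "\<phi> <= 2 * pi * r T"
   unfolding B_def sector_def by blast
  then have "z = v (\<phi> / (2 * pi)) (2 - \<rho>) & l T <= \<phi> / (2 * pi) & \<phi> / (2 * pi) <= r T & bt T <= 2 - \<rho> & 2 - \<rho> <= tp T"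
   unfolding v_def by (auto simp: field_simps)
  then show "z \<in> {v x y | x y. l T <= x & x <= r T & bt T <= y & y <= tp T}" by blast
 next
  fix z assume "z \<in> {v x y | x y. l T <= x & x <= r T & bt T <= y & y <= tp T}"
  then obtain x y where z: "z = v x y" "l T <= x" "x <= r T" "bt T <= y" "y <= tp T" by blast
  then have "z = rcis (2 - y) (2 * pi * x) & 2 - tp T <= 2 - y & 2 - y <= 2 - bt T & 2 * pi * l T <= 2 * pi * x & 2 * pi * x <= 2 * pi * r T"
   unfolding v_def by simp
  then show "z \<in> B T" unfolding B_def sector_def by blast
 qed
 have order: "in_order_along (rcis (2 - y)) I (map f xs)"
  if "sorted_wrt (<) ps" "map X xs = map frac ps" "(%x. 2 * pi * x) ` set ps \<subseteq> I" "!!x. x \<in> set xs ==> f x = v (X x) y" for ps I xs f y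
  unfolding in_order_along_def
 proof (intro exI conjI)
  show "set (map (%x. 2 * pi * x) ps) \<subseteq> I" using that(3) by simp
  show "sorted_wrt (<) (map (%x. 2 * pi * x) ps)" using that(1) by (simp add: sorted_wrt_map)
  have "map f xs = map (%u. v u y) (map X xs)" using that(4) by simp
  also have "\<dots> = map (rcis (2 - y)) (map (%x. 2 * pi * x) ps)"
  proof -
   have "cis (2 * pi * frac u) = cis (2 * pi * u)" for u unfolding cis_2pi_eq frac_def by (intro exI[of _ "- \<lfloor>u\<rfloor>"]) simp
   then show ?thesis unfolding that(2) by (simp add: v_def rcis_def)
  qed
  finally show "map f xs = map (rcis (2 - y)) (map (%x. 2 * pi * x) ps)" .
 qed
 have ends: "pathstart (\<gamma> x) = v (X x) (lo x)" "pathfinish (\<gamma> x) = v (X x) (hi x)" for x unfolding \<gamma>_def by simp_all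
 have "disjoint_drawing dg {z. 1 < norm z & norm z < 2} B \<gamma>" unfolding \<gamma>_def
 proof (rule disjoint_drawing_of_layout[where v = v and B = B, OF _ _ _ box])
  show "y = y' & frac x = frac x'" if "0 <= y" "y <= 1" "0 <= y'" "y' <= 1" "v x y = v x' y'" for x y x' y'
   using that rcis_2pi_eq[of "2 - y" "2 - y'" x x'] unfolding v_def frac_eq_frac_iff by auto
  show "linepath (v x y) (v x y') s = v x ((1 - s) * y + s * y')" for x y y' s
   unfolding linepath_def v_def rcis_def by (simp add: complex_eq_iff algebra_simps)
 qed (simp add: v_def)
 moreover have "in_order_along (rcis 1) {0<..<0 + 2 * pi} (map (%x. pathfinish (\<gamma> x)) (ftop dg))"
 proof -
  have "map X (ftop dg) = map frac (map X (ftop dg))" using tops(5) wire_pos by (simp add: frac_eq)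
  moreover have "(%x. 2 * pi * x) ` set (map X (ftop dg)) \<subseteq> {0<..<0 + 2 * pi}" using ftop_height wire_pos tops(5) by auto
  ultimately have "in_order_along (rcis (2 - 1)) {0<..<0 + 2 * pi} (map (%x. pathfinish (\<gamma> x)) (ftop dg))"
   using ftop_height by (intro order[OF ftop_order]) (simp_all add: ends)
  then show ?thesis by simp
 qed
 moreover obtain \<beta> where "in_order_along (rcis 2) {2 * pi * \<beta><..<2 * pi * \<beta> + 2 * pi} (map (%x. pathstart (\<gamma> x)) (fbot dg))"
 proof -
  obtain \<beta> ps where ps: "set ps \<subseteq> {\<beta><..<\<beta> + 1}" "sorted_wrt (<) ps" "map X (fbot dg) = map frac ps" using fbot_order by blast
  have "2 * pi * x < 2 * pi * \<beta> + 2 * pi" if "x < \<beta> + 1" for x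
   using mult_strict_left_mono[OF that, of "2 * pi"] by (simp add: algebra_simps)
  then have "(%x. 2 * pi * x) ` set ps \<subseteq> {2 * pi * \<beta><..<2 * pi * \<beta> + 2 * pi}" using ps(1) by auto
  then have "in_order_along (rcis (2 - 0)) {2 * pi * \<beta><..<2 * pi * \<beta> + 2 * pi} (map (%x. pathstart (\<gamma> x)) (fbot dg))"
   using fbot_height by (intro order[OF ps(2,3)]) (simp_all add: ends)
  then show thesis using that by simp
 qed
 moreover have "1 < 2 - tp T & 2 - tp T < 2 - bt T & 2 - bt T < 2 & 2 * pi * l T < 2 * pi * r T & 2 * pi * r T < 2 * pi * l T + 2 * pi"
  if "T \<in> transistors dg" for T using box_pos[OF that] mult_strict_left_mono[of "r T" "l T + 1" "2 * pi"] by (simp add: algebra_simps)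
 moreover have "in_order_along (rcis (2 - tp T)) {2 * pi * l T..2 * pi * r T} (map (%x. pathstart (\<gamma> x)) (ttop dg T))"
  if T: "T \<in> transistors dg" for T
 proof -
  obtain ps where ps: "set ps \<subseteq> {l T..r T}" "sorted_wrt (<) ps" "map X (ttop dg T) = map frac ps" using ttop_order[OF T] by blast
  show ?thesis using ps(1) ttop_height[OF T] by (intro order[OF ps(2,3)]) (auto simp: ends)
 qed
 moreover have "in_order_along (rcis (2 - bt T)) {2 * pi * l T..2 * pi * r T} (map (%x. pathfinish (\<gamma> x)) (tbot dg T))"
  if T: "T \<in> transistors dg" for T
 proof -
  obtain ps where ps: "set ps \<subseteq> {l T..r T}" "sorted_wrt (<) ps" "map X (tbot dg T) = map frac ps" using tbot_order[OF T] by blast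
  show ?thesis using ps(1) tbot_height[OF T] by (intro order[OF ps(2,3)]) (auto simp: ends)
 qed
 ultimately show ?thesis unfolding annular_diagram_def B_def
  by - (rule exI[of _ "%T. 2 - tp T"], rule exI[of _ "%T. 2 - bt T"], rule exI[of _ "%T. 2 * pi * l T"],
   rule exI[of _ "%T. 2 * pi * r T"], rule exI[of _ \<gamma>], rule exI[of _ 0], rule exI[of _ "2 * pi * \<beta>"], simp)
qed

end

section \<open>Drawings are monotone\<close>

lemma in_order_along_positions:
 assumes "in_order_along \<sigma> I (map f xs)" "distinct xs"
 shows "\<exists>P. sorted_wrt (<) (map P xs) & (\<forall>x\<in>set xs. P x \<in> I & f x = \<sigma> (P x))"
proof -
 obtain ss where ss: "set ss \<subseteq> I" "sorted_wrt (<) ss" "map f xs = map \<sigma> ss" using assms(1) unfolding in_order_along_def by blast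
 define P where "P x = ss ! (THE i. i < length xs & xs ! i = x)" for x
 have len: "length ss = length xs" using ss(3) by (metis length_map)
 have P: "P (xs ! i) = ss ! i" if "i < length xs" for i
 proof -
  have "(THE j. j < length xs & xs ! j = xs ! i) = i" using assms(2) that by (intro the_equality) (auto simp: nth_eq_iff_index_eq)
  then show ?thesis by (simp add: P_def)
 qed
 have m: "map P xs = ss" using P len by (intro nth_equalityI) auto
 have "P x \<in> I & f x = \<sigma> (P x)" if "x \<in> set xs" for x
 proof -
  obtain i where i: "i < length xs" "x = xs ! i" using \<open>x \<in> set xs\<close> by (auto simp: in_set_conv_nth)
  have "f (xs ! i) = \<sigma> (ss ! i)" using arg_cong[OF ss(3), of "%l. l ! i"] i(1) len by simp
  moreover have "ss ! i \<in> I" using ss(1) i(1) len nth_mem by (metis subsetD)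
  ultimately show ?thesis using P i by simp
 qed
 then show ?thesis using m ss(2) by blast
qed

text \<open>Each end of a wire lies on just one side, so the parameters found side by side combine
  to one function on wires.\<close>

lemma positions_of_sides:
 assumes F: "in_order_along \<sigma> I (map f xs)" "distinct xs"
  and T: "!!T. T \<in> A ==> in_order_along (\<sigma>' T) (I' T) (map f (s T))" "!!T. T \<in> A ==> distinct (s T)"
  and dj: "!!T. T \<in> A ==> set xs \<inter> set (s T) = {}" "!!S T. S \<in> A ==> T \<in> A ==> S ~= T ==> set (s S) \<inter> set (s T) = {}"
 shows "\<exists>P. sorted_wrt (<) (map P xs) & (\<forall>x\<in>set xs. P x \<in> I & f x = \<sigma> (P x)) &
  (\<forall>T\<in>A. sorted_wrt (<) (map P (s T)) & (\<forall>x\<in>set (s T). P x \<in> I' T & f x = \<sigma>' T (P x)))"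
proof -
 obtain P0 where P0: "sorted_wrt (<) (map P0 xs)" "!!x. x \<in> set xs ==> P0 x \<in> I & f x = \<sigma> (P0 x)"
  using in_order_along_positions[OF F] by blast
 have "\<forall>T\<in>A. \<exists>P. sorted_wrt (<) (map P (s T)) & (\<forall>x\<in>set (s T). P x \<in> I' T & f x = \<sigma>' T (P x))"
  using in_order_along_positions[OF T] by blast
 then obtain Q where Q: "!!T. T \<in> A ==> sorted_wrt (<) (map (Q T) (s T)) & (\<forall>x\<in>set (s T). Q T x \<in> I' T & f x = \<sigma>' T (Q T x))"
  by metis
 define P where "P x = (if x \<in> set xs then P0 x else Q (THE T. T \<in> A & x \<in> set (s T)) x)" for x
 have PF: "P x = P0 x" if "x \<in> set xs" for x using that by (simp add: P_def)
 have PT: "P x = Q T x" if "T \<in> A" "x \<in> set (s T)" for T x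
 proof -
  have "(THE T. T \<in> A & x \<in> set (s T)) = T" using that dj(2) by (intro the_equality) blast+
  moreover have "x \<notin> set xs" using dj(1) that by blast
  ultimately show ?thesis by (simp add: P_def)
 qed
 have m0: "map P xs = map P0 xs" using PF by simp
 have mT: "map P (s T) = map (Q T) (s T)" if "T \<in> A" for T using PT[OF that] by simp
 show ?thesis
 proof (rule exI[of _ P], intro conjI ballI)
  show "sorted_wrt (<) (map P xs)" unfolding m0 by (rule P0(1))
  fix T assume T: "T \<in> A"
  show "sorted_wrt (<) (map P (s T))" unfolding mT[OF T] using Q[OF T] by blast
  fix x assume "x \<in> set (s T)"
  then show "P x \<in> I' T" "f x = \<sigma>' T (P x)" using Q[OF T] PT[OF T] by auto
 qed (use P0(2) PF in auto)
qed

text \<open>The angle, counted in full turns, is the imaginary part of a continuous logarithm along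
  the path.\<close>

lemma angular_lift:
 assumes "path \<gamma>" "!!s. s \<in> {0..1} ==> \<gamma> s ~= 0"
 shows "\<exists>\<phi>. continuous_on {0..1} \<phi> & (\<forall>s\<in>{0..1}. \<gamma> s = rcis (norm (\<gamma> s)) (2 * pi * \<phi> s))"
proof -
 have "contractible {0..1::real}" by (intro convex_imp_contractible) simp
 then obtain L where L: "continuous_on {0..1} L" "!!s. s \<in> {0..1} ==> \<gamma> s = exp (L s)"
  using continuous_logarithm_on_contractible[of "{0..1}" \<gamma>] assms unfolding path_def by metis
 have "continuous_on {0..1} (%s. Im (L s) / (2 * pi))" using L(1) by (intro continuous_intros) auto
 moreover have "\<gamma> s = rcis (norm (\<gamma> s)) (2 * pi * (Im (L s) / (2 * pi)))" if "s \<in> {0..1}" for s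
  unfolding L(2)[OF that] norm_exp_eq_Re by (simp add: exp_eq_polar rcis_def)
 ultimately show ?thesis by blast
qed

context ww_diagram
begin

lemma wire_end_cases:
 assumes x: "x \<in> wires dg" and s: "s \<in> {0..1::real}"
  and "s \<in> {0<..<1} ==> Q s" "x \<in> set (fbot dg) ==> Q 0" "x \<in> set (ftop dg) ==> Q 1"
  "!!T. T \<in> transistors dg ==> x \<in> set (ttop dg T) ==> Q 0" "!!T. T \<in> transistors dg ==> x \<in> set (tbot dg T) ==> Q 1"
 shows "Q s"
proof -
 consider "s = 0" | "s = 1" | "s \<in> {0<..<1}" using s by force
 then show ?thesis using assms(3-7) x bots(5) tops(5) by cases blast+
qed

lemma planar_monotone:
 assumes "planar_diagram dg"
 shows "monotone_diagram True dg"
proof -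
 obtain p q \<gamma> where pq: "!!T. T \<in> transistors dg ==> Re (p T) < Re (q T) & Im (p T) < Im (q T)"
  and dd: "disjoint_drawing dg (box 0 (Complex 1 1)) (%T. cbox (p T) (q T)) \<gamma>"
  and Ft: "in_order_along (%s. Complex s 1) {0..1} (map (%x. pathfinish (\<gamma> x)) (ftop dg))"
  and Fb: "in_order_along (%s. Complex s 0) {0..1} (map (%x. pathstart (\<gamma> x)) (fbot dg))"
  and Tt: "!!T. T \<in> transistors dg ==> in_order_along (%s. Complex s (Im (q T))) {Re (p T)..Re (q T)} (map (%x. pathstart (\<gamma> x)) (ttop dg T))"
  and Tb: "!!T. T \<in> transistors dg ==> in_order_along (%s. Complex s (Im (p T))) {Re (p T)..Re (q T)} (map (%x. pathfinish (\<gamma> x)) (tbot dg T))"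
  using assms unfolding planar_diagram_def by blast
 obtain P0 where P0: "sorted_wrt (<) (map P0 (fbot dg))" "!!x. x \<in> set (fbot dg) ==> P0 x \<in> {0..1} & pathstart (\<gamma> x) = Complex (P0 x) 0"
  "!!T. T \<in> transistors dg ==> sorted_wrt (<) (map P0 (ttop dg T))"
  "!!T x. T \<in> transistors dg ==> x \<in> set (ttop dg T) ==> P0 x \<in> {Re (p T)..Re (q T)} & pathstart (\<gamma> x) = Complex (P0 x) (Im (q T))"
  using positions_of_sides[where A = "transistors dg" and s = "ttop dg", OF Fb bots(1) Tt bots(2-4)] by auto
 obtain P1 where P1: "sorted_wrt (<) (map P1 (ftop dg))" "!!x. x \<in> set (ftop dg) ==> P1 x \<in> {0..1} & pathfinish (\<gamma> x) = Complex (P1 x) 1"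
  "!!T. T \<in> transistors dg ==> sorted_wrt (<) (map P1 (tbot dg T))"
  "!!T x. T \<in> transistors dg ==> x \<in> set (tbot dg T) ==> P1 x \<in> {Re (p T)..Re (q T)} & pathfinish (\<gamma> x) = Complex (P1 x) (Im (p T))"
  using positions_of_sides[where A = "transistors dg" and s = "tbot dg", OF Ft tops(1) Tb tops(2-4)] by auto
 have inU: "0 < Re z & Re z < 1 & 0 < Im z & Im z < 1" if "T \<in> transistors dg" "z \<in> cbox (p T) (q T)" for T z
  using dd that unfolding disjoint_drawing_def by (force simp: in_box_complex_iff)
 have corners: "p T \<in> cbox (p T) (q T)" "q T \<in> cbox (p T) (q T)" if "T \<in> transistors dg" for T
  using pq[OF that] by (auto simp: in_cbox_complex_iff)
 have wU: "0 < Re (\<gamma> x s) & Re (\<gamma> x s) < 1 & 0 < Im (\<gamma> x s) & Im (\<gamma> x s) < 1 & (\<forall>T\<in>transistors dg. \<gamma> x s \<notin> cbox (p T) (q T))"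
  if "x \<in> wires dg" "s \<in> {0<..<1}" for x s using dd that unfolding disjoint_drawing_def by (fastforce simp: in_box_complex_iff)
 have wR: "0 <= Re (\<gamma> x s) & Re (\<gamma> x s) <= 1" if x: "x \<in> wires dg" and s: "s \<in> {0..1}" for x s using x s
 proof (rule wire_end_cases)
  fix T assume T: "T \<in> transistors dg"
  note c = inU[OF T corners(1)[OF T]] inU[OF T corners(2)[OF T]]
  show "0 <= Re (\<gamma> x 0) & Re (\<gamma> x 0) <= 1" if "x \<in> set (ttop dg T)" using P0(4)[OF T that] c by (auto simp: pathstart_def)
  show "0 <= Re (\<gamma> x 1) & Re (\<gamma> x 1) <= 1" if "x \<in> set (tbot dg T)" using P1(4)[OF T that] c by (auto simp: pathfinish_def)
 qed (use wU[OF x] P0(2) P1(2) in \<open>auto simp: pathstart_def pathfinish_def less_imp_le\<close>)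
 \<comment> \<open>Halving the abscissa leaves room between the integer translates of the unit
   square, whose vertical edges would otherwise touch.\<close>
 define h where "h z = Complex (Re z / 2) (Im z)" for z
 have h_inj: "h y = h z \<longleftrightarrow> y = z" for y z by (auto simp: h_def complex_eq_iff)
 have h_box: "h z \<in> cbox (h (p T)) (h (q T)) \<longleftrightarrow> z \<in> cbox (p T) (q T)" for z T
  by (auto simp: h_def in_cbox_complex_iff)
 have h_surj: "\<exists>y. z = h y" for z by (intro exI[of _ "Complex (2 * Re z) (Im z)"]) (simp add: h_def)
 have j0: "j = 0" if "h z = h y + of_int j | h y + of_int j = h z" "0 <= Re z" "Re z <= 1" "0 <= Re y" "Re y <= 1" for y z and j :: int
 proof -
  have "Re z / 2 = Re y / 2 + of_int j" using that(1) by (auto simp: h_def complex_eq_iff)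
  then have "\<bar>real_of_int j\<bar> < 1" using that(2-5) by linarith
  then show ?thesis by linarith
 qed
 interpret strip A R w dg "%T. h (p T)" "%T. h (q T)" "%x. h \<circ> \<gamma> x" "%_. 0" "%x. P0 x / 2" "%x. P1 x / 2"
 proof
  fix T assume T: "T \<in> transistors dg"
  show "Re (h (p T)) < Re (h (q T)) & 0 < Im (h (p T)) & Im (h (p T)) < Im (h (q T)) & Im (h (q T)) < 1"
   using pq[OF T] inU[OF T] corners[OF T] by (simp add: h_def)
  show "sorted_wrt (<) (map (%x. P0 x / 2) (ttop dg T))" "sorted_wrt (<) (map (%x. P1 x / 2) (tbot dg T))"
   using P0(3)[OF T] P1(3)[OF T] by (simp_all add: sorted_wrt_map)
  show "Re (h (p T)) <= P0 x / 2 & P0 x / 2 <= Re (h (q T)) & pathstart (h \<circ> \<gamma> x) = Complex (P0 x / 2 + real_of_int 0) (Im (h (q T)))"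
   if "x \<in> set (ttop dg T)" for x using P0(4)[OF T that] by (simp add: h_def pathstart_compose)
  show "Re (h (p T)) <= P1 x / 2 & P1 x / 2 <= Re (h (q T)) & pathfinish (h \<circ> \<gamma> x) = Complex (P1 x / 2) (Im (h (p T)))"
   if "x \<in> set (tbot dg T)" for x using P1(4)[OF T that] by (simp add: h_def pathfinish_compose)
  show "S = T & j = 0" if S: "S \<in> transistors dg" "z \<in> cbox (h (p S)) (h (q S))" "z + of_int j \<in> cbox (h (p T)) (h (q T))" for S z j
  proof -
   obtain y where y: "z = h y" using h_surj by blast
   obtain y' where y': "z + of_int j = h y'" using h_surj by blast
   have yb: "y \<in> cbox (p S) (q S)" "y' \<in> cbox (p T) (q T)" using S y y' h_box by simp_all
   have "j = 0" using j0[of y' y j] inU[OF S(1) yb(1)] inU[OF T yb(2)] y y' by simp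
   then have "y = y'" using y y' h_inj by simp
   then show ?thesis using dd S(1) T yb \<open>j = 0\<close> unfolding disjoint_drawing_def disjoint_family_on_def by blast
  qed
 next
  fix x assume x: "x \<in> wires dg"
  have "arc (\<gamma> x)" using dd x unfolding disjoint_drawing_def by blast
  moreover have "continuous_on (\<gamma> x ` {0..1}) h" unfolding h_def Complex_eq by (intro continuous_intros) auto
  ultimately show "arc (h \<circ> \<gamma> x)"
   unfolding arc_def path_def by (auto simp: inj_on_def h_inj simp del: o_apply intro!: continuous_on_compose) (auto simp: h_inj)
  show "0 < Im ((h \<circ> \<gamma> x) s) & Im ((h \<circ> \<gamma> x) s) < 1" if "s \<in> {0<..<1}" for s
   using wU[OF x that] by (simp add: h_def)
  show "(h \<circ> \<gamma> x) s + of_int j \<notin> cbox (h (p T)) (h (q T))" if T: "T \<in> transistors dg" "s \<in> {0<..<1}" for T s j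
  proof
   assume b: "(h \<circ> \<gamma> x) s + of_int j \<in> cbox (h (p T)) (h (q T))"
   obtain y where y: "h (\<gamma> x s) + of_int j = h y" using h_surj by metis
   have yb: "y \<in> cbox (p T) (q T)" using b y h_box by simp
   have "j = 0" using j0[of y "\<gamma> x s" j] y inU[OF T(1) yb] wU[OF x T(2)] by simp
   then have "y = \<gamma> x s" using y h_inj by simp
   then show False using wU[OF x T(2)] yb T(1) by blast
  qed
  show "x = y & j = 0" if y: "y \<in> wires dg" "s \<in> {0..1}" "t \<in> {0..1}" "(h \<circ> \<gamma> x) s = (h \<circ> \<gamma> y) t + of_int j" for y s t j
  proof -
   have j: "j = 0" using j0[of "\<gamma> x s" "\<gamma> y t" j] wR[OF x y(2)] wR[OF y(1,3)] y(4) by simp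
   then have "\<gamma> x s = \<gamma> y t" using y(4) h_inj by simp
   then have "path_image (\<gamma> x) \<inter> path_image (\<gamma> y) ~= {}" using y(2,3) unfolding path_image_def by blast
   then show ?thesis using j dd x y(1) unfolding disjoint_drawing_def disjoint_family_on_def by blast
  qed
 next
  show "sorted_wrt (<) (map (%x. P1 x / 2) (ftop dg))" "sorted_wrt (<) (map (%x. P0 x / 2) (fbot dg))"
   using P0(1) P1(1) by (simp_all add: sorted_wrt_map)
  show "pathfinish (h \<circ> \<gamma> x) = Complex (P1 x / 2) 1" if "x \<in> set (ftop dg)" for x
   using P1(2)[OF that] by (simp add: pathfinish_compose h_def)
  show "pathstart (h \<circ> \<gamma> x) = Complex (P0 x / 2 + real_of_int 0) 0" if "x \<in> set (fbot dg)" for x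
   using P0(2)[OF that] by (simp add: pathstart_compose h_def)
  show "P1 x / 2 < P1 y / 2 + 1" if "x \<in> set (ftop dg)" "y \<in> set (ftop dg)" for x y using P1(2)[OF that(1)] P1(2)[OF that(2)] by auto
  show "P0 x / 2 < P0 y / 2 + 1" if "x \<in> set (fbot dg)" "y \<in> set (fbot dg)" for x y using P0(2)[OF that(1)] P0(2)[OF that(2)] by auto
 qed
 show ?thesis by (rule monotone_strip) simp
qed

lemma annular_monotone:
 assumes "annular_diagram dg"
 shows "monotone_diagram False dg"
proof -
 obtain r r' \<theta> \<theta>' \<gamma> \<alpha> \<beta> where rr: "!!T. T \<in> transistors dg ==> 1 < r T & r T < r' T & r' T < 2 & \<theta> T < \<theta>' T & \<theta>' T < \<theta> T + 2 * pi"
  and dd: "disjoint_drawing dg {z. 1 < norm z & norm z < 2} (%T. sector (r T) (r' T) (\<theta> T) (\<theta>' T)) \<gamma>"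
  and Ft: "in_order_along (rcis 1) {\<alpha><..<\<alpha> + 2 * pi} (map (%x. pathfinish (\<gamma> x)) (ftop dg))"
  and Fb: "in_order_along (rcis 2) {\<beta><..<\<beta> + 2 * pi} (map (%x. pathstart (\<gamma> x)) (fbot dg))"
  and Tt: "!!T. T \<in> transistors dg ==> in_order_along (rcis (r T)) {\<theta> T..\<theta>' T} (map (%x. pathstart (\<gamma> x)) (ttop dg T))"
  and Tb: "!!T. T \<in> transistors dg ==> in_order_along (rcis (r' T)) {\<theta> T..\<theta>' T} (map (%x. pathfinish (\<gamma> x)) (tbot dg T))"
  using assms unfolding annular_diagram_def by blast
 obtain P0 where P0: "sorted_wrt (<) (map P0 (fbot dg))" "!!x. x \<in> set (fbot dg) ==> P0 x \<in> {\<beta><..<\<beta> + 2 * pi} & pathstart (\<gamma> x) = rcis 2 (P0 x)"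
  "!!T. T \<in> transistors dg ==> sorted_wrt (<) (map P0 (ttop dg T))"
  "!!T x. T \<in> transistors dg ==> x \<in> set (ttop dg T) ==> P0 x \<in> {\<theta> T..\<theta>' T} & pathstart (\<gamma> x) = rcis (r T) (P0 x)"
  using positions_of_sides[where A = "transistors dg" and s = "ttop dg", OF Fb bots(1) Tt bots(2-4)] by auto
 obtain P1 where P1: "sorted_wrt (<) (map P1 (ftop dg))" "!!x. x \<in> set (ftop dg) ==> P1 x \<in> {\<alpha><..<\<alpha> + 2 * pi} & pathfinish (\<gamma> x) = rcis 1 (P1 x)"
  "!!T. T \<in> transistors dg ==> sorted_wrt (<) (map P1 (tbot dg T))"
  "!!T x. T \<in> transistors dg ==> x \<in> set (tbot dg T) ==> P1 x \<in> {\<theta> T..\<theta>' T} & pathfinish (\<gamma> x) = rcis (r' T) (P1 x)"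
  using positions_of_sides[where A = "transistors dg" and s = "tbot dg", OF Ft tops(1) Tb tops(2-4)] by auto
 have arcs: "arc (\<gamma> x)" if "x \<in> wires dg" for x using dd that unfolding disjoint_drawing_def by blast
 have wU: "1 < norm (\<gamma> x s) & norm (\<gamma> x s) < 2 & (\<forall>T\<in>transistors dg. \<gamma> x s \<notin> sector (r T) (r' T) (\<theta> T) (\<theta>' T))"
  if "x \<in> wires dg" "s \<in> {0<..<1}" for x s using dd that unfolding disjoint_drawing_def by fastforce
 have start: "\<exists>d>0. \<gamma> x 0 = rcis d (P0 x)" if "x \<in> wires dg" for x
 proof -
  consider "x \<in> set (fbot dg)" | T where "T \<in> transistors dg" "x \<in> set (ttop dg T)" using bots(5) \<open>x \<in> wires dg\<close> by blast
  then show ?thesis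
  proof cases
   case (2 T)
   then have "0 < r T" "\<gamma> x 0 = rcis (r T) (P0 x)" using rr[of T] P0(4)[of T x] by (simp_all add: pathstart_def)
   then show ?thesis by blast
  qed (use P0(2)[of x] in \<open>auto simp: pathstart_def intro!: exI[of _ 2]\<close>)
 qed
 have finish: "\<exists>d>0. \<gamma> x 1 = rcis d (P1 x)" if "x \<in> wires dg" for x
 proof -
  consider "x \<in> set (ftop dg)" | T where "T \<in> transistors dg" "x \<in> set (tbot dg T)" using tops(5) \<open>x \<in> wires dg\<close> by blast
  then show ?thesis
  proof cases
   case (2 T)
   then have "0 < r' T" "\<gamma> x 1 = rcis (r' T) (P1 x)" using rr[of T] P1(4)[of T x] by (simp_all add: pathfinish_def)
   then show ?thesis by blast
  qed (use P1(2)[of x] in \<open>auto simp: pathfinish_def intro!: exI[of _ 1]\<close>)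
 qed
 have nz: "\<gamma> x s ~= 0" if x: "x \<in> wires dg" and s: "s \<in> {0..1}" for x s
 proof -
  consider "s = 0" | "s = 1" | "s \<in> {0<..<1}" using s by force
  then show ?thesis by cases (use start[OF x] finish[OF x] wU[OF x] in \<open>fastforce+\<close>)
 qed
 \<comment> \<open>The lift of a wire is normalised at its upper end. At the lower end the angle
   then agrees with the prescribed one up to an integer, which becomes the shift \<open>a x\<close>
   of the strip.\<close>
 have "\<forall>x\<in>wires dg. \<exists>\<phi>. continuous_on {0..1} \<phi> & (\<forall>s\<in>{0..1}. \<gamma> x s = rcis (norm (\<gamma> x s)) (2 * pi * \<phi> s)) & \<phi> 1 = P1 x / (2 * pi)"
 proof
  fix x assume x: "x \<in> wires dg"
  obtain \<phi> where \<phi>: "continuous_on {0..1} \<phi>" "!!s. s \<in> {0..1} ==> \<gamma> x s = rcis (norm (\<gamma> x s)) (2 * pi * \<phi> s)"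
   using angular_lift[of "\<gamma> x"] nz[OF x] arcs[OF x] arc_imp_path by blast
  obtain d where d: "d > 0" "\<gamma> x 1 = rcis d (P1 x)" using finish[OF x] by blast
  have "rcis d (2 * pi * (P1 x / (2 * pi))) = rcis (norm (\<gamma> x 1)) (2 * pi * \<phi> 1)" using \<phi>(2)[of 1] d by simp
  then obtain k :: int where k: "P1 x / (2 * pi) = \<phi> 1 + of_int k"
   using rcis_2pi_eq[of d "norm (\<gamma> x 1)" "P1 x / (2 * pi)" "\<phi> 1"] d(1) nz[OF x, of 1] by auto
  have "rcis t (2 * pi * (\<phi> s + of_int k)) = rcis t (2 * pi * \<phi> s)" for t s
   using cis_2pi_eq[of "\<phi> s + of_int k" "\<phi> s"] by (auto simp: rcis_def)
  then show "\<exists>\<phi>. continuous_on {0..1} \<phi> & (\<forall>s\<in>{0..1}. \<gamma> x s = rcis (norm (\<gamma> x s)) (2 * pi * \<phi> s)) & \<phi> 1 = P1 x / (2 * pi)"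
   using \<phi> k by (intro exI[of _ "%s. \<phi> s + of_int k"]) (auto intro!: continuous_intros)
 qed
 then obtain \<phi> where \<phi>: "!!x. x \<in> wires dg ==> continuous_on {0..1} (\<phi> x)"
  "!!x s. x \<in> wires dg ==> s \<in> {0..1} ==> \<gamma> x s = rcis (norm (\<gamma> x s)) (2 * pi * \<phi> x s)" "!!x. x \<in> wires dg ==> \<phi> x 1 = P1 x / (2 * pi)"
  by metis
 have "\<forall>x\<in>wires dg. \<exists>k::int. \<phi> x 0 = P0 x / (2 * pi) + of_int k"
 proof
  fix x assume x: "x \<in> wires dg"
  obtain d where d: "d > 0" "\<gamma> x 0 = rcis d (P0 x)" using start[OF x] by blast
  have "rcis (norm (\<gamma> x 0)) (2 * pi * \<phi> x 0) = rcis d (2 * pi * (P0 x / (2 * pi)))" using \<phi>(2)[OF x, of 0] d by simp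
  then show "\<exists>k::int. \<phi> x 0 = P0 x / (2 * pi) + of_int k"
   using rcis_2pi_eq[of "norm (\<gamma> x 0)" d "\<phi> x 0" "P0 x / (2 * pi)"] d(1) nz[OF x, of 0] by auto
 qed
 then obtain a :: "nat => int" where a: "!!x. x \<in> wires dg ==> \<phi> x 0 = P0 x / (2 * pi) + of_int (a x)" by metis
 \<comment> \<open>The universal covering of the annulus by the strip. Collisions in the strip are
   pushed down along it and excluded by the drawing.\<close>
 define E where "E z = rcis (2 - Im z) (2 * pi * Re z)" for z
 have E_shift: "E (z + of_int j) = E z" for z j using cis_2pi_eq[of "Re z + of_int j" "Re z"] by (auto simp: E_def rcis_def)
 define p where "p T = Complex (\<theta> T / (2 * pi)) (2 - r' T)" for T
 define q where "q T = Complex (\<theta>' T / (2 * pi)) (2 - r T)" for T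
 define g where "g x s = Complex (\<phi> x s) (2 - norm (\<gamma> x s))" for x s
 have E_g: "E (g x s) = \<gamma> x s" if "x \<in> wires dg" "s \<in> {0..1}" for x s using \<phi>(2)[OF that] by (simp add: E_def g_def)
 have E_box: "E z \<in> sector (r T) (r' T) (\<theta> T) (\<theta>' T)" if "z \<in> cbox (p T) (q T)" for z T
 proof -
  have "r T <= 2 - Im z & 2 - Im z <= r' T & \<theta> T <= 2 * pi * Re z & 2 * pi * Re z <= \<theta>' T"
   using that unfolding p_def q_def by (auto simp: in_cbox_complex_iff field_simps)
  then show ?thesis unfolding E_def sector_def by blast
 qed
 interpret strip A R w dg p q g a "%x. P0 x / (2 * pi)" "%x. P1 x / (2 * pi)"
 proof
  fix T assume T: "T \<in> transistors dg"
  show "Re (p T) < Re (q T) & 0 < Im (p T) & Im (p T) < Im (q T) & Im (q T) < 1"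
   using rr[OF T] by (simp add: p_def q_def divide_strict_right_mono)
  show "sorted_wrt (<) (map (%x. P0 x / (2 * pi)) (ttop dg T))" "sorted_wrt (<) (map (%x. P1 x / (2 * pi)) (tbot dg T))"
   using P0(3)[OF T] P1(3)[OF T] by (simp_all add: sorted_wrt_map divide_less_cancel)
  show "Re (p T) <= P0 x / (2 * pi) & P0 x / (2 * pi) <= Re (q T) & pathstart (g x) = Complex (P0 x / (2 * pi) + a x) (Im (q T))"
   if x: "x \<in> set (ttop dg T)" for x
  proof -
   have "x \<in> wires dg" using bots(5) T x by blast
   then show ?thesis using P0(4)[OF T x] a rr[OF T] by (simp add: p_def q_def g_def pathstart_def divide_right_mono)
  qed
  show "Re (p T) <= P1 x / (2 * pi) & P1 x / (2 * pi) <= Re (q T) & pathfinish (g x) = Complex (P1 x / (2 * pi)) (Im (p T))"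
   if x: "x \<in> set (tbot dg T)" for x
  proof -
   have "x \<in> wires dg" using tops(5) T x by blast
   then show ?thesis using P1(4)[OF T x] \<phi>(3) rr[OF T] by (simp add: p_def q_def g_def pathfinish_def divide_right_mono)
  qed
  show "S = T & j = 0" if S: "S \<in> transistors dg" "z \<in> cbox (p S) (q S)" "z + of_int j \<in> cbox (p T) (q T)" for S z j
  proof -
   have "E z \<in> sector (r S) (r' S) (\<theta> S) (\<theta>' S) \<inter> sector (r T) (r' T) (\<theta> T) (\<theta>' T)"
    using E_box[OF S(2)] E_box[OF S(3)] E_shift by simp
   then have e: "S = T" using dd S(1) T unfolding disjoint_drawing_def disjoint_family_on_def by blast
   \<comment> \<open>Different translates of one box cannot meet, as a sector spans less than a full
     turn.\<close>
   have "\<theta>' T / (2 * pi) < \<theta> T / (2 * pi) + 1" using rr[OF T] by (simp add: field_simps)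
   then have "\<bar>real_of_int j\<bar> < 1" using S(2,3) unfolding e p_def q_def by (auto simp: in_cbox_complex_iff)
   then show ?thesis using e by linarith
  qed
 next
  fix x assume x: "x \<in> wires dg"
  have c: "continuous_on {0..1} (\<gamma> x)" using arcs[OF x] unfolding arc_def path_def by blast
  have "continuous_on {0..1} (g x)" unfolding g_def Complex_eq using \<phi>(1)[OF x] c by (intro continuous_intros)
  moreover have "inj_on (g x) {0..1}" using arcs[OF x] E_g[OF x] unfolding arc_def inj_on_def by metis
  ultimately show "arc (g x)" unfolding arc_def path_def by blast
  show "0 < Im (g x s) & Im (g x s) < 1" if "s \<in> {0<..<1}" for s using wU[OF x that] by (simp add: g_def)
  show "g x s + of_int j \<notin> cbox (p T) (q T)" if T: "T \<in> transistors dg" "s \<in> {0<..<1}" for T s j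
   using E_box[of "g x s + of_int j" T] E_shift E_g[OF x, of s] wU[OF x T(2)] T by auto
  show "x = y & j = 0" if y: "y \<in> wires dg" "s \<in> {0..1}" "t \<in> {0..1}" "g x s = g y t + of_int j" for y s t j
  proof -
   have e: "\<gamma> x s = \<gamma> y t" using y E_g[OF x y(2)] E_g[OF y(1,3)] E_shift by metis
   then have "path_image (\<gamma> x) \<inter> path_image (\<gamma> y) ~= {}" using y(2,3) unfolding path_image_def by blast
   then have xy: "x = y" using dd x y(1) unfolding disjoint_drawing_def disjoint_family_on_def by blast
   then have "s = t" using e arcs[OF x] y(2,3) unfolding arc_def inj_on_def by blast
   then show ?thesis using y(4) xy by simp
  qed
 next
  show "sorted_wrt (<) (map (%x. P1 x / (2 * pi)) (ftop dg))" "sorted_wrt (<) (map (%x. P0 x / (2 * pi)) (fbot dg))"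
   using P0(1) P1(1) by (simp_all add: sorted_wrt_map divide_less_cancel)
  show "pathfinish (g x) = Complex (P1 x / (2 * pi)) 1" if x: "x \<in> set (ftop dg)" for x
   using P1(2)[OF x] \<phi>(3)[of x] tops(5) x by (simp add: pathfinish_def g_def)
  show "pathstart (g x) = Complex (P0 x / (2 * pi) + a x) 0" if x: "x \<in> set (fbot dg)" for x
   using P0(2)[OF x] a[of x] bots(5) x by (simp add: pathstart_def g_def)
  show "P1 x / (2 * pi) < P1 y / (2 * pi) + 1" if "x \<in> set (ftop dg)" "y \<in> set (ftop dg)" for x y
   using P1(2)[OF that(1)] P1(2)[OF that(2)] by (simp add: field_simps)
  show "P0 x / (2 * pi) < P0 y / (2 * pi) + 1" if "x \<in> set (fbot dg)" "y \<in> set (fbot dg)" for x y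
   using P0(2)[OF that(1)] P0(2)[OF that(2)] by (simp add: field_simps)
 qed
 show ?thesis by (rule monotone_strip) simp
qed

theorem planar_iff_monotone: "planar_diagram dg \<longleftrightarrow> monotone_diagram True dg"
 and annular_iff_monotone: "annular_diagram dg \<longleftrightarrow> monotone_diagram False dg"
proof -
 show "planar_diagram dg \<longleftrightarrow> monotone_diagram True dg" using ex_layout[of True] layout.planar planar_monotone by blast
 show "annular_diagram dg \<longleftrightarrow> monotone_diagram False dg" using ex_layout[of False] layout.annular annular_monotone by blast
qed

end

section \<open>The images in Thompson's groups\<close>

context
 fixes f g
 assumes bij: "bij f" and l: "lifts g f"
begin

lemma degree_one_shift: "degree_one g (x + of_int k) = degree_one g x + of_int k" by (simp add: degree_one_def frac_def)

text \<open>An increasing function whose image is the whole line has no jumps.\<close>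

lemma degree_one_continuous: "continuous_on UNIV (degree_one g)"
proof (rule continuous_onI_mono)
 have "range (degree_one g) = UNIV" using degree_one_surj[OF bij l] by (metis surjI surj_def)
 then show "open (range (degree_one g))" by simp
 fix x y :: real assume "x <= y"
 then show "degree_one g x <= degree_one g y" using strict_mono_less_eq[OF degree_one_strict_mono[OF bij l]] by simp
qed

lemma degree_one_frac: "x \<in> {0..<1} ==> frac (degree_one g x) = real_map f x"
 using frac_degree_one[OF l, of x] by (simp add: real_map_def frac_eq)

text \<open>The degree one extension descends to the circle; there it is a continuous bijection of a
  compact space, hence a homeomorphism.\<close>

lemma real_map_in_T:
 assumes "chart f"
 shows "real_map f \<in> carrier thompson_T"
proof -
 let ?F = "degree_one g"
 define h where "h z = cis (2 * pi * ?F (Arg z / (2 * pi)))" for z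
 have h_eq: "h (cis (2 * pi * x)) = cis (2 * pi * ?F x)" for x
 proof -
  let ?y = "Arg (cis (2 * pi * x)) / (2 * pi)"
  have "cis (2 * pi * ?y) = cis (2 * pi * x)" by (simp add: cis_Arg sgn_div_norm)
  then obtain k :: int where "?y = x + of_int k" unfolding cis_2pi_eq by blast
  then show ?thesis unfolding h_def cis_2pi_eq using degree_one_shift by metis
 qed
 have sph: "\<exists>x. z = cis (2 * pi * x)" if "z \<in> sphere 0 1" for z
 proof (intro exI)
  have "cis (Arg z) = z" using that by (subst cis_Arg) (auto simp: sgn_div_norm)
  then show "z = cis (2 * pi * (Arg z / (2 * pi)))" by simp
 qed
 have cont: "continuous_on (sphere 0 1) h" unfolding continuous_on_eq_continuous_within
 proof
  fix z0 :: complex assume z0: "z0 \<in> sphere 0 1"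
  obtain x0 where x0: "z0 = cis (2 * pi * x0)" using sph[OF z0] by blast
  have nz: "z0 ~= 0" using z0 by auto
  \<comment> \<open>Near \<open>z0\<close> the angle is measured from \<open>z0\<close>, away from
    the branch cut of \<open>Arg\<close>. On the circle this describes the same map, because the
    extension commutes with integer shifts.\<close>
  define k where "k z = cis (2 * pi * ?F (x0 + Arg (z / z0) / (2 * pi)))" for z
  have eq: "k z = h z" if "z \<in> sphere 0 1" for z
  proof -
   have "cis (Arg (z / z0)) = z / z0" using that z0 nz by (subst cis_Arg) (auto simp: sgn_div_norm norm_divide)
   then have "cis (2 * pi * (x0 + Arg (z / z0) / (2 * pi))) = z" using nz x0 by (simp add: distrib_left cis_mult[symmetric])
   then show ?thesis unfolding k_def h_eq[symmetric] by simp
  qed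
  have "isCont Arg (z0 / z0)" using nz by (intro continuous_at_Arg) simp
  moreover have "isCont (%z. z / z0) z0" using nz by (intro continuous_intros)
  ultimately have "isCont (%z. Arg (z / z0)) z0" by (rule isCont_o2[rotated])
  then have "isCont (%z. x0 + Arg (z / z0) / (2 * pi)) z0" by (intro continuous_intros) auto
  moreover have "isCont ?F x" for x using degree_one_continuous by (simp add: continuous_on_eq_continuous_at)
  ultimately have "isCont (%z. ?F (x0 + Arg (z / z0) / (2 * pi))) z0" by (rule isCont_o2)
  then have "isCont k z0" unfolding k_def cis_conv_exp by (intro continuous_intros)
  then have "continuous (at z0 within sphere 0 1) k" by (rule continuous_at_imp_continuous_at_within)
  then show "continuous (at z0 within sphere 0 1) h" by (rule continuous_transform_within[OF _ zero_less_one z0]) (rule eq)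
 qed
 have im: "h ` sphere 0 1 = sphere 0 1"
 proof
  show "h ` sphere 0 1 \<subseteq> sphere 0 1" by (auto simp: h_def)
  show "sphere 0 1 \<subseteq> h ` sphere 0 1"
  proof
   fix z :: complex assume "z \<in> sphere 0 1"
   then obtain y where y: "z = cis (2 * pi * y)" using sph by blast
   obtain x where "?F x = y" using degree_one_surj[OF bij l] by blast
   then have "z = h (cis (2 * pi * x))" using h_eq y by simp
   then show "z \<in> h ` sphere 0 1" by (rule image_eqI) simp
  qed
 qed
 have "inj_on h (sphere 0 1)"
 proof (rule inj_onI)
  fix y z assume z: "y \<in> sphere 0 1" "z \<in> sphere 0 1" "h y = h z"
  obtain s t where st: "y = cis (2 * pi * s)" "z = cis (2 * pi * t)" using sph z by metis
  then obtain k :: int where "?F s = ?F t + of_int k" using z(3) h_eq cis_2pi_eq by metis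
  then have "?F s = ?F (t + of_int k)" by (simp add: degree_one_shift)
  then have "s = t + of_int k" using strict_mono_eq[OF degree_one_strict_mono[OF bij l]] by blast
  then show "y = z" unfolding st cis_2pi_eq by blast
 qed
 then obtain h' where "homeomorphism (sphere 0 1) (sphere 0 1) h h'" using homeomorphism_compact[OF _ cont im] by auto
 moreover have "h (cis (2 * pi * x)) = cis (2 * pi * real_map f x)" if "x \<in> {0..<1}" for x
 proof -
  have "cis (2 * pi * ?F x) = cis (2 * pi * frac (?F x))" unfolding cis_2pi_eq frac_def by (intro exI[of _ "\<lfloor>?F x\<rfloor>"]) simp
  then show ?thesis unfolding h_eq degree_one_frac[OF that] .
 qed
 ultimately show ?thesis unfolding thompson_T_def using real_map_in_V[OF bij assms] by auto
qed

end

text \<open>F acts on the closed interval, so the missing point 1 is added as a fixed point.\<close>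

definition unit_map :: "(ivl => ivl) => real => real" where
 "unit_map f = (\<lambda>x\<in>{0..1}. if x < 1 then real_map f x else 1)"

text \<open>A lift with values in [0,1) is the map itself. The map is therefore increasing and,
  being onto, fixes 0; its degree one extension then also fixes 1 and restricts to a homeomorphism
  of [0,1].\<close>

lemma unit_map_in_F:
 assumes f: "bij f" "chart f" and g: "lifts g f" "!!t. 0 <= g t & g t < 1"
 shows "unit_map f \<in> carrier thompson_F"
proof -
 let ?F = "degree_one g"
 have gf: "g t = pt (f t)" for t using g unfolding lifts_def by (metis frac_eq)
 obtain t0 where t0: "f t0 = mk 0" using f(1) by (metis bij_pointE)
 have z: "pt (mk 0) = 0" by (rule pt_mk) auto
 have "~ pt (mk 0) < pt t0"
 proof
  assume "pt (mk 0) < pt t0"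
  then have "g (mk 0) < g t0" using g(1) unfolding lifts_def lift_ok_def by blast
  then show False using g(2)[of "mk 0"] unfolding gf[of t0] t0 z by simp
 qed
 then have "pt t0 = pt (mk 0)" using pt_bounds(1)[of t0] z by simp
 then have "t0 = mk 0" unfolding pt_eq_iff .
 then have g0: "g (mk 0) = 0" using gf[of t0] t0 z by simp
 have eq: "unit_map f x = ?F x" if "x \<in> {0..1}" for x
 proof (cases "x < 1")
  case True
  then have "frac x = x" "\<lfloor>x\<rfloor> = 0" using that by (auto simp: frac_eq floor_eq_iff)
  then show ?thesis using that True gf by (simp add: unit_map_def degree_one_def real_map_def)
 next
  case False
  then have "x = 1" using that by simp
  then show ?thesis using g0 by (simp add: unit_map_def degree_one_def)
 qed
 have F01: "?F 0 = 0" "?F 1 = 1" using g0 by (simp_all add: degree_one_def)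
 note less = degree_one_less[OF f(1) g(1)]
 have le: "?F x <= ?F y \<longleftrightarrow> x <= y" for x y using less[of y x] by auto
 have sm: "strict_mono_on {0..1} (unit_map f)" by (rule strict_mono_onI) (simp add: eq less)
 have im: "unit_map f ` {0..1} = {0..1}"
 proof
  show "unit_map f ` {0..1} \<subseteq> {0..1}" using eq le[of 0] le[of _ 1] F01 by auto
  show "{0..1} \<subseteq> unit_map f ` {0..1}"
  proof
   fix y :: real assume y: "y \<in> {0..1}"
   obtain x where x: "?F x = y" using degree_one_surj[OF f(1) g(1)] by blast
   have "x \<in> {0..1}" using y le[of 0 x] le[of x 1] F01 x by simp
   then show "y \<in> unit_map f ` {0..1}" using eq x by (metis image_eqI)
  qed
 qed
 have inj: "inj_on (unit_map f) {0..1}" using sm by (rule strict_mono_on_imp_inj_on)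
 have Bij: "unit_map f \<in> Bij {0..1}" unfolding Bij_def bij_betw_def using im inj by (simp add: unit_map_def)
 have "continuous_on {0..1} ?F" using degree_one_continuous[OF f(1) g(1)] by (rule continuous_on_subset) simp
 then have cont: "continuous_on {0..1} (unit_map f)" by (rule continuous_on_eq) (simp add: eq)
 have ho: "\<exists>f'. homeomorphism {0..1} {0..1} (unit_map f) f'" using homeomorphism_compact[OF _ cont im inj] by simp
 obtain Q where Q: "finite Q" "Q \<subseteq> dyadic \<inter> {0..<1}" "\<forall>a b. a < b & (\<forall>x\<in>{a<..<b}. frac x \<notin> Q) -->
    (\<exists>(k::int) c. \<forall>x\<in>{a<..<b}. real_map f (frac x) = frac (2 powi k * x + c))"
  using real_map_in_V[OF f] unfolding carrier_thompson_V by (elim conjE exE) (rule that)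
 have "\<exists>(k::int) c. \<forall>x\<in>{a<..<b}. unit_map f x = 2 powi k * x + c" if ab: "a < b" "{a<..<b} \<subseteq> {0..1} - Q" for a b
 proof -
  have "0 <= a & b <= 1" using ab closure_mono[of "{a<..<b}" "{0..1}"] by (auto simp: closure_greaterThanLessThan)
  then have fx: "frac x = x" "x \<in> {0..1}" "x < 1" if "x \<in> {a<..<b}" for x using that by (auto simp: frac_eq)
  then have "\<forall>x\<in>{a<..<b}. frac x \<notin> Q" using ab(2) by auto
  then obtain k :: int and c where q: "\<forall>x\<in>{a<..<b}. real_map f (frac x) = frac (2 powi k * x + c)" using Q(3) ab(1) by meson
  then have kc: "unit_map f x = frac (2 powi k * x + c)" if "x \<in> {a<..<b}" for x
   using bspec[OF q that] fx[OF that] by (simp add: unit_map_def)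
  define v where "v x = 2 powi k * x + c" for x
  have pos: "(2::real) powi k > 0" by simp
  \<comment> \<open>Membership in V describes the map on the interval only modulo 1. If the integer
    part changed inside, the map would take the value 0 at a point to the right of other points of
    the interval, against strict monotonicity.\<close>
  have fl: "\<lfloor>v x\<rfloor> = \<lfloor>v y\<rfloor>" if xy: "x \<in> {a<..<b}" "y \<in> {a<..<b}" "x < y" for x y
  proof (rule ccontr)
   assume ne: "\<lfloor>v x\<rfloor> ~= \<lfloor>v y\<rfloor>"
   have "v x < v y" using xy(3) pos by (simp add: v_def)
   then have "\<lfloor>v x\<rfloor> < \<lfloor>v y\<rfloor>" using ne floor_mono[of "v x" "v y"] by simp
   then have n: "v x < of_int \<lfloor>v y\<rfloor>" "of_int \<lfloor>v y\<rfloor> <= v y" by linarith+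
   define z where "z = (of_int \<lfloor>v y\<rfloor> - c) / 2 powi k"
   have vz: "v z = of_int \<lfloor>v y\<rfloor>" using pos by (simp add: v_def z_def)
   have "x < z" "z <= y" using n pos unfolding z_def v_def by (simp_all add: field_simps)
   then have z: "z \<in> {a<..<b}" using xy by auto
   have "unit_map f z = 0" using kc[OF z] vz unfolding v_def by simp
   moreover have "unit_map f x < unit_map f z" using \<open>x < z\<close> fx(2) z xy(1) by (simp add: eq less)
   moreover have "0 <= unit_map f x" using kc[OF xy(1)] by simp
   ultimately show False by simp
  qed
  define m where "m = (a + b) / 2"
  have m: "m \<in> {a<..<b}" using ab by (simp add: m_def)
  have "unit_map f x = 2 powi k * x + (c - of_int \<lfloor>v m\<rfloor>)" if "x \<in> {a<..<b}" for x
  proof -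
   have "\<lfloor>v x\<rfloor> = \<lfloor>v m\<rfloor>" using fl[OF that m] fl[OF m that] by (metis linorder_neqE_linordered_idom)
   then show ?thesis using kc[OF that] unfolding frac_def v_def by simp
  qed
  then show ?thesis by blast
 qed
 then show ?thesis unfolding thompson_F_def using Bij ho sm Q(1,2) by (auto intro!: exI[of _ Q])
qed

lemma real_map_comp: "real_map (f \<circ> g) = compose {0..<1} (real_map f) (real_map g)"
 using pt_bounds by (auto simp: real_map_def compose_def pt_inverse fun_eq_iff)

lemma real_map_id: "real_map id = (\<lambda>x\<in>{0..<1}. x)" by (auto simp: real_map_def pt_mk fun_eq_iff)

lemma real_map_inj: "real_map f = real_map g ==> f = g" using real_map_pt by (metis ext pt_eq_iff)

lemma unit_map_comp: "unit_map (f \<circ> g) = compose {0..1} (unit_map f) (unit_map g)"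
 using pt_bounds by (auto simp: unit_map_def real_map_def compose_def pt_inverse fun_eq_iff less_imp_le)

lemma unit_map_id: "unit_map id = (\<lambda>x\<in>{0..1}. x)" by (auto simp: unit_map_def real_map_def pt_mk fun_eq_iff)

lemma unit_map_inj: "unit_map f = unit_map g ==> f = g"
proof
 fix t assume "unit_map f = unit_map g"
 then have "unit_map f (pt t) = unit_map g (pt t)" by simp
 then show "f t = g t" using pt_bounds[of t] by (simp add: unit_map_def real_map_def pt_inverse pt_eq_iff less_imp_le)
qed

section \<open>The three classes of diagrams\<close>

context
 fixes A :: "'a set" and R :: "('a list \<times> 'a list) set" and w :: "'a list"
 assumes pres: "semigroup_presentation A R" and wA: "w \<in> lists A" and wne: "w ~= []"
begin

lemma diagram_classI:
 assumes "G = {dg \<in> ww_diagrams A R w. P dg}" "P (id_diagram w)"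
  and "!!dg. dg \<in> ww_diagrams A R w ==> P dg ==> P (flip dg)"
  and "!!dg dg'. dg \<in> ww_diagrams A R w ==> dg' \<in> ww_diagrams A R w ==> P dg ==> P dg' ==> P (concat_diagram dg dg')"
  and "C \<subseteq> Bij S" "!!dg c. dg \<in> ww_diagrams A R w ==> P dg ==> charting dg c ==> e (joinl (map c (fbot dg))) \<in> C"
  and "!!f g. e (f \<circ> g) = compose S (e f) (e g)" "e id = (\<lambda>x\<in>S. x)" "!!f g. e f = e g ==> f = g"
 shows "diagram_class A R w G S C e"
proof
 note wwI = ww_diagramI[OF pres wne]
 show "flip dg \<in> G" if "dg \<in> G" for dg using that assms(3) ww_diagram.flip_in_ww[OF wwI] unfolding assms(1) by blast
 show "concat_diagram dg dg' \<in> G" if "dg \<in> G" "dg' \<in> G" for dg dg'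
  using that assms(4) ww_pair.concat_in_ww[OF ww_pairI[OF pres wne]] unfolding assms(1) by blast
 show "e f \<in> C" if "dg \<in> G" "evals R dg f u" for dg f u using that assms(6) unfolding assms(1) evals_def by blast
 show "semigroup_presentation A R" "w \<in> lists A" "w ~= []" by (fact pres wA wne)+
 show "G \<subseteq> ww_diagrams A R w" "id_diagram w \<in> G" using assms(2) id_in_ww[OF wA wne] unfolding assms(1) by auto
 show "C \<subseteq> Bij S" "e id = (\<lambda>x\<in>S. x)" by (fact assms)+
 show "e (f \<circ> g) = compose S (e f) (e g)" for f g by (fact assms)
 show "f = g" if "e f = e g" for f g using that by (fact assms)
qed

lemma frame_map:
 assumes "dg \<in> ww_diagrams A R w" "charting dg c"
 shows "bij (joinl (map c (fbot dg)))" "chart (joinl (map c (fbot dg)))"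
  "monotone_diagram b dg ==> monotone_chart b (joinl (map c (fbot dg)))"
proof -
 interpret ww_diagram A R w dg by (rule ww_diagramI[OF pres wne assms(1)])
 show "bij (joinl (map c (fbot dg)))" "chart (joinl (map c (fbot dg)))" using frame_chart[OF assms(2)] by auto
 assume "monotone_diagram b dg"
 then obtain d where d: "charting dg d" "monotone_chart b (joinl (map d (fbot dg)))" unfolding monotone_diagram_def by blast
 have e: "map c (fbot dg) = map d (fbot dg)" using charting_agree[OF assms(2) d(1)] bots(5) by simp
 show "monotone_chart b (joinl (map c (fbot dg)))" unfolding e by (rule d(2))
qed

lemma braided_class: "diagram_class A R w (ww_diagrams A R w) {0..<1} (carrier thompson_V) real_map"
proof (rule diagram_classI[where P = "%_. True", OF _ _ _ _ _ _ real_map_comp real_map_id real_map_inj])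
 show "carrier thompson_V \<subseteq> Bij {0..<1}" by (auto simp: thompson_V_def)
 show "real_map (joinl (map c (fbot dg))) \<in> carrier thompson_V" if "dg \<in> ww_diagrams A R w" "charting dg c" for dg c
  using real_map_in_V frame_map(1,2)[OF that] by blast
qed simp_all

text \<open>Closure under the operations is obtained on the side of charts; replacing
  \<open>monotone_diagram\<close> by the existence of a drawing afterwards gives the planar and
  annular classes.\<close>

lemma monotone_class:
 assumes "!!f. bij f ==> chart f ==> monotone_chart b f ==> e f \<in> C" "C \<subseteq> Bij S"
  and "!!f g. e (f \<circ> g) = compose S (e f) (e g)" "e id = (\<lambda>x\<in>S. x)" "!!f g. e f = e g ==> f = g"
 shows "diagram_class A R w {dg \<in> ww_diagrams A R w. monotone_diagram b dg} S C e"
proof (rule diagram_classI[where P = "monotone_diagram b", OF HOL.refl _ _ _ assms(2) _ assms(3-5)])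
 show "e (joinl (map c (fbot dg))) \<in> C" if "dg \<in> ww_diagrams A R w" "monotone_diagram b dg" "charting dg c" for dg c
  using frame_map[OF that(1,3)] that(2) assms(1) by blast
 show "monotone_diagram b (flip dg)" if "dg \<in> ww_diagrams A R w" "monotone_diagram b dg" for dg
  using ww_diagram.monotone_flip[OF ww_diagramI[OF pres wne that(1)] that(2)] .
 show "monotone_diagram b (concat_diagram dg dg')"
  if "dg \<in> ww_diagrams A R w" "dg' \<in> ww_diagrams A R w" "monotone_diagram b dg" "monotone_diagram b dg'" for dg dg'
  using ww_pair.monotone_concat[OF ww_pairI[OF pres wne that(1,2)] that(3,4)] .
qed (rule monotone_id[OF wne])

lemma monotone_chart_in_T: "bij f ==> chart f ==> monotone_chart b f ==> real_map f \<in> carrier thompson_T"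
 using real_map_in_T unfolding monotone_chart_def by blast

lemma monotone_chart_in_F: "bij f ==> chart f ==> monotone_chart True f ==> unit_map f \<in> carrier thompson_F"
 using unit_map_in_F unfolding monotone_chart_def by blast

lemma planar_class: "diagram_class A R w {dg \<in> ww_diagrams A R w. planar_diagram dg} {0..1} (carrier thompson_F) unit_map"
proof -
 have "{dg \<in> ww_diagrams A R w. planar_diagram dg} = {dg \<in> ww_diagrams A R w. monotone_diagram True dg}"
  using ww_diagram.planar_iff_monotone[OF ww_diagramI[OF pres wne]] by blast
 moreover have "carrier thompson_F \<subseteq> Bij {0..1}" by (auto simp: thompson_F_def)
 ultimately show ?thesis using monotone_class[OF monotone_chart_in_F _ unit_map_comp unit_map_id unit_map_inj] by simp
qed

lemma annular_class: "diagram_class A R w {dg \<in> ww_diagrams A R w. annular_diagram dg} {0..<1} (carrier thompson_T) real_map"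
proof -
 have "{dg \<in> ww_diagrams A R w. annular_diagram dg} = {dg \<in> ww_diagrams A R w. monotone_diagram False dg}"
  using ww_diagram.annular_iff_monotone[OF ww_diagramI[OF pres wne]] by blast
 moreover have "carrier thompson_T \<subseteq> Bij {0..<1}" by (auto simp: thompson_T_def thompson_V_def)
 ultimately show ?thesis using monotone_class[OF monotone_chart_in_T _ real_map_comp real_map_id real_map_inj] by simp
qed

end

lemma thompson_as_subgroup: "(BijGroup {0..<1})\<lparr>carrier := carrier thompson_V\<rparr> = thompson_V"
 "(BijGroup {0..1})\<lparr>carrier := carrier thompson_F\<rparr> = thompson_F"
 "(BijGroup {0..<1})\<lparr>carrier := carrier thompson_T\<rparr> = thompson_T" by (simp_all add: thompson_V_def thompson_F_def thompson_T_def)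

theorem theorem1p1:
  fixes A :: "'a set" and R :: "('a list \<times> 'a list) set" and w :: "'a list"
    and D :: "'a diagram set monoid" and Th :: "(real \<Rightarrow> real) monoid"
  assumes "semigroup_presentation A R" and "w \<in> lists A" and "w \<noteq> []"
    and "(D, Th) \<in> {(braided_diagram_group A R w, thompson_V),
                     (planar_diagram_group A R w, thompson_F),
                     (annular_diagram_group A R w, thompson_T)}"
  shows "\<exists>(V :: 'a diagram set) E H K i p.
           simple_graph V E \<and>
           subgroup H (right_angled_Artin_group V E) \<and>
           subgroup K Th \<and>
           group_extension ((right_angled_Artin_group V E)\<lparr>carrier := H\<rparr>) D (Th\<lparr>carrier := K\<rparr>) i p"
proof -
 have b: "(braided_diagram_group A R w)\<lparr>carrier := ww_diagrams A R w // dipole_rel A R w\<rparr> = braided_diagram_group A R w"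
  by (simp add: braided_diagram_group_def)
 note c = diagram_class.ex_extension[OF braided_class] diagram_class.ex_extension[OF planar_class]
  diagram_class.ex_extension[OF annular_class]
 from assms(4) consider "D = braided_diagram_group A R w" "Th = thompson_V"
  | "D = planar_diagram_group A R w" "Th = thompson_F" | "D = annular_diagram_group A R w" "Th = thompson_T" by blast
 then show ?thesis
 proof cases
  case 1
  show ?thesis unfolding 1 using c(1)[OF assms(1-3)] unfolding b thompson_as_subgroup .
 next
  case 2
  show ?thesis unfolding 2 planar_diagram_group_def using c(2)[OF assms(1-3)] unfolding thompson_as_subgroup .
 next
  case 3
  show ?thesis unfolding 3 annular_diagram_group_def using c(3)[OF assms(1-3)] unfolding thompson_as_subgroup .
 qed
qed

end
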